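(* Let $\{\gamma_i\}_{i\in\mathcal O}$ satisfy $\gamma_i>0$ for all $i\in\mathcal O$ and $\sum_{i\in\mathcal O}\gamma_i=1$. Then there exist coefficients $K_{ij}$ ($i,j\in\mathcal M$) with $K_{ij}\ge0$, $K_{ij}=K_{ji}$, and such that for every $i\in\mathcal I$ there is at least one $j\in\mathcal O$ with $K_{ij}>0$, for which the limit of the vanishing viscosity approximation satisfies $$\lambda_iu_i(0,t)=\gamma_i\sum_{j\in\mathcal I}\lambda_ju_j(L_j,t)\qquad\forall i\in\mathcal O.$$ That is: for every $u_0\in BV(\mathcal A)$, every $B_i\in\mathbb R$ ($i\in\mathcal I$), every decreasing sequence $\epsilon_n\to0$ of positive numbers, every admissible approximation $\{u_0^{\epsilon_n}\}$ of $u_0$ and every $T>0$, the solutions $u^{\epsilon_n}$ of the parabolic problems $(P_n)$ with these $K_{ij}$ converge in $L^1(\mathcal A\times(0,T))$ to the solution of the transport problem $(H_\gamma)$ with $\gamma_{ij}=\gamma_i$ for all $i\in\mathcal O$, $j\in\mathcal I$.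
   Context: Network. $\mathcal M=\{1,\dots,m\}$ is the disjoint union of two nonempty sets $\mathcal I$ (arcs incoming in the inner node $N$) and $\mathcal O$ (arcs outgoing from $N$). For $i\in\mathcal M$, $L_i>0$, $I_i=(0,L_i)$, $\lambda_i>0$. For a function $f_i$ on $I_i$ (with traces), $f_i(N)$ means $f_i(L_i)$ if $i\in\mathcal I$ and $f_i(0)$ if $i\in\mathcal O$. Set $\beta_i=1$ if $i\in\mathcal I$, $\beta_i=-1$ if $i\in\mathcal O$. Spaces. $L^p(\mathcal A)$, $W^{k,p}(\mathcal A)$, $BV(\mathcal A)$, $L^1(\mathcal A\times(0,T))$, $BV(\mathcal A\times(0,T))$ denote the $m$-tuples $f=(f_1,\dots,f_m)$ with $f_i$ in $L^p(I_i)$, $W^{k,p}(I_i)$, $BV(I_i)$, $L^1(I_i\times(0,T))$, $BV(I_i\times(0,T))$ respectively, with norm $\|f\|=\sum_{i\in\mathcal M}\|f_i\|$. Admissible approximation of $u_0$ (for given $K_{ij}$, $B_i$, $\epsilon_n$): a sequence $\{u_0^{\epsilon_n}\}$ with $u_0^{\epsilon_n}\in W^{2,1}(\mathcal A)$, $u^{\epsilon_n}_{0i}(0)=B_i$ for $i\in\mathcal I$, $\beta_i\big(-\lambda_i u_{0i}^{\epsilon_n}(N)+\epsilon_n (u_{0i}^{\epsilon_n})_x(N)\big)=\sum_{j\in\mathcal M}K_{ij}\big(u^{\epsilon_n}_{0j}(N)-u^{\epsilon_n}_{0i}(N)\big)$ for $i\in\mathcal M$, such that $u_0^{\epsilon_n}\to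 u_0$ in $L^1(\mathcal A)$, $\|(u_0^{\epsilon_n})_x\|_{L^1(\mathcal A)}$ is bounded by a quantity depending on $\|u_0\|_{BV(\mathcal A)}$ and independent of $n$, and $\epsilon_n\|u_0^{\epsilon_n}\|_{W^{2,1}(\mathcal A)}$ is bounded independently of $n$. Problem $(P_n)$: find $u^{\epsilon_n}\in C([0,+\infty);W^{2,1}(\mathcal A))\cap C^1([0,+\infty);L^1(\mathcal A))$ with, for all $i\in\mathcal M$ and $t>0$, $$(u_i^{\epsilon_n})_t=-\lambda_i (u_i^{\epsilon_n})_x+\epsilon_n (u_i^{\epsilon_n})_{xx}\ \text{ in } I_i,\qquad u_i^{\epsilon_n}(x,0)=u_{0i}^{\epsilon_n}(x),$$ $$\beta_i\big(-\lambda_i u_i^{\epsilon_n}(N,t)+\epsilon_n (u_i^{\epsilon_n})_x(N,t)\big)=\sum_{j\in\mathcal M}K_{ij}\big(u_j^{\epsilon_n}(N,t)-u_i^{\epsilon_n}(N,t)\big),$$ $$u_i^{\epsilon_n}(0,t)=B_i\ (i\in\mathcal I),\qquad u_i^{\epsilon_n}(L_i,t)=u_{0i}^{\epsilon_n}(L_i)\ (i\in\mathcal O).$$ (This problem has a unique solution.) Problem $(H_\gamma)$: $u_{i,t}=-\lambda_i u_{i,x}$ in $I_i$ ($i\in\mathcal M$), $u_i(x,0)=u_{0i}(x)$, $u_i(0,t)=B_i$ for $i\in\mathcal I$, $\lambda_i u_i(0,t)=\sum_{j\in\mathcal I}\gamma_{ij}\lambda_j u_j(L_j,t)$ for $i\in\mathcal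 O$. A solution on $(0,T)$ is a function $u\in BV(\mathcal A\times(0,T))$ such that for all $\phi_i\in C^1_0([0,L_i)\times[0,T))$ (compactly supported), $$\int_0^T\!\!\int_{I_i}u_i(\phi_{i,t}+\lambda_i\phi_{i,x})\,dx\,dt+\int_{I_i}u_{0i}(x)\phi_i(x,0)\,dx=-\lambda_iB_i\int_0^T\phi_i(0,t)\,dt,\quad i\in\mathcal I,$$ $$\int_0^T\!\!\int_{I_i}u_i(\phi_{i,t}+\lambda_i\phi_{i,x})\,dx\,dt+\int_{I_i}u_{0i}(x)\phi_i(x,0)\,dx=-\int_0^T\phi_i(0,t)\sum_{j\in\mathcal I}\gamma_{ij}\lambda_ju_j(L_j,t)\,dt,\quad i\in\mathcal O,$$ where $u_j(L_j,\cdot)$ is the trace of the $BV$ function $u_j$. (Such a solution exists and is unique.) *)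

theory Defs
  imports "HOL-Analysis.Analysis"
begin

text \<open>
  Elements of Lebesgue and Sobolev spaces are represented by functions considered up to equality
  almost everywhere. A point of an arc is \<open>x\<close>, a point of space-time is the pair \<open>(x, t)\<close>.
\<close>

section \<open>Function spaces\<close>

definition L1_norm :: "'a::euclidean_space set \<Rightarrow> ('a \<Rightarrow> real) \<Rightarrow> real" where
  "L1_norm S f = (LINT x:S|lebesgue. \<bar>f x\<bar>)"

text \<open>
  \<open>C1c_on S \<phi> D\<phi>\<close>: \<open>\<phi>\<close> is of class \<open>C\<^sup>1\<close> on \<open>S\<close> with derivative \<open>D\<phi>\<close> and has compact support in
  \<open>S\<close>. The set \<open>S\<close> need not be open: for \<open>S = [0,l) \<times> [0,T)\<close> the function \<open>\<phi>\<close> is \<open>C\<^sup>1\<close> up to the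
  sides \<open>x = 0\<close> and \<open>t = 0\<close>, where it need not vanish. Values outside \<open>S\<close> are irrelevant.
\<close>
definition C1c_on ::
  "'a::euclidean_space set \<Rightarrow> ('a \<Rightarrow> 'b::euclidean_space) \<Rightarrow> ('a \<Rightarrow> 'a \<Rightarrow> 'b) \<Rightarrow> bool" where
  "C1c_on S \<phi> D\<phi> \<longleftrightarrow>
     (\<forall>x\<in>S. (\<phi> has_derivative D\<phi> x) (at x within S)) \<and>
     (\<forall>h. continuous_on S (\<lambda>x. D\<phi> x h)) \<and>
     (\<exists>K. compact K \<and> K \<subseteq> S \<and> (\<forall>x\<in>S - K. \<phi> x = 0))"

text \<open>
  Functions of bounded variation on an open set: integrable, with
  \<open>sup {\<integral> u div \<phi> | \<phi> \<in> C\<^sup>1\<^sub>c(S; \<real>\<^sup>d), |\<phi>| \<le> 1}\<close> finite.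
\<close>
definition BV_on :: "'a::euclidean_space set \<Rightarrow> ('a \<Rightarrow> real) \<Rightarrow> bool" where
  "BV_on S u \<longleftrightarrow> u absolutely_integrable_on S \<and>
     (\<exists>C. \<forall>(\<phi>::'a \<Rightarrow> 'a) D\<phi>. C1c_on S \<phi> D\<phi> \<and> (\<forall>x\<in>S. norm (\<phi> x) \<le> 1) \<longrightarrow>
        (LINT x:S|lebesgue. u x * (\<Sum>b\<in>Basis. D\<phi> x b \<bullet> b)) \<le> C)"

definition has_weak_deriv :: "real set \<Rightarrow> (real \<Rightarrow> real) \<Rightarrow> (real \<Rightarrow> real) \<Rightarrow> bool" where
  "has_weak_deriv S f g \<longleftrightarrow> f absolutely_integrable_on S \<and> g absolutely_integrable_on S \<and>
     (\<forall>(\<phi>::real \<Rightarrow> real) D\<phi>. C1c_on S \<phi> D\<phi> \<longrightarrow>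
        (LINT x:S|lebesgue. f x * D\<phi> x 1) = - (LINT x:S|lebesgue. g x * \<phi> x))"

definition weak_deriv :: "real set \<Rightarrow> (real \<Rightarrow> real) \<Rightarrow> real \<Rightarrow> real" where
  "weak_deriv S f = (SOME g. has_weak_deriv S f g)"

definition W21_on :: "real set \<Rightarrow> (real \<Rightarrow> real) \<Rightarrow> bool" where
  "W21_on S f \<longleftrightarrow> (\<exists>g h. has_weak_deriv S f g \<and> has_weak_deriv S g h)"

definition W21_norm :: "real set \<Rightarrow> (real \<Rightarrow> real) \<Rightarrow> real" where
  "W21_norm S f =
     L1_norm S f + L1_norm S (weak_deriv S f) + L1_norm S (weak_deriv S (weak_deriv S f))"

text \<open>
  Boundary traces, in the usual sense for BV functions: \<open>w\<close> is the trace of \<open>u\<close> at the boundary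
  point \<open>x\<close> of \<open>S\<close> if \<open>r\<^sup>-\<^sup>d \<integral> |u - w|\<close> over \<open>S \<inter> B(x,r)\<close> tends to \<open>0\<close> as \<open>r \<rightarrow> 0\<close>. For
  \<open>W\<^sup>1\<^sup>,\<^sup>1\<close> functions on an interval this is the boundary value of the continuous representative.
\<close>
definition has_boundary_trace ::
  "'a::euclidean_space set \<Rightarrow> ('a \<Rightarrow> real) \<Rightarrow> 'a \<Rightarrow> real \<Rightarrow> bool" where
  "has_boundary_trace S u x w \<longleftrightarrow> u absolutely_integrable_on S \<and>
     ((\<lambda>r. (LINT y:S \<inter> ball x r|lebesgue. \<bar>u y - w\<bar>) / r ^ DIM('a)) \<longlongrightarrow> 0) (at_right 0)"

definition boundary_trace :: "'a::euclidean_space set \<Rightarrow> ('a \<Rightarrow> real) \<Rightarrow> 'a \<Rightarrow> real" where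
  "boundary_trace S u x = (THE w. has_boundary_trace S u x w)"


section \<open>The network\<close>

text \<open>
  \<open>Inc\<close> and \<open>Out\<close> are the index sets of the incoming and outgoing arcs and \<open>L i\<close> is the length of
  arc \<open>i\<close>; \<open>lam i\<close> is its velocity.
\<close>

definition arc_interval :: "(nat \<Rightarrow> real) \<Rightarrow> nat \<Rightarrow> real set" where
  "arc_interval L i = {0<..<L i}"

definition L1_net_norm :: "nat set \<Rightarrow> (nat \<Rightarrow> real) \<Rightarrow> (nat \<Rightarrow> real \<Rightarrow> real) \<Rightarrow> real" where
  "L1_net_norm M L f = (\<Sum>i\<in>M. L1_norm (arc_interval L i) (f i))"

definition W21_net_norm :: "nat set \<Rightarrow> (nat \<Rightarrow> real) \<Rightarrow> (nat \<Rightarrow> real \<Rightarrow> real) \<Rightarrow> real" where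
  "W21_net_norm M L f = (\<Sum>i\<in>M. W21_norm (arc_interval L i) (f i))"

definition node_sign :: "nat set \<Rightarrow> nat \<Rightarrow> real" where
  "node_sign Inc i = (if i \<in> Inc then 1 else - 1)"

definition node_value :: "nat set \<Rightarrow> (nat \<Rightarrow> real) \<Rightarrow> nat \<Rightarrow> (real \<Rightarrow> real) \<Rightarrow> real" where
  "node_value Inc L i f = boundary_trace (arc_interval L i) f (if i \<in> Inc then L i else 0)"

definition node_condition ::
  "nat set \<Rightarrow> nat set \<Rightarrow> (nat \<Rightarrow> real) \<Rightarrow> (nat \<Rightarrow> real) \<Rightarrow> (nat \<Rightarrow> nat \<Rightarrow> real) \<Rightarrow> real
   \<Rightarrow> (nat \<Rightarrow> real \<Rightarrow> real) \<Rightarrow> bool" where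
  "node_condition Inc Out L lam K e f \<longleftrightarrow>
     (\<forall>i\<in>Inc \<union> Out.
        node_sign Inc i * (- lam i * node_value Inc L i (f i)
                           + e * node_value Inc L i (weak_deriv (arc_interval L i) (f i))) =
        (\<Sum>j\<in>Inc \<union> Out. K i j * (node_value Inc L j (f j) - node_value Inc L i (f i))))"

definition admissible_approximation ::
  "nat set \<Rightarrow> nat set \<Rightarrow> (nat \<Rightarrow> real) \<Rightarrow> (nat \<Rightarrow> real) \<Rightarrow> (nat \<Rightarrow> nat \<Rightarrow> real) \<Rightarrow> (nat \<Rightarrow> real)
   \<Rightarrow> (nat \<Rightarrow> real) \<Rightarrow> (nat \<Rightarrow> real \<Rightarrow> real) \<Rightarrow> (nat \<Rightarrow> nat \<Rightarrow> real \<Rightarrow> real) \<Rightarrow> bool" where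
  "admissible_approximation Inc Out L lam K B eps u0 u0n \<longleftrightarrow>
     (\<forall>n. (\<forall>i\<in>Inc \<union> Out. W21_on (arc_interval L i) (u0n n i)) \<and>
          (\<forall>i\<in>Inc. boundary_trace (arc_interval L i) (u0n n i) 0 = B i) \<and>
          node_condition Inc Out L lam K (eps n) (u0n n)) \<and>
     (\<lambda>n. L1_net_norm (Inc \<union> Out) L (\<lambda>i x. u0n n i x - u0 i x)) \<longlonglongrightarrow> 0 \<and>
     (\<exists>C. \<forall>n. L1_net_norm (Inc \<union> Out) L (\<lambda>i. weak_deriv (arc_interval L i) (u0n n i)) \<le> C) \<and>
     (\<exists>C. \<forall>n. eps n * W21_net_norm (Inc \<union> Out) L (u0n n) \<le> C)"


section \<open>The parabolic problem\<close>

text \<open>Curves \<open>[0,\<infinity>) \<rightarrow> X\<close> are handled through the norm of the Banach space \<open>X\<close>.\<close>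

definition continuous_curve ::
  "((nat \<Rightarrow> real \<Rightarrow> real) \<Rightarrow> real) \<Rightarrow> (nat \<Rightarrow> real \<times> real \<Rightarrow> real) \<Rightarrow> bool" where
  "continuous_curve nrm u \<longleftrightarrow>
     (\<forall>s\<ge>0. ((\<lambda>t. nrm (\<lambda>i x. u i (x, t) - u i (x, s))) \<longlongrightarrow> 0) (at s within {0..}))"

definition has_curve_derivative ::
  "((nat \<Rightarrow> real \<Rightarrow> real) \<Rightarrow> real) \<Rightarrow> (nat \<Rightarrow> real \<times> real \<Rightarrow> real)
   \<Rightarrow> (nat \<Rightarrow> real \<times> real \<Rightarrow> real) \<Rightarrow> bool" where
  "has_curve_derivative nrm u u' \<longleftrightarrow>
     (\<forall>s\<ge>0. ((\<lambda>t. nrm (\<lambda>i x. (u i (x, t) - u i (x, s)) / (t - s) - u' i (x, s))) \<longlongrightarrow> 0)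
              (at s within {0..}))"

text \<open>
  The first condition only concerns the choice of representatives: a curve in \<open>L\<^sup>1\<close> is given by an
  equivalence class for each \<open>t\<close>, and joint measurability makes it a function on space-time.
\<close>
definition parabolic_solution ::
  "nat set \<Rightarrow> nat set \<Rightarrow> (nat \<Rightarrow> real) \<Rightarrow> (nat \<Rightarrow> real) \<Rightarrow> (nat \<Rightarrow> nat \<Rightarrow> real) \<Rightarrow> (nat \<Rightarrow> real)
   \<Rightarrow> real \<Rightarrow> (nat \<Rightarrow> real \<Rightarrow> real) \<Rightarrow> (nat \<Rightarrow> real \<times> real \<Rightarrow> real) \<Rightarrow> bool" where
  "parabolic_solution Inc Out L lam K B e u0 u \<longleftrightarrow>
     (\<forall>i\<in>Inc \<union> Out. u i \<in> borel_measurable (lebesgue_on (arc_interval L i \<times> {0<..}))) \<and>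
     (\<forall>i\<in>Inc \<union> Out. \<forall>t\<ge>0. W21_on (arc_interval L i) (\<lambda>x. u i (x, t))) \<and>
     continuous_curve (W21_net_norm (Inc \<union> Out) L) u \<and>
     (\<exists>ut. (\<forall>i\<in>Inc \<union> Out. \<forall>t\<ge>0. (\<lambda>x. ut i (x, t)) absolutely_integrable_on arc_interval L i) \<and>
           continuous_curve (L1_net_norm (Inc \<union> Out) L) ut \<and>
           has_curve_derivative (L1_net_norm (Inc \<union> Out) L) u ut \<and>
           (\<forall>i\<in>Inc \<union> Out. \<forall>t>0. AE x in lebesgue. x \<in> arc_interval L i \<longrightarrow>
              ut i (x, t) =
                - lam i * weak_deriv (arc_interval L i) (\<lambda>y. u i (y, t)) x
                + e * weak_deriv (arc_interval L i) (weak_deriv (arc_interval L i) (\<lambda>y. u i (y, t))) x)) \<and>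
     (\<forall>i\<in>Inc \<union> Out. AE x in lebesgue. x \<in> arc_interval L i \<longrightarrow> u i (x, 0) = u0 i x) \<and>
     (\<forall>t>0. node_condition Inc Out L lam K e (\<lambda>i x. u i (x, t))) \<and>
     (\<forall>i\<in>Inc. \<forall>t>0. boundary_trace (arc_interval L i) (\<lambda>x. u i (x, t)) 0 = B i) \<and>
     (\<forall>i\<in>Out. \<forall>t>0. boundary_trace (arc_interval L i) (\<lambda>x. u i (x, t)) (L i) =
                     boundary_trace (arc_interval L i) (u0 i) (L i))"


section \<open>The transport problem\<close>

text \<open>
  Weak form on \<open>(0,l) \<times> (0,T)\<close> of \<open>u\<^sub>t = - a u\<^sub>x\<close>, \<open>u(x,0) = v(x)\<close>, with inflow flux
  \<open>a u(0,t) = q(t)\<close>. For a test function \<open>\<phi>\<close>, \<open>\<phi>\<^sub>x\<close> and \<open>\<phi>\<^sub>t\<close> at \<open>z\<close> are \<open>D\<phi> z (1, 0)\<close> and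
  \<open>D\<phi> z (0, 1)\<close>.
\<close>
definition weak_transport ::
  "real \<Rightarrow> real \<Rightarrow> real \<Rightarrow> (real \<Rightarrow> real) \<Rightarrow> (real \<Rightarrow> real) \<Rightarrow> (real \<times> real \<Rightarrow> real) \<Rightarrow> bool" where
  "weak_transport l T a v q u \<longleftrightarrow>
     (\<forall>(\<phi>::real \<times> real \<Rightarrow> real) D\<phi>. C1c_on ({0..<l} \<times> {0..<T}) \<phi> D\<phi> \<longrightarrow>
        (LINT z:{0<..<l} \<times> {0<..<T}|lebesgue. u z * (D\<phi> z (0, 1) + a * D\<phi> z (1, 0)))
        + (LINT x:{0<..<l}|lebesgue. v x * \<phi> (x, 0)) =
        - (LINT t:{0<..<T}|lebesgue. \<phi> (0, t) * q t))"

definition transport_solution ::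
  "nat set \<Rightarrow> nat set \<Rightarrow> (nat \<Rightarrow> real) \<Rightarrow> (nat \<Rightarrow> real) \<Rightarrow> (nat \<Rightarrow> nat \<Rightarrow> real) \<Rightarrow> (nat \<Rightarrow> real)
   \<Rightarrow> (nat \<Rightarrow> real \<Rightarrow> real) \<Rightarrow> real \<Rightarrow> (nat \<Rightarrow> real \<times> real \<Rightarrow> real) \<Rightarrow> bool" where
  "transport_solution Inc Out L lam \<gamma> B u0 T u \<longleftrightarrow>
     (\<forall>i\<in>Inc \<union> Out. BV_on (arc_interval L i \<times> {0<..<T}) (u i)) \<and>
     (\<forall>i\<in>Inc. weak_transport (L i) T (lam i) (u0 i) (\<lambda>t. lam i * B i) (u i)) \<and>
     (\<forall>i\<in>Out. weak_transport (L i) T (lam i) (u0 i)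
        (\<lambda>t. \<Sum>j\<in>Inc. \<gamma> i j * lam j * boundary_trace (arc_interval L j \<times> {0<..<T}) (u j) (L j, t)) (u i))"

definition L1_converges ::
  "nat set \<Rightarrow> (nat \<Rightarrow> real) \<Rightarrow> real \<Rightarrow> (nat \<Rightarrow> nat \<Rightarrow> real \<times> real \<Rightarrow> real)
   \<Rightarrow> (nat \<Rightarrow> real \<times> real \<Rightarrow> real) \<Rightarrow> bool" where
  "L1_converges M L T u v \<longleftrightarrow>
     (\<forall>n. \<forall>i\<in>M. u n i absolutely_integrable_on arc_interval L i \<times> {0<..<T}) \<and>
     (\<forall>i\<in>M. v i absolutely_integrable_on arc_interval L i \<times> {0<..<T}) \<and>
     (\<lambda>n. \<Sum>i\<in>M. L1_norm (arc_interval L i \<times> {0<..<T}) (\<lambda>z. u n i z - v i z)) \<longlonglongrightarrow> 0"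

end

theory Submission imports Defs "HOL-Probability.Helly_Selection" begin

text \<open>
  Take \<open>K\<^sub>i\<^sub>j = K\<^sub>j\<^sub>i = c\<^sub>i\<close> for \<open>i\<close> outgoing and \<open>j\<close> incoming, and \<open>0\<close> otherwise. Let \<open>F\<^sub>i = \<lambda>\<^sub>i u\<^sub>i - \<epsilon> (u\<^sub>i)\<^sub>x\<close>
  be the flux, \<open>k\<close> the number of incoming arcs and \<open>S\<close> the sum of \<open>u\<^sub>j(L\<^sub>j)\<close> over them. The node condition
  on an outgoing arc reads \<open>F\<^sub>i(0) = c\<^sub>i (S - k u\<^sub>i(0))\<close>. There is no boundary layer where the velocity points into the
  arc: the time integral of \<open>F\<^sub>i(0) - \<lambda>\<^sub>i u\<^sub>i(0)\<close> is \<open>O(\<epsilon>)\<close>. So \<open>F\<^sub>i(0) = c\<^sub>i S / (1 + c\<^sub>i k / \<lambda>\<^sub>i)\<close> up to a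
  small error, and \<open>c\<^sub>i = \<theta> \<gamma>\<^sub>i (1 + c\<^sub>i k / \<lambda>\<^sub>i)\<close>, solvable for small \<open>\<theta>\<close>, makes the outgoing fluxes proportional
  to \<open>\<gamma>\<^sub>i\<close>; the factor is the total flux, because the node condition with symmetric \<open>K\<close> conserves mass.

  Compactness is replaced by a direct comparison with the transported profile. The problem is an \<open>L\<^sup>1\<close> contraction,
  which bounds \<open>u\<^sub>t = - F\<^sub>x\<close> in \<open>L\<^sup>1\<close>, hence \<open>F\<close> and \<open>u\<close> uniformly and, by duality, \<open>u\<^sub>x\<close> in \<open>L\<^sup>1\<close>. On an arc a second
  antiderivative of the difference to the transported profile solves a transport equation with source \<open>\<epsilon> u\<close>;
  it is therefore small, and with the bounds on the variation so is the difference itself in \<open>L\<^sup>1\<close>.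
\<close>

text \<open>The obstacle is the boundary layer at the outflow end of each arc: the node values of
  incoming arcs need not approach the traces of the limit, so no step passes to the limit in a
  trace, and only time integrals of fluxes are followed. The first antiderivative in
  \<open>x\<close> of the error solves a transport equation with source \<open>eps * u_x\<close>,
  which can be of order one inside a layer; the second has source \<open>eps * u\<close>, small
  everywhere, and this is why two integrations are made. They are undone by interpolation, first
  with a Lipschitz bound, then with the bound on the variation. Incoming arcs come first, because
  mass balance then yields the flux that they deliver at the node, and this flux feeds the outgoing
  arcs. The limit is explicit in the variable \<open>x - lam * t\<close>, so the whole sequence
  converges; that every solution of the transport problem coincides with it is a separate uniqueness
  statement. The initial datum gets a pointwise representative of bounded variation from its own
  admissible approximations, by Helly's theorem.\<close>

text \<open>For an integrand that is not integrable the value is \<open>0\<close>.\<close>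
abbreviation abs_integral :: "real \<Rightarrow> (real \<Rightarrow> real) \<Rightarrow> real" where
  "abs_integral l f \<equiv> integral {0..l} (\<lambda>x. \<bar>f x\<bar>)"

section \<open>Integrals over boxes and boundary traces\<close>

text \<open>Boxes are an intersection-stable generator of the Borel sets, so Dynkin induction
  carries the vanishing to every Borel set, and a density whose integrals all vanish is zero. The
  complement step needs the integral over the whole space, obtained as a limit over growing
  boxes.\<close>

lemma AE_zero_if_box_integrals_zero:
  fixes f :: "'a::euclidean_space \<Rightarrow> real"
  assumes int: "integrable lborel f"
    and zero: "\<And>a b. (LINT x:box a b|lborel. f x) = 0"
  shows "AE x in lborel. f x = 0"
proof -
  let ?A = "\<lambda>n::nat. box (- (real n *\<^sub>R One)) (real n *\<^sub>R One) :: 'a set"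
  have si: "set_integrable lborel A f" if "A \<in> sets borel" for A
    unfolding set_integrable_def using int that by (intro integrable_mult_indicator) simp_all
  have "incseq ?A"
    unfolding incseq_def by (intro allI impI subset_box_imp) (auto simp: inner_simps)
  then have "(\<lambda>n. LINT x:?A n|lborel. f x) \<longlonglongrightarrow> (LINT x:(\<Union>n. ?A n)|lborel. f x)"
    by (intro set_integral_cont_up) (auto intro!: si)
  then have UNIV0: "(LINT x:UNIV|lborel. f x) = 0"
    unfolding UN_box_eq_UNIV zero by (simp add: LIMSEQ_const_iff)
  have IS: "Int_stable (range (\<lambda>(a, b). box a b :: 'a set))"
    by (auto simp: Int_stable_def box_Int_box)
  have G: "range (\<lambda>(a, b). box a b :: 'a set) \<subseteq> Pow UNIV" by simp
  have main: "(LINT x:A|lborel. f x) = 0" if "A \<in> sets borel" for A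
  proof -
    have "A \<in> sigma_sets UNIV (range (\<lambda>(a, b). box a b :: 'a set))"
      using that by (simp add: borel_eq_box)
    then show ?thesis
    proof (induction rule: sigma_sets_induct_disjoint[OF IS G, consumes 1, case_names basic empty compl union])
      case (basic A) then show ?case using zero by auto
    next
      case empty then show ?case by (simp add: set_lebesgue_integral_def)
    next
      case (compl A)
      then have A: "A \<in> sets borel" by (simp add: borel_eq_box)
      have "(LINT x:UNIV|lborel. f x) = (LINT x:A \<union> (UNIV - A)|lborel. f x)" by simp
      also have "\<dots> = (LINT x:A|lborel. f x) + (LINT x:(UNIV - A)|lborel. f x)"
        using A by (intro set_integral_Un) (auto intro!: si)
      finally show ?case using UNIV0 compl by simp
    next
      case (union A)
      then have A: "\<And>i. A i \<in> sets borel" by (auto simp: borel_eq_box)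
      have "(LINT x:(\<Union>i. A i)|lborel. f x) = (\<Sum>i. (LINT x:A i|lborel. f x))"
      proof (rule lebesgue_integral_countable_add)
        show "set_integrable lborel (\<Union> (range A)) f" using A by (intro si) auto
      qed (use A union(1) in \<open>auto simp: disjoint_family_on_def\<close>)
      then show ?case using union by simp
    qed
  qed
  show ?thesis
    by (rule sigma_finite_measure.density_zero[OF sigma_finite_lborel int]) (use main in simp)
qed

lemma negligible_iff_AE: "negligible {x. \<not> P x} \<longleftrightarrow> (AE x in lebesgue. P x)"
  by (metis dual_order.refl eventually_ae_filter_negligible negligible_subset)

text \<open>The local form: the integrand is cut off to a box whose closure lies in \<open>Q\<close>
  and replaced by a Borel representative, so that the global form applies. Countably many closed
  boxes exhaust the open set.\<close>

lemma negligible_nonzero_if_box_integrals_zero: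
  fixes f :: "'a::euclidean_space \<Rightarrow> real"
  assumes "open Q" and f: "f absolutely_integrable_on Q"
    and zero: "\<And>a b. cbox a b \<subseteq> Q \<Longrightarrow> integral (cbox a b) f = 0"
  shows "negligible {x\<in>Q. f x \<noteq> 0}"
proof -
  have box: "negligible {x\<in>box c d. f x \<noteq> 0}" if sub': "cbox c d \<subseteq> Q" for c d
  proof -
    have sub: "box c d \<subseteq> Q" using sub' box_subset_cbox by blast
    define g where "g x = indicator (box c d) x * f x" for x
    have fi: "f absolutely_integrable_on box a b" if "box a b \<subseteq> Q" for a b
      using f that set_integrable_subset by (metis lmeasurable_box fmeasurableD)
    have "integrable lebesgue g"
      using fi[OF sub] by (simp add: g_def[abs_def] set_integrable_def)
    then obtain h where h: "h \<in> borel_measurable lborel" "AE x in lborel. g x = h x"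
      using completion_ex_borel_measurable_real[of g lborel] by (auto dest: borel_measurable_integrable)
    have gm[measurable]: "g \<in> borel_measurable lebesgue" using \<open>integrable lebesgue g\<close> by auto
    have hl: "AE x in lebesgue. g x = h x" using h(2) by (rule AE_completion)
    have ih: "integrable lebesgue h"
      using \<open>integrable lebesgue g\<close> hl h(1) by (subst integrable_cong_AE[of _ _ g]) (auto simp: measurable_completion eq_commute)
    then have ihb: "integrable lborel h" using h(1) by (simp add: integrable_completion)
    have "(LINT x:box a b|lborel. h x) = 0" for a b
    proof -
      have "(LINT x:box a b|lborel. h x) = (LINT x:box a b|lebesgue. h x)"
        unfolding set_lebesgue_integral_def
        by (intro integral_completion[symmetric] borel_measurable_scaleR borel_measurable_indicator h(1)) auto
      also have "\<dots> = (LINT x:box a b|lebesgue. g x)"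
        using hl measurable_completion[OF h(1)] unfolding set_lebesgue_integral_def
        by (intro integral_cong_AE borel_measurable_scaleR borel_measurable_indicator gm) auto
      \<comment> \<open>A test box meets the cutoff box again in a box, with closure inside
        \<open>Q\<close>. So the hypothesis also settles test boxes that leave
        \<open>Q\<close>.\<close>
      also have "\<dots> = (LINT x:box a b \<inter> box c d|lebesgue. f x)"
        unfolding set_lebesgue_integral_def g_def by (intro Bochner_Integration.integral_cong) (auto simp: indicator_def)
      also have "\<dots> = 0"
      proof -
        obtain a' b' where ab: "box a b \<inter> box c d = box a' b'" by (simp add: box_Int_box)
        then have Q: "box a' b' \<subseteq> Q" using sub by auto
        have "integral (box a' b') f = 0"
        proof (cases "box a' b' = {}")
          case False
          then have "cbox a' b' \<subseteq> cbox c d"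
            using ab closure_mono[of "box a' b'" "box c d"] by (metis Int_empty_right Int_lower2 closure_box)
          then show ?thesis using zero[of a' b'] sub' by (simp add: integral_open_interval)
        qed simp
        then show ?thesis unfolding ab using fi[OF Q] by (simp add: set_lebesgue_integral_eq_integral(2))
      qed
      finally show ?thesis .
    qed
    then have "AE x in lborel. h x = 0" by (rule AE_zero_if_box_integrals_zero[OF ihb])
    then have "AE x in lebesgue. g x = 0" using AE_completion[of "\<lambda>x. h x = 0" lborel] hl by auto
    then have "AE x in lebesgue. x \<in> box c d \<longrightarrow> f x = 0" by eventually_elim (auto simp: g_def)
    then have "negligible {x. \<not> (x \<in> box c d \<longrightarrow> f x = 0)}" 
      unfolding negligible_iff_AE .
    then show ?thesis by (rule negligible_subset) auto
  qed
  obtain D where D: "countable D" "D \<subseteq> Pow Q" "\<And>X. X \<in> D \<Longrightarrow> \<exists>a b. X = cbox a b" "\<Union>D = Q"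
    using open_countable_Union_open_cbox[OF \<open>open Q\<close>] by metis
  have "negligible {x\<in>X. f x \<noteq> 0}" if X: "X \<in> D" for X
  proof -
    obtain c d where cd: "X = cbox c d" using D X by blast
    then have "cbox c d \<subseteq> Q" using D X by blast
    moreover have "negligible (cbox c d - box c d)" by (rule negligible_frontier_interval)
    ultimately have "negligible ({x\<in>box c d. f x \<noteq> 0} \<union> (cbox c d - box c d))" using box by simp
    then show ?thesis by (rule negligible_subset) (auto simp: cd)
  qed
  then have "negligible (\<Union>X\<in>D. {x\<in>X. f x \<noteq> 0})"
    using D(1) by (intro negligible_countable_Union) auto
  then show ?thesis by (rule negligible_subset) (use D in auto)
qed


section \<open>Boundary traces computed from a representative with a limit\<close>

text \<open>Existence: near \<open>x\<close> the integrand is below a small constant off a null set,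
  so its integral is a small multiple of the volume of the ball. Uniqueness, on which the
  description operator in \<open>boundary_trace\<close> depends, comes from the density bound
  \<open>c\<close>: two traces would keep the averages of \<open>\<bar>w' - w\<bar>\<close> over the
  balls away from zero.\<close>

lemma
  fixes u F :: "'a::euclidean_space \<Rightarrow> real"
  assumes u: "u absolutely_integrable_on S" and S: "S \<in> sets lebesgue"
    and N: "negligible N" "\<And>y. y \<in> S - N \<Longrightarrow> u y = F y"
    and F: "(F \<longlongrightarrow> w) (at x within S)" and x: "x \<notin> S"
    and c: "c > 0" "\<forall>\<^sub>F r in at_right 0. measure lebesgue (S \<inter> ball x r) \<ge> c * r ^ DIM('a)"
  shows has_boundary_trace_eqI: "has_boundary_trace S u x w"
    and boundary_trace_eqI: "boundary_trace S u x = w"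
proof -
  let ?B = "\<lambda>r. S \<inter> ball x r"
  have B: "?B r \<in> lmeasurable" for r
    using S by (metis inf_commute fmeasurable_Int_fmeasurable lmeasurable_ball)
  have ui: "u absolutely_integrable_on ?B r" for r
    using u B set_integrable_subset by (metis fmeasurableD inf_le1)
  have ci: "(\<lambda>y. k::real) absolutely_integrable_on ?B r" for r k
    using B by simp
  have di: "(\<lambda>y. u y - k) absolutely_integrable_on ?B r" for r k
    using set_integral_diff(1)[OF ui ci] .
  have ai: "(\<lambda>y. \<bar>u y - k\<bar>) absolutely_integrable_on ?B r" for r k
    using absolutely_integrable_abs[OF di] by simp
  note hk = set_lebesgue_integral_eq_integral
  have E: "(LINT y:?B r|lebesgue. \<bar>u y - k\<bar>) = integral (?B r) (\<lambda>y. \<bar>u y - k\<bar>)" for r k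
    using ai by (simp add: hk(2))
  have cont: "integral (?B r) (\<lambda>y. k) = k * measure lebesgue (?B r)" for r and k::real
    using lmeasure_integral[OF B, of r] B integral_mult_right[of "?B r" k "\<lambda>x. 1"] by simp
  have tr: "((\<lambda>r. (LINT y:?B r|lebesgue. \<bar>u y - w\<bar>) / r ^ DIM('a)) \<longlongrightarrow> 0) (at_right 0)"
  proof (rule tendstoI)
    fix e :: real assume "e > 0"
    define V where "V = measure lebesgue (ball (0::'a) 1)"
    have V: "measure lebesgue (ball x r) = r ^ DIM('a) * V" if "r \<ge> 0" for r
      using content_ball_conv_unit_ball[OF that, of x] by (simp add: V_def)
    have "V \<ge> 0" by (simp add: V_def)
    \<comment> \<open>The tolerance is scaled by the volume \<open>V\<close> of the unit ball; the
      summand 1 keeps the divisor positive when only \<open>V \<ge> 0\<close> is at hand.\<close>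
    define k where "k = e / (2 * (V + 1))"
    have "k > 0" using \<open>e > 0\<close> \<open>V \<ge> 0\<close> by (simp add: k_def)
    have "k * V < e"
    proof -
      have "k * V \<le> k * (V + 1)" using \<open>k > 0\<close> by simp
      also have "\<dots> = e / 2" using \<open>V \<ge> 0\<close> by (simp add: k_def field_simps)
      finally show ?thesis using \<open>e > 0\<close> by linarith
    qed
    obtain d where d: "d > 0" "\<And>y. y \<in> S \<Longrightarrow> dist y x < d \<Longrightarrow> \<bar>F y - w\<bar> < k"
      using F \<open>k > 0\<close> x unfolding tendsto_iff eventually_at dist_real_def by metis
    have "dist ((LINT y:?B r|lebesgue. \<bar>u y - w\<bar>) / r ^ DIM('a)) 0 < e" if r: "0 < r" "r < d" for r
    proof -
      have "integral (?B r) (\<lambda>y. \<bar>u y - w\<bar>) \<le> integral (?B r) (\<lambda>y. k)"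
      proof -
        have "integral (?B r) (\<lambda>y. \<bar>u y - w\<bar>) = integral (?B r) (\<lambda>y. if y \<in> N then 0 else \<bar>u y - w\<bar>)"
          by (rule integral_spike[OF N(1)]) auto
        also have "\<dots> \<le> integral (?B r) (\<lambda>y. k)"
        proof (rule integral_le)
          show "(\<lambda>y. if y \<in> N then 0 else \<bar>u y - w\<bar>) integrable_on ?B r"
            by (rule integrable_spike[OF _ N(1), of "\<lambda>y. \<bar>u y - w\<bar>"]) (use ai hk(1) in auto)
          show "(\<lambda>y. k) integrable_on ?B r" using ci hk(1) by blast
          show "(if y \<in> N then 0 else \<bar>u y - w\<bar>) \<le> k" if "y \<in> ?B r" for y
            using that N(2)[of y] d(2)[of y] r \<open>k > 0\<close> by (auto simp: dist_commute less_imp_le)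
        qed
        finally show ?thesis .
      qed
      also have "\<dots> \<le> k * measure lebesgue (ball x r)"
        unfolding cont using \<open>k > 0\<close> S by (intro mult_left_mono measure_mono_fmeasurable) (auto intro: fmeasurableD B)
      also have "\<dots> = k * V * r ^ DIM('a)" using V r by simp
      finally have "(LINT y:?B r|lebesgue. \<bar>u y - w\<bar>) / r ^ DIM('a) \<le> k * V"
        unfolding E using r by (simp add: field_simps)
      moreover have "(LINT y:?B r|lebesgue. \<bar>u y - w\<bar>) \<ge> 0"
        unfolding E by (intro integral_nonneg) (auto intro!: hk(1) ai)
      ultimately show ?thesis using \<open>k * V < e\<close> r by simp
    qed
    then show "\<forall>\<^sub>F r in at_right 0. dist ((LINT y:?B r|lebesgue. \<bar>u y - w\<bar>) / r ^ DIM('a)) 0 < e"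
      using d(1) by (auto simp: eventually_at_right_field)
  qed
  show ht: "has_boundary_trace S u x w"
    using tr u by (simp add: has_boundary_trace_def)
  have "w' = w" if w': "has_boundary_trace S u x w'" for w'
  proof (rule ccontr)
    assume "w' \<noteq> w"
    then have p: "c * \<bar>w' - w\<bar> > 0" using c(1) by simp
    let ?q = "\<lambda>k r. (LINT y:?B r|lebesgue. \<bar>u y - k\<bar>) / r ^ DIM('a)"
    have "((\<lambda>r. ?q w' r + ?q w r) \<longlongrightarrow> 0 + 0) (at_right 0)"
      using w' tr by (intro tendsto_add) (auto simp: has_boundary_trace_def)
    then have "\<forall>\<^sub>F r in at_right 0. ?q w' r + ?q w r < c * \<bar>w' - w\<bar>"
      using p by (intro order_tendstoD) auto
    moreover have "\<forall>\<^sub>F r in at_right (0::real). r > 0" by (auto simp: eventually_at_right_field intro: exI[of _ 1])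
    ultimately have "\<forall>\<^sub>F r in at_right (0::real). False" using c(2)
    proof eventually_elim
      case (elim r)
      have "c * \<bar>w' - w\<bar> * r ^ DIM('a) \<le> \<bar>w' - w\<bar> * measure lebesgue (?B r)"
        using mult_left_mono[OF elim(3), of "\<bar>w' - w\<bar>"] by (simp add: mult_ac)
      also have "\<dots> = integral (?B r) (\<lambda>y. \<bar>w' - w\<bar>)" by (simp add: cont)
      also have "\<dots> \<le> integral (?B r) (\<lambda>y. \<bar>u y - w'\<bar> + \<bar>u y - w\<bar>)"
        by (intro integral_le integrable_add) (auto intro!: hk(1) ai ci)
      also have "\<dots> = integral (?B r) (\<lambda>y. \<bar>u y - w'\<bar>) + integral (?B r) (\<lambda>y. \<bar>u y - w\<bar>)"
        by (intro integral_add) (auto intro!: hk(1) ai)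
      also have "\<dots> = (?q w' r + ?q w r) * r ^ DIM('a)"
        unfolding E using elim(2) by (simp add: field_simps)
      also have "\<dots> < c * \<bar>w' - w\<bar> * r ^ DIM('a)"
        using elim by (intro mult_strict_right_mono) auto
      finally show False by simp
    qed
    then show False by (simp add: trivial_limit_at_right_real eventually_False)
  qed
  then show "boundary_trace S u x = w"
    unfolding boundary_trace_def using ht by blast
qed

text \<open>Dominated convergence with majorant \<open>\<bar>f\<bar>\<close>. It passes from
  identities tested with continuous cutoffs to integrals over the limiting set.\<close>

lemma integral_zero_if_cutoffs_zero:
  fixes f :: "'a::euclidean_space \<Rightarrow> real"
  assumes f: "f absolutely_integrable_on Q" and Q: "Q \<in> sets lebesgue" and B: "B \<subseteq> Q"
    and ch: "\<And>k::nat. continuous_on UNIV (ch k)" "\<And>k x. \<bar>ch k x\<bar> \<le> 1"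
      "\<And>x. x \<in> Q \<Longrightarrow> (\<lambda>k. ch k x) \<longlonglongrightarrow> indicator B x"
    and zero: "\<And>k. integral Q (\<lambda>x. f x * ch k x) = 0"
  shows "integral B f = 0"
proof -
  have a: "(\<lambda>x. f x * ch k x) absolutely_integrable_on Q" for k
  proof -
    have "ch k \<in> borel_measurable (lebesgue_on Q)"
      using ch(1) Q by (meson continuous_imp_measurable_on_sets_lebesgue continuous_on_subset subset_UNIV)
    moreover have "bounded (ch k ` Q)" using ch(2) by (auto simp: bounded_iff)
    ultimately have "(\<lambda>x. ch k x * f x) absolutely_integrable_on Q"
      using absolutely_integrable_bounded_measurable_product[OF bilinear_times, of "ch k" Q f] f Q by simp
    then show ?thesis by (simp add: mult.commute)
  qed
  have "(\<lambda>k. integral Q (\<lambda>x. f x * ch k x)) \<longlonglongrightarrow> integral Q (\<lambda>x. f x * indicator B x)"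
  proof (rule dominated_convergence(2))
    show "(\<lambda>x. f x * ch k x) integrable_on Q" for k using a set_lebesgue_integral_eq_integral(1) by blast
    show "(\<lambda>x. \<bar>f x\<bar>) integrable_on Q"
      using set_lebesgue_integral_eq_integral(1)[OF absolutely_integrable_abs[OF f]] by simp
    show "norm (f x * ch k x) \<le> \<bar>f x\<bar>" for k x using ch(2)[of k x] by (simp add: abs_mult mult_left_le)
    show "(\<lambda>k. f x * ch k x) \<longlonglongrightarrow> f x * indicator B x" if "x \<in> Q" for x
      using ch(3)[OF that] by (intro tendsto_intros)
  qed
  then have "integral Q (\<lambda>x. f x * indicator B x) = 0" by (simp add: zero LIMSEQ_const_iff)
  moreover have "integral Q (\<lambda>x. f x * indicator B x) = integral (Q \<inter> B) f"
  proof -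
    have "(\<lambda>x. f x * indicator B x) = (\<lambda>x. if x \<in> B then f x else 0)" by (auto simp: indicator_def)
    then show ?thesis by (simp add: integral_restrict_Int Int_commute)
  qed
  ultimately show ?thesis using B by (simp add: Int_absorb1)
qed

section \<open>Explicit continuously differentiable cutoffs of intervals\<close>

text \<open>The square of the positive part is continuously differentiable, also at \<open>p\<close>
  and \<open>q\<close>, and the map \<open>y \<mapsto> k * y / (1 + k * y)\<close> pushes positive
  values to 1 as \<open>k\<close> grows while fixing 0. This regularity is all that
  \<open>C1c_on\<close> asks of a test function.\<close>

definition bump :: "nat \<Rightarrow> real \<Rightarrow> real \<Rightarrow> real \<Rightarrow> real" where
  "bump k p q x = k * (max 0 ((x - p) * (q - x)))\<^sup>2 / (1 + k * (max 0 ((x - p) * (q - x)))\<^sup>2)"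

lemma bump_denominator_pos: "1 + real k * (y::real)\<^sup>2 > 0"
  by (smt (verit) mult_nonneg_nonneg of_nat_0_le_iff zero_le_power2)

lemma bump_nonneg: "0 \<le> bump k p q x"
  unfolding bump_def using bump_denominator_pos by (intro divide_nonneg_pos) auto

lemma bump_le_1: "bump k p q x \<le> 1"
  unfolding bump_def using bump_denominator_pos by (simp add: divide_le_eq_1)

lemma bump_eq_0:
  assumes "p < q" "x \<notin> {p<..<q}"
  shows "bump k p q x = 0"
proof -
  have "(x - p) * (q - x) \<le> 0" using assms by (auto simp: mult_le_0_iff)
  then show ?thesis by (simp add: bump_def max_def)
qed

lemma has_real_derivative_max_0_square:
  "((\<lambda>x::real. (max 0 x)\<^sup>2) has_real_derivative 2 * max 0 x) (at x)"
proof (cases "x = 0")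
  case True
  have "((\<lambda>h. (max 0 h)\<^sup>2 / h) \<longlongrightarrow> 0) (at (0::real))"
  proof (rule Lim_null_comparison)
    show "\<forall>\<^sub>F h in at (0::real). norm ((max 0 h)\<^sup>2 / h) \<le> \<bar>h\<bar>"
      by (auto simp: eventually_at max_def power2_eq_square intro!: exI[of _ 1])
    show "((\<lambda>h. \<bar>h\<bar>) \<longlongrightarrow> 0) (at (0::real))" by (auto intro!: tendsto_eq_intros)
  qed
  then show ?thesis using True by (simp add: DERIV_def)
next
  case False
  show ?thesis
  proof (cases "x > 0")
    case True
    have "((\<lambda>x::real. x\<^sup>2) has_real_derivative 2 * max 0 x) (at x)"
      using True by (auto intro!: derivative_eq_intros)
    then show ?thesis
      by (rule has_field_derivative_transform_within_open[of _ _ _ "{0<..}"]) (use True in \<open>auto simp: max_def\<close>)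
  next
    case False
    with \<open>x \<noteq> 0\<close> have "x < 0" by simp
    have "((\<lambda>x::real. 0) has_real_derivative 2 * max 0 x) (at x)"
      using \<open>x < 0\<close> by (auto intro!: derivative_eq_intros)
    then show ?thesis
      by (rule has_field_derivative_transform_within_open[of _ _ _ "{..<0}"]) (use \<open>x < 0\<close> in \<open>auto simp: max_def\<close>)
  qed
qed

lemma bump_differentiable:
  obtains b' where "\<And>x. (bump k p q has_real_derivative b' x) (at x)" "continuous_on UNIV b'"
proof
  let ?m = "\<lambda>x. max 0 ((x - p) * (q - x))"
  let ?m' = "\<lambda>x. 2 * ?m x * (p + q - 2 * x)"
  show "(bump k p q has_real_derivative (k * ?m' x * (1 + k * (?m x)\<^sup>2) - k * (?m x)\<^sup>2 * (k * ?m' x)) / (1 + k * (?m x)\<^sup>2)\<^sup>2) (at x)" for x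
  proof -
    have "((\<lambda>x. (x - p) * (q - x)) has_real_derivative (p + q - 2 * x)) (at x)"
      by (auto intro!: derivative_eq_intros simp: algebra_simps)
    from DERIV_chain2[OF has_real_derivative_max_0_square this]
    have d: "((\<lambda>x. (?m x)\<^sup>2) has_real_derivative ?m' x) (at x)" by simp
    have "1 + k * (?m x)\<^sup>2 \<noteq> 0" using bump_denominator_pos[of k "?m x"] by linarith
    from DERIV_divide[OF DERIV_cmult[OF d, of k] DERIV_add[OF DERIV_const DERIV_cmult[OF d, of k]] this]
    show ?thesis unfolding bump_def[abs_def] by (simp add: power2_eq_square)
  qed
  show "continuous_on UNIV (\<lambda>x. (k * ?m' x * (1 + k * (?m x)\<^sup>2) - k * (?m x)\<^sup>2 * (k * ?m' x)) / (1 + k * (?m x)\<^sup>2)\<^sup>2)"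
    using bump_denominator_pos by (intro continuous_intros) (metis less_numeral_extra(3) power_eq_0_iff)
qed

lemma continuous_on_bump: "continuous_on A (bump k p q)"
proof -
  obtain b' where "\<And>x. (bump k p q has_real_derivative b' x) (at x)" using bump_differentiable by blast
  then show ?thesis by (intro DERIV_continuous_on) (rule has_field_derivative_at_within)
qed

lemma bump_tendsto: "p < q \<Longrightarrow> (\<lambda>k. bump k p q x) \<longlonglongrightarrow> indicator {p<..<q} x"
  (is "_ \<Longrightarrow> ?lim")
proof (cases "x \<in> {p<..<q}")
  case True
  define m where "m = (max 0 ((x - p) * (q - x)))\<^sup>2"
  have "m > 0" using True by (simp add: m_def)
  have "(\<lambda>k. 1 - 1 / (1 + real k * m)) \<longlonglongrightarrow> 1 - 0"
    by (intro tendsto_diff tendsto_const tendsto_divide_0[OF tendsto_const] filterlim_at_top_imp_at_infinity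
        filterlim_tendsto_add_at_top[OF tendsto_const] filterlim_at_top_mult_tendsto_pos[OF tendsto_const \<open>m > 0\<close>] filterlim_real_sequentially)
  moreover have "1 - 1 / (1 + real k * m) = bump k p q x" for k
    unfolding bump_def m_def[symmetric] using \<open>m > 0\<close> by (simp add: field_simps add_nonneg_eq_0_iff)
  ultimately show ?thesis using True by simp
next
  assume "p < q"
  case False then show ?thesis using bump_eq_0[OF \<open>p < q\<close>] by simp
qed

section \<open>Primitives and weak derivatives on an interval\<close>

lemma absolutely_integrable_mult_continuous:
  fixes g \<phi> :: "real \<Rightarrow> real"
  assumes "g absolutely_integrable_on {a..b}" "continuous_on {a..b} \<phi>"
  shows "(\<lambda>x. g x * \<phi> x) absolutely_integrable_on {a..b}"
proof -
  have "(\<lambda>x. \<phi> x * g x) absolutely_integrable_on {a..b}"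
  proof (rule absolutely_integrable_bounded_measurable_product_real)
    show "\<phi> \<in> borel_measurable (lebesgue_on {a..b})"
      using assms(2) by (intro continuous_imp_measurable_on_sets_lebesgue) auto
    show "bounded (\<phi> ` {a..b})"
      using assms(2) compact_continuous_image compact_imp_bounded by blast
  qed (use assms in auto)
  then show ?thesis by (simp add: mult.commute)
qed

text \<open>The increment is \<open>y - x\<close> times a quantity that vanishes as \<open>y\<close>
  approaches \<open>x\<close>, so \<open>R\<close> has derivative 0 at every point. Product rules
  for indefinite integrals thereby avoid differentiation almost everywhere.\<close>

lemma eq_endpoints_if_diff_le:
  fixes R A :: "real \<Rightarrow> real"
  assumes ab: "a \<le> b" and A: "continuous_on {a..b} A"
    and R: "\<And>x y. a \<le> x \<Longrightarrow> x \<le> y \<Longrightarrow> y \<le> b \<Longrightarrow> \<bar>R y - R x\<bar> \<le> C * (y - x) * \<bar>A y - A x\<bar>"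
  shows "R b = R a"
proof -
  have "(R has_real_derivative 0) (at x within {a..b})" if x: "x \<in> {a..b}" for x
  proof -
    have "((\<lambda>y. (R y - R x) / (y - x)) \<longlongrightarrow> 0) (at x within {a..b})"
    proof (rule Lim_null_comparison)
      have "\<bar>(R y - R x) / (y - x)\<bar> \<le> C * \<bar>A y - A x\<bar>" if "y \<in> {a..b}" "y \<noteq> x" for y
      proof (cases "x < y")
        case True
        then show ?thesis using R[of x y] x that by (simp add: field_simps)
      next
        case False
        then show ?thesis using R[of y x] x that
          by (simp add: field_simps abs_minus_commute)
      qed
      then show "\<forall>\<^sub>F y in at x within {a..b}. norm ((R y - R x) / (y - x)) \<le> C * \<bar>A y - A x\<bar>"
        by (auto simp: eventually_at intro!: exI[of _ 1])
      have "((\<lambda>y. A y) \<longlongrightarrow> A x) (at x within {a..b})"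
        using A x by (auto simp: continuous_on_def)
      then show "((\<lambda>y. C * \<bar>A y - A x\<bar>) \<longlongrightarrow> 0) (at x within {a..b})"
        by (auto intro!: tendsto_eq_intros)
    qed
    then show ?thesis by (simp add: has_field_derivative_iff)
  qed
  then obtain c where "\<forall>x\<in>{a..b}. R x = c"
    using has_field_derivative_zero_constant[of "{a..b}" R] by (auto simp: convex_real_interval)
  then show ?thesis using ab by auto
qed

section \<open>Absolutely continuous functions on a compact interval\<close>

text \<open>Absolute continuity, expressed through a density instead of a pointwise derivative,
  since a weak derivative supplies exactly a density.\<close>

definition primitive_on :: "real \<Rightarrow> real \<Rightarrow> (real \<Rightarrow> real) \<Rightarrow> (real \<Rightarrow> real) \<Rightarrow> bool" where
  "primitive_on a b f g \<longleftrightarrow> g absolutely_integrable_on {a..b} \<and>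
     (\<forall>x\<in>{a..b}. f x = f a + integral {a..x} g)"

lemma primitive_onD:
  assumes "primitive_on a b f g"
  shows "g absolutely_integrable_on {a..b}" "x \<in> {a..b} \<Longrightarrow> f x = f a + integral {a..x} g"
  using assms unfolding primitive_on_def by blast+

lemma absolutely_integrable_subinterval:
  fixes g :: "real \<Rightarrow> real"
  assumes "g absolutely_integrable_on {a..b}" "a \<le> c" "d \<le> b"
  shows "g absolutely_integrable_on {c..d}"
  using assms by (intro set_integrable_subset[OF assms(1)]) auto

lemma primitive_on_diff:
  assumes f: "primitive_on a b f g" and xy: "a \<le> x" "x \<le> y" "y \<le> b"
  shows "f y - f x = integral {x..y} g"
proof -
  have "g integrable_on {a..y}"
    using absolutely_integrable_subinterval[OF primitive_onD(1)[OF f] order_refl xy(3)]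
      set_lebesgue_integral_eq_integral(1) by blast
  then have "integral {a..x} g + integral {x..y} g = integral {a..y} g"
    using xy by (intro Henstock_Kurzweil_Integration.integral_combine)
  then show ?thesis using primitive_onD(2)[OF f, of x] primitive_onD(2)[OF f, of y] xy by simp
qed

lemma primitive_on_continuous:
  assumes "primitive_on a b f g"
  shows "continuous_on {a..b} f"
proof -
  have "continuous_on {a..b} (\<lambda>x. f a + integral {a..x} g)"
    using set_lebesgue_integral_eq_integral(1)[OF primitive_onD(1)[OF assms]]
    by (intro continuous_on_add continuous_on_const indefinite_integral_continuous_1)
  moreover have "f a + integral {a..x} g = f x" if "x \<in> {a..b}" for x
    using primitive_onD(2)[OF assms that] by (rule sym)
  ultimately show ?thesis by (rule continuous_on_eq)
qed

lemma primitive_on_minus: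
  assumes f: "primitive_on a b f g" and f': "primitive_on a b f' g'"
  shows "primitive_on a b (\<lambda>x. f x - f' x) (\<lambda>x. g x - g' x)"
  unfolding primitive_on_def
proof (intro conjI ballI)
  show "(\<lambda>x. g x - g' x) absolutely_integrable_on {a..b}"
    using set_integral_diff(1)[OF primitive_onD(1)[OF f] primitive_onD(1)[OF f']] .
  fix x assume x: "x \<in> {a..b}"
  then have "integral {a..x} (\<lambda>x. g x - g' x) = integral {a..x} g - integral {a..x} g'"
    by (intro integral_diff set_lebesgue_integral_eq_integral(1)
        absolutely_integrable_subinterval[OF primitive_onD(1)[OF f] order_refl]
        absolutely_integrable_subinterval[OF primitive_onD(1)[OF f'] order_refl]) auto
  then show "f x - f' x = f a - f' a + integral {a..x} (\<lambda>x. g x - g' x)"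
    using primitive_onD(2)[OF f x] primitive_onD(2)[OF f' x] by simp
qed

lemma primitive_on_of_derivative:
  assumes "\<And>x. x \<in> {a..b} \<Longrightarrow> (f has_real_derivative g x) (at x within {a..b})" "continuous_on {a..b} g"
  shows "primitive_on a b f g"
  unfolding primitive_on_def
proof (intro conjI ballI)
  show "g absolutely_integrable_on {a..b}" using assms(2) absolutely_integrable_continuous_real by blast
  fix x assume x: "x \<in> {a..b}"
  have "(f has_vector_derivative g y) (at y within {a..x})" if "y \<in> {a..x}" for y
    using DERIV_subset[OF assms(1), of y "{a..x}"] that x
    by (auto simp: has_real_derivative_iff_has_vector_derivative)
  then have "(g has_integral f x - f a) {a..x}"
    using x by (intro fundamental_theorem_of_calculus) auto
  then show "f x = f a + integral {a..x} g" by (simp add: integral_unique)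
qed

text \<open>The difference of the two sides, as a function of the right endpoint, is \<open>o(y - x)\<close>.\<close>
lemma primitive_on_integral_by_parts:
  assumes ab: "a \<le> b" and f: "primitive_on a b f g"
    and \<phi>: "\<And>x. x \<in> {a..b} \<Longrightarrow> (\<phi> has_real_derivative \<phi>' x) (at x within {a..b})"
    and \<phi>': "continuous_on {a..b} \<phi>'"
  shows "integral {a..b} (\<lambda>x. f x * \<phi>' x) = f b * \<phi> b - f a * \<phi> a - integral {a..b} (\<lambda>x. g x * \<phi> x)"
proof -
  note hk = set_lebesgue_integral_eq_integral(1)
  have c\<phi>: "continuous_on {a..b} \<phi>" using \<phi> by (rule DERIV_continuous_on)
  have cf: "continuous_on {a..b} f" using f by (rule primitive_on_continuous)
  have g: "g absolutely_integrable_on {a..b}" using primitive_onD(1)[OF f] .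
  have p: "primitive_on a b \<phi> \<phi>'" using \<phi> \<phi>' by (rule primitive_on_of_derivative)
  \<comment> \<open>Increments of \<open>f\<close> are bounded by increments of \<open>A\<close>,
    which is continuous but need not be Lipschitz; this is why the criterion for \<open>R\<close>
    allows a general continuous \<open>A\<close>.\<close>
  define A where "A x = integral {a..x} (\<lambda>x. \<bar>g x\<bar>)" for x
  have ga: "(\<lambda>x. \<bar>g x\<bar>) absolutely_integrable_on {a..b}" using absolutely_integrable_abs[OF g] by simp
  have A: "continuous_on {a..b} A" unfolding A_def using hk[OF ga] by (rule indefinite_integral_continuous_1)
  obtain K where K: "\<And>x. x \<in> {a..b} \<Longrightarrow> \<bar>\<phi>' x\<bar> \<le> K" "K \<ge> 0"
  proof -
    have "bounded (\<phi>' ` {a..b})" using \<phi>' compact_continuous_image compact_imp_bounded by blast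
    then obtain K where "\<forall>x\<in>{a..b}. \<bar>\<phi>' x\<bar> \<le> K" by (auto simp: bounded_iff)
    then show ?thesis using that[of "max K 0"] by fastforce
  qed
  define R where "R x = f x * \<phi> x - integral {a..x} (\<lambda>x. g x * \<phi> x) - integral {a..x} (\<lambda>x. f x * \<phi>' x)" for x
  have "R b = R a"
  proof (rule eq_endpoints_if_diff_le[OF ab A, where C = "2 * K"])
    fix x y assume xy: "a \<le> x" "x \<le> y" "y \<le> b"
    have sub: "h absolutely_integrable_on {c..d}" if "h absolutely_integrable_on {a..b}" "a \<le> c" "d \<le> b" for h :: "real \<Rightarrow> real" and c d
      using absolutely_integrable_subinterval[OF that] .
    have i: "h integrable_on {x..y}" "h integrable_on {a..y}" if "h absolutely_integrable_on {a..b}" for h :: "real \<Rightarrow> real"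
      using hk[OF sub[where c=x and d=y, OF that]] hk[OF sub[where c=a and d=y, OF that]] xy by auto
    have comb: "integral {a..y} h - integral {a..x} h = integral {x..y} h" if "h absolutely_integrable_on {a..b}" for h :: "real \<Rightarrow> real"
      using Henstock_Kurzweil_Integration.integral_combine[OF xy(1,2) i(2)[OF that]] by simp
    have ac: "h absolutely_integrable_on {a..b}" if "continuous_on {a..b} h" for h :: "real \<Rightarrow> real"
      using that absolutely_integrable_continuous_real by blast
    note ac = ac
    have a1: "(\<lambda>x. g x * \<phi> x) absolutely_integrable_on {a..b}" using absolutely_integrable_mult_continuous[OF g c\<phi>] .
    have a2: "(\<lambda>x. f x * \<phi>' x) absolutely_integrable_on {a..b}" by (intro ac continuous_intros cf \<phi>')
    have a3: "(\<lambda>s. g s * (\<phi> y - \<phi> s)) absolutely_integrable_on {a..b}"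
      by (intro absolutely_integrable_mult_continuous[OF g] continuous_intros c\<phi>)
    have a4: "(\<lambda>s. (f s - f x) * \<phi>' s) absolutely_integrable_on {a..b}" by (intro ac continuous_intros cf \<phi>')
    have A': "A y - A x = integral {x..y} (\<lambda>x. \<bar>g x\<bar>)" unfolding A_def using comb[OF ga] .
    have mono: "integral {x..s} (\<lambda>x. \<bar>g x\<bar>) \<le> A y - A x" if "s \<in> {x..y}" for s
      unfolding A' using that xy by (intro integral_subset_le) (auto intro!: hk sub[OF ga])
    have A0: "A y - A x \<ge> 0" unfolding A' by (intro integral_nonneg i ga) auto
    have e1: "integral {x..y} (\<lambda>s. g s * (\<phi> y - \<phi> s)) = (f y - f x) * \<phi> y - integral {x..y} (\<lambda>s. g s * \<phi> s)"
    proof -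
      have "integral {x..y} (\<lambda>s. g s * (\<phi> y - \<phi> s)) = integral {x..y} (\<lambda>s. g s * \<phi> y - g s * \<phi> s)"
        by (simp add: algebra_simps)
      also have "\<dots> = integral {x..y} (\<lambda>s. g s * \<phi> y) - integral {x..y} (\<lambda>s. g s * \<phi> s)"
        using i[OF g] i[OF a1] by (intro integral_diff integrable_on_mult_left) auto
      finally show ?thesis using primitive_on_diff[OF f xy] by simp
    qed
    have e2: "integral {x..y} (\<lambda>s. (f s - f x) * \<phi>' s) = integral {x..y} (\<lambda>s. f s * \<phi>' s) - f x * (\<phi> y - \<phi> x)"
    proof -
      have "integral {x..y} (\<lambda>s. (f s - f x) * \<phi>' s) = integral {x..y} (\<lambda>s. f s * \<phi>' s - f x * \<phi>' s)"
        by (simp add: algebra_simps)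
      also have "\<dots> = integral {x..y} (\<lambda>s. f s * \<phi>' s) - integral {x..y} (\<lambda>s. f x * \<phi>' s)"
        using i[OF ac[OF \<phi>']] i[OF a2] by (intro integral_diff integrable_on_mult_right) auto
      finally show ?thesis using primitive_on_diff[OF p xy] by simp
    qed
    \<comment> \<open>Freezing \<open>\<phi>\<close> at the right end and \<open>f\<close> at the
      left end leaves two integrals, each carrying one increment of \<open>\<phi>\<close> or of
      length and one increment controlled by \<open>A\<close>.\<close>
    have "R y - R x = integral {x..y} (\<lambda>s. g s * (\<phi> y - \<phi> s)) - integral {x..y} (\<lambda>s. (f s - f x) * \<phi>' s)"
      unfolding e1 e2 R_def using comb[OF a1] comb[OF a2] by (simp add: algebra_simps)
    moreover have "\<bar>integral {x..y} (\<lambda>s. g s * (\<phi> y - \<phi> s))\<bar> \<le> K * (y - x) * (A y - A x)"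
    proof -
      have "norm (integral {x..y} (\<lambda>s. g s * (\<phi> y - \<phi> s))) \<le> integral {x..y} (\<lambda>s. K * (y - x) * \<bar>g s\<bar>)"
      proof (rule integral_norm_bound_integral)
        show "(\<lambda>s. g s * (\<phi> y - \<phi> s)) integrable_on {x..y}" by (rule i[OF a3])
        show "(\<lambda>s. K * (y - x) * \<bar>g s\<bar>) integrable_on {x..y}" by (intro integrable_on_mult_right i ga)
        fix s assume s: "s \<in> {x..y}"
        have "norm (integral {s..y} \<phi>') \<le> integral {s..y} (\<lambda>_. K)"
          using s xy K by (intro integral_norm_bound_integral) (auto intro!: hk sub ac \<phi>')
        then have "\<bar>\<phi> y - \<phi> s\<bar> \<le> K * (y - s)"
          using primitive_on_diff[OF p, of s y] s xy by (simp add: mult.commute)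
        also have "\<dots> \<le> K * (y - x)" using s K by (intro mult_left_mono) auto
        finally show "norm (g s * (\<phi> y - \<phi> s)) \<le> K * (y - x) * \<bar>g s\<bar>"
          by (simp add: abs_mult mult.commute mult_left_mono)
      qed
      then show ?thesis unfolding A' by simp
    qed
    moreover have "\<bar>integral {x..y} (\<lambda>s. (f s - f x) * \<phi>' s)\<bar> \<le> K * (y - x) * (A y - A x)"
    proof -
      have "norm (integral {x..y} (\<lambda>s. (f s - f x) * \<phi>' s)) \<le> integral {x..y} (\<lambda>s. (A y - A x) * K)"
      proof (rule integral_norm_bound_integral)
        show "(\<lambda>s. (f s - f x) * \<phi>' s) integrable_on {x..y}" by (rule i[OF a4])
        fix s assume s: "s \<in> {x..y}"
        have "norm (integral {x..s} g) \<le> integral {x..s} (\<lambda>x. \<bar>g x\<bar>)"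
          using hk[OF sub[where c=x and d=s, OF g]] hk[OF sub[where c=x and d=s, OF ga]] s xy by (intro integral_norm_bound_integral) auto
        then have "\<bar>f s - f x\<bar> \<le> A y - A x"
          using mono[OF s] primitive_on_diff[OF f, of x s] s xy by simp
        then show "norm ((f s - f x) * \<phi>' s) \<le> (A y - A x) * K"
          using K(1)[of s] K(2) s xy A0 by (auto simp: abs_mult intro!: mult_mono)
      qed auto
      then show ?thesis using xy by (simp add: mult_ac)
    qed
    ultimately show "\<bar>R y - R x\<bar> \<le> 2 * K * (y - x) * \<bar>A y - A x\<bar>" using A0 by (simp add: algebra_simps)
  qed
  then show ?thesis by (simp add: R_def)
qed

text \<open>At a maximum of \<open>N t - (c + d) * t\<close> to the right of \<open>a\<close>, the
  left quotient would produce an earlier point with a larger value; so the maximum sits at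
  \<open>a\<close>. It is made for \<open>L^1\<close> norms, whose increments are estimated only
  towards the past.\<close>

lemma le_if_left_difference_quotient_le:
  fixes N :: "real \<Rightarrow> real"
  assumes ab: "a \<le> b" and cont: "continuous_on {a..b} N"
    and left: "\<And>t e. a < t \<Longrightarrow> t \<le> b \<Longrightarrow> e > 0 \<Longrightarrow> \<exists>s. a \<le> s \<and> s < t \<and> N t - N s \<le> (c + e) * (t - s)"
  shows "N b - N a \<le> c * (b - a)"
proof -
  have "N b - N a \<le> c * (b - a) + e" if e: "e > 0" for e
  proof -
    define d where "d = e / (b - a + 1)"
    have d: "d > 0" "d * (b - a) \<le> e" using e ab by (auto simp: d_def field_simps)
    define p where "p t = N t - (c + d) * t" for t
    have "continuous_on {a..b} p" unfolding p_def by (intro continuous_intros cont)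
    then obtain t where t: "t \<in> {a..b}" "\<And>s. s \<in> {a..b} \<Longrightarrow> p s \<le> p t"
      using continuous_attains_sup[of "{a..b}" p] ab by auto
    have "t = a"
    proof (rule ccontr)
      assume "t \<noteq> a"
      then obtain s where s: "a \<le> s" "s < t" "N t - N s \<le> (c + d / 2) * (t - s)"
        using left[of t "d / 2"] t d by auto
      have "p t - p s \<le> - (d / 2) * (t - s)" using s(3) by (simp add: p_def field_simps)
      also have "\<dots> < 0" using s d by simp
      finally show False using t(2)[of s] s t(1) by auto
    qed
    then have "p b \<le> p a" using t(2)[of b] ab by auto
    then show ?thesis using d(2) by (simp add: p_def algebra_simps)
  qed
  then show ?thesis by (meson field_le_epsilon)
qed

lemma C1c_on_interval_if_eq_0_outside:
  assumes \<phi>: "\<And>x. (\<phi> has_real_derivative \<phi>' x) (at x)" and c: "continuous_on UNIV \<phi>'"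
    and pq: "a < p" "q < b" and z: "\<And>x. x \<notin> {p..q} \<Longrightarrow> \<phi> x = 0"
  shows "C1c_on {a<..<b} \<phi> (\<lambda>x h. \<phi>' x * h)"
  unfolding C1c_on_def
proof (intro conjI ballI allI)
  show "(\<phi> has_derivative (*) (\<phi>' x)) (at x within {a<..<b})" for x
    using \<phi>[of x] by (simp add: has_field_derivative_def has_derivative_at_withinI)
  show "continuous_on {a<..<b} (\<lambda>x. \<phi>' x * h)" for h
    using c by (intro continuous_intros) (rule continuous_on_subset, auto)
  show "\<exists>K. compact K \<and> K \<subseteq> {a<..<b} \<and> (\<forall>x\<in>{a<..<b} - K. \<phi> x = 0)"
    using pq z by (intro exI[of _ "{p..q}"]) auto
qed

lemma integral_open_closed_interval: 
  fixes f :: "real \<Rightarrow> real"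
  shows "integral {a<..<b} f = integral {a..b} f"
  using integral_open_interval[of a b f] by (simp add: box_real)

lemma absolutely_integrable_open_closed_interval:
  fixes f :: "real \<Rightarrow> real"
  shows "f absolutely_integrable_on {a<..<b} \<longleftrightarrow> f absolutely_integrable_on {a..b}"
proof (rule absolutely_integrable_spike_set_eq)
  show "negligible {x \<in> {a<..<b} - {a..b}. f x \<noteq> 0}" by (rule negligible_subset[of "{}"]) auto
  show "negligible {x \<in> {a..b} - {a<..<b}. f x \<noteq> 0}" by (rule negligible_subset[of "{a, b}"]) auto
qed

lemma has_weak_deriv_integral:
  assumes w: "has_weak_deriv {a<..<b} f g" and \<phi>: "\<And>x. (\<phi> has_real_derivative \<phi>' x) (at x)" and c: "continuous_on UNIV \<phi>'"
    and pq: "a < p" "q < b" and z: "\<And>x. x \<notin> {p..q} \<Longrightarrow> \<phi> x = 0"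
  shows "integral {a..b} (\<lambda>x. f x * \<phi>' x) = - integral {a..b} (\<lambda>x. g x * \<phi> x)"
proof -
  have f: "f absolutely_integrable_on {a..b}" and g: "g absolutely_integrable_on {a..b}"
    using w by (auto simp: has_weak_deriv_def absolutely_integrable_open_closed_interval)
  have c\<phi>: "continuous_on UNIV \<phi>" using \<phi> by (intro DERIV_continuous_on) auto
  have "(LINT x:{a<..<b}|lebesgue. f x * \<phi>' x) = - (LINT x:{a<..<b}|lebesgue. g x * \<phi> x)"
  proof -
    have "\<forall>\<phi> D\<phi>. C1c_on {a<..<b} \<phi> D\<phi> \<longrightarrow>
        (LINT x:{a<..<b}|lebesgue. f x * D\<phi> x 1) = - (LINT x:{a<..<b}|lebesgue. g x * \<phi> x)"
      using w by (simp add: has_weak_deriv_def)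
    from this[rule_format, OF C1c_on_interval_if_eq_0_outside[OF \<phi> c pq z]] show ?thesis by simp
  qed
  moreover have "(\<lambda>x. f x * \<phi>' x) absolutely_integrable_on {a<..<b}" "(\<lambda>x. g x * \<phi> x) absolutely_integrable_on {a<..<b}"
    unfolding absolutely_integrable_open_closed_interval
    by (rule absolutely_integrable_mult_continuous f g continuous_on_subset[OF c] continuous_on_subset[OF c\<phi>] subset_UNIV)+
  ultimately show ?thesis by (simp add: set_lebesgue_integral_eq_integral(2) integral_open_closed_interval)
qed

text \<open>For \<open>k = 0\<close> the bump vanishes identically, hence the disjunction.
  Positivity at \<open>q\<close> allows one primitive to be rescaled to match another to the right
  of their bumps.\<close>

lemma bump_primitive:
  assumes pq: "p < q"
  obtains \<Phi> where "\<And>x. (\<Phi> has_real_derivative bump k p q x) (at x)" "\<And>x. x \<le> p \<Longrightarrow> \<Phi> x = 0"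
    "\<Phi> q > 0 \<or> k = 0" "\<And>x. x \<ge> q \<Longrightarrow> \<Phi> x = \<Phi> q"
proof
  \<comment> \<open>Starting at \<open>p - 1\<close> makes every point from \<open>p\<close> on
    interior to the interval of integration, so the derivative there is two-sided.\<close>
  define \<Phi> where "\<Phi> x = integral {p - 1..x} (bump k p q)" for x
  show z: "\<Phi> x = 0" if "x \<le> p" for x
  proof -
    have "integral {p - 1..x} (bump k p q) = integral {p - 1..x} (\<lambda>x. 0)"
      using that bump_eq_0[OF pq] by (intro integral_cong) auto
    then show ?thesis by (simp add: \<Phi>_def)
  qed
  show D: "(\<Phi> has_real_derivative bump k p q x) (at x)" for x
  proof (cases "x < p")
    case True
    have "((\<lambda>x. 0) has_real_derivative bump k p q x) (at x)" using bump_eq_0[OF pq, of x] True by simp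
    then show ?thesis
      by (rule has_field_derivative_transform_within_open[of _ _ _ "{..<p}"]) (use True z in auto)
  next
    case False
    have "(\<Phi> has_vector_derivative bump k p q x) (at x within {p - 1..x + 1})"
      unfolding \<Phi>_def using False by (intro integral_has_vector_derivative continuous_on_bump) auto
    moreover have "at x within {p - 1..x + 1} = at x"
      using False by (intro at_within_interior) (auto simp: interior_atLeastAtMost_real)
    ultimately show ?thesis by (simp add: has_real_derivative_iff_has_vector_derivative)
  qed
  have c: "continuous_on A \<Phi>" for A using D by (intro DERIV_continuous_on) (rule has_field_derivative_at_within)
  show "\<Phi> q > 0 \<or> k = 0"
  proof (cases "k = 0")
    case False
    have "\<Phi> p < \<Phi> q"
    proof (rule DERIV_pos_imp_increasing_open[OF pq])
      fix x assume "p < x" "x < q"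
      then have "bump k p q x > 0" unfolding bump_def using False bump_denominator_pos
        by (intro divide_pos_pos) auto
      then show "\<exists>y. (\<Phi> has_real_derivative y) (at x) \<and> y > 0" using D by blast
    qed (rule c)
    then show ?thesis using z[of p] by simp
  qed simp
  show "\<Phi> x = \<Phi> q" if "x \<ge> q" for x
  proof (cases "x = q")
    case False
    then have "q < x" using that by simp
    then show ?thesis
    proof (rule DERIV_isconst_end)
      show "(\<Phi> has_real_derivative 0) (at y)" if "q < y" "y < x" for y
        using D[of y] bump_eq_0[OF pq, of y] that by simp
    qed (rule c)
  qed simp
qed

text \<open>du Bois-Reymond: subtract from an arbitrary bump a multiple of a fixed one with the same integral.\<close>
lemma has_weak_deriv_imp_primitive_on:
  assumes l: "a < b" and w: "has_weak_deriv {a<..<b} f g"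
  obtains F where "primitive_on a b F g" "negligible {x\<in>{a<..<b}. f x \<noteq> F x}"
proof -
  note hk = set_lebesgue_integral_eq_integral
  have f: "f absolutely_integrable_on {a..b}" and g: "g absolutely_integrable_on {a..b}"
    using w by (auto simp: has_weak_deriv_def absolutely_integrable_open_closed_interval)
  define P where "P x = integral {a..x} g" for x
  have P: "primitive_on a b P g" unfolding primitive_on_def P_def using g by simp
  have Pa: "P absolutely_integrable_on {a..b}"
    using primitive_on_continuous[OF P] absolutely_integrable_continuous_real by blast
  define d where "d x = f x - P x" for x
  have d: "d absolutely_integrable_on {a..b}" unfolding d_def using set_integral_diff(1)[OF f Pa] .
  \<comment> \<open>The primitive of \<open>g\<close> satisfies the same identity against test
    functions as \<open>f\<close>, so their difference \<open>d\<close> annihilates all derivatives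
    of test functions.\<close>
  have key: "integral {a..b} (\<lambda>x. d x * \<phi>' x) = 0"
    if \<phi>: "\<And>x. (\<phi> has_real_derivative \<phi>' x) (at x)" and c: "continuous_on UNIV \<phi>'"
      and pq: "a < p" "q < b" and z: "\<And>x. x \<notin> {p..q} \<Longrightarrow> \<phi> x = 0" for \<phi> \<phi>' p q
  proof -
    have c': "continuous_on {a..b} \<phi>'" using c continuous_on_subset by blast
    have "integral {a..b} (\<lambda>x. P x * \<phi>' x) = P b * \<phi> b - P a * \<phi> a - integral {a..b} (\<lambda>x. g x * \<phi> x)"
      using \<phi> by (intro primitive_on_integral_by_parts P c') (auto intro: has_field_derivative_at_within l less_imp_le)
    also have "\<dots> = - integral {a..b} (\<lambda>x. g x * \<phi> x)" using z pq by simp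
    also have "\<dots> = integral {a..b} (\<lambda>x. f x * \<phi>' x)" using has_weak_deriv_integral[OF w \<phi> c pq z] by simp
    finally have e: "integral {a..b} (\<lambda>x. P x * \<phi>' x) = integral {a..b} (\<lambda>x. f x * \<phi>' x)" .
    have "integral {a..b} (\<lambda>x. d x * \<phi>' x) = integral {a..b} (\<lambda>x. f x * \<phi>' x - P x * \<phi>' x)"
      by (simp add: d_def algebra_simps)
    also have "\<dots> = 0" 
      unfolding e[symmetric] using absolutely_integrable_mult_continuous[OF f c'] absolutely_integrable_mult_continuous[OF Pa c'] e
      by (subst integral_diff) (auto intro: hk(1))
    finally show ?thesis .
  qed
  define p0 where "p0 = (2 * a + b) / 3"
  define q0 where "q0 = (a + 2 * b) / 3"
  have pq0: "a < p0" "p0 < q0" "q0 < b" using l by (auto simp: p0_def q0_def)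
  obtain \<Phi>0 where \<Phi>0: "\<And>x. (\<Phi>0 has_real_derivative bump 1 p0 q0 x) (at x)" "\<And>x. x \<le> p0 \<Longrightarrow> \<Phi>0 x = 0"
    "\<Phi>0 q0 > 0" "\<And>x. x \<ge> q0 \<Longrightarrow> \<Phi>0 x = \<Phi>0 q0"
    using bump_primitive[of p0 q0 1] pq0 by (metis One_nat_def zero_neq_one)
  define I0 where "I0 = \<Phi>0 q0"
  \<comment> \<open>\<open>I0\<close> is the integral of the fixed bump, so \<open>c\<close> is the
    mean of \<open>d\<close> with that bump as weight.\<close>
  define c where "c = integral {a..b} (\<lambda>x. d x * bump 1 p0 q0 x) / I0"
  have bc: "integral {a..b} (\<lambda>x. (d x - c) * bump k p q x) = 0" if pq: "a < p" "p < q" "q < b" for k p q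
  proof -
    obtain \<Phi> where \<Phi>: "\<And>x. (\<Phi> has_real_derivative bump k p q x) (at x)" "\<And>x. x \<le> p \<Longrightarrow> \<Phi> x = 0"
      "\<And>x. x \<ge> q \<Longrightarrow> \<Phi> x = \<Phi> q" using bump_primitive[of p q k] pq by metis
    \<comment> \<open>With this ratio the two primitives agree to the right of both bumps; their
      difference has compact support and is an admissible test function.\<close>
    define r where "r = \<Phi> q / I0"
    have "integral {a..b} (\<lambda>x. d x * (bump k p q x - r * bump 1 p0 q0 x)) = 0"
    proof (rule key)
      show "((\<lambda>x. \<Phi> x - r * \<Phi>0 x) has_real_derivative (bump k p q x - r * bump 1 p0 q0 x)) (at x)" for x
        by (intro DERIV_diff DERIV_cmult \<Phi> \<Phi>0)
      show "continuous_on UNIV (\<lambda>x. bump k p q x - r * bump 1 p0 q0 x)"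
        by (intro continuous_intros continuous_on_bump)
      show "a < min p p0" "max q q0 < b" using pq pq0 by auto
      show "\<Phi> x - r * \<Phi>0 x = 0" if "x \<notin> {min p p0..max q q0}" for x
      proof (cases "x < min p p0")
        case True then show ?thesis using \<Phi>(2)[of x] \<Phi>0(2)[of x] by simp
      next
        case False
        then have "x \<ge> q" "x \<ge> q0" using that by auto
        then show ?thesis using \<Phi>(3)[of x] \<Phi>0(3) \<Phi>0(4)[of x] by (simp add: r_def I0_def)
      qed
    qed
    moreover have "integral {a..b} (\<lambda>x. d x * (bump k p q x - r * bump 1 p0 q0 x)) =
        integral {a..b} (\<lambda>x. d x * bump k p q x) - r * integral {a..b} (\<lambda>x. d x * bump 1 p0 q0 x)"
    proof -
      have i: "(\<lambda>x. d x * bump k p q x) integrable_on {a..b}" for k p q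
        by (intro hk(1) absolutely_integrable_mult_continuous d continuous_on_bump)
      have "integral {a..b} (\<lambda>x. d x * (bump k p q x - r * bump 1 p0 q0 x)) =
        integral {a..b} (\<lambda>x. d x * bump k p q x - r * (d x * bump 1 p0 q0 x))" by (simp add: algebra_simps)
      also have "\<dots> = integral {a..b} (\<lambda>x. d x * bump k p q x) - r * integral {a..b} (\<lambda>x. d x * bump 1 p0 q0 x)"
        by (subst integral_diff) (auto intro: i integrable_on_mult_right)
      finally show ?thesis .
    qed
    moreover have "integral {a..b} (bump k p q) = \<Phi> q"
    proof -
      have "(bump k p q has_integral \<Phi> b - \<Phi> a) {a..b}"
        using l \<Phi>(1) by (intro fundamental_theorem_of_calculus)
          (auto simp: has_real_derivative_iff_has_vector_derivative[symmetric] intro: has_field_derivative_at_within)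
      then show ?thesis using \<Phi>(2)[of a] \<Phi>(3)[of b] pq by (simp add: integral_unique)
    qed
    moreover have "integral {a..b} (\<lambda>x. (d x - c) * bump k p q x) =
        integral {a..b} (\<lambda>x. d x * bump k p q x) - c * integral {a..b} (bump k p q)"
    proof -
      have i: "(\<lambda>x. d x * bump k p q x) integrable_on {a..b}" "bump k p q integrable_on {a..b}" for k p q
        by (intro hk(1) absolutely_integrable_mult_continuous d continuous_on_bump integrable_continuous_real)+
      have "integral {a..b} (\<lambda>x. (d x - c) * bump k p q x) = integral {a..b} (\<lambda>x. d x * bump k p q x - c * bump k p q x)"
        by (simp add: algebra_simps)
      then show ?thesis by (simp add: integral_diff i integrable_on_mult_right)
    qed
    ultimately show ?thesis by (simp add: c_def r_def)
  qed
  have dc: "(\<lambda>x. d x - c) absolutely_integrable_on {a<..<b}"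
    unfolding absolutely_integrable_open_closed_interval by (intro set_integral_diff(1) d) auto
  have "negligible {x\<in>{a<..<b}. d x - c \<noteq> 0}"
  proof (rule negligible_nonzero_if_box_integrals_zero[OF _ dc])
    fix p q assume pq: "cbox p q \<subseteq> {a<..<b}"
    show "integral (cbox p q) (\<lambda>x. d x - c) = 0"
    proof (cases "p < q")
      case True
      then have "a < p" "q < b" using pq by (auto simp: subset_eq)
      have "integral {p<..<q} (\<lambda>x. d x - c) = 0"
      proof (rule integral_zero_if_cutoffs_zero[OF dc, where ch = "\<lambda>k. bump k p q"])
        show "\<bar>bump k p q x\<bar> \<le> 1" for k x using bump_nonneg[of k p q x] bump_le_1[of k p q x] by simp
        show "integral {a<..<b} (\<lambda>x. (d x - c) * bump k p q x) = 0" for k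
          using bc[OF \<open>a < p\<close> True \<open>q < b\<close>] by (simp add: integral_open_closed_interval)
      qed (use pq True in \<open>auto simp: continuous_on_bump bump_tendsto\<close>)
      then show ?thesis by (simp add: integral_open_closed_interval)
    next
      case False
      then have "measure lborel (cbox p q) = 0" by (simp add: content_real_eq_0)
      then show ?thesis by (rule integral_null)
    qed
  qed auto
  moreover have "primitive_on a b (\<lambda>x. P x + c) g"
    unfolding primitive_on_def using primitive_onD(1)[OF P] by (simp add: P_def)
  ultimately show ?thesis by (intro that[of "\<lambda>x. P x + c"]) (auto simp: d_def elim!: negligible_subset)
qed

text \<open>Uniqueness is what gives content to the choice made in \<open>weak_deriv\<close>. Bumps
  are test functions, so both derivatives have equal integrals against them, and the cutoffs turn
  this into equal integrals over intervals.\<close>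

lemma has_weak_deriv_unique:
  assumes w: "has_weak_deriv {a<..<b} f g" "has_weak_deriv {a<..<b} f' g'"
    and ff: "negligible {x\<in>{a<..<b}. f x \<noteq> f' x}"
  shows "negligible {x\<in>{a<..<b}. g x \<noteq> g' x}"
proof -
  note hk = set_lebesgue_integral_eq_integral
  have g: "g absolutely_integrable_on {a<..<b}" "g' absolutely_integrable_on {a<..<b}"
    using w by (auto simp: has_weak_deriv_def)
  have d: "(\<lambda>x. g x - g' x) absolutely_integrable_on {a<..<b}" using set_integral_diff(1)[OF g] .
  have "negligible {x\<in>{a<..<b}. g x - g' x \<noteq> 0}"
  proof (rule negligible_nonzero_if_box_integrals_zero[OF _ d])
    fix p q assume pq: "cbox p q \<subseteq> {a<..<b}"
    show "integral (cbox p q) (\<lambda>x. g x - g' x) = 0"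
    proof (cases "p < q")
      case True
      then have ab: "a < p" "q < b" using pq by (auto simp: subset_eq)
      have "integral {p<..<q} (\<lambda>x. g x - g' x) = 0"
      proof (rule integral_zero_if_cutoffs_zero[OF d, where ch = "\<lambda>k. bump k p q"])
        show "\<bar>bump k p q x\<bar> \<le> 1" for k x using bump_nonneg[of k p q x] bump_le_1[of k p q x] by simp
        show "integral {a<..<b} (\<lambda>x. (g x - g' x) * bump k p q x) = 0" for k
        proof -
          obtain b' where b': "\<And>x. (bump k p q has_real_derivative b' x) (at x)" "continuous_on UNIV b'"
            using bump_differentiable by blast
          have z: "x \<notin> {p..q} \<Longrightarrow> bump k p q x = 0" for x using bump_eq_0[OF True, of x] by auto
          have "integral {a..b} (\<lambda>x. g x * bump k p q x) = integral {a..b} (\<lambda>x. g' x * bump k p q x)"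
          proof -
            have "integral {a<..<b} (\<lambda>x. f x * b' x) = integral {a<..<b} (\<lambda>x. f' x * b' x)"
              by (rule integral_spike[OF ff]) auto
            then show ?thesis
              using has_weak_deriv_integral[OF w(1) b' ab z] has_weak_deriv_integral[OF w(2) b' ab z]
              by (simp add: integral_open_closed_interval)
          qed
          moreover have "integral {a<..<b} (\<lambda>x. (g x - g' x) * bump k p q x) =
              integral {a..b} (\<lambda>x. g x * bump k p q x) - integral {a..b} (\<lambda>x. g' x * bump k p q x)"
            unfolding integral_open_closed_interval left_diff_distrib
            using g unfolding absolutely_integrable_open_closed_interval
            by (intro integral_diff hk(1) absolutely_integrable_mult_continuous continuous_on_bump)
          ultimately show ?thesis by simp
        qed
      qed (use pq True in \<open>auto simp: continuous_on_bump bump_tendsto\<close>)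
      then show ?thesis by (simp add: integral_open_closed_interval)
    next
      case False
      then have "measure lborel (cbox p q) = 0" by (simp add: content_real_eq_0)
      then show ?thesis by (rule integral_null)
    qed
  qed auto
  then show ?thesis by simp
qed

section \<open>A single viscous arc\<close>

lemma has_real_derivative_integral_at:
  fixes f :: "real \<Rightarrow> real"
  assumes "continuous_on {0..} f" "t > 0"
  shows "((\<lambda>t. integral {0..t} f) has_real_derivative f t) (at t)"
proof -
  have "((\<lambda>t. integral {0..t} f) has_real_derivative f t) (at t within {0..t + 1})"
    using assms by (intro integral_has_real_derivative continuous_on_subset[OF assms(1)]) auto
  moreover have "at t within {0..t + 1} = at t"
    using assms(2) by (intro at_within_interior) (auto simp: interior_atLeastAtMost_real)
  ultimately show ?thesis by simp
qed

lemma continuous_on_integral_right_end: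
  fixes f :: "real \<Rightarrow> real"
  assumes "continuous_on {0..} f"
  shows "continuous_on {0..T} (\<lambda>t. integral {0..t} f)"
  by (intro indefinite_integral_continuous_1 integrable_continuous_real continuous_on_subset[OF assms]) auto

lemma diff_le_if_derivative_le:
  fixes g :: "real \<Rightarrow> real"
  assumes "a \<le> b" "continuous_on {a..b} g"
    and D: "\<And>x. a < x \<Longrightarrow> x < b \<Longrightarrow> (g has_real_derivative g' x) (at x)"
    and C: "\<And>x. a < x \<Longrightarrow> x < b \<Longrightarrow> \<bar>g' x\<bar> \<le> C"
  shows "\<bar>g b - g a\<bar> \<le> C * (b - a)"
proof (cases "a = b")
  case False
  then have "a < b" using assms by simp
  then obtain z where z: "a < z" "z < b" "g b - g a = g' z * (b - a)"
    using mvt[OF _ assms(2), of "\<lambda>x h. g' x * h"] D by (auto simp: has_field_derivative_def)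
  then have "\<bar>g b - g a\<bar> = (b - a) * \<bar>g' z\<bar>" using assms(1) by (simp add: abs_mult)
  also have "\<dots> \<le> (b - a) * C" using C[OF z(1,2)] assms(1) by (intro mult_left_mono) auto
  finally show ?thesis by (simp add: mult.commute)
qed auto

text \<open>Time is the first argument; \<open>P\<close> stands for the space derivative and
  \<open>H\<close> for the time derivative of \<open>U\<close>. The equation enters as a
  conservation law: the flux is absolutely continuous with density \<open>- H\<close>. In this form
  no second space derivative appears, and time shifts and differences of solutions are again
  instances.\<close>

locale viscous_arc =
  fixes l lam e :: real and U P H :: "real \<Rightarrow> real \<Rightarrow> real"
  assumes l: "l > 0" and lam: "lam > 0" and e: "e > 0"
    and contU: "continuous_on ({0..} \<times> {0..l}) (\<lambda>(t, x). U t x)"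
    and contP: "continuous_on ({0..} \<times> {0..l}) (\<lambda>(t, x). P t x)"
    and derU: "\<And>t x. t \<ge> 0 \<Longrightarrow> x \<in> {0..l} \<Longrightarrow> (U t has_real_derivative P t x) (at x within {0..l})"
    and flux: "\<And>t. t > 0 \<Longrightarrow> primitive_on 0 l (\<lambda>x. lam * U t x - e * P t x) (\<lambda>x. - H t x)"
    and curve: "\<And>t. t > 0 \<Longrightarrow>
      ((\<lambda>s. abs_integral l (\<lambda>x. (U s x - U t x) / (s - t) - H t x)) \<longlongrightarrow> 0) (at t)"
begin

definition F :: "real \<Rightarrow> real \<Rightarrow> real" where "F t x = lam * U t x - e * P t x"

lemma contUx:
  assumes "t \<ge> 0"
  shows "continuous_on {0..l} (U t)"
proof -
  have "continuous_on {0..l} ((\<lambda>(t, x). U t x) \<circ> (\<lambda>x. (t, x)))" using assms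
    by (intro continuous_on_compose continuous_on_Pair continuous_on_const continuous_on_id continuous_on_subset[OF contU]) auto
  then show ?thesis by (simp add: o_def)
qed

lemma contPx:
  assumes "t \<ge> 0"
  shows "continuous_on {0..l} (P t)"
proof -
  have "continuous_on {0..l} ((\<lambda>(t, x). P t x) \<circ> (\<lambda>x. (t, x)))" using assms
    by (intro continuous_on_compose continuous_on_Pair continuous_on_const continuous_on_id continuous_on_subset[OF contP]) auto
  then show ?thesis by (simp add: o_def)
qed

lemma contUt:
  assumes "x \<in> {0..l}"
  shows "continuous_on {0..} (\<lambda>t. U t x)"
proof -
  have "continuous_on {0..} ((\<lambda>(t, x). U t x) \<circ> (\<lambda>t. (t, x)))" using assms
    by (intro continuous_on_compose continuous_on_Pair continuous_on_const continuous_on_id continuous_on_subset[OF contU]) auto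
  then show ?thesis by (simp add: o_def)
qed

lemma contPt:
  assumes "x \<in> {0..l}"
  shows "continuous_on {0..} (\<lambda>t. P t x)"
proof -
  have "continuous_on {0..} ((\<lambda>(t, x). P t x) \<circ> (\<lambda>t. (t, x)))" using assms
    by (intro continuous_on_compose continuous_on_Pair continuous_on_const continuous_on_id continuous_on_subset[OF contP]) auto
  then show ?thesis by (simp add: o_def)
qed

lemma contFx: "t \<ge> 0 \<Longrightarrow> continuous_on {0..l} (F t)"
  unfolding F_def by (intro continuous_intros contUx contPx)

lemma contFt: "x \<in> {0..l} \<Longrightarrow> continuous_on {0..} (\<lambda>t. F t x)"
  unfolding F_def by (intro continuous_intros contUt contPt)

lemma H_int: "t > 0 \<Longrightarrow> H t absolutely_integrable_on {0..l}"
  using primitive_onD(1)[OF flux[of t]] by (simp add: set_integrable_def)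

lemma primitive_F: "t > 0 \<Longrightarrow> primitive_on 0 l (F t) (\<lambda>x. - H t x)"
  unfolding F_def[abs_def] by (rule flux)

lemma int_cont: "continuous_on {0..l} f \<Longrightarrow> f integrable_on {0..l}" for f :: "real \<Rightarrow> real"
  by (rule integrable_continuous_real)

lemma int_U_weight: "t \<ge> 0 \<Longrightarrow> continuous_on {0..l} k \<Longrightarrow> (\<lambda>x. U t x * k x) integrable_on {0..l}"
  by (intro int_cont continuous_intros contUx)

lemma int_H_weight: "t > 0 \<Longrightarrow> continuous_on {0..l} k \<Longrightarrow> (\<lambda>x. H t x * k x) integrable_on {0..l}"
  by (intro set_lebesgue_integral_eq_integral(1) absolutely_integrable_mult_continuous H_int)

text \<open>A bounded weight turns convergence of difference quotients in \<open>L^1\<close> into an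
  ordinary derivative of a real function, so that calculus in time becomes available.\<close>

lemma weight_derivative:
  assumes t: "t > 0" and k: "continuous_on {0..l} k"
  shows "((\<lambda>s. integral {0..l} (\<lambda>x. U s x * k x)) has_real_derivative integral {0..l} (\<lambda>x. H t x * k x)) (at t)"
proof -
  note hk = set_lebesgue_integral_eq_integral(1)
  obtain K where K: "\<And>x. x \<in> {0..l} \<Longrightarrow> \<bar>k x\<bar> \<le> K"
  proof -
    have "bounded (k ` {0..l})" using compact_imp_bounded[OF compact_continuous_image[OF k]] by simp
    then obtain a where "\<forall>x\<in>{0..l}. \<bar>k x\<bar> \<le> a" by (auto simp: bounded_iff)
    then show ?thesis using that[of a] by simp
  qed
  let ?q = "\<lambda>s x. (U s x - U t x) / (s - t) - H t x"
  let ?N = "\<lambda>s. abs_integral l (\<lambda>x. ?q s x)"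
  let ?I = "\<lambda>s. integral {0..l} (\<lambda>x. U s x * k x)"
  have "((\<lambda>s. (?I s - ?I t) / (s - t) - integral {0..l} (\<lambda>x. H t x * k x)) \<longlongrightarrow> 0) (at t)"
  proof (rule Lim_null_comparison)
    have "norm ((?I s - ?I t) / (s - t) - integral {0..l} (\<lambda>x. H t x * k x)) \<le> K * ?N s" if "s > 0" "s \<noteq> t" for s
    proof -
      have q: "?q s absolutely_integrable_on {0..l}"
        using that t by (intro set_integral_diff(1) H_int absolutely_integrable_continuous_real continuous_intros contUx) auto
      have e1: "(?I s - ?I t) / (s - t) - integral {0..l} (\<lambda>x. H t x * k x)
          = integral {0..l} (\<lambda>x. (U s x * k x - U t x * k x) / (s - t) - H t x * k x)"
        using that t k int_U_weight[of s k] int_U_weight[of t k] int_H_weight[of t k]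
        by (simp add: integral_diff integrable_diff integrable_on_divide)
      have e2: "integral {0..l} (\<lambda>x. (U s x * k x - U t x * k x) / (s - t) - H t x * k x) = integral {0..l} (\<lambda>x. ?q s x * k x)"
        by (intro integral_cong) (simp add: field_simps)
      have "norm (integral {0..l} (\<lambda>x. ?q s x * k x)) \<le> integral {0..l} (\<lambda>x. K * \<bar>?q s x\<bar>)"
      proof (rule integral_norm_bound_integral)
        show "(\<lambda>x. ?q s x * k x) integrable_on {0..l}" by (intro hk absolutely_integrable_mult_continuous q k)
        show "(\<lambda>x. K * \<bar>?q s x\<bar>) integrable_on {0..l}"
          using hk[OF absolutely_integrable_abs[OF q]] by (intro integrable_on_mult_right) simp
        show "norm (?q s x * k x) \<le> K * \<bar>?q s x\<bar>" if "x \<in> {0..l}" for x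
          using K[OF that] by (simp add: abs_mult mult.commute mult_right_mono)
      qed
      then show ?thesis unfolding e1 e2 by simp
    qed
    then show "\<forall>\<^sub>F s in at t. norm ((?I s - ?I t) / (s - t) - integral {0..l} (\<lambda>x. H t x * k x)) \<le> K * ?N s"
      using t by (auto simp: eventually_at dist_real_def intro!: exI[of _ t])
    show "((\<lambda>s. K * ?N s) \<longlongrightarrow> 0) (at t)" using curve[OF t] by (auto intro!: tendsto_eq_intros)
  qed
  then show ?thesis unfolding has_field_derivative_iff by (rule Lim_null[THEN iffD2])
qed

text \<open>Integration by parts for \<open>H = - F_x\<close>. Stopping at \<open>x\<close> instead
  of \<open>l\<close> covers weights with a kink at \<open>x\<close>.\<close>

lemma H_by_parts:
  assumes t: "t > 0" and c: "0 \<le> x" "x \<le> l"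
    and k: "\<And>y. y \<in> {0..x} \<Longrightarrow> (k has_real_derivative k' y) (at y within {0..x})" "continuous_on {0..x} k'"
  shows "integral {0..x} (\<lambda>y. H t y * k y) = F t 0 * k 0 - F t x * k x + integral {0..x} (\<lambda>y. F t y * k' y)"
proof -
  have "primitive_on 0 x (F t) (\<lambda>x. - H t x)"
    unfolding primitive_on_def
  proof (intro conjI ballI)
    show "(\<lambda>x. - H t x) absolutely_integrable_on {0..x}"
      by (rule absolutely_integrable_subinterval[OF primitive_onD(1)[OF primitive_F[OF t]] order_refl c(2)])
    show "F t y = F t 0 + integral {0..y} (\<lambda>x. - H t x)" if "y \<in> {0..x}" for y
      using that c by (intro primitive_onD(2)[OF primitive_F[OF t]]) auto
  qed
  from primitive_on_integral_by_parts[OF c(1) this k]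
  show ?thesis by simp
qed

section \<open>Bounds for the solution, its flux and its gradient at a fixed time\<close>

text \<open>\<open>exp (- lam * x / e)\<close> is the integrating factor of
  \<open>e * U_x = lam * U - F\<close>, so the integrand is \<open>- e\<close> times an exact
  derivative.\<close>

lemma weighted_flux_integral:
  assumes "t \<ge> 0"
  shows "integral {0..l} (\<lambda>x. F t x * exp (- lam * x / e)) = e * (U t 0 - U t l * exp (- lam * l / e))"
proof -
  have "((\<lambda>x. - (F t x * exp (- lam * x / e) / e)) has_integral
     U t l * exp (- lam * l / e) - U t 0 * exp (- lam * 0 / e)) {0..l}"
  proof (rule fundamental_theorem_of_calculus)
    fix x assume x: "x \<in> {0..l}"
    have "((\<lambda>x. U t x * exp (- lam * x / e)) has_real_derivative - (F t x * exp (- lam * x / e) / e)) (at x within {0..l})"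
      using e by (auto intro!: derivative_eq_intros derU assms x simp: F_def field_simps)
    then show "((\<lambda>x. U t x * exp (- lam * x / e)) has_vector_derivative - (F t x * exp (- lam * x / e) / e)) (at x within {0..l})"
      by (simp add: has_real_derivative_iff_has_vector_derivative)
  qed (use l in simp)
  from has_integral_mult_right[OF this, of "- e"]
  have "((\<lambda>x. F t x * exp (- lam * x / e)) has_integral - e * (U t l * exp (- lam * l / e) - U t 0)) {0..l}"
    using e by simp
  then show ?thesis by (simp add: integral_unique algebra_simps)
qed

text \<open>The relation \<open>e * U_x = lam * U - F\<close> is integrated from the outlet
  backwards, the direction in which its exponential factor decays, so the bound does not deteriorate
  as \<open>e\<close> tends to 0. With the integrating factor, \<open>s * U - M\<close> becomes
  nondecreasing; the two signs \<open>s\<close> give the two sides.\<close>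

lemma U_le_flux:
  assumes t: "t \<ge> 0" and M: "\<And>x. x \<in> {0..l} \<Longrightarrow> \<bar>F t x\<bar> \<le> lam * M" and x: "x \<in> {0..l}"
  shows "\<bar>U t x\<bar> \<le> \<bar>U t l\<bar> + M"
proof -
  let ?k = "\<lambda>x. exp (- lam * x / e)"
  have M0: "M \<ge> 0" using order_trans[OF abs_ge_zero M[of 0]] l lam by (simp add: zero_le_mult_iff)
  have main: "s * U t x \<le> \<bar>U t l\<bar> + M" if s: "s = 1 \<or> s = -1" for s
  proof -
    let ?g = "\<lambda>x. (s * U t x - M) * ?k x"
    have "?g x \<le> ?g l"
    proof (rule DERIV_nonneg_imp_increasing_open[of x l ?g])
      show "x \<le> l" using x by simp
      fix y assume y: "x < y" "y < l"
      then have yi: "y \<in> {0..l}" "at y within {0..l} = at y"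
        using x by (auto intro!: at_within_interior simp: interior_atLeastAtMost_real)
      have "(?g has_real_derivative (lam * M - s * F t y) / e * ?k y) (at y)"
        using derU[OF t yi(1)] e unfolding yi(2) by (auto intro!: derivative_eq_intros simp: F_def field_simps)
      moreover have "(lam * M - s * F t y) / e * ?k y \<ge> 0"
        using M[OF yi(1)] s e by (intro mult_nonneg_nonneg divide_nonneg_pos) auto
      ultimately show "\<exists>z. (?g has_real_derivative z) (at y) \<and> z \<ge> 0" by blast
      next
      show "continuous_on {x..l} ?g"
        using e x by (intro continuous_intros continuous_on_subset[OF contUx[OF t]]) auto
    qed
    also have "?g l \<le> \<bar>U t l\<bar> * ?k x"
    proof -
      have "?g l \<le> \<bar>U t l\<bar> * ?k l" using s M0 by (intro mult_right_mono) auto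
      also have "\<dots> \<le> \<bar>U t l\<bar> * ?k x" using x lam e by (intro mult_left_mono) (auto simp: divide_le_cancel)
      finally show ?thesis .
    qed
    finally show ?thesis by simp
  qed
  show ?thesis using main[of 1] main[of "-1"] by auto
qed

text \<open>Mean plus oscillation: the flux varies by at most the integral of
  \<open>\<bar>H\<bar>\<close>, because \<open>- H\<close> is its density, and its integral over the
  arc is \<open>lam\<close> times that of \<open>U\<close> minus
  \<open>e * (U t l - U t 0)\<close>.\<close>

lemma flux_bound:
  assumes t: "t > 0" and x: "x \<in> {0..l}"
  shows "\<bar>F t x\<bar> \<le> (lam * abs_integral l (U t) + e * \<bar>U t l\<bar> + e * \<bar>U t 0\<bar>) / l + abs_integral l (H t)"
proof -
  note hk = set_lebesgue_integral_eq_integral(1)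
  let ?h = "abs_integral l (H t)"
  have ai: "(\<lambda>x. \<bar>H t x\<bar>) absolutely_integrable_on {0..l}" using absolutely_integrable_abs[OF H_int[OF t]] by simp
  have osc: "\<bar>F t y - F t x\<bar> \<le> ?h" if "0 \<le> x" "x \<le> y" "y \<le> l" for x y
  proof -
    have e1: "F t y - F t x = integral {x..y} (\<lambda>x. - H t x)" by (rule primitive_on_diff[OF primitive_F[OF t] that])
    have "norm (integral {x..y} (\<lambda>x. - H t x)) \<le> integral {x..y} (\<lambda>x. \<bar>H t x\<bar>)"
    proof (rule integral_norm_bound_integral)
      show "(\<lambda>x. - H t x) integrable_on {x..y}"
        by (rule integrable_neg[OF hk[OF absolutely_integrable_subinterval[OF H_int[OF t]]]]) (use that in auto)
      show "(\<lambda>x. \<bar>H t x\<bar>) integrable_on {x..y}"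
        by (rule hk[OF absolutely_integrable_subinterval[OF ai]]) (use that in auto)
    qed simp
    also have "\<dots> \<le> ?h" using hk[OF absolutely_integrable_subinterval[OF ai, of x y]] hk[OF ai] that
      by (intro integral_subset_le) auto
    finally show ?thesis unfolding e1 by simp
  qed
  have osc': "\<bar>F t x - F t y\<bar> \<le> ?h" if "y \<in> {0..l}" for y
    using osc[of x y] osc[of y x] that x by (cases "x \<le> y") (auto simp: abs_minus_commute)
  have t0: "t \<ge> 0" using t by simp
  have iU: "integral {0..l} (F t) = lam * integral {0..l} (U t) - e * (U t l - U t 0)"
  proof -
    have "(P t has_integral U t l - U t 0) {0..l}"
      using derU[OF t0] l by (intro fundamental_theorem_of_calculus) (auto simp: has_real_derivative_iff_has_vector_derivative)
    moreover have "(U t has_integral integral {0..l} (U t)) {0..l}"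
      using contUx[OF t0] by (intro integrable_integral int_cont)
    ultimately have "(F t has_integral lam * integral {0..l} (U t) - e * (U t l - U t 0)) {0..l}"
      unfolding F_def[abs_def] by (intro has_integral_diff has_integral_mult_right)
    then show ?thesis by (rule integral_unique)
  qed
  have e1: "l * F t x = integral {0..l} (F t) + integral {0..l} (\<lambda>y. F t x - F t y)"
    using l contFx[OF t0] by (simp add: integral_diff int_cont)
  have "\<bar>integral {0..l} (\<lambda>y. F t x - F t y)\<bar> \<le> ?h * l"
  proof -
    have "norm (integral {0..l} (\<lambda>y. F t x - F t y)) \<le> integral {0..l} (\<lambda>y. ?h)"
      using osc' contFx[OF t0] by (intro integral_norm_bound_integral int_cont continuous_intros) auto
    then show ?thesis using l by (simp add: mult.commute)
  qed
  moreover have "\<bar>integral {0..l} (F t)\<bar> \<le> lam * abs_integral l (U t) + e * \<bar>U t l\<bar> + e * \<bar>U t 0\<bar>"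
  proof -
    have "norm (integral {0..l} (U t)) \<le> abs_integral l (U t)"
      using contUx[OF t0] by (intro integral_norm_bound_integral int_cont continuous_intros) auto
    then have "\<bar>lam * integral {0..l} (U t)\<bar> \<le> lam * abs_integral l (U t)" using lam by (simp add: abs_mult)
    moreover have "\<bar>e * (U t l - U t 0)\<bar> \<le> e * \<bar>U t l\<bar> + e * \<bar>U t 0\<bar>"
      using e by (simp add: abs_mult distrib_left[symmetric])
    ultimately show ?thesis unfolding iU by linarith
  qed
  ultimately have "\<bar>l * F t x\<bar> \<le> lam * abs_integral l (U t) + e * \<bar>U t l\<bar> + e * \<bar>U t 0\<bar> + ?h * l"
    unfolding e1 by linarith
  then show ?thesis using l by (simp add: abs_mult field_simps)
qed

text \<open>Duality with the solution \<open>\<phi>\<close> of \<open>e \<phi>' + lam \<phi> = - \<psi>\<close>, \<open>\<phi> 0 = 0\<close>, where \<open>\<psi>\<close> approximates \<open>sgn (P t)\<close>.\<close>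
lemma gradient_bound:
  assumes t: "t > 0"
  shows "abs_integral l (P t) \<le> (abs_integral l (H t) + e * \<bar>P t l\<bar>) / lam"
proof -
  note hk = set_lebesgue_integral_eq_integral(1)
  have t0: "t \<ge> 0" using t by simp
  have cP: "continuous_on {0..l} (P t)" by (rule contPx[OF t0])
  have ai: "(\<lambda>x. \<bar>H t x\<bar>) absolutely_integrable_on {0..l}" using absolutely_integrable_abs[OF H_int[OF t]] by simp
  let ?B = "(abs_integral l (H t) + e * \<bar>P t l\<bar>) / lam"
  have main: "abs_integral l (P t) \<le> ?B + d * l" if d: "d > 0" for d
  proof -
    have pos: "(P t x)\<^sup>2 + d\<^sup>2 > 0" for x using d by (simp add: add_nonneg_pos)
    have sq: "sqrt ((P t x)\<^sup>2 + d\<^sup>2) \<ge> \<bar>P t x\<bar>" "sqrt ((P t x)\<^sup>2 + d\<^sup>2) \<le> \<bar>P t x\<bar> + d" "sqrt ((P t x)\<^sup>2 + d\<^sup>2) > 0" for x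
      using d pos[of x] by (auto intro!: real_le_rsqrt real_le_lsqrt simp: power2_sum)
    \<comment> \<open>A continuous substitute for the sign of \<open>P t\<close>: it is bounded by
      1, and pairing with \<open>P t\<close> loses at most \<open>d\<close> against
      \<open>\<bar>P t x\<bar>\<close> at each point.\<close>
    define \<psi> where "\<psi> x = P t x / sqrt ((P t x)\<^sup>2 + d\<^sup>2)" for x
    have \<psi>1: "\<bar>\<psi> x\<bar> \<le> 1" for x unfolding \<psi>_def using sq[of x] by (simp add: divide_le_eq)
    have \<psi>P: "P t x * \<psi> x \<ge> \<bar>P t x\<bar> - d" for x
    proof -
      define a where "a = sqrt ((P t x)\<^sup>2 + d\<^sup>2)"
      have a: "a > 0" "a \<ge> \<bar>P t x\<bar>" "a \<ge> d" "a\<^sup>2 = (P t x)\<^sup>2 + d\<^sup>2"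
        unfolding a_def using sq[of x] pos[of x] d by (auto intro: real_le_rsqrt)
      have "P t x * \<psi> x = (a\<^sup>2 - d\<^sup>2) / a" unfolding \<psi>_def a_def[symmetric] a(4) by (simp add: power2_eq_square)
      also have "\<dots> = a - d * (d / a)" using a(1) by (simp add: field_simps power2_eq_square)
      also have "\<dots> \<ge> a - d" using a d mult_left_mono[of "d / a" 1 d] by simp
      finally show ?thesis using a(2) by linarith
    qed
    have c\<psi>: "continuous_on {0..l} \<psi>" unfolding \<psi>_def
      using pos by (intro continuous_intros cP) (metis less_irrefl real_sqrt_gt_0_iff)
    define J where "J x = integral {0..x} (\<lambda>y. exp (lam * y / e) * \<psi> y)" for x
    \<comment> \<open>Variation of constants for the dual equation. Its exponential kernel has total
      mass at most \<open>1 / lam\<close>, so \<open>\<phi>\<close> is bounded independently of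
      \<open>e\<close>, which keeps the gradient bound uniform in the viscosity.\<close>
    define \<phi> where "\<phi> x = - (exp (- lam * x / e) * J x) / e" for x
    define \<phi>' where "\<phi>' x = - (\<psi> x + lam * \<phi> x) / e" for x
    have cJ: "continuous_on {0..l} (\<lambda>y. exp (lam * y / e) * \<psi> y)" using e by (intro continuous_intros c\<psi>) auto
    have dJ: "(J has_real_derivative exp (lam * x / e) * \<psi> x) (at x within {0..l})" if "x \<in> {0..l}" for x
      unfolding J_def using cJ that by (rule integral_has_real_derivative)
    have d\<phi>: "(\<phi> has_real_derivative \<phi>' x) (at x within {0..l})" if "x \<in> {0..l}" for x
    proof -
      have "exp (lam * x / e) * exp (- (lam * x / e)) = 1" by (simp add: exp_minus)
      then have "exp (- (lam * x / e)) * (exp (lam * x / e) * \<psi> x) = \<psi> x" by (simp add: mult_ac)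
      then show ?thesis unfolding \<phi>_def[abs_def] \<phi>'_def
        using e by (auto intro!: derivative_eq_intros dJ that simp: field_simps)
    qed
    have c\<phi>: "continuous_on {0..l} \<phi>" using d\<phi> by (rule DERIV_continuous_on)
    have c\<phi>': "continuous_on {0..l} \<phi>'" unfolding \<phi>'_def using e by (intro continuous_intros c\<psi> c\<phi>) auto
    have \<phi>1: "\<bar>\<phi> x\<bar> \<le> 1 / lam" if x: "x \<in> {0..l}" for x
    proof -
      have "((\<lambda>y. exp (lam * y / e)) has_integral (e / lam) * exp (lam * x / e) - (e / lam) * exp (lam * 0 / e)) {0..x}"
      proof (rule fundamental_theorem_of_calculus)
        fix y assume "y \<in> {0..x}"
        have "((\<lambda>y. (e / lam) * exp (lam * y / e)) has_real_derivative exp (lam * y / e)) (at y within {0..x})"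
          using e lam by (auto intro!: derivative_eq_intros)
        then show "((\<lambda>y. (e / lam) * exp (lam * y / e)) has_vector_derivative exp (lam * y / e)) (at y within {0..x})"
          by (simp add: has_real_derivative_iff_has_vector_derivative)
      qed (use x in simp)
      then have i: "integral {0..x} (\<lambda>y. exp (lam * y / e)) = (e / lam) * (exp (lam * x / e) - 1)"
        "(\<lambda>y. exp (lam * y / e)) integrable_on {0..x}"
        by (auto simp: integral_unique algebra_simps integrable_on_def)
      have "norm (J x) \<le> integral {0..x} (\<lambda>y. exp (lam * y / e))"
        unfolding J_def
      proof (rule integral_norm_bound_integral)
        show "(\<lambda>y. exp (lam * y / e) * \<psi> y) integrable_on {0..x}"
          using x by (intro integrable_continuous_real continuous_on_subset[OF cJ]) auto
        show "norm (exp (lam * y / e) * \<psi> y) \<le> exp (lam * y / e)" for y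
          using \<psi>1[of y] by (simp add: abs_mult mult_left_le)
      qed (rule i)
      then have "\<bar>J x\<bar> \<le> (e / lam) * exp (lam * x / e)"
        unfolding i using e lam by (simp add: algebra_simps) (smt (verit) divide_pos_pos)
      then have "exp (- lam * x / e) * \<bar>J x\<bar> \<le> exp (- lam * x / e) * ((e / lam) * exp (lam * x / e))"
        by (intro mult_left_mono) auto
      also have "\<dots> = e / lam" by (simp add: exp_minus)
      finally show ?thesis unfolding \<phi>_def using e lam by (simp add: abs_mult field_simps)
    qed
    have ip: "integral {0..l} (\<lambda>y. H t y * \<phi> y) = F t 0 * \<phi> 0 - F t l * \<phi> l + integral {0..l} (\<lambda>y. F t y * \<phi>' y)"
      using t l by (intro H_by_parts d\<phi> c\<phi>') auto
    have ipU: "integral {0..l} (\<lambda>y. U t y * \<phi>' y) = U t l * \<phi> l - U t 0 * \<phi> 0 - integral {0..l} (\<lambda>y. P t y * \<phi> y)"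
      using l by (intro primitive_on_integral_by_parts d\<phi> c\<phi>' primitive_on_of_derivative derU t0 cP) auto
    have "integral {0..l} (\<lambda>y. F t y * \<phi>' y) = lam * integral {0..l} (\<lambda>y. U t y * \<phi>' y) - e * integral {0..l} (\<lambda>y. P t y * \<phi>' y)"
    proof -
      have "integral {0..l} (\<lambda>y. F t y * \<phi>' y) = integral {0..l} (\<lambda>y. lam * (U t y * \<phi>' y) - e * (P t y * \<phi>' y))"
        by (simp add: F_def algebra_simps)
      then show ?thesis by (simp add: integral_diff int_cont continuous_intros contUx t0 cP c\<phi>')
    qed
    moreover have "e * integral {0..l} (\<lambda>y. P t y * \<phi>' y) = - integral {0..l} (\<lambda>y. P t y * \<psi> y) - lam * integral {0..l} (\<lambda>y. P t y * \<phi> y)"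
    proof -
      have "e * integral {0..l} (\<lambda>y. P t y * \<phi>' y) = integral {0..l} (\<lambda>y. e * (P t y * \<phi>' y))" by simp
      also have "\<dots> = integral {0..l} (\<lambda>y. - (P t y * \<psi> y) - lam * (P t y * \<phi> y))"
        using e by (intro integral_cong) (simp add: \<phi>'_def field_simps)
      finally show ?thesis by (simp add: integral_diff int_cont continuous_intros cP c\<psi> c\<phi>)
    qed
    moreover have "\<phi> 0 = 0" by (simp add: \<phi>_def J_def)
    \<comment> \<open>The dual equation makes the two integrals of \<open>P * \<phi>\<close> cancel,
      and at the outlet \<open>lam * U t l - F t l\<close> is \<open>e * P t l\<close>.\<close>
    ultimately have "integral {0..l} (\<lambda>y. P t y * \<psi> y) = integral {0..l} (\<lambda>y. H t y * \<phi> y) - e * P t l * \<phi> l"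
      using ip ipU F_def[of t l] by algebra
    also have "\<dots> \<le> abs_integral l (H t) / lam + e * \<bar>P t l\<bar> / lam"
    proof -
      have "norm (integral {0..l} (\<lambda>y. H t y * \<phi> y)) \<le> integral {0..l} (\<lambda>x. \<bar>H t x\<bar> * (1 / lam))"
      proof (rule integral_norm_bound_integral)
        show "(\<lambda>y. H t y * \<phi> y) integrable_on {0..l}" by (rule int_H_weight[OF t c\<phi>])
        show "(\<lambda>x. \<bar>H t x\<bar> * (1 / lam)) integrable_on {0..l}" by (intro integrable_on_mult_left hk ai)
        show "norm (H t x * \<phi> x) \<le> \<bar>H t x\<bar> * (1 / lam)" if "x \<in> {0..l}" for x
          using \<phi>1[OF that] unfolding real_norm_def abs_mult by (intro mult_left_mono) auto
      qed
      moreover have "\<bar>e * P t l * \<phi> l\<bar> \<le> e * \<bar>P t l\<bar> * (1 / lam)"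
        using \<phi>1[of l] l e unfolding abs_mult by (intro mult_mono) auto
      ultimately show ?thesis by simp
    qed
    finally have "integral {0..l} (\<lambda>y. P t y * \<psi> y) \<le> ?B" by (simp add: add_divide_distrib)
    moreover have "integral {0..l} (\<lambda>x. \<bar>P t x\<bar> - d) \<le> integral {0..l} (\<lambda>y. P t y * \<psi> y)"
      using \<psi>P by (intro integral_le int_cont continuous_intros cP c\<psi>) auto
    moreover have "integral {0..l} (\<lambda>x. \<bar>P t x\<bar> - d) = abs_integral l (P t) - d * l"
      using l by (simp add: integral_diff int_cont continuous_intros cP)
    ultimately show ?thesis by linarith
  qed
  show ?thesis
  proof (rule field_le_epsilon)
    fix r :: real assume "r > 0"
    then show "abs_integral l (P t) \<le> ?B + r" using main[of "r / l"] l by simp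
  qed
qed

end

section \<open>Weighted masses in time and the absence of a layer at the inlet\<close>

context viscous_arc
begin

lemma exp_le: "exp (- lam * l / e) \<le> e / (lam * l)"
proof -
  define z where "z = lam * l / e"
  have z: "z > 0" unfolding z_def using lam l e by simp
  have "z \<le> exp z" using exp_ge_add_one_self[of z] by linarith
  then have "exp (- z) \<le> 1 / z" using z by (simp add: exp_minus field_simps)
  then show ?thesis by (simp add: z_def)
qed

lemma exp_integral:
  "(\<lambda>x. exp (- lam * x / e)) integrable_on {0..l}" "integral {0..l} (\<lambda>x. exp (- lam * x / e)) \<le> e / lam"
proof -
  have "((\<lambda>y. exp (- lam * y / e)) has_integral - (e / lam) * exp (- lam * l / e) - - (e / lam) * exp (- lam * 0 / e)) {0..l}"
  proof (rule fundamental_theorem_of_calculus)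
    fix y
    have "((\<lambda>y. - (e / lam) * exp (- lam * y / e)) has_real_derivative exp (- lam * y / e)) (at y within {0..l})"
      using e lam by (auto intro!: derivative_eq_intros)
    then show "((\<lambda>y. - (e / lam) * exp (- lam * y / e)) has_vector_derivative exp (- lam * y / e)) (at y within {0..l})"
      by (simp add: has_real_derivative_iff_has_vector_derivative)
  qed (use l in simp)
  then have h: "((\<lambda>y. exp (- lam * y / e)) has_integral (e / lam) * (1 - exp (- lam * l / e))) {0..l}"
    by (simp add: algebra_simps)
  then show "(\<lambda>x. exp (- lam * x / e)) integrable_on {0..l}" by (auto simp: integrable_on_def)
  have "(e / lam) * (1 - exp (- lam * l / e)) \<le> (e / lam) * 1" using e lam by (intro mult_left_mono) auto
  then show "integral {0..l} (\<lambda>x. exp (- lam * x / e)) \<le> e / lam" using integral_unique[OF h] by simp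
qed

lemma continuous_on_weight:
  assumes k: "continuous_on {0..l} k"
  shows "continuous_on {0..T} (\<lambda>t. integral {0..l} (\<lambda>x. U t x * k x))"
proof -
  have "continuous_on ({0..T} \<times> cbox 0 l) (\<lambda>(t, x). U t x * k x)"
  proof -
    have cU: "continuous_on ({0..T} \<times> cbox 0 l) (\<lambda>(t, x). U t x)" by (rule continuous_on_subset[OF contU]) auto
    have ck: "continuous_on ({0..T} \<times> cbox 0 l) (\<lambda>z. k (snd z))"
      by (rule continuous_on_compose2[OF k]) (auto intro!: continuous_intros)
    show ?thesis using continuous_on_mult[OF cU ck] by (simp add: split_def)
  qed
  from integral_continuous_on_param[OF this] show ?thesis by simp
qed

text \<open>Time derivatives exist for positive times only; continuity of the weighted mass up to
  \<open>t = 0\<close> is what lets the time interval start there.\<close>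

lemma has_integral_weight_derivative:
  assumes T: "T \<ge> 0" and k: "continuous_on {0..l} k" and d: "continuous_on {0..} d"
    and H: "\<And>t. t > 0 \<Longrightarrow> integral {0..l} (\<lambda>x. H t x * k x) = d t"
  shows "integral {0..T} d = integral {0..l} (\<lambda>x. U T x * k x) - integral {0..l} (\<lambda>x. U 0 x * k x)"
proof -
  have "(d has_integral integral {0..l} (\<lambda>x. U T x * k x) - integral {0..l} (\<lambda>x. U 0 x * k x)) {0..T}"
  proof (rule fundamental_theorem_of_calculus_interior[OF T])
    show "continuous_on {0..T} (\<lambda>t. integral {0..l} (\<lambda>x. U t x * k x))"
      by (rule continuous_on_weight[OF k])
    show "((\<lambda>t. integral {0..l} (\<lambda>x. U t x * k x)) has_vector_derivative d t) (at t)" if "t \<in> {0<..<T}" for t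
      using weight_derivative[OF _ k, of t] H[of t] that by (simp add: has_real_derivative_iff_has_vector_derivative)
  qed
  then show ?thesis by (rule integral_unique)
qed

text \<open>The weight \<open>exp (- lam * x / e)\<close> solves the stationary adjoint equation, so
  the weighted mass changes through boundary terms alone. Its integral is at most
  \<open>e / lam\<close>, which gives the first summand; the terms at the outlet carry
  \<open>exp (- lam * l / e) \<le> e / (lam * l)\<close>, which gives the second.\<close>

lemma inlet_flux_bound:
  assumes T: "T \<ge> 0"
    and C: "\<And>t x. 0 \<le> t \<Longrightarrow> t \<le> T \<Longrightarrow> x \<in> {0..l} \<Longrightarrow> \<bar>U t x\<bar> \<le> C"
    and C': "\<And>t x. 0 \<le> t \<Longrightarrow> t \<le> T \<Longrightarrow> x \<in> {0..l} \<Longrightarrow> \<bar>F t x\<bar> \<le> C'"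
  shows "\<bar>integral {0..T} (\<lambda>t. F t 0 - lam * U t 0)\<bar> \<le> e * (2 * C / lam + T * (lam * C + C') / (lam * l))"
proof -
  let ?k = "\<lambda>x. exp (- lam * x / e)"
  have ck: "continuous_on {0..l} ?k" using e by (intro continuous_intros) auto
  let ?I = "\<lambda>t. integral {0..l} (\<lambda>x. U t x * ?k x)"
  have z: "0 \<in> {0..l}" "l \<in> {0..l}" using l by auto
  have "integral {0..T} (\<lambda>t. (F t 0 - lam * U t 0) + ?k l * (lam * U t l - F t l)) = ?I T - ?I 0"
  proof (rule has_integral_weight_derivative[OF T ck])
    show "continuous_on {0..} (\<lambda>t. (F t 0 - lam * U t 0) + ?k l * (lam * U t l - F t l))"
      by (intro continuous_intros contFt contUt z)
    fix t :: real assume t: "t > 0"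
    have "integral {0..l} (\<lambda>x. H t x * ?k x) = F t 0 * ?k 0 - F t l * ?k l + integral {0..l} (\<lambda>x. F t x * (- (lam / e) * ?k x))"
    proof (rule H_by_parts[OF t])
      show "(?k has_real_derivative - (lam / e) * ?k y) (at y within {0..l})" for y
        using e by (auto intro!: derivative_eq_intros simp: field_simps)
      show "continuous_on {0..l} (\<lambda>x. - (lam / e) * ?k x)" by (intro continuous_intros ck)
    qed (use l in auto)
    also have "(\<lambda>x. F t x * (- (lam / e) * ?k x)) = (\<lambda>x. - (lam / e) * (F t x * ?k x))" by (simp add: fun_eq_iff)
    also have "integral {0..l} \<dots> = - (lam / e) * (e * (U t 0 - U t l * ?k l))"
      unfolding integral_mult_right using weighted_flux_integral[of t] t by simp
    finally show "integral {0..l} (\<lambda>x. H t x * ?k x) = (F t 0 - lam * U t 0) + ?k l * (lam * U t l - F t l)"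
      using e by (simp add: algebra_simps)
  qed
  moreover have "integral {0..T} (\<lambda>t. (F t 0 - lam * U t 0) + ?k l * (lam * U t l - F t l)) =
      integral {0..T} (\<lambda>t. F t 0 - lam * U t 0) + integral {0..T} (\<lambda>t. ?k l * (lam * U t l - F t l))"
    using z by (intro integral_add integrable_continuous_real continuous_intros continuous_on_subset[OF contFt] continuous_on_subset[OF contUt]) auto
  moreover have "\<bar>integral {0..T} (\<lambda>t. ?k l * (lam * U t l - F t l))\<bar> \<le> e / (lam * l) * (lam * C + C') * T"
  proof -
    have "norm (integral {0..T} (\<lambda>t. ?k l * (lam * U t l - F t l))) \<le> integral {0..T} (\<lambda>t. e / (lam * l) * (lam * C + C'))"
    proof (rule integral_norm_bound_integral)
      show "(\<lambda>t. ?k l * (lam * U t l - F t l)) integrable_on {0..T}"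
        using z by (intro integrable_continuous_real continuous_intros continuous_on_subset[OF contFt] continuous_on_subset[OF contUt]) auto
      fix t assume t: "t \<in> {0..T}"
      have "\<bar>lam * U t l - F t l\<bar> \<le> \<bar>lam * U t l\<bar> + \<bar>F t l\<bar>" by simp
      also have "\<dots> \<le> lam * C + C'"
        using C[of t l] C'[of t l] t z lam by (intro add_mono) (auto simp: abs_mult)
      finally have "\<bar>?k l\<bar> * \<bar>lam * U t l - F t l\<bar> \<le> e / (lam * l) * (lam * C + C')"
        using exp_le by (intro mult_mono) (auto simp: order_trans[OF _ exp_le])
      then show "norm (?k l * (lam * U t l - F t l)) \<le> e / (lam * l) * (lam * C + C')" by (simp add: abs_mult)
    qed (rule integrable_const_ivl)
    then show ?thesis using T by (simp add: mult_ac)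
  qed
  moreover have "\<bar>?I t\<bar> \<le> C * (e / lam)" if t: "0 \<le> t" "t \<le> T" for t
  proof -
    have "norm (?I t) \<le> integral {0..l} (\<lambda>x. C * ?k x)"
      using C[of t] t by (intro integral_norm_bound_integral int_U_weight ck integrable_on_mult_right exp_integral)
        (auto simp: abs_mult intro!: mult_right_mono)
    also have "\<dots> \<le> C * (e / lam)"
      unfolding integral_mult_right using order_trans[OF abs_ge_zero C[of t 0]] t z
      by (intro mult_left_mono exp_integral(2)) auto
    finally show ?thesis by simp
  qed
  from this[of T] this[of 0] have "\<bar>?I T - ?I 0\<bar> \<le> 2 * (C * (e / lam))" using T by linarith
  ultimately have "\<bar>integral {0..T} (\<lambda>t. F t 0 - lam * U t 0)\<bar> \<le> 2 * (C * (e / lam)) + e / (lam * l) * (lam * C + C') * T"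
    by linarith
  also have "\<dots> = e * (2 * C / lam + T * (lam * C + C') / (lam * l))" by (simp add: field_simps)
  finally show ?thesis .
qed

end

section \<open>The potential along characteristics\<close>

text \<open>Cauchy's formula for repeated integration. The truncated kernel
  \<open>max 0 (x - y)\<close> turns it into an integral over the whole arc with a continuous
  weight, a form that can be differentiated in time.\<close>

lemma integral_double:
  fixes f :: "real \<Rightarrow> real"
  assumes f: "continuous_on {0..l} f" and x: "0 \<le> x" "x \<le> l"
  shows "integral {0..x} (\<lambda>y. integral {0..y} f) = integral {0..x} (\<lambda>y. (x - y) * f y)"
    "integral {0..x} (\<lambda>y. integral {0..y} f) = integral {0..l} (\<lambda>y. f y * max 0 (x - y))"
proof -
  have c: "continuous_on {0..x} f" using f x continuous_on_subset by fastforce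
  have p: "primitive_on 0 x (\<lambda>y. integral {0..y} f) f"
    using absolutely_integrable_continuous_real[OF c] by (simp add: primitive_on_def)
  have "integral {0..x} (\<lambda>y. integral {0..y} f * (- 1)) =
      integral {0..x} f * (x - x) - integral {0..0} f * (x - 0) - integral {0..x} (\<lambda>y. f y * (x - y))"
    by (rule primitive_on_integral_by_parts[OF x(1) p]) (auto intro!: derivative_eq_intros continuous_intros)
  then show 1: "integral {0..x} (\<lambda>y. integral {0..y} f) = integral {0..x} (\<lambda>y. (x - y) * f y)"
    by (simp add: mult.commute)
  have i: "(\<lambda>y. f y * max 0 (x - y)) integrable_on {0..l}"
    by (intro integrable_continuous_real continuous_intros f)
  have "integral {0..l} (\<lambda>y. f y * max 0 (x - y)) =
      integral {0..x} (\<lambda>y. f y * max 0 (x - y)) + integral {x..l} (\<lambda>y. f y * max 0 (x - y))"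
    using Henstock_Kurzweil_Integration.integral_combine[OF x i] by simp
  also have "integral {x..l} (\<lambda>y. f y * max 0 (x - y)) = integral {x..l} (\<lambda>y. 0)" by (intro integral_cong) auto
  also have "integral {0..x} (\<lambda>y. f y * max 0 (x - y)) = integral {0..x} (\<lambda>y. (x - y) * f y)" by (intro integral_cong) auto
  finally show "integral {0..x} (\<lambda>y. integral {0..y} f) = integral {0..l} (\<lambda>y. f y * max 0 (x - y))" using 1 by simp
qed

text \<open>Interpolation: on an interval of length \<open>s\<close> the mean value theorem finds a
  point with \<open>\<bar>D\<bar> \<le> 2 * m / s\<close>, and the Lipschitz bound carries this over
  to \<open>x\<close>. Since \<open>s \<le> l / 2\<close>, such an interval fits on one side of
  \<open>x\<close>.\<close>

lemma lipschitz_bound_from_primitive: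
  fixes G D :: "real \<Rightarrow> real"
  assumes G: "\<And>x. x \<in> {0..l} \<Longrightarrow> (G has_real_derivative D x) (at x within {0..l})" "\<And>x. x \<in> {0..l} \<Longrightarrow> \<bar>G x\<bar> \<le> m"
    and D: "\<And>x y. x \<in> {0..l} \<Longrightarrow> y \<in> {0..l} \<Longrightarrow> \<bar>D x - D y\<bar> \<le> C * \<bar>x - y\<bar>"
    and s: "0 < s" "s \<le> l / 2" and x: "x \<in> {0..l}" and C: "C \<ge> 0"
  shows "\<bar>D x\<bar> \<le> 2 * m / s + C * s"
proof -
  have main: "\<bar>D x\<bar> \<le> 2 * m / s + C * s" if ab: "0 \<le> a" "b = a + s" "b \<le> l" "x \<in> {a..b}" for a b
  proof -
    have "a < b" using ab s by simp
    have "continuous_on {a..b} G"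
      by (rule continuous_on_subset[OF DERIV_continuous_on[OF G(1)]]) (use ab in auto)
    moreover have "(G has_real_derivative D y) (at y)" if "a < y" "y < b" for y
    proof -
      have "at y within {0..l} = at y" using that ab by (intro at_within_interior) (auto simp: interior_atLeastAtMost_real)
      then show ?thesis using G(1)[of y] that ab by auto
    qed
    ultimately obtain z where z: "a < z" "z < b" "G b - G a = D z * (b - a)"
      using mvt[OF \<open>a < b\<close>, of G "\<lambda>x h. D x * h"] by (auto simp: has_field_derivative_def)
    have "\<bar>D z\<bar> * s = \<bar>G b - G a\<bar>" using z(3) ab s by (simp add: abs_mult)
    also have "\<dots> \<le> 2 * m" using G(2)[of a] G(2)[of b] ab s by (auto simp: abs_le_iff)
    finally have "\<bar>D z\<bar> \<le> 2 * m / s" using s by (simp add: field_simps)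
    moreover have "\<bar>D x - D z\<bar> \<le> C * s"
    proof -
      have "\<bar>D x - D z\<bar> \<le> C * \<bar>x - z\<bar>" using D[of x z] x z ab by auto
      also have "\<dots> \<le> C * s" using z ab C by (intro mult_left_mono) auto
      finally show ?thesis .
    qed
    ultimately show ?thesis by linarith
  qed
  show ?thesis
  proof (cases "x \<le> l / 2")
    case True then show ?thesis using main[of x "x + s"] s x by auto
  next
    case False then show ?thesis using main[of "x - s" x] s x by auto
  qed
qed

lemma continuous_on_Times_if_lipschitz:
  fixes f :: "real \<Rightarrow> real \<Rightarrow> real"
  assumes c: "\<And>x. x \<in> X \<Longrightarrow> continuous_on S (\<lambda>t. f t x)"
    and lip: "\<And>t x y. t \<in> S \<Longrightarrow> x \<in> X \<Longrightarrow> y \<in> X \<Longrightarrow> \<bar>f t x - f t y\<bar> \<le> K * \<bar>x - y\<bar>"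
  shows "continuous_on (S \<times> X) (\<lambda>(t, x). f t x)"
  unfolding continuous_on_def
proof (clarify, rule Lim_null[THEN iffD2], rule Lim_null_comparison)
  fix t x assume tx: "t \<in> S" "x \<in> X"
  show "\<forall>\<^sub>F z in at (t, x) within S \<times> X. norm ((case z of (t, x) \<Rightarrow> f t x) - f t x) \<le> K * \<bar>snd z - x\<bar> + \<bar>f (fst z) x - f t x\<bar>"
    unfolding eventually_at_filter
  proof (rule always_eventually, clarify)
    fix s y assume "s \<in> S" "y \<in> X"
    then show "norm (f s y - f t x) \<le> K * \<bar>snd (s, y) - x\<bar> + \<bar>f (fst (s, y)) x - f t x\<bar>"
      using lip[of s y x] tx by simp
  qed
  have f: "((\<lambda>z. fst z) \<longlongrightarrow> t) (at (t, x) within S \<times> X)" "((\<lambda>z. snd z) \<longlongrightarrow> x) (at (t, x) within S \<times> X)"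
    by (auto intro!: tendsto_eq_intros)
  have "((\<lambda>z. f (fst z) x) \<longlongrightarrow> f t x) (at (t, x) within S \<times> X)"
    using c[OF tx(2)] f(1) tx(1)
    by (rule continuous_on_tendsto_compose) (auto simp: eventually_at_filter intro!: always_eventually)
  then show "((\<lambda>z. K * \<bar>snd z - x\<bar> + \<bar>f (fst z) x - f t x\<bar>) \<longlongrightarrow> 0) (at (t, x) within S \<times> X)"
    using f(2) by (auto intro!: tendsto_eq_intros)
qed

lemma integral_right_end_lipschitz:
  fixes f :: "real \<Rightarrow> real"
  assumes f: "f integrable_on {0..l}" and K: "\<And>x. x \<in> {0..l} \<Longrightarrow> \<bar>f x\<bar> \<le> K" and xy: "x \<in> {0..l}" "y \<in> {0..l}"
  shows "\<bar>integral {0..x} f - integral {0..y} f\<bar> \<le> K * \<bar>x - y\<bar>"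
proof -
  have main: "\<bar>integral {0..x} f - integral {0..y} f\<bar> \<le> K * (y - x)" if xy: "0 \<le> x" "x \<le> y" "y \<le> l" for x y
  proof -
    have i: "f integrable_on {0..y}" "f integrable_on {x..y}"
      using xy by (auto intro: integrable_subinterval_real[OF f])
    have "norm (integral {x..y} f) \<le> integral {x..y} (\<lambda>x. K)"
      using xy K by (intro integral_norm_bound_integral i) auto
    then show ?thesis using Henstock_Kurzweil_Integration.integral_combine[OF xy(1,2) i(1)] xy
      by (simp add: mult.commute)
  qed
  show ?thesis using main[of x y] main[of y x] xy by (cases "x \<le> y") (auto simp: abs_minus_commute)
qed

lemma continuous_on_if_on_intervals:
  fixes f :: "real \<Rightarrow> real"
  assumes "\<And>S. continuous_on {0..S} f"
  shows "continuous_on {0..} f"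
  unfolding continuous_on_eq_continuous_within
proof
  fix x :: real assume x: "x \<in> {0..}"
  have "continuous (at x within {0..x + 1}) f" using assms[of "x + 1"] x by (auto simp: continuous_on_eq_continuous_within)
  moreover have "at x within {0..x + 1} = at x within {0..}"
    by (rule at_within_nhd[of x "{..<x + 1}"]) (use x in auto)
  ultimately show "continuous (at x within {0..}) f" by (simp add: continuous_within)
qed

context viscous_arc
begin

text \<open>\<open>G\<close> is a second antiderivative in \<open>x\<close> of the difference between the viscous solution and the
  transport solution \<open>V (x - lam * t)\<close>, normalised so that \<open>G\<^sub>t + lam G\<^sub>x = e U\<close>: its source is small.\<close>
lemma potential_estimate:
  fixes V :: "real \<Rightarrow> real"
  assumes T: "T > 0" and a: "a = - (lam * T)" and V: "primitive_on a l W V"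
    and C: "\<And>t x. 0 \<le> t \<Longrightarrow> t \<le> T \<Longrightarrow> x \<in> {0..l} \<Longrightarrow> \<bar>U t x\<bar> \<le> C"
    and CV: "\<And>x. x \<in> {a..l} \<Longrightarrow> \<bar>V x\<bar> \<le> C"
    and eta: "\<And>t. 0 \<le> t \<Longrightarrow> t \<le> T \<Longrightarrow> \<bar>integral {0..t} (\<lambda>t. F t 0) + (W (- (lam * t)) - W 0)\<bar> \<le> eta"
    and eta': "\<And>x. x \<in> {0..l} \<Longrightarrow> \<bar>integral {0..x} (U 0) - (W x - W 0)\<bar> \<le> eta'"
    and s: "0 < s" "s \<le> l / 2" and t: "0 \<le> t" "t \<le> T" and x: "x \<in> {0..l}"
  shows "\<bar>integral {0..x} (U t) - integral {0..t} (\<lambda>t. F t 0) - (W (x - lam * t) - W 0)\<bar>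
    \<le> 2 * (l * eta' + T * lam * eta + 2 * e * C * T) / s + 2 * C * s"
proof -
  have z: "0 \<in> {0..l}" "l \<in> {0..l}" using l by auto
  have C0: "C \<ge> 0" using C[of 0 0] T z by auto
  have cW: "continuous_on {a..l} W" using V by (rule primitive_on_continuous)
  define \<Phi> where "\<Phi> t = integral {0..t} (\<lambda>t. F t 0)" for t
  \<comment> \<open>The antiderivative of \<open>W - W 0\<close>, normalised to vanish at 0.\<close>
  define WW where "WW x = integral {a..x} W - integral {a..0} W - x * W 0" for x
  have dWW: "(WW has_real_derivative W x - W 0) (at x within {a..l})" if "x \<in> {a..l}" for x
    unfolding WW_def[abs_def] using integral_has_real_derivative[OF cW that] by (auto intro!: derivative_eq_intros)
  \<comment> \<open>Of the two terms in \<open>t\<close> alone, one completes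
    \<open>- lam * D\<close> and the other removes the inlet value of \<open>U\<close>, so that
    exactly \<open>G_t = - lam * D + e * U\<close> remains.\<close>
  define G where "G t x = integral {0..x} (\<lambda>y. integral {0..y} (U t)) - x * \<Phi> t + lam * integral {0..t} \<Phi>
      + e * integral {0..t} (\<lambda>t. U t 0) - WW (x - lam * t)" for t x
  define D where "D t x = integral {0..x} (U t) - \<Phi> t - (W (x - lam * t) - W 0)" for t x
  have c\<Phi>: "continuous_on {0..} \<Phi>"
  proof (rule continuous_on_if_on_intervals)
    show "continuous_on {0..S} \<Phi>" for S
      unfolding \<Phi>_def by (rule continuous_on_integral_right_end[OF contFt[OF z(1)]])
  qed
  have inn: "x - lam * t \<in> {a..l}" if "0 \<le> t" "t \<le> T" "x \<in> {0..l}" for t x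
  proof -
    have "lam * t \<le> lam * T" "lam * t \<ge> 0" using that lam by auto
    then show ?thesis using that a by auto
  qed
  have cUi: "continuous_on {0..l} (\<lambda>x. integral {0..x} (U t))" if "t \<ge> 0" for t
    by (intro indefinite_integral_continuous_1 int_cont contUx that)
  have Gx: "(G t has_real_derivative D t x) (at x within {0..l})" if t: "0 \<le> t" "t \<le> T" and x: "x \<in> {0..l}" for t x
  proof -
    have "(WW \<circ> (\<lambda>x. x - lam * t) has_real_derivative (W (x - lam * t) - W 0) * 1) (at x within {0..l})"
    proof (rule DERIV_image_chain)
      show "((\<lambda>x. x - lam * t) has_real_derivative 1) (at x within {0..l})" by (auto intro!: derivative_eq_intros)
      show "(WW has_real_derivative W (x - lam * t) - W 0) (at (x - lam * t) within (\<lambda>x. x - lam * t) ` {0..l})"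
        by (rule DERIV_subset[OF dWW[OF inn[OF t x]]]) (use inn[OF t] in blast)
    qed
    then have "((\<lambda>x. WW (x - lam * t)) has_real_derivative (W (x - lam * t) - W 0)) (at x within {0..l})"
      by (simp add: o_def)
    then show ?thesis
      unfolding G_def[abs_def] D_def
      by (auto intro!: derivative_eq_intros integral_has_real_derivative cUi t x)
  qed
  have Gt: "((\<lambda>t. G t x) has_real_derivative - lam * D t x + e * U t x) (at t)" if t: "0 < t" "t < T" and x: "x \<in> {0..<l}" for t x
  proof -
    have x': "0 \<le> x" "x \<le> l" "x \<in> {0..l}" using x by auto
    have kc: "continuous_on {0..l} (\<lambda>y. max 0 (x - y))" by (intro continuous_intros)
    \<comment> \<open>The weight has a kink at \<open>y = x\<close>; integration by parts is
      therefore carried out on \<open>{0..x}\<close>, where it is affine.\<close>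
    have Hk: "integral {0..l} (\<lambda>y. H t y * max 0 (x - y)) = x * F t 0 - lam * integral {0..x} (U t) + e * (U t x - U t 0)"
    proof -
      have "integral {0..l} (\<lambda>y. H t y * max 0 (x - y)) =
          integral {0..x} (\<lambda>y. H t y * max 0 (x - y)) + integral {x..l} (\<lambda>y. H t y * max 0 (x - y))"
        using Henstock_Kurzweil_Integration.integral_combine[OF x'(1,2) int_H_weight[OF t(1) kc]] by simp
      moreover have "integral {x..l} (\<lambda>y. H t y * max 0 (x - y)) = integral {x..l} (\<lambda>y. 0)" by (intro integral_cong) auto
      moreover have "integral {0..x} (\<lambda>y. H t y * max 0 (x - y)) = integral {0..x} (\<lambda>y. H t y * (x - y))" by (intro integral_cong) auto
      moreover have "integral {0..x} (\<lambda>y. H t y * (x - y)) = F t 0 * (x - 0) - F t x * (x - x) + integral {0..x} (\<lambda>y. F t y * (- 1))"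
        by (rule H_by_parts[OF t(1) x'(1,2)]) (auto intro!: derivative_eq_intros continuous_intros)
      moreover have "integral {0..x} (F t) = lam * integral {0..x} (U t) - e * (U t x - U t 0)"
      proof -
        have "(U t has_vector_derivative P t y) (at y within {0..x})" if "y \<in> {0..x}" for y
          using DERIV_subset[OF derU, of t y "{0..x}"] that x' t by (auto simp: has_real_derivative_iff_has_vector_derivative)
        then have "(P t has_integral U t x - U t 0) {0..x}" using x' by (intro fundamental_theorem_of_calculus) auto
        moreover have "(U t has_integral integral {0..x} (U t)) {0..x}"
          using x' t by (intro integrable_integral integrable_continuous_real continuous_on_subset[OF contUx]) auto
        ultimately have "(F t has_integral lam * integral {0..x} (U t) - e * (U t x - U t 0)) {0..x}"
          unfolding F_def[abs_def] by (intro has_integral_diff has_integral_mult_right)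
        then show ?thesis by (rule integral_unique)
      qed
      ultimately show ?thesis by simp
    qed
    have dI: "((\<lambda>t. integral {0..x} (\<lambda>y. integral {0..y} (U t))) has_real_derivative
        x * F t 0 - lam * integral {0..x} (U t) + e * (U t x - U t 0)) (at t)"
    proof (rule has_field_derivative_transform_within_open[of _ _ _ "{0<..}"])
      show "((\<lambda>t. integral {0..l} (\<lambda>y. U t y * max 0 (x - y))) has_real_derivative
        x * F t 0 - lam * integral {0..x} (U t) + e * (U t x - U t 0)) (at t)"
        using weight_derivative[OF t(1) kc] unfolding Hk .
    qed (use t integral_double(2)[OF contUx x'(1,2)] in auto)
    have dW: "((\<lambda>t. WW (x - lam * t)) has_real_derivative (W (x - lam * t) - W 0) * (- lam)) (at t)"
    proof (rule DERIV_chain2[where f = WW and g = "\<lambda>t. x - lam * t"])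
      have "lam * t > 0" "lam * t < lam * T" using t lam by auto
      then have "at (x - lam * t) within {a..l} = at (x - lam * t)"
        using x a by (intro at_within_interior) (auto simp: interior_atLeastAtMost_real)
      then show "(WW has_real_derivative W (x - lam * t) - W 0) (at (x - lam * t))"
        using dWW[OF inn[of t x]] t x' by simp
      show "((\<lambda>t. x - lam * t) has_real_derivative - lam) (at t)" by (auto intro!: derivative_eq_intros)
    qed
    have d\<Phi>: "(\<Phi> has_real_derivative F t 0) (at t)"
      unfolding \<Phi>_def[abs_def] by (rule has_real_derivative_integral_at[OF contFt[OF z(1)] t(1)])
    have d\<Phi>2: "((\<lambda>t. integral {0..t} \<Phi>) has_real_derivative \<Phi> t) (at t)"
      by (rule has_real_derivative_integral_at[OF c\<Phi> t(1)])
    have dU0: "((\<lambda>t. integral {0..t} (\<lambda>t. U t 0)) has_real_derivative U t 0) (at t)"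
      by (rule has_real_derivative_integral_at[OF contUt[OF z(1)] t(1)])
    from DERIV_diff[OF DERIV_add[OF DERIV_add[OF DERIV_diff[OF dI DERIV_cmult[OF d\<Phi>, of x]]
          DERIV_cmult[OF d\<Phi>2, of lam]] DERIV_cmult[OF dU0, of e]] dW]
    show ?thesis unfolding G_def by (rule DERIV_cong) (simp add: D_def algebra_simps)
  qed
  have cWp: "continuous_on ({0..T} \<times> {0..l}) (\<lambda>(t, x). W (x - lam * t))"
    unfolding split_def using inn by (intro continuous_on_compose2[OF cW] continuous_intros) auto
  have cWW: "continuous_on {a..l} WW" using dWW by (rule DERIV_continuous_on)
  have cWWp: "continuous_on ({0..T} \<times> {0..l}) (\<lambda>(t, x). WW (x - lam * t))"
    unfolding split_def using inn
    by (intro continuous_on_compose2[OF cWW] continuous_intros) auto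
  have c1: "continuous_on ({0..T} \<times> {0..l}) (\<lambda>(t, x). h t)" if "continuous_on {0..T} h" for h :: "real \<Rightarrow> real"
    unfolding split_def by (intro continuous_on_compose2[OF that] continuous_intros) auto
  have cIU: "continuous_on ({0..T} \<times> {0..l}) (\<lambda>(t, x). integral {0..x} (U t))"
  proof (rule continuous_on_Times_if_lipschitz)
    show "continuous_on {0..T} (\<lambda>t. integral {0..x} (U t))" if "x \<in> {0..l}" for x
    proof -
      have "continuous_on ({0..T} \<times> cbox 0 x) (\<lambda>(t, x). U t x)"
        by (rule continuous_on_subset[OF contU]) (use that in auto)
      from integral_continuous_on_param[OF this] show ?thesis by simp
    qed
    show "\<bar>integral {0..x} (U t) - integral {0..y} (U t)\<bar> \<le> C * \<bar>x - y\<bar>"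
      if "t \<in> {0..T}" "x \<in> {0..l}" "y \<in> {0..l}" for t x y
      using that C[of t] by (intro integral_right_end_lipschitz[of "U t" l] int_cont contUx) auto
  qed
  have cIIU: "continuous_on ({0..T} \<times> {0..l}) (\<lambda>(t, x). integral {0..x} (\<lambda>y. integral {0..y} (U t)))"
  proof (rule continuous_on_Times_if_lipschitz)
    show "continuous_on {0..T} (\<lambda>t. integral {0..x} (\<lambda>y. integral {0..y} (U t)))" if x: "x \<in> {0..l}" for x
    proof (rule continuous_on_eq)
      show "continuous_on {0..T} (\<lambda>t. integral {0..l} (\<lambda>y. U t y * max 0 (x - y)))"
        by (intro continuous_on_weight continuous_intros)
      show "integral {0..l} (\<lambda>y. U t y * max 0 (x - y)) = integral {0..x} (\<lambda>y. integral {0..y} (U t))" if "t \<in> {0..T}" for t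
        using integral_double(2)[OF contUx, of t x] that x by auto
    qed
    show "\<bar>integral {0..x} (\<lambda>y. integral {0..y} (U t)) - integral {0..y} (\<lambda>y. integral {0..y} (U t))\<bar> \<le> (C * l) * \<bar>x - y\<bar>"
      if t: "t \<in> {0..T}" and xy: "x \<in> {0..l}" "y \<in> {0..l}" for t x y
    proof (rule integral_right_end_lipschitz[OF _ _ xy])
      show "(\<lambda>y. integral {0..y} (U t)) integrable_on {0..l}" using t by (intro int_cont cUi) auto
      show "\<bar>integral {0..y} (U t)\<bar> \<le> C * l" if y: "y \<in> {0..l}" for y
      proof -
        have "\<bar>integral {0..y} (U t) - integral {0..0} (U t)\<bar> \<le> C * \<bar>y - 0\<bar>"
          using t y z C[of t] by (intro integral_right_end_lipschitz[of "U t" l] int_cont contUx) auto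
        also have "\<dots> \<le> C * l" using y C0 by (intro mult_left_mono) auto
        finally show ?thesis by simp
      qed
    qed
  qed
  have cG: "continuous_on ({0..T} \<times> {0..l}) (\<lambda>(t, x). G t x)" 
    using cIIU c1[OF continuous_on_subset[OF c\<Phi>]] c1[OF continuous_on_integral_right_end[OF c\<Phi>]]
      c1[OF continuous_on_integral_right_end[OF contUt[OF z(1)]]] cWWp
    unfolding G_def split_def by (intro continuous_intros) (auto simp: split_def)
  have cD: "continuous_on ({0..T} \<times> {0..l}) (\<lambda>(t, x). D t x)"
    using cIU c1[OF continuous_on_subset[OF c\<Phi>]] cWp
    unfolding D_def split_def by (intro continuous_intros) (auto simp: split_def)
  \<comment> \<open>\<open>U\<close> and the profile are bounded densities of the two parts of
    \<open>D\<close>; each contributes \<open>C\<close> to the Lipschitz constant.\<close>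
  have Dlip: "\<bar>D t x - D t y\<bar> \<le> 2 * C * \<bar>x - y\<bar>" if t: "0 \<le> t" "t \<le> T" and xy: "x \<in> {0..l}" "y \<in> {0..l}" for t x y
  proof -
    have main: "\<bar>D t y - D t x\<bar> \<le> 2 * C * (y - x)" if xy: "0 \<le> x" "x \<le> y" "y \<le> l" for x y
    proof -
      have "W (y - lam * t) - W (x - lam * t) = integral {x - lam * t..y - lam * t} V"
        using inn[OF t, of x] inn[OF t, of y] xy by (intro primitive_on_diff[OF V]) auto
      moreover have "norm (integral {x - lam * t..y - lam * t} V) \<le> integral {x - lam * t..y - lam * t} (\<lambda>x. C)"
      proof (rule integral_norm_bound_integral)
        show "V integrable_on {x - lam * t..y - lam * t}"
          using inn[OF t, of x] inn[OF t, of y] xy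
          by (intro set_lebesgue_integral_eq_integral(1) absolutely_integrable_subinterval[OF primitive_onD(1)[OF V]]) auto
        show "norm (V z) \<le> C" if "z \<in> {x - lam * t..y - lam * t}" for z
          using inn[OF t, of x] inn[OF t, of y] xy that CV[of z] by auto
      qed (rule integrable_const_ivl)
      moreover have "integral {0..y} (U t) - integral {0..x} (U t) = integral {x..y} (U t)"
        using Henstock_Kurzweil_Integration.integral_combine[OF xy(1,2), of "U t"] xy t
        by (simp add: algebra_simps integrable_continuous_real continuous_on_subset[OF contUx])
      moreover have "norm (integral {x..y} (U t)) \<le> integral {x..y} (\<lambda>x. C)"
        using xy t C[of t] by (intro integral_norm_bound_integral integrable_continuous_real continuous_on_subset[OF contUx]) auto
      moreover have "integral {x - lam * t..y - lam * t} (\<lambda>x. C) = C * (y - x)" "integral {x..y} (\<lambda>x. C) = C * (y - x)"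
        using xy by (auto simp: mult.commute)
      moreover have "D t y - D t x = integral {0..y} (U t) - integral {0..x} (U t) - (W (y - lam * t) - W (x - lam * t))"
        by (simp add: D_def)
      ultimately have "\<bar>D t y - D t x\<bar> \<le> C * (y - x) + C * (y - x)" unfolding real_norm_def by linarith
      then show ?thesis by simp
    qed
    show ?thesis using main[of x y] main[of y x] xy by (cases "x \<le> y") (auto simp: abs_minus_commute)
  qed
  let ?m = "l * eta' + T * lam * eta + 2 * e * C * T"
  have eta0: "eta \<ge> 0" "eta' \<ge> 0" using eta[of 0] eta'[of 0] T z by auto
  have G00: "G 0 0 = 0" by (simp add: G_def WW_def)
  have G0: "\<bar>G 0 x\<bar> \<le> l * eta'" if x: "x \<in> {0..l}" for x
  proof -
    have "\<bar>G 0 x - G 0 0\<bar> \<le> eta' * (x - 0)"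
    proof (rule diff_le_if_derivative_le[where g' = "D 0"])
      show "continuous_on {0..x} (G 0)"
        using x T by (intro continuous_on_subset[OF DERIV_continuous_on[OF Gx]]) auto
      show "(G 0 has_real_derivative D 0 y) (at y)" if "0 < y" "y < x" for y
      proof -
        have "at y within {0..l} = at y" using that x by (intro at_within_interior) (auto simp: interior_atLeastAtMost_real)
        then show ?thesis using Gx[of 0 y] that x T by auto
      qed
      show "\<bar>D 0 y\<bar> \<le> eta'" if "0 < y" "y < x" for y
        using eta'[of y] that x by (simp add: D_def \<Phi>_def)
    qed (use x in auto)
    also have "\<dots> \<le> l * eta'" using x eta0 by (simp add: mult.commute mult_left_mono)
    finally show ?thesis by (simp add: G00)
  qed
  \<comment> \<open>At the inlet \<open>D\<close> reduces to minus the error of the time-integrated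
    flux, which \<open>eta\<close> bounds. Integrating the equation for \<open>G\<close> in time
    costs a factor \<open>T\<close>.\<close>
  have Gb: "\<bar>G t 0\<bar> \<le> T * lam * eta + e * C * T" if t: "0 \<le> t" "t \<le> T" for t
  proof -
    have "\<bar>G t 0 - G 0 0\<bar> \<le> (lam * eta + e * C) * (t - 0)"
    proof (rule diff_le_if_derivative_le[where g' = "\<lambda>t. - lam * D t 0 + e * U t 0"])
      show "continuous_on {0..t} (\<lambda>t. G t 0)"
      proof -
        have "continuous_on {0..t} (\<lambda>s. (\<lambda>(t, x). G t x) (s, 0))"
          by (rule continuous_on_compose2[OF cG]) (use t z in \<open>auto intro!: continuous_intros\<close>)
        then show ?thesis by simp
      qed
      show "((\<lambda>t. G t 0) has_real_derivative - lam * D s 0 + e * U s 0) (at s)" if "0 < s" "s < t" for s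
        using Gt[of s 0] that t l by auto
      show "\<bar>- lam * D s 0 + e * U s 0\<bar> \<le> lam * eta + e * C" if "0 < s" "s < t" for s
      proof -
        have "D s 0 = - (integral {0..s} (\<lambda>t. F t 0) + (W (- (lam * s)) - W 0))" by (simp add: D_def \<Phi>_def)
        then have "\<bar>D s 0\<bar> \<le> eta" using eta[of s] that t by simp
        then have "\<bar>- lam * D s 0\<bar> \<le> lam * eta" using lam by (simp add: abs_mult)
        moreover have "\<bar>e * U s 0\<bar> \<le> e * C" using C[of s 0] e that t z by (simp add: abs_mult)
        ultimately show ?thesis by linarith
      qed
    qed (use t in auto)
    also have "\<dots> \<le> (lam * eta + e * C) * T" using t lam e eta0 C0 by (intro mult_left_mono) auto
    finally show ?thesis by (simp add: G00 algebra_simps)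
  qed
  \<comment> \<open>Along a characteristic the transport terms cancel; only the source
    \<open>e * U\<close> acts, for a time of at most \<open>T\<close>.\<close>
  have char: "\<bar>G t x - G r (x - lam * (t - r))\<bar> \<le> e * C * T"
    if r: "0 \<le> r" "r \<le> t" "t \<le> T" "0 \<le> x - lam * (t - r)" "x \<le> l" for t r x
  proof -
    let ?p = "\<lambda>q. x - lam * (t - q)"
    have pin: "?p q \<in> {0..l}" if "q \<in> {r..t}" for q
    proof -
      have "lam * (t - q) \<ge> 0" "lam * (t - q) \<le> lam * (t - r)" using that lam by auto
      then show ?thesis using r by auto
    qed
    have "\<bar>G t (?p t) - G r (?p r)\<bar> \<le> (e * C) * (t - r)"
    proof (rule diff_le_if_derivative_le[where g' = "\<lambda>q. e * U q (?p q)"])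
      have "continuous_on {r..t} (\<lambda>q. (\<lambda>(t, x). G t x) (q, ?p q))"
        using pin r by (intro continuous_on_compose2[OF cG] continuous_intros) auto
      then show "continuous_on {r..t} (\<lambda>q. G q (?p q))" by simp
      show "\<bar>e * U q (?p q)\<bar> \<le> e * C" if "r < q" "q < t" for q
        using C[of q "?p q"] pin[of q] that r e by (auto simp: abs_mult)
      show "((\<lambda>q. G q (?p q)) has_real_derivative e * U q (?p q)) (at q)" if q: "r < q" "q < t" for q
      proof -
        have "lam * (t - q) > 0" "lam * (t - q) < lam * (t - r)" using q lam by auto
        then have pq: "?p q \<in> {0<..<l}" using r by auto
        \<comment> \<open>The joint derivative follows from the two partial ones because
          \<open>D\<close>, the derivative in \<open>x\<close>, is continuous in both
          variables.\<close>
        have "((\<lambda>(t, x). G t x) has_derivative (\<lambda>(tx, ty). (- lam * D q (?p q) + e * U q (?p q)) * tx + blinfun_apply (D q (?p q) *\<^sub>R id_blinfun) ty)) (at (q, ?p q) within {0<..<T} \<times> {0<..<l})"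
        proof (rule has_derivative_partialsI)
          show "((\<lambda>t. G t (?p q)) has_derivative (*) (- lam * D q (?p q) + e * U q (?p q))) (at q within {0<..<T})"
            using Gt[of q "?p q"] q r pq by (auto simp: has_field_derivative_def intro: has_derivative_at_withinI)
          show "((\<lambda>y. G s y) has_derivative blinfun_apply (D s y *\<^sub>R id_blinfun)) (at y within {0<..<l})"
            if "s \<in> {0<..<T}" "y \<in> {0<..<l}" for s y
          proof -
            have "(G s has_real_derivative D s y) (at y within {0<..<l})"
              using that by (intro DERIV_subset[OF Gx]) auto
            then show ?thesis by (simp add: has_field_derivative_def scaleR_blinfun.rep_eq)
          qed
          have "continuous_on ({0<..<T} \<times> {0<..<l}) (\<lambda>(t, x). D t x *\<^sub>R (id_blinfun :: real \<Rightarrow>\<^sub>L real))"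
          proof -
            have "continuous_on ({0<..<T} \<times> {0<..<l}) (\<lambda>(t, x). D t x)"
              by (rule continuous_on_subset[OF cD]) (auto simp: less_imp_le)
            then show ?thesis unfolding split_def by (intro continuous_intros)
          qed
          then show "continuous (at (q, ?p q) within {0<..<T} \<times> {0<..<l}) (\<lambda>(t, x). D t x *\<^sub>R (id_blinfun :: real \<Rightarrow>\<^sub>L real))"
            using pq q r by (auto simp: continuous_on_eq_continuous_within)
        qed (use pq in auto)
        moreover have "at (q, ?p q) within {0<..<T} \<times> {0<..<l} = at (q, ?p q)"
          using pq q r by (intro at_within_open) (auto intro: open_Times)
        ultimately have d: "((\<lambda>(t, x). G t x) has_derivative (\<lambda>(tx, ty). (- lam * D q (?p q) + e * U q (?p q)) * tx + D q (?p q) * ty)) (at (q, ?p q))"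
          by (simp add: scaleR_blinfun.rep_eq)
        have dp: "((\<lambda>q. (q, ?p q)) has_derivative (\<lambda>h. (h, lam * h))) (at q)"
          by (auto intro!: derivative_eq_intros)
        have "((\<lambda>q. (\<lambda>(t, x). G t x) (q, ?p q)) has_derivative
           (\<lambda>h. (\<lambda>(tx, ty). (- lam * D q (?p q) + e * U q (?p q)) * tx + D q (?p q) * ty) (h, lam * h))) (at q)"
          using diff_chain_at[OF dp d] by (simp add: o_def)
        moreover have "(\<lambda>h. (\<lambda>(tx, ty). (- lam * D q (?p q) + e * U q (?p q)) * tx + D q (?p q) * ty) (h, lam * h))
            = (*) (e * U q (?p q))"
          by (simp add: fun_eq_iff algebra_simps)
        ultimately show ?thesis by (simp add: has_field_derivative_def)
      qed
    qed (use r in auto)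
    also have "\<dots> \<le> e * C * T" using r e C0 by (intro mult_left_mono) auto
    finally show ?thesis by simp
  qed
  \<comment> \<open>Traced backwards, a characteristic ends on the initial line if
    \<open>lam * t \<le> x\<close>, and otherwise at the inlet at time
    \<open>t - x / lam\<close>.\<close>
  have Gm: "\<bar>G t x\<bar> \<le> ?m" if t: "0 \<le> t" "t \<le> T" and x: "x \<in> {0..l}" for t x
  proof -
    have nn: "T * lam * eta \<ge> 0" "l * eta' \<ge> 0" "e * C * T \<ge> 0" using T lam l e eta0 C0 by auto
    show ?thesis
    proof (cases "x \<ge> lam * t")
      case True
      have "\<bar>G t x - G 0 (x - lam * (t - 0))\<bar> \<le> e * C * T" using char[of 0 t x] True t x by auto
      moreover have "lam * t \<ge> 0" using lam t by simp
      then have "x - lam * t \<in> {0..l}" using True x by auto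
      ultimately show ?thesis using G0[of "x - lam * t"] nn by simp
    next
      case False
      let ?r = "t - x / lam"
      have r: "0 \<le> ?r" "?r \<le> t" "x - lam * (t - ?r) = 0" using False lam x by (auto simp: field_simps)
      have "\<bar>G t x - G ?r 0\<bar> \<le> e * C * T" using char[of ?r t x] r t x by auto
      then show ?thesis using Gb[OF r(1)] r t nn by linarith
    qed
  qed
  have "\<bar>D t x\<bar> \<le> 2 * ?m / s + 2 * C * s"
    using lipschitz_bound_from_primitive[OF Gx[OF t] Gm[OF t] Dlip[OF t] s x] C0 by simp
  then show ?thesis by (simp add: D_def \<Phi>_def)
qed
end

section \<open>Contraction on the network\<close>

text \<open>Split the interval into \<open>k\<close> cells; on each cell \<open>w\<close> deviates from its mean at most as much as the increment of \<open>R\<close>.\<close>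
lemma L1_bound_by_primitive_and_variation:
  fixes w R :: "real \<Rightarrow> real"
  assumes l: "l > 0" and k: "k > 0" and w: "w absolutely_integrable_on {0..l}"
    and R: "\<And>x y. 0 \<le> x \<Longrightarrow> x \<le> y \<Longrightarrow> y \<le> l \<Longrightarrow> \<bar>w x - w y\<bar> \<le> R y - R x"
    and m: "\<And>x. x \<in> {0..l} \<Longrightarrow> \<bar>integral {0..x} w\<bar> \<le> m"
  shows "abs_integral l w \<le> 2 * real k * m + l / real k * (R l - R 0)"
proof -
  note hk = set_lebesgue_integral_eq_integral(1)
  have wa: "(\<lambda>x. \<bar>w x\<bar>) absolutely_integrable_on {0..l}" using absolutely_integrable_abs[OF w] by simp
  have iw: "w integrable_on {a..b}" "(\<lambda>x. \<bar>w x\<bar>) integrable_on {a..b}" if "0 \<le> a" "b \<le> l" for a b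
    using hk[OF absolutely_integrable_subinterval[OF w that]] hk[OF absolutely_integrable_subinterval[OF wa that]] by auto
  define d where "d = l / real k"
  have d: "d > 0" "real k * d = l" using l k by (auto simp: d_def)
  have cell: "integral {a..b} (\<lambda>x. \<bar>w x\<bar>) \<le> 2 * m + d * (R b - R a)" if ab: "0 \<le> a" "b = a + d" "b \<le> l" for a b
  proof -
    have "a \<le> b" using ab d by simp
    have W: "\<bar>integral {a..b} w\<bar> \<le> 2 * m"
      using Henstock_Kurzweil_Integration.integral_combine[OF ab(1) \<open>a \<le> b\<close> iw(1)] m[of a] m[of b] ab d by auto
    have pt: "d * \<bar>w x\<bar> \<le> 2 * m + d * (R b - R a)" if x: "x \<in> {a..b}" for x
    proof -
      have "d * w x = integral {a..b} w + integral {a..b} (\<lambda>y. w x - w y)"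
      proof -
        have "integral {a..b} (\<lambda>y. w x - w y) = integral {a..b} (\<lambda>y. w x) - integral {a..b} w"
          using iw(1)[of a b] ab by (intro integral_diff integrable_const_ivl) auto
        then show ?thesis using ab d by simp
      qed
      moreover have "norm (integral {a..b} (\<lambda>y. w x - w y)) \<le> integral {a..b} (\<lambda>y. R b - R a)"
      proof (rule integral_norm_bound_integral)
        show "(\<lambda>y. w x - w y) integrable_on {a..b}" using iw(1)[of a b] ab by (intro integrable_diff) auto
        fix y assume y: "y \<in> {a..b}"
        have mono: "R p \<le> R q" if "0 \<le> p" "p \<le> q" "q \<le> l" for p q using R[OF that] by linarith
        have "\<bar>w x - w y\<bar> \<le> \<bar>R y - R x\<bar>"
          using R[of x y] R[of y x] x y ab by (cases "x \<le> y") (auto simp: abs_minus_commute)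
        also have "\<dots> \<le> R b - R a"
          using mono[of a x] mono[of x b] mono[of a y] mono[of y b] x y ab by auto
        finally show "norm (w x - w y) \<le> R b - R a" by simp
      qed (rule integrable_const_ivl)
      ultimately have "\<bar>d * w x\<bar> \<le> 2 * m + d * (R b - R a)" using W ab \<open>a \<le> b\<close> by simp
      then show ?thesis using d by (simp add: abs_mult)
    qed
    have "d * integral {a..b} (\<lambda>x. \<bar>w x\<bar>) = integral {a..b} (\<lambda>x. d * \<bar>w x\<bar>)" by simp
    also have "\<dots> \<le> integral {a..b} (\<lambda>x. 2 * m + d * (R b - R a))"
      using pt iw(2)[of a b] ab by (intro integral_le integrable_on_mult_right integrable_const_ivl) auto
    also have "\<dots> = d * (2 * m + d * (R b - R a))" using ab \<open>a \<le> b\<close> by simp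
    finally show ?thesis using d by simp
  qed
  have "integral {0..real j * d} (\<lambda>x. \<bar>w x\<bar>) \<le> 2 * real j * m + d * (R (real j * d) - R 0)" if "j \<le> k" for j
    using that
  proof (induction j)
    case (Suc j)
    have jl: "real j * d \<le> real (Suc j) * d" "real (Suc j) * d \<le> l" "0 \<le> real j * d"
      using d Suc.prems unfolding d(2)[symmetric] by (auto intro!: mult_right_mono)
    have "integral {0..real (Suc j) * d} (\<lambda>x. \<bar>w x\<bar>) =
        integral {0..real j * d} (\<lambda>x. \<bar>w x\<bar>) + integral {real j * d..real (Suc j) * d} (\<lambda>x. \<bar>w x\<bar>)"
      using Henstock_Kurzweil_Integration.integral_combine[OF jl(3,1) iw(2)] jl by simp
    also have "\<dots> \<le> (2 * real j * m + d * (R (real j * d) - R 0)) + (2 * m + d * (R (real (Suc j) * d) - R (real j * d)))"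
      using Suc jl by (intro add_mono cell) (auto simp: algebra_simps)
    finally show ?case by (simp add: algebra_simps)
  qed simp
  from this[of k] show ?thesis unfolding d(2) by (simp add: d_def)
qed

section \<open>A smooth convex approximation of the absolute value\<close>

lemma soft_abs:
  fixes d z :: real
  assumes d: "d > 0"
  shows "sqrt (z\<^sup>2 + d\<^sup>2) > 0" "\<bar>z\<bar> \<le> sqrt (z\<^sup>2 + d\<^sup>2)" "sqrt (z\<^sup>2 + d\<^sup>2) \<le> \<bar>z\<bar> + d" "d \<le> sqrt (z\<^sup>2 + d\<^sup>2)"
    "\<bar>z / sqrt (z\<^sup>2 + d\<^sup>2)\<bar> \<le> 1"
proof -
  show p: "sqrt (z\<^sup>2 + d\<^sup>2) > 0" using d by (simp add: add_nonneg_pos)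
  show a: "\<bar>z\<bar> \<le> sqrt (z\<^sup>2 + d\<^sup>2)" by (rule real_le_rsqrt) simp
  show "sqrt (z\<^sup>2 + d\<^sup>2) \<le> \<bar>z\<bar> + d" using d by (intro real_le_lsqrt) (auto simp: power2_sum)
  show "d \<le> sqrt (z\<^sup>2 + d\<^sup>2)" by (rule real_le_rsqrt) simp
  show "\<bar>z / sqrt (z\<^sup>2 + d\<^sup>2)\<bar> \<le> 1" using a p by (simp add: divide_le_eq)
qed

lemma soft_abs_derivative:
  fixes d :: real
  assumes d: "d > 0"
  shows "((\<lambda>z. sqrt (z\<^sup>2 + d\<^sup>2)) has_real_derivative z / sqrt (z\<^sup>2 + d\<^sup>2)) (at z)"
    "((\<lambda>z. z / sqrt (z\<^sup>2 + d\<^sup>2)) has_real_derivative d\<^sup>2 / sqrt (z\<^sup>2 + d\<^sup>2) ^ 3) (at z)"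
proof -
  have p: "z\<^sup>2 + d\<^sup>2 > 0" using d by (simp add: add_nonneg_pos)
  show 1: "((\<lambda>z. sqrt (z\<^sup>2 + d\<^sup>2)) has_real_derivative z / sqrt (z\<^sup>2 + d\<^sup>2)) (at z)"
    using p by (auto intro!: derivative_eq_intros simp: field_simps)
  define r where "r = sqrt (z\<^sup>2 + d\<^sup>2)"
  have r: "r > 0" "r\<^sup>2 = z\<^sup>2 + d\<^sup>2" using p by (auto simp: r_def)
  have "((\<lambda>z. z / sqrt (z\<^sup>2 + d\<^sup>2)) has_real_derivative (1 * r - z * (z / r)) / (r * r)) (at z)"
    unfolding r_def by (rule DERIV_divide[OF DERIV_ident 1]) (use r in \<open>unfold r_def, linarith\<close>)
  moreover have "(1 * r - z * (z / r)) / (r * r) = d\<^sup>2 / r ^ 3"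
  proof -
    have "1 * r - z * (z / r) = (r\<^sup>2 - z\<^sup>2) / r" using r by (simp add: field_simps power2_eq_square)
    then show ?thesis using r by (simp add: power3_eq_cube)
  qed
  ultimately show "((\<lambda>z. z / sqrt (z\<^sup>2 + d\<^sup>2)) has_real_derivative d\<^sup>2 / sqrt (z\<^sup>2 + d\<^sup>2) ^ 3) (at z)"
    by (simp add: r_def)
qed

text \<open>The tangent inequality of a convex function. Multiplied by the first root it becomes the
  Cauchy-Schwarz inequality for the vectors \<open>(z, d)\<close> and \<open>(y, d)\<close>.\<close>

lemma soft_abs_convex:
  fixes d z y :: real
  assumes d: "d > 0"
  shows "sqrt (z\<^sup>2 + d\<^sup>2) - sqrt (y\<^sup>2 + d\<^sup>2) \<le> z / sqrt (z\<^sup>2 + d\<^sup>2) * (z - y)"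
proof -
  define a where "a = sqrt (z\<^sup>2 + d\<^sup>2)"
  define b where "b = sqrt (y\<^sup>2 + d\<^sup>2)"
  have a: "a > 0" "a\<^sup>2 = z\<^sup>2 + d\<^sup>2" and b: "b > 0" "b\<^sup>2 = y\<^sup>2 + d\<^sup>2" using soft_abs(1)[OF d] by (auto simp: a_def b_def)
  have "(z * y + d\<^sup>2)\<^sup>2 \<le> (a * b)\<^sup>2"
  proof -
    have "(a * b)\<^sup>2 - (z * y + d\<^sup>2)\<^sup>2 = (d * (z - y))\<^sup>2"
      unfolding power_mult_distrib a(2) b(2) by (simp add: power2_eq_square algebra_simps)
    then show ?thesis using zero_le_power2[of "d * (z - y)"] by linarith
  qed
  then have "z * y + d\<^sup>2 \<le> a * b" by (rule power2_le_imp_le) (use a(1) b(1) in simp)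
  then have "a * a - a * b \<le> z * (z - y)" using a(2) by (simp add: power2_eq_square algebra_simps)
  then have "a - b \<le> z * (z - y) / a" using a(1) by (simp add: field_simps)
  then show ?thesis by (simp add: a_def b_def)
qed

text \<open>Adding the tangent inequalities at \<open>z\<close> and at \<open>y\<close> cancels the
  function values.\<close>

lemma soft_sgn_mono:
  fixes d z y :: real
  assumes d: "d > 0"
  shows "(z - y) * (z / sqrt (z\<^sup>2 + d\<^sup>2) - y / sqrt (y\<^sup>2 + d\<^sup>2)) \<ge> 0"
proof -
  define A where "A = z / sqrt (z\<^sup>2 + d\<^sup>2)"
  define B where "B = y / sqrt (y\<^sup>2 + d\<^sup>2)"
  have "0 \<le> A * (z - y) + B * (y - z)"
    unfolding A_def B_def using soft_abs_convex[OF d, of z y] soft_abs_convex[OF d, of y z] by linarith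
  also have "\<dots> = (z - y) * (A - B)" by (simp add: algebra_simps)
  finally show ?thesis by (simp only: A_def B_def)
qed

context viscous_arc
begin

lemma soft_sgn_estimate:
  assumes t: "t > 0" and d: "d > 0"
  shows "integral {0..l} (\<lambda>x. H t x * (U t x / sqrt ((U t x)\<^sup>2 + d\<^sup>2)))
    \<le> F t 0 * (U t 0 / sqrt ((U t 0)\<^sup>2 + d\<^sup>2)) - F t l * (U t l / sqrt ((U t l)\<^sup>2 + d\<^sup>2)) + lam * d"
proof -
  have t0: "t \<ge> 0" using t by simp
  let ?r = "\<lambda>x. sqrt ((U t x)\<^sup>2 + d\<^sup>2)"
  let ?k = "\<lambda>x. U t x / ?r x"
  let ?k' = "\<lambda>x. d\<^sup>2 / ?r x ^ 3 * P t x"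
  have r: "?r x > 0" for x using soft_abs(1)[OF d] .
  have cr: "continuous_on {0..l} ?r" by (intro continuous_intros contUx t0)
  have dk: "(?k has_real_derivative ?k' x) (at x within {0..l})" if "x \<in> {0..l}" for x
    using DERIV_chain2[OF soft_abs_derivative(2)[OF d] derU[OF t0 that]] .
  have rn: "?r x \<noteq> 0" for x using r[of x] by linarith
  have ck': "continuous_on {0..l} ?k'"
    by (intro continuous_on_mult continuous_on_divide continuous_on_const continuous_on_power cr contPx t0 ballI power_not_zero rn)
  have 1: "integral {0..l} (\<lambda>x. H t x * ?k x) = F t 0 * ?k 0 - F t l * ?k l + integral {0..l} (\<lambda>x. F t x * ?k' x)"
    using l by (intro H_by_parts[OF t _ order_refl dk ck']) auto
  let ?g' = "\<lambda>x. lam * (U t x * ?k' x)"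
  have g: "(?g' has_integral lam * (d - d\<^sup>2 / ?r l) - lam * (d - d\<^sup>2 / ?r 0)) {0..l}"
  proof (rule fundamental_theorem_of_calculus)
    fix x assume x: "x \<in> {0..l}"
    have "((\<lambda>z. lam * (d - d\<^sup>2 / sqrt (z\<^sup>2 + d\<^sup>2))) has_real_derivative lam * (0 - (0 * ?r x - d\<^sup>2 * (U t x / ?r x)) / (?r x * ?r x))) (at (U t x))"
      using r[of x] by (intro DERIV_cmult DERIV_diff DERIV_const DERIV_divide soft_abs_derivative d) auto
    from DERIV_chain2[OF this derU[OF t0 x]]
    have "((\<lambda>x. lam * (d - d\<^sup>2 / ?r x)) has_real_derivative ?g' x) (at x within {0..l})"
      by (rule DERIV_cong) (use r[of x] in \<open>simp add: field_simps power3_eq_cube\<close>)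
    then show "((\<lambda>x. lam * (d - d\<^sup>2 / ?r x)) has_vector_derivative ?g' x) (at x within {0..l})"
      by (simp add: has_real_derivative_iff_has_vector_derivative)
  qed (use l in simp)
  have "integral {0..l} (\<lambda>x. F t x * ?k' x) \<le> integral {0..l} ?g'"
  proof (rule integral_le)
    show "(\<lambda>x. F t x * ?k' x) integrable_on {0..l}" by (intro int_cont continuous_on_mult contFx t0 ck')
    show "?g' integrable_on {0..l}" using g by (auto simp: integrable_on_def)
    fix x
    have "?g' x - F t x * ?k' x = e * (P t x)\<^sup>2 * (d\<^sup>2 / ?r x ^ 3)"
    proof -
      have "lam * (u * (c * p)) - (lam * u - e * p) * (c * p) = e * p\<^sup>2 * c" for u c p
        by (simp add: algebra_simps power2_eq_square)
      then show ?thesis unfolding F_def .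
    qed
    also have "\<dots> \<ge> 0" using e r[of x] by (intro mult_nonneg_nonneg divide_nonneg_pos zero_less_power) auto
    finally show "F t x * ?k' x \<le> ?g' x" by linarith
  qed
  also have "\<dots> \<le> lam * d"
  proof -
    have "d\<^sup>2 / ?r l \<ge> 0" using r[of l] by simp
    moreover have "d\<^sup>2 / ?r 0 \<le> d"
      using soft_abs(4)[OF d, of "U t 0"] r[of 0] d by (simp add: divide_le_eq power2_eq_square)
    ultimately have "(d - d\<^sup>2 / ?r l) - (d - d\<^sup>2 / ?r 0) \<le> d" by linarith
    then have "lam * ((d - d\<^sup>2 / ?r l) - (d - d\<^sup>2 / ?r 0)) \<le> lam * d" using lam by (intro mult_left_mono) auto
    then show ?thesis using integral_unique[OF g] by (simp add: right_diff_distrib)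
  qed
  finally show ?thesis using 1 by linarith
qed

text \<open>The tangent is taken at the later time \<open>t\<close>, so \<open>H t\<close> appears
  and the bound concerns increments towards the past. The last term is the \<open>L^1\<close> error
  of the difference quotient, small for \<open>s\<close> near \<open>t\<close>.\<close>

lemma soft_L1_increment:
  assumes t: "t > 0" and s: "0 < s" "s < t" and d: "d > 0"
  shows "integral {0..l} (\<lambda>x. sqrt ((U t x)\<^sup>2 + d\<^sup>2)) - integral {0..l} (\<lambda>x. sqrt ((U s x)\<^sup>2 + d\<^sup>2))
    \<le> (t - s) * (integral {0..l} (\<lambda>x. H t x * (U t x / sqrt ((U t x)\<^sup>2 + d\<^sup>2)))
        + abs_integral l (\<lambda>x. (U s x - U t x) / (s - t) - H t x))"
proof -
  note hk = set_lebesgue_integral_eq_integral(1)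
  let ?r = "\<lambda>t x. sqrt ((U t x)\<^sup>2 + d\<^sup>2)"
  let ?k = "\<lambda>x. U t x / ?r t x"
  let ?q = "\<lambda>x. (U s x - U t x) / (s - t) - H t x"
  have r: "?r t x > 0" for t x using soft_abs(1)[OF d] .
  have cr: "continuous_on {0..l} (?r t)" if "t > 0" for t using that by (intro continuous_intros contUx) auto
  have ck: "continuous_on {0..l} ?k" using r t by (intro continuous_intros contUx cr) (auto simp: less_le)
  have q: "?q absolutely_integrable_on {0..l}"
    using s t by (intro set_integral_diff(1) H_int absolutely_integrable_continuous_real continuous_intros contUx) auto
  have qa: "(\<lambda>x. \<bar>?q x\<bar>) integrable_on {0..l}" using hk[OF absolutely_integrable_abs[OF q]] by simp
  have iH: "(\<lambda>x. H t x * ?k x) integrable_on {0..l}" by (rule int_H_weight[OF t ck])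
  have "integral {0..l} (?r t) - integral {0..l} (?r s) = integral {0..l} (\<lambda>x. ?r t x - ?r s x)"
    using t s by (intro integral_diff[symmetric] int_cont cr) auto
  also have "\<dots> \<le> integral {0..l} (\<lambda>x. (t - s) * (H t x * ?k x + \<bar>?q x\<bar>))"
  proof (rule integral_le)
    show "(\<lambda>x. ?r t x - ?r s x) integrable_on {0..l}" using t s by (intro int_cont continuous_on_diff cr) auto
    show "(\<lambda>x. (t - s) * (H t x * ?k x + \<bar>?q x\<bar>)) integrable_on {0..l}"
      by (intro integrable_on_mult_right integrable_add iH qa)
    fix x
    have "?r t x - ?r s x \<le> ?k x * (U t x - U s x)" by (rule soft_abs_convex[OF d])
    also have "U t x - U s x = (t - s) * (H t x + ?q x)" using s by (simp add: field_simps)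
    also have "?k x * ((t - s) * (H t x + ?q x)) = (t - s) * (H t x * ?k x + ?k x * ?q x)"
    proof -
      have "k * (c * (h + q)) = c * (h * k + k * q)" for k c h q :: real by (simp add: algebra_simps)
      then show ?thesis .
    qed
    also have "\<dots> \<le> (t - s) * (H t x * ?k x + \<bar>?q x\<bar>)"
    proof -
      have "?k x * ?q x \<le> \<bar>?k x\<bar> * \<bar>?q x\<bar>" by (metis abs_ge_self abs_mult)
      also have "\<dots> \<le> 1 * \<bar>?q x\<bar>" by (intro mult_right_mono soft_abs(5)[OF d]) auto
      finally show ?thesis using s by (intro mult_left_mono) auto
    qed
    finally show "?r t x - ?r s x \<le> (t - s) * (H t x * ?k x + \<bar>?q x\<bar>)" .
  qed
  also have "\<dots> = (t - s) * (integral {0..l} (\<lambda>x. H t x * ?k x) + abs_integral l (\<lambda>x. ?q x))"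
    by (simp only: integral_mult_right integral_add[OF iH qa])
  finally show ?thesis .
qed

lemma soft_L1_near_L1:
  assumes t: "t \<ge> 0" and d: "d > 0"
  shows "abs_integral l (U t) \<le> integral {0..l} (\<lambda>x. sqrt ((U t x)\<^sup>2 + d\<^sup>2))"
    "integral {0..l} (\<lambda>x. sqrt ((U t x)\<^sup>2 + d\<^sup>2)) \<le> abs_integral l (U t) + d * l"
proof -
  have c: "(\<lambda>x. sqrt ((U t x)\<^sup>2 + d\<^sup>2)) integrable_on {0..l}" "(\<lambda>x. \<bar>U t x\<bar>) integrable_on {0..l}"
    by (intro int_cont continuous_intros contUx t)+
  show "abs_integral l (U t) \<le> integral {0..l} (\<lambda>x. sqrt ((U t x)\<^sup>2 + d\<^sup>2))"
    by (rule integral_le[OF c(2,1) soft_abs(2)[OF d]])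
  have "integral {0..l} (\<lambda>x. sqrt ((U t x)\<^sup>2 + d\<^sup>2)) \<le> integral {0..l} (\<lambda>x. \<bar>U t x\<bar> + d)"
    by (rule integral_le[OF c(1) integrable_add[OF c(2) integrable_const_ivl] soft_abs(3)[OF d]])
  also have "\<dots> = abs_integral l (U t) + d * l" using l integral_add[OF c(2) integrable_const_ivl, of d] by simp
  finally show "integral {0..l} (\<lambda>x. sqrt ((U t x)\<^sup>2 + d\<^sup>2)) \<le> abs_integral l (U t) + d * l" .
qed

lemma continuous_on_soft_L1:
  assumes s: "0 \<le> s"
  shows "continuous_on {s..T} (\<lambda>t. integral {0..l} (\<lambda>x. sqrt ((U t x)\<^sup>2 + d\<^sup>2)))"
proof -
  have "continuous_on ({s..T} \<times> cbox 0 l) (\<lambda>(t, x). U t x)" by (rule continuous_on_subset[OF contU]) (use s in auto)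
  then have "continuous_on ({s..T} \<times> cbox 0 l) (\<lambda>(t, x). sqrt ((U t x)\<^sup>2 + d\<^sup>2))"
    unfolding split_def by (intro continuous_intros)
  from integral_continuous_on_param[OF this] show ?thesis by simp
qed

end

section \<open>Dissipation at the node and contraction\<close>

text \<open>Exchanging \<open>i\<close> and \<open>j\<close> and using symmetry of \<open>K\<close>,
  twice the sum equals minus the sum of \<open>K i j * (w i - w j) * (g i - g j)\<close>, whose
  terms are nonnegative.\<close>

lemma sum_node_coupling_le_0:
  fixes K :: "'a \<Rightarrow> 'a \<Rightarrow> real" and w g :: "'a \<Rightarrow> real"
  assumes K: "\<And>i j. i \<in> M \<Longrightarrow> j \<in> M \<Longrightarrow> K i j \<ge> 0 \<and> K i j = K j i"
    and g: "\<And>i j. i \<in> M \<Longrightarrow> j \<in> M \<Longrightarrow> (w i - w j) * (g i - g j) \<ge> 0"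
  shows "(\<Sum>i\<in>M. g i * (\<Sum>j\<in>M. K i j * (w j - w i))) \<le> 0"
proof -
  let ?S = "\<Sum>i\<in>M. \<Sum>j\<in>M. g i * (K i j * (w j - w i))"
  have "?S = (\<Sum>i\<in>M. \<Sum>j\<in>M. g j * (K j i * (w i - w j)))" by (rule sum.swap)
  also have "\<dots> = (\<Sum>i\<in>M. \<Sum>j\<in>M. g j * (K i j * (w i - w j)))"
  proof (intro sum.cong refl)
    fix i j assume "i \<in> M" "j \<in> M"
    then have "K j i = K i j" using K by blast
    then show "g j * (K j i * (w i - w j)) = g j * (K i j * (w i - w j))" by simp
  qed
  finally have "2 * ?S = ?S + (\<Sum>i\<in>M. \<Sum>j\<in>M. g j * (K i j * (w i - w j)))" by simp
  also have "\<dots> = (\<Sum>i\<in>M. \<Sum>j\<in>M. - (K i j * ((w i - w j) * (g i - g j))))"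
    by (simp add: sum.distrib[symmetric] algebra_simps)
  also have "\<dots> \<le> 0" using K g by (intro sum_nonpos) auto
  finally have "?S \<le> 0" by linarith
  then show ?thesis by (simp only: sum_distrib_left)
qed

text \<open>Zero values at the outer ends remove the boundary terms of Kato's inequality there, and
  the terms at the node add up to a dissipative sum. The smoothed norm then grows at rate at most
  \<open>c * d\<close>, and \<open>d\<close> tends to 0 at the end.\<close>

lemma network_L1_contraction:
  fixes l lam :: "nat \<Rightarrow> real" and Z P H :: "nat \<Rightarrow> real \<Rightarrow> real \<Rightarrow> real"
  assumes fin: "finite Inc" "finite Out" and disj: "Inc \<inter> Out = {}"
    and arc: "\<And>i. i \<in> Inc \<union> Out \<Longrightarrow> viscous_arc (l i) (lam i) e (Z i) (P i) (H i)"
    and K: "\<And>i j. i \<in> Inc \<union> Out \<Longrightarrow> j \<in> Inc \<union> Out \<Longrightarrow> K i j \<ge> 0 \<and> K i j = K j i"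
    and nd: "\<And>i. nd i = (if i \<in> Inc then l i else 0)"
    and node: "\<And>i t. i \<in> Inc \<union> Out \<Longrightarrow> t > 0 \<Longrightarrow>
      node_sign Inc i * (- lam i * Z i t (nd i) + e * P i t (nd i)) = (\<Sum>j\<in>Inc \<union> Out. K i j * (Z j t (nd j) - Z i t (nd i)))"
    and inlet: "\<And>i t. i \<in> Inc \<Longrightarrow> t > 0 \<Longrightarrow> Z i t 0 = 0"
    and outlet: "\<And>i t. i \<in> Out \<Longrightarrow> t > 0 \<Longrightarrow> Z i t (l i) = 0"
    and st: "0 < s" "s \<le> t"
  shows "(\<Sum>i\<in>Inc \<union> Out. abs_integral (l i) (Z i t)) \<le> (\<Sum>i\<in>Inc \<union> Out. abs_integral (l i) (Z i s))"
proof -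
  let ?M = "Inc \<union> Out"
  have finM: "finite ?M" using fin by simp
  define c where "c = (\<Sum>i\<in>?M. lam i)"
  define L where "L = (\<Sum>i\<in>?M. l i)"
  \<comment> \<open>\<open>d * L\<close> pays for replacing the absolute value by its smooth version
    at time \<open>s\<close>; \<open>c * d\<close> is the error of the transport terms per unit of
    time.\<close>
  have main: "(\<Sum>i\<in>?M. abs_integral (l i) (Z i t)) \<le> (\<Sum>i\<in>?M. abs_integral (l i) (Z i s)) + d * (L + c * (t - s))"
    if d: "d > 0" for d
  proof -
    define N where "N t = (\<Sum>i\<in>?M. integral {0..l i} (\<lambda>x. sqrt ((Z i t x)\<^sup>2 + d\<^sup>2)))" for t
    let ?k = "\<lambda>i t x. Z i t x / sqrt ((Z i t x)\<^sup>2 + d\<^sup>2)"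
    let ?q = "\<lambda>i t s. abs_integral (l i) (\<lambda>x. (Z i s x - Z i t x) / (s - t) - H i t x)"
    have dis: "(\<Sum>i\<in>?M. integral {0..l i} (\<lambda>x. H i t x * ?k i t x)) \<le> c * d" if t: "t > 0" for t
    proof -
      have "(\<Sum>i\<in>?M. integral {0..l i} (\<lambda>x. H i t x * ?k i t x)) \<le>
         (\<Sum>i\<in>?M. ?k i t (nd i) * (\<Sum>j\<in>?M. K i j * (Z j t (nd j) - Z i t (nd i))) + lam i * d)"
      proof (rule sum_mono)
        fix i assume i: "i \<in> ?M"
        interpret a: viscous_arc "l i" "lam i" e "Z i" "P i" "H i" using arc[OF i] .
        have "integral {0..l i} (\<lambda>x. H i t x * ?k i t x) \<le> a.F t 0 * ?k i t 0 - a.F t (l i) * ?k i t (l i) + lam i * d"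
          by (rule a.soft_sgn_estimate[OF t d])
        also have "a.F t 0 * ?k i t 0 - a.F t (l i) * ?k i t (l i) = ?k i t (nd i) * (\<Sum>j\<in>?M. K i j * (Z j t (nd j) - Z i t (nd i)))"
        proof (cases "i \<in> Inc")
          case True
          then show ?thesis using node[OF i t] inlet[OF True t] by (simp add: a.F_def nd node_sign_def algebra_simps)
        next
          case False
          then have "i \<in> Out" using i by simp
          then show ?thesis using node[OF i t] outlet[of i t] t False by (simp add: a.F_def nd node_sign_def algebra_simps)
        qed
        finally show "integral {0..l i} (\<lambda>x. H i t x * ?k i t x) \<le>
          ?k i t (nd i) * (\<Sum>j\<in>?M. K i j * (Z j t (nd j) - Z i t (nd i))) + lam i * d" .
      qed
      also have "\<dots> = (\<Sum>i\<in>?M. ?k i t (nd i) * (\<Sum>j\<in>?M. K i j * (Z j t (nd j) - Z i t (nd i)))) + c * d"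
        by (simp add: sum.distrib c_def sum_distrib_right)
      also have "(\<Sum>i\<in>?M. ?k i t (nd i) * (\<Sum>j\<in>?M. K i j * (Z j t (nd j) - Z i t (nd i)))) \<le> 0"
        by (rule sum_node_coupling_le_0[where g = "\<lambda>i. ?k i t (nd i)" and w = "\<lambda>i. Z i t (nd i)", OF K soft_sgn_mono[OF d]])
      finally show ?thesis by simp
    qed
    have "N t - N s \<le> (c * d) * (t - s)"
    proof (rule le_if_left_difference_quotient_le[OF st(2)])
      show "continuous_on {s..t} N" unfolding N_def
        using st by (intro continuous_on_sum viscous_arc.continuous_on_soft_L1[OF arc]) auto
      fix r :: real and h :: real assume r: "s < r" "r \<le> t" and h: "h > 0"
      then have r0: "r > 0" using st by simp
      have "((\<lambda>p. \<Sum>i\<in>?M. ?q i r p) \<longlongrightarrow> (\<Sum>i\<in>?M. 0)) (at r)"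
        by (intro tendsto_sum viscous_arc.curve[OF arc r0])
      then have "\<forall>\<^sub>F p in at r. (\<Sum>i\<in>?M. ?q i r p) < h" using h by (intro order_tendstoD) auto
      then obtain b where b: "b > 0" "\<And>p. p \<noteq> r \<Longrightarrow> dist p r < b \<Longrightarrow> (\<Sum>i\<in>?M. ?q i r p) < h"
        by (auto simp: eventually_at)
      define p where "p = max s (r - b / 2)"
      have p: "s \<le> p" "p < r" "p \<noteq> r" "dist p r < b" using r b by (auto simp: p_def dist_real_def)
      have "N r - N p = (\<Sum>i\<in>?M. integral {0..l i} (\<lambda>x. sqrt ((Z i r x)\<^sup>2 + d\<^sup>2)) - integral {0..l i} (\<lambda>x. sqrt ((Z i p x)\<^sup>2 + d\<^sup>2)))"
        by (simp add: N_def sum_subtractf)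
      also have "\<dots> \<le> (\<Sum>i\<in>?M. (r - p) * (integral {0..l i} (\<lambda>x. H i r x * ?k i r x) + ?q i r p))"
        using st p r0 d by (intro sum_mono viscous_arc.soft_L1_increment[OF arc]) auto
      also have "\<dots> = (r - p) * ((\<Sum>i\<in>?M. integral {0..l i} (\<lambda>x. H i r x * ?k i r x)) + (\<Sum>i\<in>?M. ?q i r p))"
        by (simp add: sum_distrib_left[symmetric] sum.distrib)
      also have "\<dots> \<le> (r - p) * (c * d + h)"
        using p b(2)[OF p(3,4)] dis[OF r0] by (intro mult_left_mono add_mono) auto
      finally show "\<exists>p. s \<le> p \<and> p < r \<and> N r - N p \<le> (c * d + h) * (r - p)"
        using p by (intro exI[of _ p]) (simp add: mult.commute)
    qed
    moreover have "(\<Sum>i\<in>?M. abs_integral (l i) (Z i t)) \<le> N t" unfolding N_def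
      using st d by (intro sum_mono viscous_arc.soft_L1_near_L1(1)[OF arc]) auto
    moreover have "N s \<le> (\<Sum>i\<in>?M. abs_integral (l i) (Z i s)) + d * L"
    proof -
      have "N s \<le> (\<Sum>i\<in>?M. abs_integral (l i) (Z i s) + d * l i)" unfolding N_def
        using st d by (intro sum_mono viscous_arc.soft_L1_near_L1(2)[OF arc]) auto
      then show ?thesis by (simp add: sum.distrib L_def sum_distrib_left)
    qed
    ultimately show ?thesis by (simp add: algebra_simps)
  qed
  show ?thesis
  proof (rule field_le_epsilon)
    fix r :: real assume r: "r > 0"
    define A where "A = L + c * (t - s)"
    have "c \<ge> 0" unfolding c_def by (intro sum_nonneg less_imp_le viscous_arc.lam[OF arc])
    have "L \<ge> 0" unfolding L_def by (intro sum_nonneg less_imp_le viscous_arc.l[OF arc])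
    then have A: "A \<ge> 0" using st \<open>c \<ge> 0\<close> by (simp add: A_def)
    have "r / (A + 1) * A \<le> r" using A r by (simp add: field_simps)
    then show "(\<Sum>i\<in>?M. abs_integral (l i) (Z i t)) \<le> (\<Sum>i\<in>?M. abs_integral (l i) (Z i s)) + r"
      using main[of "r / (A + 1)"] A r unfolding A_def[symmetric] by simp
  qed
qed

section \<open>Time increments and bounds uniform in the viscosity\<close>

context viscous_arc
begin

text \<open>Together with closure under differences this makes the increments
  \<open>U (t + h) - U t\<close> instances of the locale, to which the contraction applies.\<close>

lemma shift:
  assumes h: "h \<ge> 0"
  shows "viscous_arc l lam e (\<lambda>t. U (t + h)) (\<lambda>t. P (t + h)) (\<lambda>t. H (t + h))"
proof
  show "l > 0" "lam > 0" "e > 0" by (fact l lam e)+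
  show "continuous_on ({0..} \<times> {0..l}) (\<lambda>(t, x). U (t + h) x)"
  proof -
    have "continuous_on ({0..} \<times> {0..l}) (\<lambda>z. (\<lambda>(t, x). U t x) (fst z + h, snd z))"
      by (rule continuous_on_compose2[OF contU]) (use h in \<open>auto intro!: continuous_intros\<close>)
    then show ?thesis by (simp add: split_def)
  qed
  show "continuous_on ({0..} \<times> {0..l}) (\<lambda>(t, x). P (t + h) x)"
  proof -
    have "continuous_on ({0..} \<times> {0..l}) (\<lambda>z. (\<lambda>(t, x). P t x) (fst z + h, snd z))"
      by (rule continuous_on_compose2[OF contP]) (use h in \<open>auto intro!: continuous_intros\<close>)
    then show ?thesis by (simp add: split_def)
  qed
  show "(U (t + h) has_real_derivative P (t + h) x) (at x within {0..l})" if "t \<ge> 0" "x \<in> {0..l}" for t x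
    using derU that h by auto
  show "primitive_on 0 l (\<lambda>x. lam * U (t + h) x - e * P (t + h) x) (\<lambda>x. - H (t + h) x)" if "t > 0" for t
    using flux[of "t + h"] that h by simp
  show "((\<lambda>s. abs_integral l (\<lambda>x. (U (s + h) x - U (t + h) x) / (s - t) - H (t + h) x)) \<longlongrightarrow> 0) (at t)" if t: "t > 0" for t
  proof -
    have "filterlim (\<lambda>s. s + h) (at (t + h)) (at t)"
      by (auto simp: filterlim_at eventually_at_filter intro!: tendsto_eq_intros)
    from filterlim_compose[OF curve[of "t + h"] this] t h show ?thesis by simp
  qed
qed

lemma quotient_integrable:
  assumes "t > 0" "s > 0"
  shows "(\<lambda>x. (U s x - U t x) / (s - t) - H t x) absolutely_integrable_on {0..l}"
proof (cases "s = t")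
  case True
  have "(\<lambda>x. - H t x) absolutely_integrable_on {0..l}" using H_int[OF assms(1)] by (simp add: set_integrable_def)
  then show ?thesis using True by simp
next
  case False
  then show ?thesis
    using assms by (intro set_integral_diff(1) H_int absolutely_integrable_continuous_real continuous_intros contUx) auto
qed

text \<open>By the reverse triangle inequality the two norms differ by at most the
  \<open>L^1\<close> error of the difference quotient.\<close>

lemma tendsto_difference_quotient_L1:
  assumes t: "t > 0"
  shows "((\<lambda>s. abs_integral l (\<lambda>x. U s x - U t x) / \<bar>s - t\<bar>) \<longlongrightarrow> abs_integral l (H t)) (at t)"
proof (rule Lim_null[THEN iffD2], rule Lim_null_comparison[OF _ curve[OF t]])
  note hk = set_lebesgue_integral_eq_integral(1)
  have aH: "(\<lambda>x. \<bar>H t x\<bar>) absolutely_integrable_on {0..l}" using absolutely_integrable_abs[OF H_int[OF t]] by simp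
  have "norm (abs_integral l (\<lambda>x. U s x - U t x) / \<bar>s - t\<bar> - abs_integral l (H t))
      \<le> abs_integral l (\<lambda>x. (U s x - U t x) / (s - t) - H t x)" if s: "s > 0" "s \<noteq> t" for s
  proof -
    have c: "(\<lambda>x. \<bar>U s x - U t x\<bar> / \<bar>s - t\<bar>) integrable_on {0..l}"
      using s t by (intro int_cont continuous_intros contUx) auto
    have "abs_integral l (\<lambda>x. U s x - U t x) / \<bar>s - t\<bar> - abs_integral l (H t)
        = integral {0..l} (\<lambda>x. \<bar>U s x - U t x\<bar> / \<bar>s - t\<bar> - \<bar>H t x\<bar>)"
      using integral_diff[OF c hk[OF aH]] by simp
    moreover have "norm (integral {0..l} (\<lambda>x. \<bar>U s x - U t x\<bar> / \<bar>s - t\<bar> - \<bar>H t x\<bar>)) \<le>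
        abs_integral l (\<lambda>x. (U s x - U t x) / (s - t) - H t x)"
    proof (rule integral_norm_bound_integral)
      show "(\<lambda>x. \<bar>U s x - U t x\<bar> / \<bar>s - t\<bar> - \<bar>H t x\<bar>) integrable_on {0..l}" by (rule integrable_diff[OF c hk[OF aH]])
      show "(\<lambda>x. \<bar>(U s x - U t x) / (s - t) - H t x\<bar>) integrable_on {0..l}"
        using hk[OF absolutely_integrable_abs[OF quotient_integrable[OF t s(1)]]] by simp
      show "norm (\<bar>U s x - U t x\<bar> / \<bar>s - t\<bar> - \<bar>H t x\<bar>) \<le> \<bar>(U s x - U t x) / (s - t) - H t x\<bar>" for x
        unfolding abs_divide[symmetric] real_norm_def by (rule abs_triangle_ineq3)
    qed
    ultimately show ?thesis by simp
  qed
  then show "\<forall>\<^sub>F s in at t. norm (abs_integral l (\<lambda>x. U s x - U t x) / \<bar>s - t\<bar> - abs_integral l (H t))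
      \<le> abs_integral l (\<lambda>x. (U s x - U t x) / (s - t) - H t x)"
    using t by (auto simp: eventually_at dist_real_def intro!: exI[of _ t])
qed

text \<open>The left difference quotient of the norm is at most the norm of the difference quotient,
  whose limit is the norm of \<open>H\<close>.\<close>

lemma L1_growth:
  assumes C: "\<And>t. t > 0 \<Longrightarrow> abs_integral l (H t) \<le> C" and T: "T \<ge> 0"
  shows "abs_integral l (\<lambda>x. U T x) \<le> abs_integral l (U 0) + C * T"
proof -
  have "abs_integral l (\<lambda>x. U T x) - abs_integral l (U 0) \<le> C * (T - 0)"
  proof (rule le_if_left_difference_quotient_le[OF T])
    have "continuous_on ({0..T} \<times> cbox 0 l) (\<lambda>(t, x). U t x)" by (rule continuous_on_subset[OF contU]) auto
    then have "continuous_on ({0..T} \<times> cbox 0 l) (\<lambda>(t, x). \<bar>U t x\<bar>)" unfolding split_def by (intro continuous_intros)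
    from integral_continuous_on_param[OF this] show "continuous_on {0..T} (\<lambda>t. abs_integral l (U t))" by simp
    fix t r :: real assume t: "0 < t" "t \<le> T" and r: "r > 0"
    have "\<forall>\<^sub>F s in at t. abs_integral l (\<lambda>x. U s x - U t x) / \<bar>s - t\<bar> < C + r"
      using C[OF t(1)] r by (intro order_tendstoD(2)[OF tendsto_difference_quotient_L1[OF t(1)]]) auto
    then obtain b where b: "b > 0" "\<And>s. s \<noteq> t \<Longrightarrow> dist s t < b \<Longrightarrow> abs_integral l (\<lambda>x. U s x - U t x) / \<bar>s - t\<bar> < C + r"
      by (auto simp: eventually_at)
    define s where "s = max 0 (t - b / 2)"
    have s: "0 \<le> s" "s < t" "s \<noteq> t" "dist s t < b" using t b by (auto simp: s_def dist_real_def)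
    have i: "(\<lambda>x. \<bar>U t x\<bar>) integrable_on {0..l}" "(\<lambda>x. \<bar>U s x\<bar>) integrable_on {0..l}" "(\<lambda>x. \<bar>U s x - U t x\<bar>) integrable_on {0..l}"
      using s t by (auto intro!: int_cont continuous_intros contUx)
    have "abs_integral l (U t) \<le> integral {0..l} (\<lambda>x. \<bar>U s x\<bar> + \<bar>U s x - U t x\<bar>)"
      by (intro integral_le i integrable_add) auto
    also have "\<dots> = abs_integral l (U s) + abs_integral l (\<lambda>x. U s x - U t x)"
      by (rule integral_add[OF i(2,3)])
    also have "abs_integral l (\<lambda>x. U s x - U t x) \<le> (C + r) * (t - s)"
      using b(2)[OF s(3,4)] s by (simp add: field_simps)
    finally show "\<exists>s\<ge>0. s < t \<and> abs_integral l (U t) - abs_integral l (U s) \<le> (C + r) * (t - s)"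
      using s by (intro exI[of _ s]) auto
  qed
  then show ?thesis by simp
qed

text \<open>Backward integration from the outlet, combined with the flux bound, controls the inlet
  value by data plus \<open>e / (lam * l)\<close> times itself. For
  \<open>e \<le> lam * l / 2\<close> that multiple is at most one half and is absorbed, which
  produces the factor 2.\<close>

lemma inner_value_bound:
  assumes t: "t > 0" and C: "abs_integral l (U t) \<le> C2" "abs_integral l (H t) \<le> C1" "\<bar>U t l\<bar> \<le> Cb"
    and e1: "e \<le> 1" "e \<le> lam * l / 2"
  shows "\<bar>U t 0\<bar> \<le> 2 * (Cb + ((lam * C2 + Cb) / l + C1) / lam)"
proof -
  let ?w = "\<bar>U t 0\<bar>"
  let ?M = "((lam * C2 + Cb + e * ?w) / l + C1) / lam"
  define A where "A = Cb + ((lam * C2 + Cb) / l + C1) / lam"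
  have Cb0: "Cb \<ge> 0" using C(3) by linarith
  have "\<bar>F t x\<bar> \<le> lam * ?M" if "x \<in> {0..l}" for x
  proof -
    have "\<bar>F t x\<bar> \<le> (lam * abs_integral l (U t) + e * \<bar>U t l\<bar> + e * ?w) / l + abs_integral l (H t)"
      by (rule flux_bound[OF t that])
    also have "\<dots> \<le> (lam * C2 + 1 * Cb + e * ?w) / l + C1"
      using C e1 l lam e Cb0 by (intro add_mono divide_right_mono mult_left_mono mult_mono) auto
    finally show ?thesis using lam by simp
  qed
  then have "?w \<le> \<bar>U t l\<bar> + ?M" using l t by (intro U_le_flux) auto
  also have "\<dots> \<le> Cb + ((lam * C2 + Cb) / l + C1) / lam + e / (lam * l) * ?w"
    using C(3) l lam by (simp add: field_simps)
  finally have "?w \<le> A + e / (lam * l) * ?w" unfolding A_def .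
  moreover have "e / (lam * l) * ?w \<le> (1 / 2) * ?w"
    using e1(2) l lam by (intro mult_right_mono) (auto simp: field_simps)
  ultimately have "?w \<le> 2 * A" by linarith
  then show ?thesis unfolding A_def .
qed

lemma sup_bounds:
  assumes t: "t > 0" and C: "abs_integral l (U t) \<le> C2" "abs_integral l (H t) \<le> C1" "\<bar>U t l\<bar> \<le> Cb" "\<bar>U t 0\<bar> \<le> Cb"
    and e1: "e \<le> 1" and x: "x \<in> {0..l}"
  shows "\<bar>F t x\<bar> \<le> (lam * C2 + 2 * Cb) / l + C1" "\<bar>U t x\<bar> \<le> Cb + ((lam * C2 + 2 * Cb) / l + C1) / lam"
proof -
  have Cb0: "Cb \<ge> 0" using C(3) by linarith
  have F: "\<bar>F t x\<bar> \<le> (lam * C2 + 2 * Cb) / l + C1" if "x \<in> {0..l}" for x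
  proof -
    have "\<bar>F t x\<bar> \<le> (lam * abs_integral l (U t) + e * \<bar>U t l\<bar> + e * \<bar>U t 0\<bar>) / l + abs_integral l (H t)"
      by (rule flux_bound[OF t that])
    also have "\<dots> \<le> (lam * C2 + 1 * Cb + 1 * Cb) / l + C1"
      using C e1 l lam e Cb0 by (intro add_mono divide_right_mono mult_left_mono mult_mono) auto
    finally show ?thesis by (simp add: algebra_simps)
  qed
  show "\<bar>F t x\<bar> \<le> (lam * C2 + 2 * Cb) / l + C1" by (rule F[OF x])
  have "\<bar>U t x\<bar> \<le> \<bar>U t l\<bar> + ((lam * C2 + 2 * Cb) / l + C1) / lam"
    using F lam t x by (intro U_le_flux) auto
  then show "\<bar>U t x\<bar> \<le> Cb + ((lam * C2 + 2 * Cb) / l + C1) / lam" using C(3) by linarith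
qed

lemma mass_balance:
  assumes T: "T \<ge> 0"
  shows "integral {0..T} (\<lambda>t. F t l) = integral {0..T} (\<lambda>t. F t 0) - (integral {0..l} (U T) - integral {0..l} (U 0))"
proof -
  have z: "0 \<in> {0..l}" "l \<in> {0..l}" using l by auto
  have "integral {0..T} (\<lambda>t. F t 0 - F t l) = integral {0..l} (\<lambda>x. U T x * 1) - integral {0..l} (\<lambda>x. U 0 x * 1)"
  proof (rule has_integral_weight_derivative[OF T])
    show "continuous_on {0..} (\<lambda>t. F t 0 - F t l)" by (intro continuous_intros contFt z)
    show "integral {0..l} (\<lambda>x. H t x * 1) = F t 0 - F t l" if "t > 0" for t
      using H_by_parts[OF that _ order_refl, of "\<lambda>_. 1" "\<lambda>_. 0"] l by simp
  qed simp
  moreover have "integral {0..T} (\<lambda>t. F t 0 - F t l) = integral {0..T} (\<lambda>t. F t 0) - integral {0..T} (\<lambda>t. F t l)"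
    by (intro integral_diff integrable_continuous_real continuous_on_subset[OF contFt] z) auto
  ultimately show ?thesis by simp
qed

end

lemma viscous_arc_diff:
  assumes "viscous_arc l lam e U P H" "viscous_arc l lam e U' P' H'"
  shows "viscous_arc l lam e (\<lambda>t x. U t x - U' t x) (\<lambda>t x. P t x - P' t x) (\<lambda>t x. H t x - H' t x)"
proof -
  interpret a: viscous_arc l lam e U P H by fact
  interpret b: viscous_arc l lam e U' P' H' by fact
  note hk = set_lebesgue_integral_eq_integral(1)
  show ?thesis
  proof
    show "l > 0" "lam > 0" "e > 0" by (fact a.l a.lam a.e)+
    show "continuous_on ({0..} \<times> {0..l}) (\<lambda>(t, x). U t x - U' t x)"
      using continuous_on_diff[OF a.contU b.contU] by (simp add: split_def)
    show "continuous_on ({0..} \<times> {0..l}) (\<lambda>(t, x). P t x - P' t x)"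
      using continuous_on_diff[OF a.contP b.contP] by (simp add: split_def)
    show "((\<lambda>x. U t x - U' t x) has_real_derivative P t x - P' t x) (at x within {0..l})" if "t \<ge> 0" "x \<in> {0..l}" for t x
      by (intro DERIV_diff a.derU b.derU that)
    show "primitive_on 0 l (\<lambda>x. lam * (U t x - U' t x) - e * (P t x - P' t x)) (\<lambda>x. - (H t x - H' t x))" if "t > 0" for t
      using primitive_on_minus[OF a.flux[OF that] b.flux[OF that]] by (simp add: algebra_simps)
    fix t :: real assume t: "t > 0"
    let ?q = "\<lambda>U H s x. (U s x - U t x) / (s - t) - H t x"
    let ?N = "\<lambda>U H s. abs_integral l (\<lambda>x. ?q U H s x)"
    show "((\<lambda>s. abs_integral l (\<lambda>x. (U s x - U' s x - (U t x - U' t x)) / (s - t) - (H t x - H' t x))) \<longlongrightarrow> 0) (at t)"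
    proof (rule Lim_null_comparison)
      show "((\<lambda>s. ?N U H s + ?N U' H' s) \<longlongrightarrow> 0) (at t)"
        using tendsto_add[OF a.curve[OF t] b.curve[OF t]] by simp
      have "norm (abs_integral l (\<lambda>x. (U s x - U' s x - (U t x - U' t x)) / (s - t) - (H t x - H' t x))) \<le> ?N U H s + ?N U' H' s"
        if s: "s > 0" for s
      proof -
        have e: "(U s x - U' s x - (U t x - U' t x)) / (s - t) - (H t x - H' t x) = ?q U H s x - ?q U' H' s x" for x
          by (simp add: diff_divide_distrib)
        note q = a.quotient_integrable[OF t s] b.quotient_integrable[OF t s]
        have i: "(\<lambda>x. \<bar>?q U H s x\<bar>) integrable_on {0..l}" "(\<lambda>x. \<bar>?q U' H' s x\<bar>) integrable_on {0..l}"
          "(\<lambda>x. \<bar>?q U H s x - ?q U' H' s x\<bar>) integrable_on {0..l}"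
          using hk[OF absolutely_integrable_abs[OF q(1)]] hk[OF absolutely_integrable_abs[OF q(2)]]
            hk[OF absolutely_integrable_abs[OF set_integral_diff(1)[OF q]]] by auto
        have "norm (abs_integral l (\<lambda>x. ?q U H s x - ?q U' H' s x)) \<le> integral {0..l} (\<lambda>x. \<bar>?q U H s x\<bar> + \<bar>?q U' H' s x\<bar>)"
          by (intro integral_norm_bound_integral i integrable_add) (simp add: abs_triangle_ineq4)
        then show ?thesis unfolding e integral_add[OF i(1,2)] .
      qed
      then show "\<forall>\<^sub>F s in at t. norm (abs_integral l (\<lambda>x. (U s x - U' s x - (U t x - U' t x)) / (s - t) - (H t x - H' t x))) \<le> ?N U H s + ?N U' H' s"
        using t by (auto simp: eventually_at dist_real_def intro!: exI[of _ t])
    qed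
  qed
qed

text \<open>The contraction is applied to time increments: the outer values do not depend on time
  and cancel, while the linear node condition is inherited. Dividing by \<open>h\<close> and letting
  \<open>h\<close> tend to 0 replaces increments by \<open>H\<close>.\<close>

lemma network_time_derivative_decreasing:
  fixes l lam :: "nat \<Rightarrow> real" and U P H :: "nat \<Rightarrow> real \<Rightarrow> real \<Rightarrow> real"
  assumes fin: "finite Inc" "finite Out" and disj: "Inc \<inter> Out = {}"
    and arc: "\<And>i. i \<in> Inc \<union> Out \<Longrightarrow> viscous_arc (l i) (lam i) e (U i) (P i) (H i)"
    and K: "\<And>i j. i \<in> Inc \<union> Out \<Longrightarrow> j \<in> Inc \<union> Out \<Longrightarrow> K i j \<ge> 0 \<and> K i j = K j i"
    and nd: "\<And>i. nd i = (if i \<in> Inc then l i else 0)"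
    and node: "\<And>i t. i \<in> Inc \<union> Out \<Longrightarrow> t > 0 \<Longrightarrow>
      node_sign Inc i * (- lam i * U i t (nd i) + e * P i t (nd i)) = (\<Sum>j\<in>Inc \<union> Out. K i j * (U j t (nd j) - U i t (nd i)))"
    and inlet: "\<And>i t. i \<in> Inc \<Longrightarrow> t > 0 \<Longrightarrow> U i t 0 = B i"
    and outlet: "\<And>i t. i \<in> Out \<Longrightarrow> t > 0 \<Longrightarrow> U i t (l i) = b i"
    and st: "0 < s" "s \<le> t"
  shows "(\<Sum>i\<in>Inc \<union> Out. abs_integral (l i) (H i t)) \<le> (\<Sum>i\<in>Inc \<union> Out. abs_integral (l i) (H i s))"
proof -
  let ?M = "Inc \<union> Out"
  have c: "(\<Sum>i\<in>?M. abs_integral (l i) (\<lambda>x. U i (t + h) x - U i t x)) \<le> (\<Sum>i\<in>?M. abs_integral (l i) (\<lambda>x. U i (s + h) x - U i s x))"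
    if h: "h > 0" for h
  proof (rule network_L1_contraction[OF fin disj _ K nd _ _ _ st,
      where Z = "\<lambda>i t x. U i (t + h) x - U i t x" and P = "\<lambda>i t x. P i (t + h) x - P i t x"
        and H = "\<lambda>i t x. H i (t + h) x - H i t x" and lam = lam and e = e])
    show "viscous_arc (l i) (lam i) e (\<lambda>t x. U i (t + h) x - U i t x) (\<lambda>t x. P i (t + h) x - P i t x) (\<lambda>t x. H i (t + h) x - H i t x)"
      if "i \<in> ?M" for i
      using h by (intro viscous_arc_diff viscous_arc.shift[OF arc[OF that]] arc[OF that]) auto
    show "node_sign Inc i * (- lam i * (U i (t + h) (nd i) - U i t (nd i)) + e * (P i (t + h) (nd i) - P i t (nd i)))
        = (\<Sum>j\<in>?M. K i j * (U j (t + h) (nd j) - U j t (nd j) - (U i (t + h) (nd i) - U i t (nd i))))"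
      if "i \<in> ?M" "t > 0" for i t
    proof -
      have "t + h > 0" using that h by simp
      have "node_sign Inc i * (- lam i * (U i (t + h) (nd i) - U i t (nd i)) + e * (P i (t + h) (nd i) - P i t (nd i)))
        = node_sign Inc i * (- lam i * U i (t + h) (nd i) + e * P i (t + h) (nd i)) - node_sign Inc i * (- lam i * U i t (nd i) + e * P i t (nd i))"
        by (simp add: algebra_simps)
      also have "\<dots> = (\<Sum>j\<in>?M. K i j * (U j (t + h) (nd j) - U i (t + h) (nd i)) - K i j * (U j t (nd j) - U i t (nd i)))"
        unfolding node[OF that] node[OF that(1) \<open>t + h > 0\<close>] by (simp add: sum_subtractf)
      also have "\<dots> = (\<Sum>j\<in>?M. K i j * (U j (t + h) (nd j) - U j t (nd j) - (U i (t + h) (nd i) - U i t (nd i))))"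
        by (intro sum.cong refl) (simp add: algebra_simps)
      finally show ?thesis .
    qed
  qed (use inlet outlet h in auto)
  have lim: "((\<lambda>h. (\<Sum>i\<in>?M. abs_integral (l i) (\<lambda>x. U i (t + h) x - U i t x)) / h) \<longlongrightarrow> (\<Sum>i\<in>?M. abs_integral (l i) (H i t))) (at_right 0)"
    if t: "t > 0" for t
  proof -
    have "filterlim (\<lambda>h. t + h) (at t) (at_right 0)"
      by (auto simp: filterlim_at eventually_at_filter intro!: tendsto_eq_intros)
    from filterlim_compose[OF viscous_arc.tendsto_difference_quotient_L1[OF arc t] this]
    have "((\<lambda>h. \<Sum>i\<in>?M. abs_integral (l i) (\<lambda>x. U i (t + h) x - U i t x) / \<bar>h\<bar>) \<longlongrightarrow> (\<Sum>i\<in>?M. abs_integral (l i) (H i t))) (at_right 0)"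
      by (intro tendsto_sum) simp
    then show ?thesis
      by (rule Lim_transform_eventually) (auto simp: eventually_at_filter sum_divide_distrib)
  qed
  show ?thesis
  proof (rule tendsto_le[OF _ lim lim])
    show "\<forall>\<^sub>F h in at_right 0. (\<Sum>i\<in>?M. abs_integral (l i) (\<lambda>x. U i (t + h) x - U i t x)) / h
        \<le> (\<Sum>i\<in>?M. abs_integral (l i) (\<lambda>x. U i (s + h) x - U i s x)) / h"
      using c by (auto simp: eventually_at_filter intro!: divide_right_mono always_eventually)
  qed (use st in auto)
qed

section \<open>The vanishing viscosity limit\<close>

text \<open>The order of choices matters: the Lipschitz term fixes \<open>s\<close> first, and only
  then are the other errors made small relative to \<open>s\<close>. The predicates \<open>A\<close>
  and \<open>B\<close> stand for smallness of the error in the inlet flux and in the initial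
  data.\<close>

lemma eventually_uniformly_small_from_potential:
  fixes D :: "nat \<Rightarrow> real \<Rightarrow> real \<Rightarrow> real"
  assumes l: "l > 0" and C: "C \<ge> 0" and T: "T > 0" and lam: "lam > 0" and eps: "eps \<longlonglongrightarrow> 0"
    and eta: "\<And>r. r > 0 \<Longrightarrow> \<forall>\<^sub>F n in sequentially. A n r"
    and eta': "\<And>r. r > 0 \<Longrightarrow> \<forall>\<^sub>F n in sequentially. B n r"
    and D: "\<forall>\<^sub>F n in sequentially. \<forall>p q s. A n p \<longrightarrow> B n q \<longrightarrow> 0 < s \<longrightarrow> s \<le> l / 2 \<longrightarrow>
        (\<forall>t\<in>{0..T}. \<forall>x\<in>{0..l}. \<bar>D n t x\<bar> \<le> 2 * (l * q + T * lam * p + 2 * eps n * C * T) / s + 2 * C * s)"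
    and r: "r > 0"
  shows "\<forall>\<^sub>F n in sequentially. \<forall>t\<in>{0..T}. \<forall>x\<in>{0..l}. \<bar>D n t x\<bar> \<le> r"
proof -
  define s where "s = min (l / 2) (r / (4 * (C + 1)))"
  have s: "0 < s" using l r C by (simp add: s_def)
  have s': "s \<le> l / 2" unfolding s_def by (rule min.cobounded1)
  have "2 * C * s \<le> 2 * (C + 1) * (r / (4 * (C + 1)))"
    using s C by (intro mult_mono) (auto simp: s_def)
  also have "\<dots> = r / 2" using C by (simp add: field_simps)
  finally have s2: "2 * C * s \<le> r / 2" .
  \<comment> \<open>Each of the three summands in the numerator is thereby at most
    \<open>r * s / 16\<close>; doubled and divided by \<open>s\<close> they give
    \<open>3 * r / 8\<close>, which leaves room for the \<open>r / 2\<close> from the Lipschitz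
    term.\<close>
  define q where "q = r * s / (16 * l)"
  define p where "p = r * s / (16 * (T * lam))"
  define d where "d = r * s / (32 * ((C + 1) * T))"
  have pqd: "p > 0" "q > 0" "d > 0" using r s l T lam C by (auto simp: p_def q_def d_def)
  have "\<forall>\<^sub>F n in sequentially. eps n < d" using order_tendstoD(2)[OF eps pqd(3)] .
  with eta[OF pqd(1)] eta'[OF pqd(2)] D show ?thesis
  proof eventually_elim
    case (elim n)
    have e1: "l * q = r * s / 16" "T * lam * p = r * s / 16" using l T lam by (auto simp: p_def q_def field_simps)
    have "2 * eps n * C * T = 2 * T * (eps n * C)" by simp
    also have "eps n * C \<le> d * (C + 1)" using elim(4) pqd C by (smt (verit, best) mult_mono mult_nonneg_nonneg mult_right_mono)
    then have "2 * T * (eps n * C) \<le> 2 * T * (d * (C + 1))" using T by (intro mult_left_mono) auto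
    also have "\<dots> = 2 * (d * ((C + 1) * T))" by simp
    also have "\<dots> = r * s / 16"
    proof -
      have "(C + 1) * T \<noteq> 0" using T C by simp
      then have "d * ((C + 1) * T) = r * s / 32" unfolding d_def by simp
      then show ?thesis by simp
    qed
    finally have "l * q + T * lam * p + 2 * eps n * C * T \<le> 3 * (r * s / 16)" unfolding e1 by simp
    then have "2 * (l * q + T * lam * p + 2 * eps n * C * T) / s \<le> 2 * (3 * (r * s / 16)) / s"
      using s by (intro divide_right_mono mult_left_mono) auto
    also have "\<dots> = 3 * r / 8" using s by simp
    finally have b: "2 * (l * q + T * lam * p + 2 * eps n * C * T) / s + 2 * C * s \<le> r" using s2 r by linarith
    have "\<forall>t\<in>{0..T}. \<forall>x\<in>{0..l}. \<bar>D n t x\<bar> \<le> 2 * (l * q + T * lam * p + 2 * eps n * C * T) / s + 2 * C * s"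
      using elim(1-3) s s' by blast
    then show ?case using b by (meson order_trans)
  qed
qed

text \<open>\<open>V i (x - lam i * t)\<close> is the expected limit, \<open>W i\<close> an antiderivative of \<open>V i\<close> and \<open>R i\<close> a bound for its variation.\<close>
locale viscosity_limit =
  fixes Inc Out :: "nat set" and l lam g c :: "nat \<Rightarrow> real" and th :: real and eps :: "nat \<Rightarrow> real"
    and U P H :: "nat \<Rightarrow> nat \<Rightarrow> real \<Rightarrow> real \<Rightarrow> real"
    and B :: "nat \<Rightarrow> real" and b :: "nat \<Rightarrow> nat \<Rightarrow> real" and T C1 C2 Cb CV :: real
    and V W R :: "nat \<Rightarrow> real \<Rightarrow> real"
  assumes fin: "finite Inc" "finite Out" and disj: "Inc \<inter> Out = {}" and ne: "Inc \<noteq> {}" "Out \<noteq> {}"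
    and T: "T > 0"
    and c: "\<And>i. i \<in> Out \<Longrightarrow> c i > 0"
    and c_rel: "\<And>i. i \<in> Out \<Longrightarrow> c i = th * g i * (1 + c i * card Inc / lam i)"
    and g: "(\<Sum>i\<in>Out. g i) = 1"
    and arc: "\<And>n i. i \<in> Inc \<union> Out \<Longrightarrow> viscous_arc (l i) (lam i) (eps n) (U n i) (P n i) (H n i)"
    and eps: "eps \<longlonglongrightarrow> 0"
    and node_in: "\<And>n i t. i \<in> Inc \<Longrightarrow> t > 0 \<Longrightarrow>
      lam i * U n i t (l i) - eps n * P n i t (l i) = (\<Sum>j\<in>Out. c j * (U n i t (l i) - U n j t 0))"
    and node_out: "\<And>n i t. i \<in> Out \<Longrightarrow> t > 0 \<Longrightarrow>
      lam i * U n i t 0 - eps n * P n i t 0 = (\<Sum>j\<in>Inc. c i * (U n j t (l j) - U n i t 0))"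
    and inlet: "\<And>n i t. i \<in> Inc \<Longrightarrow> t > 0 \<Longrightarrow> U n i t 0 = B i"
    and outlet: "\<And>n i t. i \<in> Out \<Longrightarrow> t > 0 \<Longrightarrow> U n i t (l i) = b n i"
    and H_bound: "\<And>n i t. i \<in> Inc \<union> Out \<Longrightarrow> t > 0 \<Longrightarrow> abs_integral (l i) (H n i t) \<le> C1"
    and U_bound: "\<And>n i t. i \<in> Inc \<union> Out \<Longrightarrow> 0 < t \<Longrightarrow> t \<le> T \<Longrightarrow> abs_integral (l i) (U n i t) \<le> C2"
    and b_bound: "\<And>n i. i \<in> Out \<Longrightarrow> \<bar>b n i\<bar> \<le> Cb" and B_bound: "\<And>i. i \<in> Inc \<Longrightarrow> \<bar>B i\<bar> \<le> Cb"
    and V: "\<And>i. i \<in> Inc \<union> Out \<Longrightarrow> primitive_on (- (lam i * T)) (l i) (W i) (V i)"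
    and V_bound: "\<And>i x. i \<in> Inc \<union> Out \<Longrightarrow> \<bar>V i x\<bar> \<le> CV"
    and R: "\<And>i x y. i \<in> Inc \<union> Out \<Longrightarrow> x \<le> y \<Longrightarrow> \<bar>V i x - V i y\<bar> \<le> R i y - R i x"
    and R_bound: "\<And>i x. i \<in> Inc \<union> Out \<Longrightarrow> \<bar>R i x\<bar> \<le> CV"
    and V_in: "\<And>i x. i \<in> Inc \<Longrightarrow> x \<le> 0 \<Longrightarrow> V i x = B i"
    and V_out: "\<And>i t. i \<in> Out \<Longrightarrow> 0 \<le> t \<Longrightarrow> t \<le> T \<Longrightarrow>
      W i 0 - W i (- (lam i * t)) = g i * (\<Sum>j\<in>Inc. W j (l j) - W j (l j - lam j * t))"
    and init: "\<And>r. r > 0 \<Longrightarrow> \<forall>\<^sub>F n in sequentially. \<forall>i\<in>Inc \<union> Out. \<forall>x\<in>{0..l i}.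
      \<bar>integral {0..x} (U n i 0) - (W i x - W i 0)\<bar> \<le> r"
begin

definition F where "F n i t x = lam i * U n i t x - eps n * P n i t x"
definition D where "D n i t x = integral {0..x} (U n i t) - integral {0..t} (\<lambda>t. F n i t 0) - (W i (x - lam i * t) - W i 0)"

lemma arcF: "i \<in> Inc \<union> Out \<Longrightarrow> viscous_arc.F (lam i) (eps n) (U n i) (P n i) = F n i"
  using viscous_arc.F_def[OF arc] by (auto simp: F_def fun_eq_iff)

lemma arc_pos: "i \<in> Inc \<union> Out \<Longrightarrow> l i > 0" "i \<in> Inc \<union> Out \<Longrightarrow> lam i > 0" "eps n > 0"
  using viscous_arc.l[OF arc] viscous_arc.lam[OF arc] viscous_arc.e[OF arc] ne by blast+

text \<open>On outgoing arcs the outlet value is prescribed, which bounds the value at the node. On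
  incoming arcs the node is the outlet; there the node condition expresses \<open>s\<close> times
  the value by the flux and the node values of the outgoing arcs, and the small multiple of the
  value inside the flux bound is absorbed.\<close>

lemma uniform_bound:
  obtains C where "C \<ge> 0" "CV \<le> C"
    "\<forall>\<^sub>F n in sequentially. \<forall>i\<in>Inc \<union> Out. \<forall>t\<in>{0..T}. \<forall>x\<in>{0..l i}. \<bar>U n i t x\<bar> \<le> C \<and> \<bar>F n i t x\<bar> \<le> C"
proof -
  let ?M = "Inc \<union> Out"
  have finM: "finite ?M" using fin by simp
  define s where "s = (\<Sum>j\<in>Out. c j)"
  have s: "s > 0" unfolding s_def using fin ne c by (intro sum_pos) auto
  \<comment> \<open>\<open>w\<close> bounds node values on outgoing arcs and \<open>w'\<close> those
    on incoming arcs; the factor \<open>2 / s\<close> in \<open>w'\<close> comes from absorbing half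
    of \<open>s\<close> times the value.\<close>
  define w where "w i = 2 * (Cb + ((lam i * C2 + Cb) / l i + C1) / lam i)" for i
  define w' where "w' i = 2 * ((lam i * C2 + Cb) / l i + C1 + (\<Sum>j\<in>Out. c j * w j)) / s" for i
  have fin_ex: "\<exists>K. \<forall>i\<in>?M. f i \<le> K" for f :: "nat \<Rightarrow> real"
    using finM by (metis Max_ge finite_imageI image_eqI)
  obtain K1 where K1: "\<And>i. i \<in> ?M \<Longrightarrow> \<bar>w i\<bar> + \<bar>w' i\<bar> + \<bar>Cb\<bar> \<le> K1"
    using fin_ex[of "\<lambda>i. \<bar>w i\<bar> + \<bar>w' i\<bar> + \<bar>Cb\<bar>"] by blast
  define f where "f i = \<bar>(lam i * C2 + 2 * K1) / l i + C1\<bar> + \<bar>K1 + ((lam i * C2 + 2 * K1) / l i + C1) / lam i\<bar> + \<bar>CV\<bar>" for i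
  obtain K2 where K2: "\<And>i. i \<in> ?M \<Longrightarrow> f i \<le> K2" using fin_ex by metis
  have K20: "K2 \<ge> \<bar>CV\<bar>"
  proof -
    obtain i where "i \<in> ?M" using ne by auto
    from K2[OF this] show ?thesis unfolding f_def by linarith
  qed
  have bnd: "\<bar>U n i t x\<bar> \<le> K2 \<and> \<bar>F n i t x\<bar> \<le> K2"
    if n: "eps n \<le> 1" "\<And>i. i \<in> ?M \<Longrightarrow> eps n \<le> lam i * l i / 2" "\<And>i. i \<in> ?M \<Longrightarrow> eps n \<le> s * l i / 2"
      and i: "i \<in> ?M" and t: "0 < t" "t \<le> T" and x: "x \<in> {0..l i}" for n i t x
  proof -
    have wo: "\<bar>U n j t 0\<bar> \<le> w j" if j: "j \<in> Out" for j
    proof -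
      have jm: "j \<in> ?M" using j by simp
      interpret a: viscous_arc "l j" "lam j" "eps n" "U n j" "P n j" "H n j" using arc[OF jm] .
      have "\<bar>U n j t (l j)\<bar> \<le> Cb" using outlet[OF j t(1)] b_bound[OF j] by simp
      from a.inner_value_bound[OF t(1) U_bound[OF jm t] H_bound[OF jm t(1)] this n(1) n(2)[OF jm]]
      show ?thesis unfolding w_def .
    qed
    have wi: "\<bar>U n j t (l j)\<bar> \<le> w' j" if j: "j \<in> Inc" for j
    proof -
      interpret a: viscous_arc "l j" "lam j" "eps n" "U n j" "P n j" "H n j" using arc j by blast
      let ?w = "\<bar>U n j t (l j)\<bar>"
      have jm: "j \<in> ?M" using j by simp
      have lj: "l j \<in> {0..l j}" using a.l by auto
      have "U n j t (l j) * s = F n j t (l j) + (\<Sum>k\<in>Out. c k * U n k t 0)"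
      proof -
        have "(\<Sum>k\<in>Out. c k * (x - U n k t 0)) = s * x - (\<Sum>k\<in>Out. c k * U n k t 0)" for x
          unfolding s_def sum_distrib_right by (simp add: sum_subtractf right_diff_distrib)
        then show ?thesis using node_in[OF j t(1), of n] by (simp add: F_def mult.commute)
      qed
      then have "?w * s = \<bar>F n j t (l j) + (\<Sum>k\<in>Out. c k * U n k t 0)\<bar>" using s by (metis abs_mult abs_of_pos)
      also have "\<dots> \<le> \<bar>F n j t (l j)\<bar> + (\<Sum>k\<in>Out. c k * w k)"
      proof -
        have "\<bar>\<Sum>k\<in>Out. c k * U n k t 0\<bar> \<le> (\<Sum>k\<in>Out. \<bar>c k * U n k t 0\<bar>)" by (rule sum_abs)
        also have "\<dots> \<le> (\<Sum>k\<in>Out. c k * w k)"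
          using wo c by (intro sum_mono) (auto simp: abs_mult less_imp_le intro!: mult_mono)
        finally show ?thesis by linarith
      qed
      also have "\<bar>F n j t (l j)\<bar> \<le> (lam j * C2 + eps n * ?w + 1 * Cb) / l j + C1"
      proof -
        have "\<bar>a.F t (l j)\<bar> \<le> (lam j * abs_integral (l j) (U n j t) + eps n * ?w + eps n * \<bar>U n j t 0\<bar>) / l j
            + abs_integral (l j) (H n j t)" by (rule a.flux_bound[OF t(1) lj])
        also have "\<dots> \<le> (lam j * C2 + eps n * ?w + 1 * Cb) / l j + C1"
          using U_bound[OF jm t] H_bound[OF jm t(1)] B_bound[OF j] inlet[OF j t(1)] n(1) a.l a.lam a.e
          by (intro add_mono divide_right_mono mult_left_mono mult_mono) auto
        finally show ?thesis unfolding arcF[OF jm] .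
      qed
      finally have "?w * s \<le> (lam j * C2 + Cb) / l j + C1 + (\<Sum>k\<in>Out. c k * w k) + eps n / l j * ?w"
        using a.l by (simp add: field_simps)
      moreover have "eps n / l j * ?w \<le> (s / 2) * ?w"
        using n(3)[OF jm] a.l by (intro mult_right_mono) (auto simp: field_simps)
      ultimately have "?w * s \<le> (lam j * C2 + Cb) / l j + C1 + (\<Sum>k\<in>Out. c k * w k) + (s / 2) * ?w" by linarith
      then have "?w * (s / 2) \<le> (lam j * C2 + Cb) / l j + C1 + (\<Sum>k\<in>Out. c k * w k)" by (simp add: field_simps)
      then show ?thesis unfolding w'_def using s by (simp add: field_simps)
    qed
    have ends: "\<bar>U n i t (l i)\<bar> \<le> K1" "\<bar>U n i t 0\<bar> \<le> K1"
    proof -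
      show "\<bar>U n i t (l i)\<bar> \<le> K1"
        using i wi[of i] outlet[of i t n] b_bound[of i n] t K1[OF i] by fastforce
      show "\<bar>U n i t 0\<bar> \<le> K1"
        using i wo[of i] inlet[of i t n] B_bound[of i] t K1[OF i] by fastforce
    qed
    have "\<bar>F n i t x\<bar> \<le> (lam i * C2 + 2 * K1) / l i + C1"
      using viscous_arc.sup_bounds(1)[OF arc[OF i] t(1) U_bound[OF i t] H_bound[OF i t(1)] ends n(1) x] unfolding arcF[OF i] .
    moreover have "\<bar>U n i t x\<bar> \<le> K1 + ((lam i * C2 + 2 * K1) / l i + C1) / lam i"
      using viscous_arc.sup_bounds(2)[OF arc[OF i] t(1) U_bound[OF i t] H_bound[OF i t(1)] ends n(1) x] .
    ultimately show ?thesis using K2[OF i] unfolding f_def by linarith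
  qed
  \<comment> \<open>The estimates hold at positive times; continuity extends them to
    \<open>t = 0\<close>, where the potential starts.\<close>
  have cl: "\<bar>h 0\<bar> \<le> K2" if h: "continuous_on {0..} h" "\<And>t. 0 < t \<Longrightarrow> t \<le> T \<Longrightarrow> \<bar>h t\<bar> \<le> K2" for h :: "real \<Rightarrow> real"
  proof -
    have "((\<lambda>t. h t) \<longlongrightarrow> h 0) (at_right 0)"
      using h(1) by (auto simp: continuous_on_def intro: tendsto_within_subset)
    then have "((\<lambda>t. \<bar>h t\<bar>) \<longlongrightarrow> \<bar>h 0\<bar>) (at_right 0)" by (rule tendsto_rabs)
    moreover have "\<forall>\<^sub>F t in at_right 0. \<bar>h t\<bar> \<le> K2"
      using T h(2) by (auto simp: eventually_at_right_field intro!: exI[of _ T])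
    ultimately show ?thesis by (intro tendsto_upperbound) auto
  qed
  have ev1: "\<forall>\<^sub>F n in sequentially. eps n \<le> 1" using order_tendstoD(2)[OF eps, of 1] by (auto elim: eventually_mono)
  have ev: "\<forall>\<^sub>F n in sequentially. \<forall>i\<in>?M. eps n \<le> h i" if h: "\<And>i. i \<in> ?M \<Longrightarrow> h i > 0" for h :: "nat \<Rightarrow> real"
  proof (intro eventually_ball_finite finM ballI)
    show "\<forall>\<^sub>F n in sequentially. eps n \<le> h i" if "i \<in> ?M" for i
      using order_tendstoD(2)[OF eps h[OF that]] by (rule eventually_mono) simp
  qed
  have "\<forall>\<^sub>F n in sequentially. \<forall>i\<in>?M. eps n \<le> lam i * l i / 2" using arc_pos by (intro ev) auto
  moreover note ev1
  moreover have "\<forall>\<^sub>F n in sequentially. \<forall>i\<in>?M. eps n \<le> s * l i / 2" using arc_pos s by (intro ev) auto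
  ultimately have "\<forall>\<^sub>F n in sequentially. \<forall>i\<in>?M. \<forall>t\<in>{0..T}. \<forall>x\<in>{0..l i}. \<bar>U n i t x\<bar> \<le> K2 \<and> \<bar>F n i t x\<bar> \<le> K2"
  proof eventually_elim
    case (elim n)
    show ?case
    proof (intro ballI)
      fix i t x assume i: "i \<in> ?M" and t: "t \<in> {0..T}" and x: "x \<in> {0..l i}"
      note b = bnd[of n, OF elim(2) elim(1)[rule_format] elim(3)[rule_format] i _ _ x]
      show "\<bar>U n i t x\<bar> \<le> K2 \<and> \<bar>F n i t x\<bar> \<le> K2"
      proof (cases "t = 0")
        case True
        then show ?thesis
          using cl[OF viscous_arc.contUt[OF arc[OF i] x]] cl[OF viscous_arc.contFt[OF arc[OF i] x, unfolded arcF[OF i]]] b by blast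
      qed (use b t in auto)
    qed
  qed
  then show ?thesis using that[of K2] K20 by auto
qed

end

lemma has_integral_shift:
  fixes f :: "real \<Rightarrow> real"
  assumes "(f has_integral i) {a - c..b - c}"
  shows "((\<lambda>x. f (x - c)) has_integral i) {a..b}"
  using has_integral_affinity'[of f i "a - c" "b - c" 1 "- c"] assms by simp

lemma absolutely_integrable_shift:
  fixes f :: "real \<Rightarrow> real"
  assumes "f absolutely_integrable_on {a - c..b - c}"
  shows "(\<lambda>x. f (x - c)) absolutely_integrable_on {a..b}"
proof (rule absolutely_integrable_onI)
  show "(\<lambda>x. f (x - c)) integrable_on {a..b}"
    using has_integral_shift assms set_lebesgue_integral_eq_integral(1) unfolding integrable_on_def by blast
  have "(\<lambda>x. norm (f x)) integrable_on {a - c..b - c}"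
    using assms absolutely_integrable_on_def by blast
  then show "(\<lambda>x. norm (f (x - c))) integrable_on {a..b}"
    using has_integral_shift[of "\<lambda>x. norm (f x)"] unfolding integrable_on_def by blast
qed

context viscosity_limit
begin

lemma F_arc_props:
  assumes i: "i \<in> Inc \<union> Out" and x: "x \<in> {0..l i}"
  shows "continuous_on {0..} (\<lambda>t. F n i t x)" "continuous_on {0..} (\<lambda>t. U n i t x)"
  using viscous_arc.contFt[OF arc[OF i] x, unfolded arcF[OF i]] viscous_arc.contUt[OF arc[OF i] x] by auto

lemma flux_integrable:
  assumes i: "i \<in> Inc \<union> Out" and x: "x \<in> {0..l i}"
  shows "(\<lambda>t. F n i t x) integrable_on {0..t}" "(\<lambda>t. U n i t x) integrable_on {0..t}"
  using F_arc_props[OF i x, of n]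
  by (auto intro!: integrable_continuous_real intro: continuous_on_subset)

lemma inlet_layer_small:
  assumes r: "r > 0"
  shows "\<forall>\<^sub>F n in sequentially. \<forall>i\<in>Inc \<union> Out. \<forall>t\<in>{0..T}. \<bar>integral {0..t} (\<lambda>t. F n i t 0 - lam i * U n i t 0)\<bar> \<le> r"
proof -
  let ?M = "Inc \<union> Out"
  obtain C where C: "C \<ge> 0" "CV \<le> C"
    "\<forall>\<^sub>F n in sequentially. \<forall>i\<in>?M. \<forall>t\<in>{0..T}. \<forall>x\<in>{0..l i}. \<bar>U n i t x\<bar> \<le> C \<and> \<bar>F n i t x\<bar> \<le> C"
    using uniform_bound .
  define k where "k i = 2 * C / lam i + T * (lam i * C + C) / (lam i * l i)" for i
  have k0: "k i \<ge> 0" if "i \<in> ?M" for i unfolding k_def using arc_pos(1,2)[OF that] C(1) T by auto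
  have "\<forall>\<^sub>F n in sequentially. \<forall>i\<in>?M. eps n * k i < r"
  proof (intro eventually_ball_finite ballI)
    show "finite ?M" using fin by simp
    have "(\<lambda>n. eps n * k i) \<longlonglongrightarrow> 0" for i using eps by (rule tendsto_mult_left_zero)
    then show "\<forall>\<^sub>F n in sequentially. eps n * k i < r" for i using order_tendstoD(2) r by blast
  qed
  with C(3) show ?thesis
  proof eventually_elim
    case (elim n)
    show ?case
    proof (intro ballI)
      fix i t assume i: "i \<in> ?M" and t: "t \<in> {0..T}"
      interpret a: viscous_arc "l i" "lam i" "eps n" "U n i" "P n i" "H n i" using arc[OF i] .
      have "\<bar>integral {0..t} (\<lambda>t. a.F t 0 - lam i * U n i t 0)\<bar> \<le> eps n * (2 * C / lam i + t * (lam i * C + C) / (lam i * l i))"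
        by (rule a.inlet_flux_bound) (use elim(1) i t in \<open>auto simp: arcF[OF i]\<close>)
      also have "\<dots> \<le> eps n * k i"
        unfolding k_def using t C(1) a.e a.l a.lam by (intro mult_left_mono add_left_mono divide_right_mono mult_right_mono) auto
      also have "\<dots> \<le> r" using elim(2) i by (simp add: less_imp_le)
      finally show "\<bar>integral {0..t} (\<lambda>t. F n i t 0 - lam i * U n i t 0)\<bar> \<le> r" unfolding arcF[OF i] .
    qed
  qed
qed

text \<open>The initial error is small by \<open>init\<close>, so on each arc the potential estimate
  leaves a single quantity to control: the time integral of the inlet flux.\<close>

lemma D_small_if_inlet_flux_small:
  assumes i: "i \<in> Inc \<union> Out"
    and flux: "\<And>r. r > 0 \<Longrightarrow> \<forall>\<^sub>F n in sequentially. \<forall>t\<in>{0..T}. \<bar>integral {0..t} (\<lambda>t. F n i t 0) + (W i (- (lam i * t)) - W i 0)\<bar> \<le> r"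
    and r: "r > 0"
  shows "\<forall>\<^sub>F n in sequentially. \<forall>t\<in>{0..T}. \<forall>x\<in>{0..l i}. \<bar>D n i t x\<bar> \<le> r"
proof -
  let ?M = "Inc \<union> Out"
  obtain C where C: "C \<ge> 0" "CV \<le> C"
    "\<forall>\<^sub>F n in sequentially. \<forall>i\<in>?M. \<forall>t\<in>{0..T}. \<forall>x\<in>{0..l i}. \<bar>U n i t x\<bar> \<le> C \<and> \<bar>F n i t x\<bar> \<le> C"
    using uniform_bound .
  show ?thesis
  proof (rule eventually_uniformly_small_from_potential[OF arc_pos(1)[OF i] C(1) T arc_pos(2)[OF i] eps flux _ _ r])
    show "\<forall>\<^sub>F n in sequentially. \<forall>x\<in>{0..l i}. \<bar>integral {0..x} (U n i 0) - (W i x - W i 0)\<bar> \<le> r" if "r > 0" for r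
      using init[OF that] by (rule eventually_mono) (use i in blast)
    show "\<forall>\<^sub>F n in sequentially. \<forall>p q s.
       (\<forall>t\<in>{0..T}. \<bar>integral {0..t} (\<lambda>t. F n i t 0) + (W i (- (lam i * t)) - W i 0)\<bar> \<le> p) \<longrightarrow>
       (\<forall>x\<in>{0..l i}. \<bar>integral {0..x} (U n i 0) - (W i x - W i 0)\<bar> \<le> q) \<longrightarrow> 0 < s \<longrightarrow> s \<le> l i / 2 \<longrightarrow>
       (\<forall>t\<in>{0..T}. \<forall>x\<in>{0..l i}. \<bar>D n i t x\<bar> \<le> 2 * (l i * q + T * lam i * p + 2 * eps n * C * T) / s + 2 * C * s)"
      using C(3)
    proof eventually_elim
      case (elim n)
      interpret a: viscous_arc "l i" "lam i" "eps n" "U n i" "P n i" "H n i" using arc[OF i] .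
      show ?case
      proof (intro allI impI ballI)
        fix p q s t x
        assume h: "\<forall>t\<in>{0..T}. \<bar>integral {0..t} (\<lambda>t. F n i t 0) + (W i (- (lam i * t)) - W i 0)\<bar> \<le> p"
          "\<forall>x\<in>{0..l i}. \<bar>integral {0..x} (U n i 0) - (W i x - W i 0)\<bar> \<le> q" "0 < s" "s \<le> l i / 2" "t \<in> {0..T}" "x \<in> {0..l i}"
        show "\<bar>D n i t x\<bar> \<le> 2 * (l i * q + T * lam i * p + 2 * eps n * C * T) / s + 2 * C * s"
          unfolding D_def arcF[OF i, of n, symmetric]
        proof (rule a.potential_estimate[OF T refl V[OF i]])
          show "\<bar>V i x\<bar> \<le> C" for x using V_bound[OF i, of x] C(2) by linarith
        qed (use h elim i in \<open>auto simp: arcF[OF i]\<close>)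
      qed
    qed
  qed
qed

text \<open>The inlet value is \<open>B i\<close> at positive times, and in the absence of a layer
  there the time integral of the flux approaches \<open>lam i * t * B i\<close>, which is the
  increment of \<open>W i\<close> over negative arguments.\<close>

lemma D_small_inc:
  assumes i: "i \<in> Inc" and r: "r > 0"
  shows "\<forall>\<^sub>F n in sequentially. \<forall>t\<in>{0..T}. \<forall>x\<in>{0..l i}. \<bar>D n i t x\<bar> \<le> r"
proof (rule D_small_if_inlet_flux_small[OF _ _ r])
  show im: "i \<in> Inc \<union> Out" using i by simp
  fix r :: real assume r: "r > 0"
  have z: "0 \<in> {0..l i}" using arc_pos(1)[OF im] by simp
  show "\<forall>\<^sub>F n in sequentially. \<forall>t\<in>{0..T}. \<bar>integral {0..t} (\<lambda>t. F n i t 0) + (W i (- (lam i * t)) - W i 0)\<bar> \<le> r"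
    using inlet_layer_small[OF r]
  proof eventually_elim
    case (elim n)
    show ?case
    proof
      fix t assume t: "t \<in> {0..T}"
      have lt: "0 \<le> lam i * t" "lam i * t \<le> lam i * T" using t arc_pos(2)[OF im] by auto
      have "W i 0 - W i (- (lam i * t)) = integral {- (lam i * t)..0} (V i)"
        using lt arc_pos(1)[OF im] by (intro primitive_on_diff[OF V[OF im]]) auto
      also have "\<dots> = integral {- (lam i * t)..0} (\<lambda>x. B i)" using V_in[OF i] by (intro integral_cong) auto
      also have "\<dots> = lam i * t * B i" using lt by simp
      finally have W: "W i 0 - W i (- (lam i * t)) = lam i * t * B i" .
      have "integral {0..t} (\<lambda>s. U n i s 0) = integral {0..t} (\<lambda>s. B i)"
        by (rule integral_spike[of "{0}"]) (use inlet[OF i] in auto)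
      then have "integral {0..t} (\<lambda>s. lam i * U n i s 0) = lam i * t * B i" using t by simp
      moreover have "integral {0..t} (\<lambda>t. F n i t 0 - lam i * U n i t 0) = integral {0..t} (\<lambda>t. F n i t 0) - integral {0..t} (\<lambda>s. lam i * U n i s 0)"
        by (intro integral_diff flux_integrable[OF im z] integrable_on_mult_right)
      moreover have "\<bar>integral {0..t} (\<lambda>t. F n i t 0 - lam i * U n i t 0)\<bar> \<le> r" using elim im t by blast
      ultimately show "\<bar>integral {0..t} (\<lambda>t. F n i t 0) + (W i (- (lam i * t)) - W i 0)\<bar> \<le> r"
        using W by linarith
    qed
  qed
qed

section \<open>Distribution of the flux at the node and conclusion\<close>

text \<open>With \<open>q = c k * card Inc / lam k\<close> the node condition is
  \<open>(1 + q) * F = c k * S + q * (F - lam k * U)\<close>, and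
  \<open>c k = th * g k * (1 + q)\<close> turns it into \<open>F = th * g k * S\<close> plus
  \<open>rho k\<close> times the inlet defect. Since the \<open>g k\<close> sum to 1, summation
  identifies \<open>th * S\<close> with the total flux, up to defects whose time integrals are
  small.\<close>

lemma outgoing_flux_identity:
  assumes i: "i \<in> Out" and t: "t > 0"
  defines "rho \<equiv> \<lambda>k. (c k * card Inc / lam k) / (1 + c k * card Inc / lam k)"
  shows "F n i t 0 - g i * (\<Sum>j\<in>Inc. F n j t (l j)) =
    rho i * (F n i t 0 - lam i * U n i t 0) - g i * (\<Sum>k\<in>Out. rho k * (F n k t 0 - lam k * U n k t 0))"
proof -
  define S where "S = (\<Sum>j\<in>Inc. U n j t (l j))"
  have one: "F n k t 0 = th * g k * S + rho k * (F n k t 0 - lam k * U n k t 0)" if k: "k \<in> Out" for k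
  proof -
    have lk: "lam k > 0" using arc_pos(2) k by blast
    define q where "q = c k * card Inc / lam k"
    have q: "q \<ge> 0" unfolding q_def using lk c[OF k] by simp
    have f: "F n k t 0 = c k * S - q * (lam k * U n k t 0)"
      using node_out[OF k t, of n] lk by (simp add: F_def S_def q_def sum_distrib_left sum_subtractf right_diff_distrib)
    have "(1 + q) * F n k t 0 = c k * S + q * (F n k t 0 - lam k * U n k t 0)" using f by (simp add: algebra_simps)
    also have "c k = th * g k * (1 + q)" using c_rel[OF k] by (simp add: q_def)
    finally have "F n k t 0 = (th * g k * (1 + q) * S + q * (F n k t 0 - lam k * U n k t 0)) / (1 + q)"
      using q by (simp add: field_simps)
    then have "F n k t 0 = th * g k * S + q / (1 + q) * (F n k t 0 - lam k * U n k t 0)"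
      using q by (simp add: add_divide_distrib)
    then show ?thesis by (simp add: rho_def q_def)
  qed
  have "(\<Sum>j\<in>Inc. F n j t (l j)) = (\<Sum>k\<in>Out. F n k t 0)"
  proof -
    have "(\<Sum>j\<in>Inc. F n j t (l j)) = (\<Sum>j\<in>Inc. \<Sum>k\<in>Out. c k * (U n j t (l j) - U n k t 0))"
      using node_in t by (intro sum.cong refl) (simp add: F_def)
    also have "\<dots> = (\<Sum>k\<in>Out. \<Sum>j\<in>Inc. c k * (U n j t (l j) - U n k t 0))" by (rule sum.swap)
    also have "\<dots> = (\<Sum>k\<in>Out. F n k t 0)" using node_out t by (intro sum.cong refl) (simp add: F_def)
    finally show ?thesis .
  qed
  also have "\<dots> = (\<Sum>k\<in>Out. th * S * g k + rho k * (F n k t 0 - lam k * U n k t 0))"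
    using one by (intro sum.cong refl) (simp add: mult_ac)
  also have "\<dots> = th * S + (\<Sum>k\<in>Out. rho k * (F n k t 0 - lam k * U n k t 0))"
    by (simp add: sum.distrib sum_distrib_left[symmetric] g)
  finally have s: "(\<Sum>j\<in>Inc. F n j t (l j)) = th * S + (\<Sum>k\<in>Out. rho k * (F n k t 0 - lam k * U n k t 0))" .
  show ?thesis unfolding s using one[OF i] by (simp add: algebra_simps)
qed

lemma D_small_out:
  assumes i: "i \<in> Out" and r: "r > 0"
  shows "\<forall>\<^sub>F n in sequentially. \<forall>t\<in>{0..T}. \<forall>x\<in>{0..l i}. \<bar>D n i t x\<bar> \<le> r"
proof (rule D_small_if_inlet_flux_small[OF _ _ r])
  let ?M = "Inc \<union> Out"
  show im: "i \<in> ?M" using i by simp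
  fix r :: real assume r: "r > 0"
  define rho where "rho k = (c k * card Inc / lam k) / (1 + c k * card Inc / lam k)" for k
  \<comment> \<open>The coefficients of \<open>h\<close> in the final error: the defect of the arc
    itself, the defects of all outgoing arcs, and \<open>2 * h\<close> for each incoming
    flux.\<close>
  define A where "A = \<bar>rho i\<bar> + \<bar>g i\<bar> * (\<Sum>k\<in>Out. \<bar>rho k\<bar>) + \<bar>g i\<bar> * (2 * card Inc)"
  have A: "A \<ge> 0" unfolding A_def by (intro add_nonneg_nonneg mult_nonneg_nonneg sum_nonneg) auto
  define h where "h = r / (A + 1)"
  have h: "h > 0" "A * h \<le> r" using r A by (auto simp: h_def field_simps)
  have "\<forall>\<^sub>F n in sequentially. \<forall>j\<in>Inc. \<forall>t\<in>{0..T}. \<forall>x\<in>{0..l j}. \<bar>D n j t x\<bar> \<le> h"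
    using fin D_small_inc[OF _ h(1)] by (intro eventually_ball_finite) auto
  with inlet_layer_small[OF h(1)] init[OF h(1)]
  show "\<forall>\<^sub>F n in sequentially. \<forall>t\<in>{0..T}. \<bar>integral {0..t} (\<lambda>t. F n i t 0) + (W i (- (lam i * t)) - W i 0)\<bar> \<le> r"
  proof eventually_elim
    case (elim n)
    show ?case
    proof
      fix t assume t: "t \<in> {0..T}"
      define d where "d k s = F n k s 0 - lam k * U n k s 0" for k s
      have z: "0 \<in> {0..l k}" "l k \<in> {0..l k}" if "k \<in> ?M" for k using arc_pos(1)[OF that] by auto
      have di: "d k integrable_on {0..t}" if "k \<in> ?M" for k
        unfolding d_def[abs_def] by (intro integrable_diff integrable_on_mult_right flux_integrable that z)
      have dh: "\<bar>integral {0..t} (d k)\<bar> \<le> h" if "k \<in> ?M" for k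
        using elim(1) that t unfolding d_def[abs_def] by blast
      have Fi: "(\<lambda>t. F n k t x) integrable_on {0..t}" if "k \<in> ?M" "x \<in> {0..l k}" for k x
        by (rule flux_integrable[OF that])
      have "integral {0..t} (\<lambda>s. F n i s 0 - g i * (\<Sum>j\<in>Inc. F n j s (l j))) =
          integral {0..t} (\<lambda>s. rho i * d i s - g i * (\<Sum>k\<in>Out. rho k * d k s))"
        by (rule integral_spike[of "{0}"]) (use outgoing_flux_identity[OF i] in \<open>auto simp: d_def rho_def\<close>)
      also have "\<dots> = rho i * integral {0..t} (d i) - g i * (\<Sum>k\<in>Out. rho k * integral {0..t} (d k))"
        using fin im by (simp add: integral_diff integral_sum di integrable_on_mult_right integrable_sum)
      finally have e1: "integral {0..t} (\<lambda>s. F n i s 0 - g i * (\<Sum>j\<in>Inc. F n j s (l j))) =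
          rho i * integral {0..t} (d i) - g i * (\<Sum>k\<in>Out. rho k * integral {0..t} (d k))" .
      have e2: "integral {0..t} (\<lambda>s. F n i s 0 - g i * (\<Sum>j\<in>Inc. F n j s (l j))) =
          integral {0..t} (\<lambda>s. F n i s 0) - g i * (\<Sum>j\<in>Inc. integral {0..t} (\<lambda>s. F n j s (l j)))"
        using fin im z by (simp add: integral_diff integral_sum Fi integrable_on_mult_right integrable_sum)
      \<comment> \<open>Mass balance turns the flux at the node into inlet flux and masses. Compared
        with the profile this leaves the initial error minus \<open>D\<close> at the outlet, each at
        most \<open>h\<close>.\<close>
      have e3: "\<bar>integral {0..t} (\<lambda>s. F n j s (l j)) - (W j (l j) - W j (l j - lam j * t))\<bar> \<le> 2 * h" if j: "j \<in> Inc" for j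
      proof -
        have jm: "j \<in> ?M" using j by simp
        have "integral {0..t} (\<lambda>s. F n j s (l j)) = integral {0..t} (\<lambda>s. F n j s 0) - (integral {0..l j} (U n j t) - integral {0..l j} (U n j 0))"
          using viscous_arc.mass_balance[OF arc[OF jm], of t n] t unfolding arcF[OF jm] by simp
        then have "integral {0..t} (\<lambda>s. F n j s (l j)) - (W j (l j) - W j (l j - lam j * t)) =
            (integral {0..l j} (U n j 0) - (W j (l j) - W j 0)) - D n j t (l j)"
          by (simp add: D_def)
        moreover have "\<bar>D n j t (l j)\<bar> \<le> h" using elim(3) j t z[OF jm] by blast
        moreover have "\<bar>integral {0..l j} (U n j 0) - (W j (l j) - W j 0)\<bar> \<le> h" using elim(2) jm z[OF jm] by blast
        ultimately show ?thesis by linarith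
      qed
      have e4: "W i 0 - W i (- (lam i * t)) = g i * (\<Sum>j\<in>Inc. W j (l j) - W j (l j - lam j * t))"
        using V_out[OF i] t by simp
      have "integral {0..t} (\<lambda>t. F n i t 0) + (W i (- (lam i * t)) - W i 0) =
          rho i * integral {0..t} (d i) - g i * (\<Sum>k\<in>Out. rho k * integral {0..t} (d k))
          + g i * (\<Sum>j\<in>Inc. integral {0..t} (\<lambda>s. F n j s (l j)) - (W j (l j) - W j (l j - lam j * t)))"
        using e1 e2 e4 by (simp add: sum_subtractf right_diff_distrib)
      moreover have "\<bar>rho i * integral {0..t} (d i)\<bar> \<le> \<bar>rho i\<bar> * h"
        using dh[OF im] by (simp add: abs_mult mult_left_mono)
      moreover have "\<bar>g i * (\<Sum>k\<in>Out. rho k * integral {0..t} (d k))\<bar> \<le> \<bar>g i\<bar> * ((\<Sum>k\<in>Out. \<bar>rho k\<bar>) * h)"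
      proof -
        have "\<bar>\<Sum>k\<in>Out. rho k * integral {0..t} (d k)\<bar> \<le> (\<Sum>k\<in>Out. \<bar>rho k * integral {0..t} (d k)\<bar>)" by (rule sum_abs)
        also have "\<dots> \<le> (\<Sum>k\<in>Out. \<bar>rho k\<bar> * h)"
          using dh by (intro sum_mono) (auto simp: abs_mult intro!: mult_left_mono)
        finally show ?thesis by (simp add: abs_mult sum_distrib_right mult_left_mono)
      qed
      moreover have "\<bar>g i * (\<Sum>j\<in>Inc. integral {0..t} (\<lambda>s. F n j s (l j)) - (W j (l j) - W j (l j - lam j * t)))\<bar> \<le> \<bar>g i\<bar> * (2 * card Inc * h)"
      proof -
        have "\<bar>\<Sum>j\<in>Inc. integral {0..t} (\<lambda>s. F n j s (l j)) - (W j (l j) - W j (l j - lam j * t))\<bar>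
            \<le> (\<Sum>j\<in>Inc. \<bar>integral {0..t} (\<lambda>s. F n j s (l j)) - (W j (l j) - W j (l j - lam j * t))\<bar>)" by (rule sum_abs)
        also have "\<dots> \<le> (\<Sum>j\<in>Inc. 2 * h)" by (intro sum_mono e3)
        also have "\<dots> = 2 * card Inc * h" by simp
        finally show ?thesis unfolding abs_mult by (rule mult_left_mono) simp
      qed
      ultimately have "\<bar>integral {0..t} (\<lambda>t. F n i t 0) + (W i (- (lam i * t)) - W i 0)\<bar> \<le>
          \<bar>rho i\<bar> * h + \<bar>g i\<bar> * ((\<Sum>k\<in>Out. \<bar>rho k\<bar>) * h) + \<bar>g i\<bar> * (2 * card Inc * h)" by linarith
      also have "\<dots> = A * h" by (simp add: A_def algebra_simps)
      also have "\<dots> \<le> r" by (rule h(2))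
      finally show "\<bar>integral {0..t} (\<lambda>t. F n i t 0) + (W i (- (lam i * t)) - W i 0)\<bar> \<le> r" .
    qed
  qed
qed

text \<open>The error in \<open>U\<close> has the uniformly small antiderivative
  \<open>D n i t x - D n i t 0\<close>, while its variation is bounded by the gradient estimate and
  by \<open>R\<close>; the estimate by cells combines the two. Times are positive because the
  gradient estimate involves \<open>H\<close>.\<close>

theorem L1_limit:
  assumes r: "r > 0"
  shows "\<forall>\<^sub>F n in sequentially. \<forall>i\<in>Inc \<union> Out. \<forall>t\<in>{0<..T}.
    abs_integral (l i) (\<lambda>x. U n i t x - V i (x - lam i * t)) \<le> r"
proof -
  let ?M = "Inc \<union> Out"
  have finM: "finite ?M" using fin by simp
  obtain C where C: "C \<ge> 0" "CV \<le> C"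
    "\<forall>\<^sub>F n in sequentially. \<forall>i\<in>?M. \<forall>t\<in>{0..T}. \<forall>x\<in>{0..l i}. \<bar>U n i t x\<bar> \<le> C \<and> \<bar>F n i t x\<bar> \<le> C"
    using uniform_bound .
  define K where "K i = l i * ((C1 + (lam i * C + C)) / lam i + 2 * C)" for i
  \<comment> \<open>The number of cells is fixed by the variation alone, before \<open>n\<close>: it
    makes the second part of the cell estimate at most \<open>r / 2\<close>.\<close>
  obtain k :: nat where k: "k > 0" "\<And>i. i \<in> ?M \<Longrightarrow> K i / k \<le> r / 2"
  proof -
    define m where "m = Max (insert 1 (K ` ?M))"
    have m: "m \<ge> 1" "\<And>i. i \<in> ?M \<Longrightarrow> K i \<le> m" unfolding m_def using finM by auto
    obtain k :: nat where kk: "2 * m / r < k" using reals_Archimedean2 by blast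
    have "2 * m / r > 0" using m r by simp
    then have "k > 0" using kk by (smt (verit) of_nat_0_less_iff)
    moreover have "K i / k \<le> r / 2" if "i \<in> ?M" for i
    proof -
      have "2 * m < r * k" using kk r by (simp add: field_simps)
      then show ?thesis using m(2)[OF that] \<open>k > 0\<close> by (simp add: field_simps)
    qed
    ultimately show ?thesis using that by blast
  qed
  \<comment> \<open>The antiderivative is at most \<open>2 * h\<close>, so the first part of the
    cell estimate, \<open>2 * k * (2 * h)\<close>, equals \<open>r / 2\<close>.\<close>
  define h where "h = r / (8 * k)"
  have h: "h > 0" using r k by (simp add: h_def)
  have "\<forall>\<^sub>F n in sequentially. \<forall>i\<in>?M. \<forall>t\<in>{0..T}. \<forall>x\<in>{0..l i}. \<bar>D n i t x\<bar> \<le> h"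
    using finM D_small_inc[OF _ h] D_small_out[OF _ h] by (intro eventually_ball_finite) auto
  with C(3) show ?thesis
  proof eventually_elim
    case (elim n)
    show ?case
    proof (intro ballI)
      fix i t assume i: "i \<in> ?M" and t': "t \<in> {0<..T}"
      then have t: "t > 0" "t \<le> T" "t \<in> {0..T}" by auto
      interpret a: viscous_arc "l i" "lam i" "eps n" "U n i" "P n i" "H n i" using arc[OF i] .
      note hk = set_lebesgue_integral_eq_integral(1)
      define w where "w x = U n i t x - V i (x - lam i * t)" for x
      \<comment> \<open>A nondecreasing bound for the variation of the error: the part of
        \<open>U\<close> plus the part of the shifted profile.\<close>
      define Q where "Q x = abs_integral x (P n i t) + R i (x - lam i * t)" for x
      have inn: "- (lam i * T) \<le> - (lam i * t)" "- (lam i * t) \<le> 0" using t a.lam by auto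
      have Vs: "(\<lambda>x. V i (x - lam i * t)) absolutely_integrable_on {0..l i}"
      proof -
        have "V i absolutely_integrable_on {- (lam i * t)..l i - lam i * t}"
          using inn a.l by (intro absolutely_integrable_subinterval[OF primitive_onD(1)[OF V[OF i]]]) auto
        then show ?thesis using absolutely_integrable_shift[where f = "V i" and a = 0 and c = "lam i * t" and b = "l i"] by simp
      qed
      have Vi: "integral {0..x} (\<lambda>x. V i (x - lam i * t)) = W i (x - lam i * t) - W i (- (lam i * t))" if x: "x \<in> {0..l i}" for x
      proof -
        have "W i (x - lam i * t) - W i (- (lam i * t)) = integral {- (lam i * t)..x - lam i * t} (V i)"
          using inn x by (intro primitive_on_diff[OF V[OF i]]) auto
        also have "\<dots> = integral {0..x} (\<lambda>x. V i (x - lam i * t))"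
        proof -
          have "V i integrable_on {0 - lam i * t..x - lam i * t}"
            using inn x by (intro hk absolutely_integrable_subinterval[OF primitive_onD(1)[OF V[OF i]]]) auto
          from integral_unique[OF has_integral_shift[OF integrable_integral[OF this]]] show ?thesis by simp
        qed
        finally show ?thesis by simp
      qed
      have Ua: "U n i t absolutely_integrable_on {0..l i}" using t by (intro absolutely_integrable_continuous_real a.contUx) simp
      have "abs_integral (l i) w \<le> 2 * real k * (2 * h) + l i / real k * (Q (l i) - Q 0)"
      proof (rule L1_bound_by_primitive_and_variation[OF a.l k(1)])
        show "w absolutely_integrable_on {0..l i}" unfolding w_def[abs_def] using set_integral_diff(1)[OF Ua Vs] .
        show "\<bar>w x - w y\<bar> \<le> Q y - Q x" if xy: "0 \<le> x" "x \<le> y" "y \<le> l i" for x y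
        proof -
          have pU: "primitive_on 0 (l i) (U n i t) (P n i t)"
            using t by (intro primitive_on_of_derivative a.derU a.contPx) auto
          have ip: "(\<lambda>x. \<bar>P n i t x\<bar>) integrable_on {p..q}" "P n i t integrable_on {p..q}" if "0 \<le> p" "q \<le> l i" for p q
            using that t by (auto intro!: integrable_continuous_real continuous_intros continuous_on_subset[OF a.contPx])
          have "\<bar>U n i t y - U n i t x\<bar> \<le> integral {x..y} (\<lambda>x. \<bar>P n i t x\<bar>)"
            unfolding primitive_on_diff[OF pU xy] real_norm_def[symmetric] using xy
            using ip[of x y] by (intro integral_norm_bound_integral) auto
          also have "\<dots> = abs_integral y (P n i t) - abs_integral x (P n i t)"
            using Henstock_Kurzweil_Integration.integral_combine[OF xy(1,2) ip(1)] xy by simp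
          finally show ?thesis using R[OF i, of "x - lam i * t" "y - lam i * t"] xy by (simp add: w_def Q_def)
        qed
        show "\<bar>integral {0..x} w\<bar> \<le> 2 * h" if x: "x \<in> {0..l i}" for x
        proof -
          have "integral {0..x} w = integral {0..x} (U n i t) - integral {0..x} (\<lambda>x. V i (x - lam i * t))"
            unfolding w_def[abs_def] using x
            by (intro integral_diff hk absolutely_integrable_subinterval[OF Ua] absolutely_integrable_subinterval[OF Vs]) auto
          also have "\<dots> = D n i t x - D n i t 0" unfolding Vi[OF x] by (simp add: D_def)
          finally show ?thesis using elim(2) i t(3) x a.l
            by (smt (verit, best) atLeastAtMost_iff)
        qed
      qed
      moreover have Q: "Q (l i) - Q 0 \<le> (C1 + (lam i * C + C)) / lam i + 2 * C"
      proof -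
        have "eps n * \<bar>P n i t (l i)\<bar> \<le> lam i * C + C"
        proof -
          have "eps n * \<bar>P n i t (l i)\<bar> = \<bar>lam i * U n i t (l i) - F n i t (l i)\<bar>"
            using a.e by (simp add: F_def abs_mult)
          also have "\<dots> \<le> lam i * \<bar>U n i t (l i)\<bar> + \<bar>F n i t (l i)\<bar>"
            using a.lam abs_triangle_ineq4[of "lam i * U n i t (l i)" "F n i t (l i)"] by (simp add: abs_mult)
          also have "\<dots> \<le> lam i * C + C" using elim(1) i t(3) a.l a.lam by (intro add_mono mult_left_mono) auto
          finally show ?thesis .
        qed
        then have "(abs_integral (l i) (H n i t) + eps n * \<bar>P n i t (l i)\<bar>) / lam i \<le> (C1 + (lam i * C + C)) / lam i"
          using H_bound[OF i t(1), of n] a.lam by (intro divide_right_mono add_mono) auto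
        then have "abs_integral (l i) (P n i t) \<le> (C1 + (lam i * C + C)) / lam i"
          using a.gradient_bound[OF t(1)] by linarith
        moreover have "R i (l i - lam i * t) - R i (0 - lam i * t) \<le> 2 * C"
          using R_bound[OF i, of "l i - lam i * t"] R_bound[OF i, of "0 - lam i * t"] C(2) by linarith
        ultimately show ?thesis by (simp add: Q_def)
      qed
      then have "l i / real k * (Q (l i) - Q 0) \<le> l i / real k * ((C1 + (lam i * C + C)) / lam i + 2 * C)"
        using a.l by (intro mult_left_mono) auto
      ultimately have "abs_integral (l i) w \<le> 2 * real k * (2 * h) + l i / real k * ((C1 + (lam i * C + C)) / lam i + 2 * C)"
        by linarith
      also have "2 * real k * (2 * h) + l i / real k * ((C1 + (lam i * C + C)) / lam i + 2 * C) = r / 2 + K i / k"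
        using k by (simp add: h_def K_def)
      also have "\<dots> \<le> r" using k(2)[OF i] by linarith
      finally show "abs_integral (l i) (\<lambda>x. U n i t x - V i (x - lam i * t)) \<le> r"
        by (simp add: w_def)
    qed
  qed
qed

end

section \<open>Differences of bounded monotone functions\<close>

text \<open>A bounded Jordan decomposition on the whole line, because profiles are evaluated at
  \<open>x - lam * t\<close>, also outside the arc. Pointwise values with at most countably many
  discontinuities are what traces and Helly's theorem work with.\<close>

definition monotone_difference :: "(real \<Rightarrow> real) \<Rightarrow> bool" where
  "monotone_difference U \<longleftrightarrow> (\<exists>P N. mono P \<and> mono N \<and> bounded (range P) \<and> bounded (range N) \<and> U = (\<lambda>x. P x - N x))"

lemma bounded_range_iff: "bounded (range f) \<longleftrightarrow> (\<exists>C. \<forall>x. \<bar>f x\<bar> \<le> C)" for f :: "real \<Rightarrow> real"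
  by (auto simp: bounded_iff)

lemma monotone_differenceI:
  assumes "mono P" "mono N" "\<And>x. \<bar>P x\<bar> \<le> C" "\<And>x. \<bar>N x\<bar> \<le> C" "\<And>x. U x = P x - N x"
  shows "monotone_difference U"
proof -
  have "bounded (range P)" "bounded (range N)" "U = (\<lambda>x. P x - N x)" using assms by (auto simp: bounded_range_iff)
  then show ?thesis using assms(1,2) unfolding monotone_difference_def by blast
qed

lemma monotone_differenceE:
  assumes "monotone_difference U"
  obtains P N C where "mono P" "mono N" "\<And>x. \<bar>P x\<bar> \<le> C" "\<And>x. \<bar>N x\<bar> \<le> C" "\<And>x. U x = P x - N x"
proof -
  from assms obtain P N c d where *: "mono P" "mono N" "U = (\<lambda>x. P x - N x)" "\<And>x. \<bar>P x\<bar> \<le> c" "\<And>x. \<bar>N x\<bar> \<le> d"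
    unfolding monotone_difference_def bounded_range_iff by blast
  show ?thesis
    by (rule that[of P N "max c d"]) (use * in \<open>auto intro: order_trans[OF _ max.cobounded1] order_trans[OF _ max.cobounded2]\<close>)
qed

lemma monotone_difference_const: "monotone_difference (\<lambda>x. c)"
  by (rule monotone_differenceI[of "\<lambda>_. c" "\<lambda>_. 0" "\<bar>c\<bar>"]) (auto simp: mono_def)

lemma monotone_difference_minus:
  assumes "monotone_difference U" "monotone_difference V"
  shows "monotone_difference (\<lambda>x. U x - V x)"
proof -
  obtain P N c where u: "mono P" "mono N" "\<And>x. \<bar>P x\<bar> \<le> c" "\<And>x. \<bar>N x\<bar> \<le> c" "\<And>x. U x = P x - N x"
    by (rule monotone_differenceE[OF assms(1)]) blast
  obtain P' N' c' where v: "mono P'" "mono N'" "\<And>x. \<bar>P' x\<bar> \<le> c'" "\<And>x. \<bar>N' x\<bar> \<le> c'" "\<And>x. V x = P' x - N' x"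
    by (rule monotone_differenceE[OF assms(2)]) blast
  show ?thesis
  proof (rule monotone_differenceI[of "\<lambda>x. P x + N' x" "\<lambda>x. N x + P' x" "c + c'"])
    show "mono (\<lambda>x. P x + N' x)" "mono (\<lambda>x. N x + P' x)"
      using u v unfolding mono_def by (auto intro: add_mono)
    show "\<bar>P x + N' x\<bar> \<le> c + c'" for x using u(3)[of x] v(4)[of x] by linarith
    show "\<bar>N x + P' x\<bar> \<le> c + c'" for x using u(4)[of x] v(3)[of x] by linarith
  qed (use u v in auto)
qed

lemma monotone_difference_add:
  assumes "monotone_difference U" "monotone_difference V"
  shows "monotone_difference (\<lambda>x. U x + V x)"
  using monotone_difference_minus[OF assms(1) monotone_difference_minus[OF monotone_difference_const[of 0] assms(2)]]
  by simp

lemma monotone_difference_sum: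
  assumes "\<And>i. i \<in> I \<Longrightarrow> monotone_difference (U i)"
  shows "monotone_difference (\<lambda>x. \<Sum>i\<in>I. U i x)"
  using assms by (induction I rule: infinite_finite_induct)
    (auto intro: monotone_difference_const monotone_difference_add)

lemma monotone_difference_mult:
  assumes "monotone_difference U"
  shows "monotone_difference (\<lambda>x. c * U x)"
proof -
  have pos: "monotone_difference (\<lambda>x. c * U x)" if "c \<ge> 0" for c
  proof -
    obtain P N d where u: "mono P" "mono N" "\<And>x. \<bar>P x\<bar> \<le> d" "\<And>x. \<bar>N x\<bar> \<le> d" "\<And>x. U x = P x - N x"
      by (rule monotone_differenceE[OF assms]) blast
    show ?thesis
      by (rule monotone_differenceI[of "\<lambda>x. c * P x" "\<lambda>x. c * N x" "c * d"])
        (use u that in \<open>auto simp: mono_def abs_mult right_diff_distrib intro!: mult_left_mono\<close>)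
  qed
  show ?thesis
  proof (cases "c \<ge> 0")
    case False
    then have "monotone_difference (\<lambda>x. 0 - (- c) * U x)"
      by (intro monotone_difference_minus monotone_difference_const pos) simp
    then show ?thesis by simp
  qed (rule pos)
qed

lemma monotone_difference_affine:
  assumes "monotone_difference U"
  shows "monotone_difference (\<lambda>x. U (a * x + b))"
proof -
  obtain P N d where u: "mono P" "mono N" "\<And>x. \<bar>P x\<bar> \<le> d" "\<And>x. \<bar>N x\<bar> \<le> d" "\<And>x. U x = P x - N x"
    by (rule monotone_differenceE[OF assms]) blast
  show ?thesis
  proof (cases "a \<ge> 0")
    case True
    show ?thesis
      by (rule monotone_differenceI[of "\<lambda>x. P (a * x + b)" "\<lambda>x. N (a * x + b)" d])
        (use u True in \<open>auto intro!: monoI mult_left_mono monoD[OF u(1)] monoD[OF u(2)]\<close>)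
  next
    case False
    show ?thesis
      by (rule monotone_differenceI[of "\<lambda>x. - N (a * x + b)" "\<lambda>x. - P (a * x + b)" d])
        (use u False in \<open>auto intro!: monoI mult_left_mono_neg monoD[OF u(1)] monoD[OF u(2)]\<close>)
  qed
qed

lemma monotone_difference_if:
  assumes "monotone_difference U" "monotone_difference V"
  shows "monotone_difference (\<lambda>x. if x > c then U x else V x)"
proof -
  have cut: "monotone_difference (\<lambda>x. if x > c then U x else 0)" if mU: "monotone_difference U" for U
  proof -
    obtain P N d where u: "mono P" "mono N" "\<And>x. \<bar>P x\<bar> \<le> d" "\<And>x. \<bar>N x\<bar> \<le> d" "\<And>x. U x = P x - N x"
      by (rule monotone_differenceE[OF mU]) blast
    \<comment> \<open>Adding \<open>d\<close> makes both parts nonnegative, so that replacing them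
      by 0 on the left keeps them monotone; the two shifts cancel in the difference.\<close>
    have nn: "0 \<le> P x + d" "0 \<le> N x + d" "P x + d \<le> 2 * d" "N x + d \<le> 2 * d" for x
      using u(3)[of x] u(4)[of x] by linarith+
    have d: "d \<ge> 0" using u(3)[of 0] by linarith
    show ?thesis
    proof (rule monotone_differenceI[of "\<lambda>x. if x > c then P x + d else 0" "\<lambda>x. if x > c then N x + d else 0" "2 * d"])
      show "mono (\<lambda>x. if x > c then P x + d else 0)" "mono (\<lambda>x. if x > c then N x + d else 0)"
        using u(1,2) nn unfolding mono_def by auto
    qed (use u nn d in auto)
  qed
  have "monotone_difference (\<lambda>x. (if x > c then U x else 0) + (V x - (if x > c then V x else 0)))"
    by (intro monotone_difference_add monotone_difference_minus cut assms)
  moreover have "(\<lambda>x. (if x > c then U x else 0) + (V x - (if x > c then V x else 0))) = (\<lambda>x. if x > c then U x else V x)"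
    by auto
  ultimately show ?thesis by simp
qed

lemma monotone_difference_measurable: "monotone_difference U \<Longrightarrow> U \<in> borel_measurable borel"
  by (auto simp: monotone_difference_def dest!: borel_measurable_mono)

lemma monotone_difference_bounded:
  assumes "monotone_difference U"
  obtains C where "\<And>x. \<bar>U x\<bar> \<le> C"
proof -
  obtain P N d where u: "mono P" "mono N" "\<And>x. \<bar>P x\<bar> \<le> d" "\<And>x. \<bar>N x\<bar> \<le> d" "\<And>x. U x = P x - N x"
    by (rule monotone_differenceE[OF assms]) blast
  have "\<bar>U x\<bar> \<le> 2 * d" for x unfolding u(5) using u(3)[of x] u(4)[of x] by linarith
  then show ?thesis by (rule that)
qed

lemma monotone_difference_variation:
  assumes "monotone_difference U"
  obtains R C where "\<And>x y. x \<le> y \<Longrightarrow> \<bar>U x - U y\<bar> \<le> R y - R x" "\<And>x. \<bar>R x\<bar> \<le> C"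
proof -
  obtain P N d where u: "mono P" "mono N" "\<And>x. \<bar>P x\<bar> \<le> d" "\<And>x. \<bar>N x\<bar> \<le> d" "\<And>x. U x = P x - N x"
    by (rule monotone_differenceE[OF assms]) blast
  show ?thesis
  proof (rule that[of "\<lambda>x. P x + N x" "2 * d"])
    show "\<bar>U x - U y\<bar> \<le> P y + N y - (P x + N x)" if "x \<le> y" for x y
      using monoD[OF u(1) that] monoD[OF u(2) that] u(5)[of x] u(5)[of y] by linarith
    show "\<bar>P x + N x\<bar> \<le> 2 * d" for x using u(3)[of x] u(4)[of x] by linarith
  qed
qed

lemma monotone_difference_continuity:
  assumes "monotone_difference U"
  shows "countable {x. \<not> isCont U x}"
proof -
  obtain P N d where u: "mono P" "mono N" "\<And>x. \<bar>P x\<bar> \<le> d" "\<And>x. \<bar>N x\<bar> \<le> d" "\<And>x. U x = P x - N x"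
    by (rule monotone_differenceE[OF assms]) blast
  have "U = (\<lambda>x. P x - N x)" using u(5) by auto
  then have "{x. \<not> isCont U x} \<subseteq> {x. \<not> isCont P x} \<union> {x. \<not> isCont N x}" by auto
  then show ?thesis using mono_ctble_discont[OF u(1)] mono_ctble_discont[OF u(2)] countable_subset countable_Un by metis
qed

section \<open>Test functions and bounded variation on a rectangle\<close>

lemma bounded_borel_absolutely_integrable:
  fixes f :: "'a::euclidean_space \<Rightarrow> real"
  assumes f: "f \<in> borel_measurable borel" and b: "\<And>x. x \<in> S \<Longrightarrow> \<bar>f x\<bar> \<le> C" and S: "S \<in> lmeasurable"
  shows "f absolutely_integrable_on S"
proof (rule measurable_bounded_by_integrable_imp_absolutely_integrable)
  have "f \<in> borel_measurable lebesgue" using f by (simp add: measurable_completion)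
  then show "f \<in> borel_measurable (lebesgue_on S)" by (simp add: measurable_restrict_space1)
  show "S \<in> sets lebesgue" using S by blast
  show "(\<lambda>x. C) integrable_on S" using S by (simp add: integrable_on_const)
qed (use b in auto)

lemma integrable_indicator_Icc: "integrable lborel (indicat_real {a..b::real})"
  by (intro integrable_real_indicator) (auto simp: emeasure_lborel_Icc_eq)

text \<open>The derivative is a limit of difference quotients, which can be moved to the monotone factor by translation.\<close>
lemma mono_test_integral_bound:
  fixes M \<psi> :: "real \<Rightarrow> real"
  assumes M: "mono M" "\<And>x. \<bar>M x\<bar> \<le> C" and \<psi>: "\<And>x. (\<psi> has_real_derivative \<psi>' x) (at x)" and c: "continuous_on UNIV \<psi>'"
    and supp: "\<And>x. x \<notin> {a..b} \<Longrightarrow> \<psi> x = 0" and b1: "\<And>x. \<bar>\<psi> x\<bar> \<le> 1" and ab: "a < b"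
  shows "\<bar>LINT x|lborel. M x * \<psi>' x\<bar> \<le> 2 * C"
proof -
  have C0: "C \<ge> 0" using M(2)[of 0] by linarith
  have [measurable]: "M \<in> borel_measurable borel" using M(1) by (rule borel_measurable_mono)
  have c\<psi>: "continuous_on UNIV \<psi>" using \<psi> by (intro DERIV_continuous_on) auto
  have [measurable]: "\<psi> \<in> borel_measurable borel" "\<psi>' \<in> borel_measurable borel"
    using c\<psi> c borel_measurable_continuous_onI by blast+
  obtain K where K: "\<And>x. x \<in> {a - 1..b + 1} \<Longrightarrow> \<bar>\<psi>' x\<bar> \<le> K" "K \<ge> 0"
  proof -
    have "compact (\<psi>' ` {a - 1..b + 1})" using c continuous_on_subset by (intro compact_continuous_image) auto
    then have "bounded (\<psi>' ` {a - 1..b + 1})" by (rule compact_imp_bounded)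
    then obtain K where "\<forall>x\<in>{a - 1..b + 1}. \<bar>\<psi>' x\<bar> \<le> K" by (auto simp: bounded_iff)
    then show ?thesis using that[of "max K 0"] by fastforce
  qed
  have supp': "\<psi>' x = 0" if "x \<notin> {a..b}" for x
  proof -
    have "((\<lambda>x. 0) has_real_derivative \<psi>' x) (at x)"
      by (rule has_field_derivative_transform_within_open[OF \<psi>, of "- {a..b}"]) (use that supp in auto)
    then show ?thesis using DERIV_unique DERIV_const by blast
  qed
  \<comment> \<open>Steps of at most 1 keep the supports of all difference quotients inside
    \<open>{a - 1..b + 1}\<close>, where one constant dominates them.\<close>
  define h where "h n = min 1 (b - a) * inverse (real (Suc n))" for n :: nat
  have h: "h n > 0" "h n \<le> 1" "h n \<le> b - a" for n
  proof -
    have i: "0 < inverse (real (Suc n))" "inverse (real (Suc n)) \<le> 1" by (auto simp: field_simps)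
    then have "h n \<le> min 1 (b - a) * 1" unfolding h_def using ab by (intro mult_left_mono) auto
    then show "h n \<le> 1" "h n \<le> b - a" by auto
    show "h n > 0" unfolding h_def using i ab by simp
  qed
  have hlim: "h \<longlonglongrightarrow> 0" unfolding h_def
    using tendsto_mult_right_zero[OF LIMSEQ_inverse_real_of_nat] by blast
  define q where "q n x = (\<psi> (x + h n) - \<psi> x) / h n" for n x
  have qb: "\<bar>q n x\<bar> \<le> K * indicator {a - 1..b + 1} x" for n x
  proof (cases "x \<in> {a - 1..b}")
    case True
    have "\<bar>\<psi> (x + h n) - \<psi> x\<bar> \<le> K * (x + h n - x)"
      using h[of n] True K by (intro diff_le_if_derivative_le[where g' = \<psi>'] \<psi> continuous_on_subset[OF c\<psi>]) auto
    then show ?thesis using True h[of n] by (simp add: q_def field_simps)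
  next
    case False
    then have "x \<notin> {a..b}" "x + h n \<notin> {a..b}" using h[of n] by auto
    then show ?thesis using supp K(2) by (simp add: q_def)
  qed
  have qlim: "(\<lambda>n. q n x) \<longlonglongrightarrow> \<psi>' x" for x
  proof -
    have "((\<lambda>k. (\<psi> (x + k) - \<psi> x) / k) \<longlongrightarrow> \<psi>' x) (at 0)" using \<psi>[of x] by (simp add: DERIV_def)
    moreover have "filterlim h (at 0) sequentially" using hlim h(1) by (auto simp: filterlim_at less_imp_neq[symmetric])
    ultimately show ?thesis unfolding q_def by (rule filterlim_compose)
  qed
  have dom: "integrable lborel (\<lambda>x. C * (K * indicator {a - 1..b + 1} x))"
    by (intro integrable_mult_right integrable_indicator_Icc)
  have [measurable]: "q n \<in> borel_measurable borel" for n unfolding q_def[abs_def] by measurable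
  have lim: "(\<lambda>n. LINT x|lborel. M x * q n x) \<longlonglongrightarrow> (LINT x|lborel. M x * \<psi>' x)"
  proof (rule integral_dominated_convergence[OF _ _ dom])
    show "AE x in lborel. (\<lambda>n. M x * q n x) \<longlonglongrightarrow> M x * \<psi>' x" using qlim by (auto intro!: tendsto_intros)
    show "AE x in lborel. norm (M x * q n x) \<le> C * (K * indicator {a - 1..b + 1} x)" for n
      using M(2) qb C0 by (auto simp: abs_mult intro!: mult_mono)
  qed auto
  have bound: "\<bar>LINT x|lborel. M x * q n x\<bar> \<le> 2 * C" for n
  proof -
    let ?h = "h n"
    let ?I = "indicator {a..b} :: real \<Rightarrow> real"
    have i\<psi>: "integrable lborel (\<lambda>x. f x * \<psi> x)" if f: "f \<in> borel_measurable borel" "\<And>x. \<bar>f x\<bar> \<le> C" for f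
    proof (rule Bochner_Integration.integrable_bound)
      show "integrable lborel (\<lambda>x. C * ?I x)" by (intro integrable_mult_right integrable_indicator_Icc)
      show "(\<lambda>x. f x * \<psi> x) \<in> borel_measurable lborel" using f(1) by measurable
      show "AE x in lborel. norm (f x * \<psi> x) \<le> norm (C * ?I x)"
        using f(2) b1 supp C0 by (auto simp: abs_mult indicator_def intro!: mult_mono[of _ C _ 1, simplified])
    qed
    have iI: "integrable lborel (\<lambda>x. f x * ?I x)" if f: "f \<in> borel_measurable borel" "\<And>x. \<bar>f x\<bar> \<le> C" for f
    proof (rule Bochner_Integration.integrable_bound)
      show "integrable lborel (\<lambda>x. C * ?I x)" by (intro integrable_mult_right integrable_indicator_Icc)
      show "(\<lambda>x. f x * ?I x) \<in> borel_measurable lborel" using f(1) by measurable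
      show "AE x in lborel. norm (f x * ?I x) \<le> norm (C * ?I x)"
        using f(2) C0 by (auto simp: abs_mult indicator_def)
    qed
    have s\<psi>: "integrable lborel (\<lambda>x. M x * \<psi> (x + ?h))" "(LINT x|lborel. M x * \<psi> (x + ?h)) = (LINT x|lborel. M (x - ?h) * \<psi> x)"
      using lborel_integrable_real_affine[OF i\<psi>[of "\<lambda>x. M (x - ?h)"], of 1 ?h] M(2)
        lborel_integral_real_affine[of 1 "\<lambda>x. M (x - ?h) * \<psi> x" ?h] by (auto simp: add.commute)
    have sI: "integrable lborel (\<lambda>x. M x * ?I (x + ?h))" "(LINT x|lborel. M x * ?I (x + ?h)) = (LINT x|lborel. M (x - ?h) * ?I x)"
      using lborel_integrable_real_affine[OF iI[of "\<lambda>x. M (x - ?h)"], of 1 ?h] M(2)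
        lborel_integral_real_affine[of 1 "\<lambda>x. M (x - ?h) * ?I x" ?h] by (auto simp: add.commute)
    have "?h * (LINT x|lborel. M x * q n x) = (LINT x|lborel. M x * \<psi> (x + ?h) - M x * \<psi> x)"
      using h(1)[of n] unfolding integral_mult_right_zero[symmetric]
      by (intro Bochner_Integration.integral_cong refl) (simp add: q_def field_simps)
    also have "\<dots> = (LINT x|lborel. (M (x - ?h) - M x) * \<psi> x)"
      using s\<psi> i\<psi>[of M] i\<psi>[of "\<lambda>x. M (x - ?h)"] M(2)
      by (simp add: Bochner_Integration.integral_diff left_diff_distrib)
    finally have e1: "?h * (LINT x|lborel. M x * q n x) = (LINT x|lborel. (M (x - ?h) - M x) * \<psi> x)" .
    \<comment> \<open>Monotonicity gives \<open>M (x - h) - M x\<close> a constant sign, so the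
      absolute value is an exact difference; translating it onto the indicator of
      \<open>{a..b}\<close> leaves two intervals of length \<open>h\<close>.\<close>
    have "\<bar>LINT x|lborel. (M (x - ?h) - M x) * \<psi> x\<bar> \<le> (LINT x|lborel. (M x - M (x - ?h)) * ?I x)"
    proof (rule integral_abs_bound[THEN order_trans], rule integral_mono_AE)
      show "integrable lborel (\<lambda>x. \<bar>(M (x - ?h) - M x) * \<psi> x\<bar>)"
        using i\<psi>[of M] i\<psi>[of "\<lambda>x. M (x - ?h)"] M(2) by (intro integrable_abs) (simp add: left_diff_distrib)
      show "integrable lborel (\<lambda>x. (M x - M (x - ?h)) * ?I x)"
        using iI[of M] iI[of "\<lambda>x. M (x - ?h)"] M(2) by (simp add: left_diff_distrib)
      have "M (x - ?h) \<le> M x" for x using h(1)[of n] by (intro monoD[OF M(1)]) simp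
      then show "AE x in lborel. \<bar>(M (x - ?h) - M x) * \<psi> x\<bar> \<le> (M x - M (x - ?h)) * ?I x"
        using b1 supp by (auto simp: abs_mult indicator_def intro!: mult_left_le)
    qed
    also have "\<dots> = (LINT x|lborel. M x * (?I x - ?I (x + ?h)))"
      using iI[of M] iI[of "\<lambda>x. M (x - ?h)"] M(2) sI by (simp add: Bochner_Integration.integral_diff algebra_simps)
    also have "\<dots> \<le> (LINT x|lborel. C * (indicator {a - ?h..a} x + indicator {b - ?h..b} x))"
    proof (rule integral_mono)
      show "integrable lborel (\<lambda>x. M x * (?I x - ?I (x + ?h)))"
        using iI[of M] M(2) sI by (simp add: algebra_simps)
      show "integrable lborel (\<lambda>x. C * (indicator {a - ?h..a} x + indicator {b - ?h..b} x))"
        by (intro integrable_mult_right Bochner_Integration.integrable_add integrable_indicator_Icc)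
      fix x
      have "\<bar>?I x - ?I (x + ?h)\<bar> \<le> indicator {a - ?h..a} x + indicator {b - ?h..b} x"
        using h[of n] by (auto simp: indicator_def)
      then have "\<bar>M x\<bar> * \<bar>?I x - ?I (x + ?h)\<bar> \<le> C * (indicator {a - ?h..a} x + indicator {b - ?h..b} x)"
        using M(2) C0 by (intro mult_mono) auto
      then show "M x * (?I x - ?I (x + ?h)) \<le> C * (indicator {a - ?h..a} x + indicator {b - ?h..b} x)"
        unfolding abs_mult[symmetric] by linarith
    qed
    also have "\<dots> = 2 * C * ?h" using h(1)[of n] by (simp add: algebra_simps)
    finally have "?h * \<bar>LINT x|lborel. M x * q n x\<bar> \<le> ?h * (2 * C)"
      unfolding e1[symmetric] using h(1)[of n] by (simp add: abs_mult mult_ac)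
    then show ?thesis using h(1)[of n] by simp
  qed
  show ?thesis
    by (rule LIMSEQ_le_const2[OF tendsto_rabs[OF lim]]) (use bound in auto)
qed

text \<open>The field \<open>D\<close> vanishes off the support: at interior points by uniqueness of
  derivatives, at the remaining points of \<open>S\<close> by continuity, as limits of interior
  points. Extension by zero is then continuously differentiable relative to \<open>Q\<close>, so
  half-open rectangles, where test functions may be nonzero on two sides, are covered.\<close>

lemma C1c_on_extension:
  fixes \<phi> :: "'a::euclidean_space \<Rightarrow> 'b::euclidean_space"
  assumes \<phi>: "C1c_on S \<phi> D" and S: "S = Q \<inter> G" "open G" "S \<subseteq> closure (interior S)"
  defines "\<phi>' \<equiv> \<lambda>z. if z \<in> S then \<phi> z else 0" and "D' \<equiv> \<lambda>z h. if z \<in> S then D z h else 0"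
  obtains K where "compact K" "K \<subseteq> S" "\<And>z. z \<notin> K \<Longrightarrow> \<phi>' z = 0" "\<And>z h. z \<notin> K \<Longrightarrow> D' z h = 0"
    "\<And>z. z \<in> Q \<Longrightarrow> (\<phi>' has_derivative D' z) (at z within Q)" "\<And>h. continuous_on Q (\<lambda>z. D' z h)"
proof -
  obtain K where K: "compact K" "K \<subseteq> S" "\<And>x. x \<in> S - K \<Longrightarrow> \<phi> x = 0"
    using \<phi> unfolding C1c_on_def by blast
  have oK: "open (- K)" using K(1) compact_imp_closed by blast
  have d: "\<And>x. x \<in> S \<Longrightarrow> (\<phi> has_derivative D x) (at x within S)" and c: "\<And>h. continuous_on S (\<lambda>x. D x h)"
    using \<phi> unfolding C1c_on_def by auto
  have D0i: "D z h = 0" if z: "z \<in> interior S - K" for z h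
  proof -
    have zS: "z \<in> S" using z interior_subset by blast
    have "(\<phi> has_derivative D z) (at z)" using d[OF zS] at_within_interior[of z S] z by simp
    moreover have "(\<phi> has_derivative (\<lambda>_. 0)) (at z)"
      by (rule has_derivative_transform_within_open[of "\<lambda>_. 0" _ _ _ "interior S - K"])
        (use z K(3) oK interior_subset in \<open>auto simp: open_Diff[OF open_interior compact_imp_closed[OF K(1)]]\<close>)
    ultimately have "D z = (\<lambda>_. 0)" by (rule has_derivative_unique)
    then show ?thesis by simp
  qed
  have D0: "D z h = 0" if z: "z \<in> S - K" for z h
  proof (rule ccontr)
    assume nz: "D z h \<noteq> 0"
    have "((\<lambda>x. D x h) \<longlongrightarrow> D z h) (at z within S)" using c[of h] z by (auto simp: continuous_on_def)
    then have "\<forall>\<^sub>F x in at z within S. dist (D x h) (D z h) < norm (D z h)" using nz by (intro tendstoD) auto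
    then obtain r where r: "r > 0" "\<And>x. x \<in> S \<Longrightarrow> x \<noteq> z \<Longrightarrow> dist x z < r \<Longrightarrow> dist (D x h) (D z h) < norm (D z h)"
      unfolding eventually_at by blast
    obtain r' where r': "r' > 0" "ball z r' \<subseteq> - K" using oK z unfolding open_contains_ball by blast
    have "z \<in> closure (interior S)" using S(3) z by blast
    then obtain x where x: "x \<in> interior S" "dist x z < min r r'"
      using r(1) r'(1) unfolding closure_approachable by (metis min_less_iff_conj)
    have xK: "x \<notin> K" using x(2) r'(2) by (auto simp: subset_eq dist_commute)
    have "D x h = 0" using D0i x xK by blast
    moreover have "x \<in> S" using x(1) interior_subset by blast
    ultimately show False using r(2)[of x] x(2) nz by (cases "x = z") (auto simp: dist_norm)
  qed
  have \<phi>0: "\<phi>' z = 0" "D' z h = 0" if "z \<notin> K" for z h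
    using that K(3) D0 by (auto simp: \<phi>'_def D'_def)
  have der: "(\<phi>' has_derivative D' z) (at z within Q)" if z: "z \<in> Q" for z
  proof (cases "z \<in> K")
    case True
    then have zS: "z \<in> S" using K(2) by blast
    have "(\<phi>' has_derivative D z) (at z within S)"
      by (rule has_derivative_transform[OF zS _ d[OF zS]]) (simp add: \<phi>'_def)
    moreover have "at z within S = at z within Q"
      by (rule at_within_nhd[of z G]) (use zS S in auto)
    ultimately show ?thesis using zS by (simp add: D'_def)
  next
    case False
    then obtain r where r: "r > 0" "ball z r \<subseteq> - K" using oK unfolding open_contains_ball by blast
    have "((\<lambda>_. 0) has_derivative (\<lambda>_. 0)) (at z within Q)" by simp
    then have "(\<phi>' has_derivative (\<lambda>_. 0)) (at z within Q)"
    proof (rule has_derivative_transform_within[OF _ r(1) z])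
      show "0 = \<phi>' x" if "x \<in> Q" "dist x z < r" for x
        using that r(2) \<phi>0(1)[of x] by (auto simp: subset_eq dist_commute)
    qed
    moreover have "D' z = (\<lambda>_. 0)" using \<phi>0(2)[OF False] by auto
    ultimately show ?thesis by simp
  qed
  have cont: "continuous_on Q (\<lambda>z. D' z h)" for h
  proof -
    have Q: "S \<union> (Q \<inter> - K) = Q" using S(1) K(2) by blast
    have "continuous_on (S \<union> (Q \<inter> - K)) (\<lambda>z. D' z h)"
    proof (rule continuous_on_Un_local_open)
      show "openin (top_of_set (S \<union> (Q \<inter> - K))) S"
        unfolding Q unfolding S(1) using S(2) by (simp add: openin_open_Int)
      show "openin (top_of_set (S \<union> (Q \<inter> - K))) (Q \<inter> - K)"
        unfolding Q using oK by (rule openin_open_Int)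
      show "continuous_on S (\<lambda>z. D' z h)" using c[of h] by (rule continuous_on_eq) (simp add: D'_def)
      have "continuous_on (Q \<inter> - K) (\<lambda>z. 0::'b)" by simp
      then show "continuous_on (Q \<inter> - K) (\<lambda>z. D' z h)" by (rule continuous_on_eq) (use \<phi>0 in auto)
    qed
    then show ?thesis unfolding Q .
  qed
  show ?thesis by (rule that[OF K(1,2) \<phi>0 der cont])
qed

lemma has_vector_derivative_along_line:
  assumes "(f has_derivative D) (at (p + s *\<^sub>R v) within Q)" "\<And>s. s \<in> A \<Longrightarrow> p + s *\<^sub>R v \<in> Q"
  shows "((\<lambda>s. f (p + s *\<^sub>R v)) has_vector_derivative D v) (at s within A)"
proof -
  have g: "((\<lambda>s. p + s *\<^sub>R v) has_derivative (\<lambda>h. h *\<^sub>R v)) (at s within A)"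
    by (auto intro!: derivative_eq_intros)
  have "(f has_derivative D) (at (p + s *\<^sub>R v) within (\<lambda>s. p + s *\<^sub>R v) ` A)"
    using assms by (intro has_derivative_subset[OF assms(1)]) auto
  from diff_chain_within[OF g this] have "((\<lambda>s. f (p + s *\<^sub>R v)) has_derivative (\<lambda>h. D (h *\<^sub>R v))) (at s within A)"
    by (simp add: o_def)
  moreover have "D (h *\<^sub>R v) = h *\<^sub>R D v" for h
    using has_derivative_linear[OF assms(1)] by (rule linear_scale)
  ultimately show ?thesis by (simp add: has_vector_derivative_def)
qed

text \<open>The constant does not depend on \<open>p\<close> and \<open>q\<close>: an affine
  substitution keeps monotonicity, up to a sign when \<open>p < 0\<close>. Each of the two monotone
  parts costs \<open>2 * d\<close>. The uniformity is what permits integration over slices.\<close>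

lemma monotone_difference_test_integral:
  assumes "monotone_difference V"
  obtains C where "\<And>p q a b \<psi> \<psi>'. (\<And>x. (\<psi> has_real_derivative \<psi>' x) (at x)) \<Longrightarrow> continuous_on UNIV \<psi>' \<Longrightarrow>
    (\<And>x. x \<notin> {a..b} \<Longrightarrow> \<psi> x = 0) \<Longrightarrow> (\<And>x. \<bar>\<psi> x\<bar> \<le> 1) \<Longrightarrow> a < b \<Longrightarrow>
    (LINT x|lborel. V (p * x + q) * \<psi>' x) \<le> C" "C \<ge> 0"
proof -
  obtain P N d where u: "mono P" "mono N" "\<And>x. \<bar>P x\<bar> \<le> d" "\<And>x. \<bar>N x\<bar> \<le> d" "\<And>x. V x = P x - N x"
    by (rule monotone_differenceE[OF assms]) blast
  have d0: "d \<ge> 0" using u(3)[of 0] by linarith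
  show ?thesis
  proof (rule that[of "4 * d"])
    fix p q a b and \<psi> \<psi>' :: "real \<Rightarrow> real"
    assume \<psi>: "\<And>x. (\<psi> has_real_derivative \<psi>' x) (at x)" "continuous_on UNIV \<psi>'"
      "\<And>x. x \<notin> {a..b} \<Longrightarrow> \<psi> x = 0" "\<And>x. \<bar>\<psi> x\<bar> \<le> 1" "a < b"
    have one: "\<bar>LINT x|lborel. M (p * x + q) * \<psi>' x\<bar> \<le> 2 * d" if M: "mono M" "\<And>x. \<bar>M x\<bar> \<le> d" for M
    proof (cases "p \<ge> 0")
      case True
      have "mono (\<lambda>x. M (p * x + q))" using True by (auto intro!: monoI monoD[OF M(1)] mult_left_mono)
      from mono_test_integral_bound[OF this M(2) \<psi>] show ?thesis .
    next
      case False
      have "mono (\<lambda>x. - M (p * x + q))" using False by (auto intro!: monoI monoD[OF M(1)] mult_left_mono_neg)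
      then have "\<bar>LINT x|lborel. - M (p * x + q) * \<psi>' x\<bar> \<le> 2 * d"
        using M(2) by (intro mono_test_integral_bound[OF _ _ \<psi>]) auto
      then show ?thesis by simp
    qed
    have i: "integrable lborel (\<lambda>x. M (p * x + q) * \<psi>' x)" if M: "mono M" "\<And>x. \<bar>M x\<bar> \<le> d" for M
    proof -
      have supp': "\<psi>' x = 0" if "x \<notin> {a..b}" for x
      proof -
        have "((\<lambda>x. 0) has_real_derivative \<psi>' x) (at x)"
          by (rule has_field_derivative_transform_within_open[OF \<psi>(1), of "- {a..b}"]) (use that \<psi>(3) in auto)
        then show ?thesis using DERIV_unique DERIV_const by blast
      qed
      obtain K where K: "\<And>x. x \<in> {a..b} \<Longrightarrow> \<bar>\<psi>' x\<bar> \<le> K"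
      proof -
        have "compact (\<psi>' ` {a..b})" using \<psi>(2) continuous_on_subset by (intro compact_continuous_image) auto
        then have "bounded (\<psi>' ` {a..b})" by (rule compact_imp_bounded)
        then obtain K where "\<forall>x\<in>{a..b}. \<bar>\<psi>' x\<bar> \<le> K" by (auto simp: bounded_iff)
        then show ?thesis using that[of K] by auto
      qed
      have [measurable]: "M \<in> borel_measurable borel" "\<psi>' \<in> borel_measurable borel"
        using M(1) \<psi>(2) borel_measurable_mono borel_measurable_continuous_onI by blast+
      show ?thesis
      proof (rule Bochner_Integration.integrable_bound)
        show "integrable lborel (\<lambda>x. (d * K) * indicator {a..b} x)" by (intro integrable_mult_right integrable_indicator_Icc)
        show "AE x in lborel. norm (M (p * x + q) * \<psi>' x) \<le> norm (d * K * indicator {a..b} x)"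
        proof (rule AE_I2)
          fix x
          show "norm (M (p * x + q) * \<psi>' x) \<le> norm (d * K * indicator {a..b} x)"
          proof (cases "x \<in> {a..b}")
            case True
            have "\<bar>M (p * x + q)\<bar> * \<bar>\<psi>' x\<bar> \<le> d * K" using M(2) K[OF True] d0 by (intro mult_mono) auto
            moreover have "d * K \<le> \<bar>d * K\<bar>" by (rule abs_ge_self)
            ultimately show ?thesis using True by (simp add: abs_mult)
          qed (simp add: supp')
        qed
      qed auto
    qed
    have "(LINT x|lborel. V (p * x + q) * \<psi>' x) = (LINT x|lborel. P (p * x + q) * \<psi>' x) - (LINT x|lborel. N (p * x + q) * \<psi>' x)"
      using i[OF u(1,3)] i[OF u(2,4)] by (simp add: u(5) left_diff_distrib Bochner_Integration.integral_diff)
    also have "\<dots> \<le> 4 * d" using one[OF u(1,3)] one[OF u(2,4)] by linarith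
    finally show "(LINT x|lborel. V (p * x + q) * \<psi>' x) \<le> 4 * d" .
  qed (use d0 in simp)
qed

lemma integrable_bounded_times_compact_support:
  fixes f g :: "'a::euclidean_space \<Rightarrow> real"
  assumes f: "f \<in> borel_measurable borel" "\<And>x. \<bar>f x\<bar> \<le> C" and g: "g \<in> borel_measurable borel" "\<And>x. \<bar>g x\<bar> \<le> K"
    and supp: "bounded S" "\<And>x. x \<notin> S \<Longrightarrow> g x = 0"
  shows "integrable lborel (\<lambda>x. f x * g x)"
proof -
  obtain p q where pq: "S \<subseteq> cbox p q" using bounded_subset_cbox_symmetric[OF supp(1)] by metis
  have nn: "C \<ge> 0" "K \<ge> 0" using f(2)[of undefined] g(2)[of undefined] by linarith+
  show ?thesis
  proof (rule Bochner_Integration.integrable_bound)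
    have "integrable lborel (indicat_real (cbox p q))"
      by (intro integrable_real_indicator) (auto simp: emeasure_lborel_cbox_eq)
    then show "integrable lborel (\<lambda>x. (C * K) * indicator (cbox p q) x)" by simp
    show "(\<lambda>x. f x * g x) \<in> borel_measurable lborel" using f(1) g(1) by simp
    show "AE x in lborel. norm (f x * g x) \<le> norm (C * K * indicator (cbox p q) x)"
    proof (rule AE_I2)
      fix x
      have "\<bar>f x\<bar> * \<bar>g x\<bar> \<le> C * K" using f(2) g(2) nn by (intro mult_mono) auto
      then show "norm (f x * g x) \<le> norm (C * K * indicator (cbox p q) x)"
        using supp(2)[of x] pq nn by (cases "x \<in> S") (auto simp: abs_mult)
    qed
  qed
qed

lemma integral_pair_swap:
  fixes f :: "real \<times> real \<Rightarrow> real"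
  assumes "integrable lborel f"
  shows "(LINT z|lborel. f z) = (LINT x|lborel. LINT t|lborel. f (x, t))"
    "(LINT z|lborel. f z) = (LINT t|lborel. LINT x|lborel. f (x, t))"
    "integrable lborel (\<lambda>x. LINT t|lborel. f (x, t))" "integrable lborel (\<lambda>t. LINT x|lborel. f (x, t))"
proof -
  have f: "integrable (lborel \<Otimes>\<^sub>M lborel) f" "integrable (lborel \<Otimes>\<^sub>M lborel) (case_prod (\<lambda>x t. f (x, t)))"
    using assms by (auto simp: lborel_prod case_prod_beta')
  show "(LINT z|lborel. f z) = (LINT x|lborel. LINT t|lborel. f (x, t))"
    using lborel_pair.integral_fst'[OF f(1)] by (simp add: lborel_prod)
  show "(LINT z|lborel. f z) = (LINT t|lborel. LINT x|lborel. f (x, t))"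
    using lborel_pair.integral_snd[OF f(2)] by (simp add: lborel_prod)
  show "integrable lborel (\<lambda>x. LINT t|lborel. f (x, t))" using lborel_pair.integrable_fst'[OF f(1)] .
  show "integrable lborel (\<lambda>t. LINT x|lborel. f (x, t))" using lborel_pair.integrable_snd[OF f(2)] .
qed

text \<open>Each term of the divergence is integrated first in its own variable, where the profile
  is \<open>V\<close> after an affine substitution and the component of the field is a test function
  on a line. Integrating the slice bounds gives \<open>C * T\<close> and
  \<open>C * l\<close>.\<close>

lemma BV_on_transported_profile:
  assumes V: "monotone_difference V" and lT: "l > 0" "T > 0"
  shows "BV_on ({0<..<l} \<times> {0<..<T}) (\<lambda>z. V (fst z - a * snd z))"
proof -
  let ?S = "{0<..<l} \<times> {0<..<T::real}"
  let ?v = "\<lambda>z. V (fst z - a * snd z)"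
  have VM[measurable]: "V \<in> borel_measurable borel" by (rule monotone_difference_measurable[OF V])
  have "(\<lambda>z::real \<times> real. fst z - a * snd z) \<in> borel_measurable borel"
    by (intro borel_measurable_continuous_onI continuous_intros)
  then have vM: "?v \<in> borel_measurable borel" using VM by (rule measurable_compose)
  obtain CV where CV: "\<And>x. \<bar>V x\<bar> \<le> CV" by (rule monotone_difference_bounded[OF V]) blast
  have oS: "open ?S" by (intro open_Times) auto
  have bS: "bounded ?S" by (intro bounded_Times) auto
  obtain C where C: "\<And>p q a b \<psi> \<psi>'. (\<And>x. (\<psi> has_real_derivative \<psi>' x) (at x)) \<Longrightarrow> continuous_on UNIV \<psi>' \<Longrightarrow>
    (\<And>x. x \<notin> {a..b} \<Longrightarrow> \<psi> x = 0) \<Longrightarrow> (\<And>x. \<bar>\<psi> x\<bar> \<le> 1) \<Longrightarrow> a < b \<Longrightarrow>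
    (LINT x|lborel. V (p * x + q) * \<psi>' x) \<le> C" "C \<ge> 0"
    by (rule monotone_difference_test_integral[OF V]) blast
  have vi: "?v absolutely_integrable_on ?S"
    by (rule bounded_borel_absolutely_integrable[OF vM CV lmeasurable_open[OF bS oS]])
  have "(LINT z:?S|lebesgue. ?v z * (\<Sum>b\<in>Basis. D z b \<bullet> b)) \<le> C * T + C * l"
    if \<phi>: "C1c_on ?S \<phi> D" and b1: "\<forall>x\<in>?S. norm (\<phi> x) \<le> 1" for \<phi> :: "real \<times> real \<Rightarrow> real \<times> real" and D
  proof -
    define \<phi>' where "\<phi>' z = (if z \<in> ?S then \<phi> z else 0)" for z
    define D' where "D' z h = (if z \<in> ?S then D z h else 0)" for z h
    obtain K where K: "compact K" "K \<subseteq> ?S" "\<And>z. z \<notin> K \<Longrightarrow> \<phi>' z = 0" "\<And>z h. z \<notin> K \<Longrightarrow> D' z h = 0"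
      "\<And>z. (\<phi>' has_derivative D' z) (at z)" "\<And>h. continuous_on UNIV (\<lambda>z. D' z h)"
    proof (rule C1c_on_extension[OF \<phi>, of UNIV ?S])
      show "?S \<subseteq> closure (interior ?S)" unfolding interior_open[OF oS] by (rule closure_subset)
    qed (use oS in \<open>auto simp: \<phi>'_def[abs_def] D'_def[abs_def]\<close>)
    define A where "A i z = D' z i \<bullet> i" for i z
    have cA: "continuous_on UNIV (A i)" for i unfolding A_def[abs_def] by (intro continuous_intros K)
    have AM: "A i \<in> borel_measurable borel" for i by (rule borel_measurable_continuous_onI[OF cA])
    have A0: "A i z = 0" if "z \<notin> ?S" for i z using that by (simp add: A_def D'_def)
    have Ab: "\<exists>k. \<forall>z. \<bar>A i z\<bar> \<le> k" for i
    proof -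
      have "compact (A i ` K)" by (intro compact_continuous_image K(1) continuous_on_subset[OF cA]) auto
      then obtain k where k: "\<forall>z\<in>K. \<bar>A i z\<bar> \<le> k" using compact_imp_bounded[of "A i ` K"] by (auto simp: bounded_iff)
      have "\<bar>A i z\<bar> \<le> max k 0" for z using k K(4)[of z i] by (cases "z \<in> K") (auto simp: A_def)
      then show ?thesis by blast
    qed
    have iA: "integrable lborel (\<lambda>z. ?v z * A i z)" for i
    proof -
      obtain k where "\<forall>z. \<bar>A i z\<bar> \<le> k" using Ab by blast
      then show ?thesis using CV A0 by (intro integrable_bounded_times_compact_support[OF vM _ AM _ bS]) auto
    qed
    have \<phi>1: "\<bar>\<phi>' z \<bullet> i\<bar> \<le> 1" if "i \<in> Basis" for z i
      using Basis_le_norm[OF that, of "\<phi>' z"] b1 by (auto simp: \<phi>'_def intro: order_trans)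
    have slice: "((\<lambda>s. \<phi>' (p + s *\<^sub>R i) \<bullet> i) has_real_derivative A i (p + s *\<^sub>R i)) (at s)" for p s i
    proof -
      have "((\<lambda>s. \<phi>' (p + s *\<^sub>R i)) has_vector_derivative D' (p + s *\<^sub>R i) i) (at s)"
        using K(5) by (intro has_vector_derivative_along_line[where Q = UNIV]) auto
      then have "((\<lambda>s. \<phi>' (p + s *\<^sub>R i) \<bullet> i) has_vector_derivative D' (p + s *\<^sub>R i) i \<bullet> i) (at s)"
        by (rule bounded_linear.has_vector_derivative[OF bounded_linear_inner_left])
      then show ?thesis by (simp add: has_real_derivative_iff_has_vector_derivative A_def)
    qed
    have cs: "continuous_on UNIV (\<lambda>s. A i (p + s *\<^sub>R i))" for p i
      by (rule continuous_on_compose2[OF cA]) (auto intro!: continuous_intros)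
    have sx: "(LINT x|lborel. ?v (x, t) * A (1, 0) (x, t)) \<le> C * indicator {0..T} t" for t
    proof (cases "t \<in> {0<..<T}")
      case True
      have "(LINT x|lborel. V (1 * x + (- a * t)) * A (1, 0) (x, t)) \<le> C"
      proof (rule C(1)[of "\<lambda>x. \<phi>' (x, t) \<bullet> (1, 0)" _ 0 l])
        show "((\<lambda>x. \<phi>' (x, t) \<bullet> (1, 0)) has_real_derivative A (1, 0) (x, t)) (at x)" for x
          using slice[of "(0, t)" "(1, 0)" x] by simp
        show "continuous_on UNIV (\<lambda>x. A (1, 0) (x, t))" using cs[of "(1, 0)" "(0, t)"] by simp
        show "\<bar>\<phi>' (x, t) \<bullet> (1, 0)\<bar> \<le> 1" for x by (rule \<phi>1) (simp add: Basis_prod_def)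
        show "\<phi>' (x, t) \<bullet> (1, 0) = 0" if "x \<notin> {0..l}" for x using that by (auto simp: \<phi>'_def)
      qed (use lT in auto)
      then show ?thesis using True by simp
    next
      case False
      then have "A (1, 0) (x, t) = 0" for x by (intro A0) auto
      then show ?thesis using C(2) by (simp add: indicator_def)
    qed
    have st: "(LINT t|lborel. ?v (x, t) * A (0, 1) (x, t)) \<le> C * indicator {0..l} x" for x
    proof (cases "x \<in> {0<..<l}")
      case True
      have "(LINT t|lborel. V ((- a) * t + x) * A (0, 1) (x, t)) \<le> C"
      proof (rule C(1)[of "\<lambda>t. \<phi>' (x, t) \<bullet> (0, 1)" _ 0 T])
        show "((\<lambda>t. \<phi>' (x, t) \<bullet> (0, 1)) has_real_derivative A (0, 1) (x, t)) (at t)" for t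
          using slice[of "(x, 0)" "(0, 1)" t] by simp
        show "continuous_on UNIV (\<lambda>t. A (0, 1) (x, t))" using cs[of "(0, 1)" "(x, 0)"] by simp
        show "\<bar>\<phi>' (x, t) \<bullet> (0, 1)\<bar> \<le> 1" for t by (rule \<phi>1) (simp add: Basis_prod_def)
        show "\<phi>' (x, t) \<bullet> (0, 1) = 0" if "t \<notin> {0..T}" for t using that by (auto simp: \<phi>'_def)
      qed (use lT in auto)
      then show ?thesis using True by (simp add: algebra_simps)
    next
      case False
      then have "A (0, 1) (x, t) = 0" for t by (intro A0) auto
      then show ?thesis using C(2) by (simp add: indicator_def)
    qed
    have B: "(Basis :: (real \<times> real) set) = {(1, 0), (0, 1)}" by (auto simp: Basis_prod_def)
    have "(LINT z:?S|lebesgue. ?v z * (\<Sum>b\<in>Basis. D z b \<bullet> b)) = (LINT z|lebesgue. ?v z * A (1, 0) z + ?v z * A (0, 1) z)"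
      unfolding set_lebesgue_integral_def
      by (intro Bochner_Integration.integral_cong refl) (auto simp: B A_def D'_def indicator_def algebra_simps)
    also have "\<dots> = (LINT z|lborel. ?v z * A (1, 0) z + ?v z * A (0, 1) z)"
      using iA by (intro integral_completion) auto
    also have "\<dots> = (LINT z|lborel. ?v z * A (1, 0) z) + (LINT z|lborel. ?v z * A (0, 1) z)"
      by (rule Bochner_Integration.integral_add[OF iA iA])
    also have "(LINT z|lborel. ?v z * A (1, 0) z) \<le> C * T"
    proof -
      have "(LINT z|lborel. ?v z * A (1, 0) z) = (LINT t|lborel. LINT x|lborel. ?v (x, t) * A (1, 0) (x, t))"
        by (rule integral_pair_swap(2)[OF iA])
      also have "\<dots> \<le> (LINT t|lborel. C * indicator {0..T} t)"
        by (rule integral_mono[OF integral_pair_swap(4)[OF iA] integrable_mult_right[OF integrable_indicator_Icc] sx])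
      also have "\<dots> = C * T" using lT by simp
      finally show ?thesis .
    qed
    also have "(LINT z|lborel. ?v z * A (0, 1) z) \<le> C * l"
    proof -
      have "(LINT z|lborel. ?v z * A (0, 1) z) = (LINT x|lborel. LINT t|lborel. ?v (x, t) * A (0, 1) (x, t))"
        by (rule integral_pair_swap(1)[OF iA])
      also have "\<dots> \<le> (LINT x|lborel. C * indicator {0..l} x)"
        by (rule integral_mono[OF integral_pair_swap(3)[OF iA] integrable_mult_right[OF integrable_indicator_Icc] st])
      also have "\<dots> = C * l" using lT by simp
      finally show ?thesis .
    qed
    finally show ?thesis by simp
  qed
  then show ?thesis unfolding BV_on_def using vi by blast
qed

section \<open>Weak solutions of the transport equation\<close>

text \<open>Completeness transfers measurability from one function to the other, and if neither is
  measurable both integrals take the default value 0. So expressions built from traces can be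
  replaced without first proving them measurable.\<close>

lemma lebesgue_integral_cong_AE':
  fixes f g :: "'a::euclidean_space \<Rightarrow> real"
  assumes "AE x in lebesgue. f x = g x"
  shows "integral\<^sup>L lebesgue f = integral\<^sup>L lebesgue g"
proof (cases "f \<in> borel_measurable lebesgue")
  case True
  then have "g \<in> borel_measurable lebesgue" using assms by (rule borel_measurable_AE)
  then show ?thesis using True assms by (intro integral_cong_AE)
next
  case False
  have "g \<notin> borel_measurable lebesgue"
  proof
    assume "g \<in> borel_measurable lebesgue"
    moreover have "AE x in lebesgue. g x = f x" using assms by eventually_elim simp
    ultimately have "f \<in> borel_measurable lebesgue" by (rule borel_measurable_AE)
    then show False using False by simp
  qed
  then have "\<not> integrable lebesgue f" "\<not> integrable lebesgue g" using False borel_measurable_integrable by blast+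
  then show ?thesis by (simp add: not_integrable_integral_eq)
qed

lemma set_lebesgue_integral_cong_AE':
  fixes f g :: "'a::euclidean_space \<Rightarrow> real"
  assumes "AE x in lebesgue. x \<in> S \<longrightarrow> f x = g x"
  shows "(LINT x:S|lebesgue. f x) = (LINT x:S|lebesgue. g x)"
  unfolding set_lebesgue_integral_def
  by (rule lebesgue_integral_cong_AE') (use assms in \<open>auto simp: indicator_def\<close>)

section \<open>Characteristic coordinates\<close>

lemma shear_measurable: "(\<lambda>z. (fst z + a * snd z, snd z)) \<in> borel \<rightarrow>\<^sub>M (borel :: (real \<times> real) measure)"
  by (intro borel_measurable_continuous_onI continuous_intros)

text \<open>By Tonelli with \<open>t\<close> fixed this is translation invariance in the first
  variable: the passage to characteristic coordinates preserves measure.\<close>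

lemma distr_shear: "distr lborel borel (\<lambda>z. (fst z + a * snd z, snd z)) = (lborel :: (real \<times> real) measure)"
proof (rule measure_eqI)
  let ?h = "\<lambda>z::real \<times> real. (fst z + a * snd z, snd z)"
  fix X :: "(real \<times> real) set" assume "X \<in> sets (distr lborel borel ?h)"
  then have X: "X \<in> sets borel" by simp
  then have iX: "indicator X \<in> borel_measurable (borel :: (real \<times> real) measure)" by simp
  then have m: "(\<lambda>z. indicator X (?h z) :: ennreal) \<in> borel_measurable (borel :: (real \<times> real) measure)"
    using measurable_compose[OF shear_measurable] by blast
  have m1: "(\<lambda>z. indicator X (?h z) :: ennreal) \<in> borel_measurable (lborel \<Otimes>\<^sub>M lborel)"
    "(indicator X :: _ \<Rightarrow> ennreal) \<in> borel_measurable (lborel \<Otimes>\<^sub>M lborel)"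
    using m iX by (auto simp: lborel_prod)
  have m2: "(\<lambda>s. indicator X (s, t) :: ennreal) \<in> borel_measurable borel" for t
    using measurable_compose[OF _ iX, of "\<lambda>s. (s, t)" borel] by (auto intro!: borel_measurable_continuous_onI continuous_intros)
  have "emeasure (distr lborel borel ?h) X = (\<integral>\<^sup>+z. indicator X z \<partial>distr lborel borel ?h)" using X by simp
  also have "\<dots> = (\<integral>\<^sup>+z. indicator X (?h z) \<partial>lborel)"
    by (rule nn_integral_distr) (use shear_measurable X in auto)
  also have "\<dots> = (\<integral>\<^sup>+t. \<integral>\<^sup>+s. indicator X (s + a * t, t) \<partial>lborel \<partial>lborel)"
    using lborel_pair.nn_integral_snd[OF m1(1)] by (simp add: lborel_prod)
  also have "\<dots> = (\<integral>\<^sup>+t. \<integral>\<^sup>+s. indicator X (s, t) \<partial>lborel \<partial>lborel)"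
  proof (rule nn_integral_cong)
    fix t
    show "(\<integral>\<^sup>+s. indicator X (s + a * t, t) \<partial>lborel) = (\<integral>\<^sup>+s. indicator X (s, t) \<partial>lborel)"
      using nn_integral_real_affine[OF m2[of t], of 1 "a * t"] by (simp add: add.commute)
  qed
  also have "\<dots> = emeasure lborel X"
    using lborel_pair.nn_integral_snd[OF m1(2)] X by (simp add: lborel_prod)
  finally show "emeasure (distr lborel borel ?h) X = emeasure lborel X" .
qed simp

lemma integral_shear:
  fixes f :: "real \<times> real \<Rightarrow> real"
  assumes f: "f \<in> borel_measurable borel"
  shows "(LINT z|lborel. f z) = (LINT z|lborel. f (fst z + a * snd z, snd z))"
    "integrable lborel f \<longleftrightarrow> integrable lborel (\<lambda>z. f (fst z + a * snd z, snd z))"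
proof -
  have m: "(\<lambda>z. (fst z + a * snd z, snd z)) \<in> lborel \<rightarrow>\<^sub>M (borel :: (real \<times> real) measure)" using shear_measurable by simp
  show "(LINT z|lborel. f z) = (LINT z|lborel. f (fst z + a * snd z, snd z))"
    using integral_distr[OF m f] by (simp add: distr_shear)
  show "integrable lborel f \<longleftrightarrow> integrable lborel (\<lambda>z. f (fst z + a * snd z, snd z))"
    using integrable_distr_eq[OF m f] by (simp add: distr_shear)
qed

lemma half_open_rectangle:
  fixes l T :: real
  assumes "l > 0" "T > 0"
  shows "{0..<l} \<times> {0..<T} = ({0..} \<times> {0..}) \<inter> ({..<l} \<times> {..<T})" "open ({..<l} \<times> {..<T})"
    "{0..<l} \<times> {0..<T} \<subseteq> closure (interior ({0..<l} \<times> {0..<T}))"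
proof -
  show "{0..<l} \<times> {0..<T} = ({0..} \<times> {0..}) \<inter> ({..<l} \<times> {..<T})" by auto
  show "open ({..<l} \<times> {..<T})" by (intro open_Times) auto
  have "{0<..<l} \<times> {0<..<T} \<subseteq> interior ({0..<l} \<times> {0..<T})"
    by (rule interior_maximal) (auto intro!: open_Times)
  then have "closure ({0<..<l} \<times> {0<..<T}) \<subseteq> closure (interior ({0..<l} \<times> {0..<T}))" by (rule closure_mono)
  moreover have "closure ({0<..<l} \<times> {0<..<T}) = {0..l} \<times> {0..T}" using assms by (simp add: closure_Times)
  ultimately show "{0..<l} \<times> {0..<T} \<subseteq> closure (interior ({0..<l} \<times> {0..<T}))" by auto
qed

lemma integrable_bounded_interval:
  fixes f :: "real \<Rightarrow> real"
  assumes "f \<in> borel_measurable borel" "\<And>x. \<bar>f x\<bar> \<le> C" "\<And>x. x \<notin> {a..b} \<Longrightarrow> f x = 0"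
  shows "integrable lborel f"
  using integrable_bounded_times_compact_support[of "\<lambda>_. 1" 1 f C "{a..b}"] assms by auto

text \<open>In the coordinates \<open>s = x - a t\<close>, \<open>t\<close> the transport operator is \<open>d/dt\<close>, which is integrated along each characteristic.\<close>
lemma weak_transport_of_profile:
  assumes V: "monotone_difference V" and lT: "l > 0" "T > 0" and a: "a > 0"
    and v: "AE x in lebesgue. x \<in> {0<..<l} \<longrightarrow> v x = V x"
    and q: "AE t in lebesgue. t \<in> {0<..<T} \<longrightarrow> q t = a * V (- (a * t))"
  shows "weak_transport l T a v q (\<lambda>z. V (fst z - a * snd z))"
  unfolding weak_transport_def
proof (intro allI impI)
  fix \<phi> :: "real \<times> real \<Rightarrow> real" and D
  let ?S = "{0..<l} \<times> {0..<T}" and ?R = "{0<..<l} \<times> {0<..<T}" and ?Q = "{0::real..} \<times> {0::real..}"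
  assume \<phi>: "C1c_on ?S \<phi> D"
  have VM: "V \<in> borel_measurable borel" by (rule monotone_difference_measurable[OF V])
  obtain CV where CV: "\<And>x. \<bar>V x\<bar> \<le> CV" by (rule monotone_difference_bounded[OF V]) blast
  define \<phi>' where "\<phi>' z = (if z \<in> ?S then \<phi> z else 0)" for z
  define D' where "D' z h = (if z \<in> ?S then D z h else 0)" for z h
  obtain K where K: "compact K" "K \<subseteq> ?S" "\<And>z. z \<notin> K \<Longrightarrow> \<phi>' z = 0" "\<And>z h. z \<notin> K \<Longrightarrow> D' z h = 0"
    "\<And>z. z \<in> ?Q \<Longrightarrow> (\<phi>' has_derivative D' z) (at z within ?Q)" "\<And>h. continuous_on ?Q (\<lambda>z. D' z h)"
    by (rule C1c_on_extension[OF \<phi> half_open_rectangle[OF lT]]) (auto simp: \<phi>'_def[abs_def] D'_def[abs_def])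
  have KQ: "K \<subseteq> ?Q" using K(2) by auto
  have c\<phi>: "continuous_on ?Q \<phi>'" using K(5) by (rule has_derivative_continuous_on)
  have bd: "\<exists>k. \<forall>z. \<bar>f z\<bar> \<le> k" if f: "continuous_on ?Q f" "\<And>z. z \<notin> K \<Longrightarrow> f z = 0" for f :: "real \<times> real \<Rightarrow> real"
  proof -
    have "compact (f ` K)" by (intro compact_continuous_image K(1) continuous_on_subset[OF f(1) KQ])
    then obtain k where k: "\<forall>z\<in>K. \<bar>f z\<bar> \<le> k" using compact_imp_bounded[of "f ` K"] by (auto simp: bounded_iff)
    have "\<bar>f z\<bar> \<le> max k 0" for z using k f(2)[of z] by (cases "z \<in> K") auto
    then show ?thesis by blast
  qed
  \<comment> \<open>The derivative of the extended test function in the direction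
    \<open>(a, 1)\<close> of the characteristics.\<close>
  define L where "L z = D' z (a, 1)" for z
  have cL: "continuous_on ?Q L" unfolding L_def[abs_def] by (rule K(6))
  obtain kL where kL: "\<And>z. \<bar>L z\<bar> \<le> kL" using bd[OF cL] K(4) unfolding L_def by blast
  obtain k\<phi> where k\<phi>: "\<And>z. \<bar>\<phi>' z\<bar> \<le> k\<phi>" using bd[OF c\<phi> K(3)] by blast
  have lin: "D' z (0, 1) + a * D' z (1, 0) = L z" if "z \<in> ?Q" for z
  proof -
    have li: "linear (D' z)" using K(5)[OF that] by (rule has_derivative_linear)
    have "L z = D' z ((0, 1) + a *\<^sub>R (1, 0))" by (simp add: L_def)
    also have "\<dots> = D' z (0, 1) + a *\<^sub>R D' z (1, 0)" using li by (simp only: linear_add linear_scale)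
    finally show ?thesis by simp
  qed
  define E where "E z = indicator ?R z * L z" for z
  have EM: "E \<in> borel_measurable borel"
  proof -
    have "continuous_on ?R L" by (rule continuous_on_subset[OF cL]) auto
    moreover have "?R \<in> sets borel" by (intro borel_open open_Times) auto
    ultimately show ?thesis using borel_measurable_continuous_on_indicator[of ?R L] by (simp add: E_def[abs_def])
  qed
  have Eb: "\<bar>E z\<bar> \<le> kL" for z using kL[of z] by (auto simp: E_def indicator_def)
  have "(LINT z:?R|lebesgue. V (fst z - a * snd z) * (D z (0, 1) + a * D z (1, 0))) = (LINT z|lebesgue. V (fst z - a * snd z) * E z)"
    unfolding set_lebesgue_integral_def
  proof (intro Bochner_Integration.integral_cong refl)
    fix z
    show "indicat_real ?R z *\<^sub>R (V (fst z - a * snd z) * (D z (0, 1) + a * D z (1, 0))) = V (fst z - a * snd z) * E z"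
    proof (cases "z \<in> ?R")
      case True
      then have "z \<in> ?S" "z \<in> ?Q" by auto
      then show ?thesis using lin[of z] True by (simp add: E_def D'_def)
    qed (simp add: E_def)
  qed
  also have "\<dots> = (LINT z|lborel. V (fst z - a * snd z) * E z)"
  proof (rule integral_completion)
    have "(\<lambda>z::real \<times> real. fst z - a * snd z) \<in> borel_measurable borel"
      by (intro borel_measurable_continuous_onI continuous_intros)
    from measurable_compose[OF this VM] show "(\<lambda>z. V (fst z - a * snd z) * E z) \<in> borel_measurable lborel"
      using EM by simp
  qed
  also have "\<dots> = (LINT z|lborel. V (fst z) * E (fst z + a * snd z, snd z))"
  proof -
    have "(\<lambda>z::real \<times> real. fst z - a * snd z) \<in> borel_measurable borel"
      by (intro borel_measurable_continuous_onI continuous_intros)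
    from measurable_compose[OF this VM] have "(\<lambda>z. V (fst z - a * snd z) * E z) \<in> borel_measurable borel"
      using EM by simp
    from integral_shear(1)[OF this, of a] show ?thesis by simp
  qed
  also have "\<dots> = (LINT s|lborel. LINT t|lborel. V s * E (s + a * t, t))"
  proof -
    have "(\<lambda>z::real \<times> real. fst z) \<in> borel_measurable borel"
      by (intro borel_measurable_continuous_onI continuous_intros)
    from measurable_compose[OF this VM] have "(\<lambda>z::real \<times> real. V (fst z)) \<in> borel_measurable borel" .
    moreover have "(\<lambda>z. E (fst z + a * snd z, snd z)) \<in> borel_measurable borel"
      using measurable_compose[OF shear_measurable EM] .
    ultimately have "integrable lborel (\<lambda>z. V (fst z) * E (fst z + a * snd z, snd z))"
    proof (rule integrable_bounded_times_compact_support[OF _ CV _ Eb])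
      show "bounded ({- (a * T)..l} \<times> {0..T})" by (intro bounded_Times) auto
      fix z :: "real \<times> real" assume z: "z \<notin> {- (a * T)..l} \<times> {0..T}"
      show "E (fst z + a * snd z, snd z) = 0"
      proof (rule ccontr)
        assume "E (fst z + a * snd z, snd z) \<noteq> 0"
        then have "0 < fst z + a * snd z" "fst z + a * snd z < l" "0 < snd z" "snd z < T"
          by (auto simp: E_def indicator_def split: if_splits)
        moreover from this have "a * snd z < a * T" "a * snd z > 0" using a by auto
        ultimately show False using z by (cases z) auto
      qed
    qed
    from integral_pair_swap(1)[OF this] show ?thesis by simp
  qed
  also have "\<dots> = (LINT s|lborel. V s * - \<phi>' (s + a * max 0 (- s / a), max 0 (- s / a)))"
  proof (intro Bochner_Integration.integral_cong refl)
    fix s :: real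
    \<comment> \<open>The time at which the characteristic labelled \<open>s\<close> enters the
      quadrant: 0 if it starts on the initial line, \<open>- s / a\<close> if it comes in through
      \<open>x = 0\<close>.\<close>
    define t0 where "t0 = max 0 (- s / a)"
    have t0: "t0 \<ge> 0" "s + a * t0 \<ge> 0" using a by (auto simp: t0_def max_def field_simps)
    have J: "(LINT t|lborel. E (s + a * t, t)) = - \<phi>' (s + a * t0, t0)"
    proof (cases "t0 < T")
      case True
      have inQ: "(s, 0) + t *\<^sub>R (a, 1) \<in> ?Q" if "t \<in> {t0..T}" for t
      proof -
        have "a * t \<ge> a * t0" using that a by auto
        then have "s + a * t \<ge> 0" using t0(2) by linarith
        then show ?thesis using that t0 by (simp add: mult.commute)
      qed
      have "has_bochner_integral lborel (\<lambda>t. indicator {t0..T} t *\<^sub>R L ((s, 0) + t *\<^sub>R (a, 1)))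
        (\<phi>' ((s, 0) + T *\<^sub>R (a, 1)) - \<phi>' ((s, 0) + t0 *\<^sub>R (a, 1)))"
      proof (rule has_bochner_integral_FTC_Icc)
        show "t0 \<le> T" using True by simp
        show "((\<lambda>t. \<phi>' ((s, 0) + t *\<^sub>R (a, 1))) has_vector_derivative L ((s, 0) + t *\<^sub>R (a, 1))) (at t within {t0..T})"
          if "t0 \<le> t" "t \<le> T" for t
          unfolding L_def using K(5)[OF inQ, of t] inQ that by (intro has_vector_derivative_along_line[where Q = ?Q]) auto
        show "continuous_on {t0..T} (\<lambda>t. L ((s, 0) + t *\<^sub>R (a, 1)))"
          by (rule continuous_on_compose2[OF cL]) (use inQ in \<open>auto intro!: continuous_intros\<close>)
      qed
      then have "(LINT t|lborel. indicator {t0..T} t *\<^sub>R L (s + a * t, t)) = \<phi>' (s + a * T, T) - \<phi>' (s + a * t0, t0)"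
        by (simp add: has_bochner_integral_integral_eq mult.commute)
      moreover have "\<phi>' (s + a * T, T) = 0" by (simp add: \<phi>'_def)
      moreover have "(LINT t|lborel. E (s + a * t, t)) = (LINT t|lborel. indicator {t0..T} t *\<^sub>R L (s + a * t, t))"
      proof (rule integral_cong_AE)
        show "(\<lambda>t. E (s + a * t, t)) \<in> borel_measurable lborel"
          using measurable_compose[OF _ EM, of "\<lambda>t. (s + a * t, t)" borel]
          by (auto intro!: borel_measurable_continuous_onI continuous_intros)
        have "continuous_on {t0..T} (\<lambda>t. L (s + a * t, t))"
          by (rule continuous_on_compose2[OF cL]) (use inQ in \<open>auto intro!: continuous_intros simp: mult.commute\<close>)
        from borel_measurable_continuous_on_indicator[OF _ this]
        show "(\<lambda>t. indicator {t0..T} t *\<^sub>R L (s + a * t, t)) \<in> borel_measurable lborel" by simp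
        have "AE t in lborel. t \<noteq> t0 \<and> t \<noteq> T" using AE_lborel_singleton[of t0] AE_lborel_singleton[of T] by eventually_elim simp
        then show "AE t in lborel. E (s + a * t, t) = indicator {t0..T} t *\<^sub>R L (s + a * t, t)"
        proof eventually_elim
          case (elim t)
          show ?case
          proof (cases "t \<in> {t0<..<T}")
            case True
            then have "a * t0 < a * t" using a by simp
            then have p: "s + a * t > 0" "t > 0" "t < T" using t0 True by auto
            show ?thesis
            proof (cases "s + a * t < l")
              case True
              then show ?thesis using p \<open>t \<in> {t0<..<T}\<close> by (simp add: E_def)
            next
              case False
              then have "(s + a * t, t) \<notin> K" using K(2) by auto
              then show ?thesis using K(4) False by (simp add: E_def L_def)
            qed
          next
            case False
            then have f: "t \<notin> {t0..T}" using elim by auto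
            have "(s + a * t, t) \<notin> ?R"
            proof
              assume r: "(s + a * t, t) \<in> ?R"
              then have "t < t0" using f by auto
              then have "t < - s / a" using r by (auto simp: t0_def max_def split: if_splits)
              then show False using r a by (simp add: field_simps)
            qed
            then show ?thesis using f by (simp add: E_def)
          qed
        qed
      qed
      ultimately show ?thesis by simp
    next
      case False
      have "E (s + a * t, t) = 0" for t
      proof -
        have "(s + a * t, t) \<notin> ?R"
        proof
          assume r: "(s + a * t, t) \<in> ?R"
          then have "t < t0" using False by auto
          then have "t < - s / a" using r by (auto simp: t0_def max_def split: if_splits)
          then show False using r a by (simp add: field_simps)
        qed
        then show ?thesis by (simp add: E_def)
      qed
      then show ?thesis using False by (simp add: \<phi>'_def)
    qed
    show "(LINT t|lborel. V s * E (s + a * t, t)) = V s * - \<phi>' (s + a * max 0 (- s / a), max 0 (- s / a))"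
      using J by (simp add: t0_def)
  qed
  \<comment> \<open>Labels \<open>s > 0\<close> belong to the initial line and labels
    \<open>s < 0\<close> to the inlet; the label 0 forms a null set.\<close>
  also have "\<dots> = (LINT s|lborel. - (indicator {0<..<l} s * (V s * \<phi>' (s, 0))) - indicator {- (a * T)<..<0} s * (V s * \<phi>' (0, - s / a)))"
  proof (rule integral_cong_AE)
    have p: "\<phi>' \<circ> \<gamma> \<in> borel_measurable borel" if "continuous_on UNIV \<gamma>" "\<And>s. \<gamma> s \<in> ?Q" for \<gamma> :: "real \<Rightarrow> real \<times> real"
    proof -
      have "range \<gamma> \<subseteq> ?Q" using that(2) by blast
      from continuous_on_compose2[OF c\<phi> that(1) this] show ?thesis
        unfolding o_def by (rule borel_measurable_continuous_onI)
    qed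
    have "\<phi>' \<circ> (\<lambda>s. (s + a * max 0 (- s / a), max 0 (- s / a))) \<in> borel_measurable borel"
      using a by (intro p continuous_intros) (auto simp: max_def field_simps)
    then show "(\<lambda>s. V s * - \<phi>' (s + a * max 0 (- s / a), max 0 (- s / a))) \<in> borel_measurable lborel"
      using VM by (simp add: o_def)
    have "(\<lambda>s. indicator {0<..<l} s *\<^sub>R \<phi>' (s, 0)) \<in> borel_measurable borel"
      by (intro borel_measurable_continuous_on_indicator continuous_on_compose2[OF c\<phi>]) (auto intro!: continuous_intros)
    moreover have "(\<lambda>s. indicator {- (a * T)<..<0} s *\<^sub>R \<phi>' (0, - s / a)) \<in> borel_measurable borel"
      using a by (intro borel_measurable_continuous_on_indicator continuous_on_compose2[OF c\<phi>])
        (auto intro!: continuous_intros simp: field_simps)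
    ultimately have "(\<lambda>s. - (V s * (indicator {0<..<l} s *\<^sub>R \<phi>' (s, 0))) - V s * (indicator {- (a * T)<..<0} s *\<^sub>R \<phi>' (0, - s / a))) \<in> borel_measurable borel"
      using VM by (intro borel_measurable_diff borel_measurable_uminus borel_measurable_times)
    then show "(\<lambda>s. - (indicator {0<..<l} s * (V s * \<phi>' (s, 0))) - indicator {- (a * T)<..<0} s * (V s * \<phi>' (0, - s / a))) \<in> borel_measurable lborel"
      by (simp add: mult_ac)
    show "AE s in lborel. V s * - \<phi>' (s + a * max 0 (- s / a), max 0 (- s / a)) =
       - (indicator {0<..<l} s * (V s * \<phi>' (s, 0))) - indicator {- (a * T)<..<0} s * (V s * \<phi>' (0, - s / a))"
      using AE_lborel_singleton[of 0]
    proof eventually_elim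
      case (elim s)
      show ?case
      proof (cases "s > 0")
        case True
        then have "max 0 (- s / a) = 0" using a by (simp add: max_def field_simps)
        moreover have "\<phi>' (s, 0) = 0" if "s \<ge> l" using that by (simp add: \<phi>'_def)
        ultimately show ?thesis using True by (auto simp: indicator_def)
      next
        case False
        then have s: "s < 0" using elim by simp
        then have "max 0 (- s / a) = - s / a" using a by (simp add: max_def field_simps)
        moreover have "s + a * (- s / a) = 0" using a by simp
        moreover have "\<phi>' (0, - s / a) = 0" if "s \<le> - (a * T)"
        proof -
          have "- s / a \<ge> T" using that a by (simp add: field_simps)
          then show ?thesis by (simp add: \<phi>'_def)
        qed
        ultimately show ?thesis using s by (auto simp: indicator_def)
      qed
    qed
  qed
  also have "\<dots> = - (LINT s|lborel. indicator {0<..<l} s * (V s * \<phi>' (s, 0))) - (LINT s|lborel. indicator {- (a * T)<..<0} s * (V s * \<phi>' (0, - s / a)))"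
  proof -
    have CV0: "CV \<ge> 0" "k\<phi> \<ge> 0" using CV[of 0] k\<phi>[of 0] by linarith+
    have b: "\<bar>indicator X s * (V s * \<phi>' z)\<bar> \<le> CV * k\<phi>" for X s z
    proof -
      have "\<bar>V s\<bar> * \<bar>\<phi>' z\<bar> \<le> CV * k\<phi>" using CV k\<phi> CV0 by (intro mult_mono) auto
      then show ?thesis using CV0 by (simp add: indicator_def abs_mult)
    qed
    have m1: "(\<lambda>s. indicator {0<..<l} s *\<^sub>R \<phi>' (s, 0)) \<in> borel_measurable borel"
      by (intro borel_measurable_continuous_on_indicator continuous_on_compose2[OF c\<phi>]) (auto intro!: continuous_intros)
    have m2: "(\<lambda>s. indicator {- (a * T)<..<0} s *\<^sub>R \<phi>' (0, - s / a)) \<in> borel_measurable borel"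
      using a by (intro borel_measurable_continuous_on_indicator continuous_on_compose2[OF c\<phi>])
        (auto intro!: continuous_intros simp: field_simps)
    have "integrable lborel (\<lambda>s. indicator {0<..<l} s * (V s * \<phi>' (s, 0)))"
      using borel_measurable_times[OF VM m1]
      by (intro integrable_bounded_interval[where C = "CV * k\<phi>" and a = 0 and b = l] b) (auto simp: mult_ac)
    moreover have "integrable lborel (\<lambda>s. indicator {- (a * T)<..<0} s * (V s * \<phi>' (0, - s / a)))"
      using borel_measurable_times[OF VM m2]
      by (intro integrable_bounded_interval[where C = "CV * k\<phi>" and a = "- (a * T)" and b = 0] b) (auto simp: mult_ac)
    ultimately show ?thesis by (simp add: Bochner_Integration.integral_diff)
  qed
  also have "(LINT s|lborel. indicator {0<..<l} s * (V s * \<phi>' (s, 0))) = (LINT x:{0<..<l}|lebesgue. v x * \<phi> (x, 0))"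
  proof -
    have m1: "(\<lambda>s. indicator {0<..<l} s *\<^sub>R \<phi>' (s, 0)) \<in> borel_measurable borel"
      by (intro borel_measurable_continuous_on_indicator continuous_on_compose2[OF c\<phi>]) (auto intro!: continuous_intros)
    have "(LINT x:{0<..<l}|lebesgue. v x * \<phi> (x, 0)) = (LINT x:{0<..<l}|lebesgue. V x * \<phi>' (x, 0))"
      by (rule set_lebesgue_integral_cong_AE') (use v lT in \<open>auto simp: \<phi>'_def\<close>)
    also have "\<dots> = (LINT s|lborel. indicator {0<..<l} s * (V s * \<phi>' (s, 0)))"
      unfolding set_lebesgue_integral_def
      using borel_measurable_times[OF VM m1] by (subst integral_completion) (auto simp: mult_ac)
    finally show ?thesis by simp
  qed
  also have "(LINT s|lborel. indicator {- (a * T)<..<0} s * (V s * \<phi>' (0, - s / a))) = (LINT t:{0<..<T}|lebesgue. \<phi> (0, t) * q t)"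
  proof -
    have m3: "(\<lambda>t. indicator {0<..<T} t *\<^sub>R \<phi>' (0, t)) \<in> borel_measurable borel"
      by (intro borel_measurable_continuous_on_indicator continuous_on_compose2[OF c\<phi>]) (auto intro!: continuous_intros)
    have m4: "(\<lambda>t. a * V (- (a * t))) \<in> borel_measurable borel" using VM by measurable
    have "(LINT t:{0<..<T}|lebesgue. \<phi> (0, t) * q t) = (LINT t:{0<..<T}|lebesgue. \<phi>' (0, t) * (a * V (- (a * t))))"
      by (rule set_lebesgue_integral_cong_AE') (use q lT in \<open>auto simp: \<phi>'_def\<close>)
    also have "\<dots> = (LINT t|lborel. indicator {0<..<T} t * (\<phi>' (0, t) * (a * V (- (a * t)))))"
      unfolding set_lebesgue_integral_def
      using borel_measurable_times[OF m3 m4] by (subst integral_completion) (auto simp: mult_ac)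
    \<comment> \<open>The substitution \<open>s = - (a * t)\<close> turns inlet times into negative
      arguments of the profile; the factor \<open>a\<close> of the flux is its Jacobian.\<close>
    also have "\<dots> = a * (LINT t|lborel. indicator {- (a * T)<..<0} (0 + (- a) * t) * (V (0 + (- a) * t) * \<phi>' (0, - (0 + (- a) * t) / a)))"
      unfolding integral_mult_right_zero[symmetric]
      using a by (intro Bochner_Integration.integral_cong refl) (auto simp: indicator_def mult_ac zero_less_mult_iff)
    also have "\<dots> = (LINT s|lborel. indicator {- (a * T)<..<0} s * (V s * \<phi>' (0, - s / a)))"
      using lborel_integral_real_affine[of "- a" "\<lambda>s. indicator {- (a * T)<..<0} s * (V s * \<phi>' (0, - s / a))" 0] a by simp
    finally show ?thesis by simp
  qed
  finally show "(LINT z:?R|lebesgue. V (fst z - a * snd z) * (D z (0, 1) + a * D z (1, 0)))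
      + (LINT x:{0<..<l}|lebesgue. v x * \<phi> (x, 0)) = - (LINT t:{0<..<T}|lebesgue. \<phi> (0, t) * q t)" by simp
qed

section \<open>Traces of continuous functions and of profiles\<close>

lemma interval_measure_ge:
  assumes "{p<..<q} \<subseteq> X" "X \<in> lmeasurable" "p \<le> q"
  shows "measure lebesgue X \<ge> q - p"
proof -
  have "measure lebesgue {p<..<q} \<le> measure lebesgue X"
    using assms by (intro measure_mono_fmeasurable) (auto dest: fmeasurableD)
  then show ?thesis using assms(3) by simp
qed

text \<open>The one-sided piece of length \<open>r / 2\<close> next to the endpoint lies in the
  ball, which is where the density constant 1/2 comes from.\<close>

lemma boundary_trace_interval:
  fixes f F :: "real \<Rightarrow> real"
  assumes l: "l > 0" and f: "f absolutely_integrable_on {0<..<l}" and F: "continuous_on {0..l} F"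
    and eq: "negligible {x\<in>{0<..<l}. f x \<noteq> F x}"
  shows "boundary_trace {0<..<l} f 0 = F 0" "boundary_trace {0<..<l} f l = F l"
proof -
  have lim: "(F \<longlongrightarrow> F x) (at x within {0<..<l})" if "x \<in> {0..l}" for x
  proof -
    have "(F \<longlongrightarrow> F x) (at x within {0..l})" using F that by (auto simp: continuous_on_def)
    then show ?thesis by (rule tendsto_within_subset) auto
  qed
  have m: "{0<..<l} \<inter> ball x r \<in> lmeasurable" for x r
    by (intro fmeasurable_Int_fmeasurable) auto
  show "boundary_trace {0<..<l} f 0 = F 0"
  proof (rule boundary_trace_eqI[OF f _ eq _ lim, of 0 "1 / 2"])
    have "1 / 2 * r ^ DIM(real) \<le> measure lebesgue ({0<..<l} \<inter> ball 0 r)" if "0 < r" "r < l" for r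
    proof -
      have "{0<..<r / 2} \<subseteq> {0<..<l} \<inter> ball 0 r" using that by (auto simp: dist_real_def)
      from interval_measure_ge[OF this m] that show ?thesis by simp
    qed
    then show "\<forall>\<^sub>F r in at_right 0. 1 / 2 * r ^ DIM(real) \<le> measure lebesgue ({0<..<l} \<inter> ball 0 r)"
      using l by (auto simp: eventually_at_right_field)
  qed (use l in auto)
  show "boundary_trace {0<..<l} f l = F l"
  proof (rule boundary_trace_eqI[OF f _ eq _ lim, of l "1 / 2"])
    have "1 / 2 * r ^ DIM(real) \<le> measure lebesgue ({0<..<l} \<inter> ball l r)" if "0 < r" "r < l" for r
    proof -
      have "{l - r / 2<..<l} \<subseteq> {0<..<l} \<inter> ball l r" using that by (auto simp: dist_real_def)
      from interval_measure_ge[OF this m] that show ?thesis by simp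
    qed
    then show "\<forall>\<^sub>F r in at_right 0. 1 / 2 * r ^ DIM(real) \<le> measure lebesgue ({0<..<l} \<inter> ball l r)"
      using l by (auto simp: eventually_at_right_field)
  qed (use l in auto)
qed

text \<open>Continuity of \<open>V\<close> at the arriving argument is enough, and it holds at all
  but countably many times. The density constant 1/4 is the area of a square of side
  \<open>r / 2\<close> inside the rectangle with a corner at the boundary point.\<close>

lemma boundary_trace_of_profile:
  fixes u :: "real \<times> real \<Rightarrow> real"
  assumes lT: "l > 0" "T > 0" and x0: "x0 = 0 \<or> x0 = l" and t0: "0 < t0" "t0 < T"
    and V: "isCont V (x0 - a * t0)"
    and u: "u absolutely_integrable_on {0<..<l} \<times> {0<..<T}"
    and eq: "negligible {z\<in>{0<..<l} \<times> {0<..<T}. u z \<noteq> V (fst z - a * snd z)}"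
  shows "boundary_trace ({0<..<l} \<times> {0<..<T}) u (x0, t0) = V (x0 - a * t0)"
proof (rule boundary_trace_eqI[OF u _ eq, of "\<lambda>z. V (fst z - a * snd z)" _ _ "1 / 4"])
  let ?R = "{0<..<l} \<times> {0<..<T}"
  have oR: "open ?R" by (intro open_Times) auto
  then show "?R \<in> sets lebesgue" by (simp add: borel_open)
  have "isCont (\<lambda>z::real \<times> real. fst z - a * snd z) (x0, t0)" by (intro continuous_intros)
  from isCont_o2[OF this, of V] V have "isCont (\<lambda>z::real \<times> real. V (fst z - a * snd z)) (x0, t0)" by simp
  then have "((\<lambda>z::real \<times> real. V (fst z - a * snd z)) \<longlongrightarrow> V (x0 - a * t0)) (at (x0, t0))" by (simp add: isCont_def)
  then show "((\<lambda>z. V (fst z - a * snd z)) \<longlongrightarrow> V (x0 - a * t0)) (at (x0, t0) within ?R)"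
    by (rule tendsto_within_subset) simp
  have "1 / 4 * r ^ DIM(real \<times> real) \<le> measure lebesgue (?R \<inter> ball (x0, t0) r)" if r: "0 < r" "r < min l (T - t0)" for r
  proof -
    define p where "p = (if x0 = 0 then 0 else l - r / 2)"
    let ?B = "box (p, t0) (p + r / 2, t0 + r / 2)"
    have B: "?B = {p<..<p + r / 2} \<times> {t0<..<t0 + r / 2}" by (auto simp: box_prod box_real)
    have "?B \<subseteq> ?R \<inter> ball (x0, t0) r"
    proof
      fix z assume "z \<in> ?B"
      then obtain x t where z: "z = (x, t)" "x \<in> {p<..<p + r / 2}" "t \<in> {t0<..<t0 + r / 2}" unfolding B by auto
      have "dist (x0, t0) (x, t) \<le> dist x0 x + dist t0 t"
        unfolding dist_Pair_Pair by (rule sqrt_sum_squares_le_sum) auto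
      also have "\<dots> < r / 2 + r / 2"
        using z x0 by (intro add_strict_mono) (auto simp: dist_real_def p_def split: if_splits)
      finally have "dist (x0, t0) (x, t) < r" by simp
      then show "z \<in> ?R \<inter> ball (x0, t0) r" using z x0 r t0 by (auto simp: p_def split: if_splits)
    qed
    moreover have "?R \<inter> ball (x0, t0) r \<in> lmeasurable"
      using oR by (intro lmeasurable_open) (auto intro: bounded_subset[OF bounded_ball])
    ultimately have "measure lebesgue ?B \<le> measure lebesgue (?R \<inter> ball (x0, t0) r)"
      by (intro measure_mono_fmeasurable) auto
    moreover have "measure lebesgue ?B = r / 2 * (r / 2)"
    proof -
      have "measure lebesgue ?B = measure lborel (box (p, t0) (p + r / 2, t0 + r / 2))" by simp
      also have "\<dots> = (\<Prod>b\<in>Basis. ((p + r / 2, t0 + r / 2) - (p, t0)) \<bullet> b)"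
        using r by (subst measure_lborel_box_eq) (auto simp: Basis_prod_def)
      also have "\<dots> = r / 2 * (r / 2)"
        unfolding Basis_prod_def by (subst prod.union_disjoint) (auto simp: prod.reindex inj_on_def)
      finally show ?thesis .
    qed
    ultimately show ?thesis by (simp add: power2_eq_square)
  qed
  then show "\<forall>\<^sub>F r in at_right 0. 1 / 4 * r ^ DIM(real \<times> real) \<le> measure lebesgue (?R \<inter> ball (x0, t0) r)"
    using lT t0 by (auto simp: eventually_at_right_field intro!: exI[of _ "min l (T - t0)"])
qed (use x0 t0 in auto)

text \<open>Test functions \<open>\<alpha>(x - a t) \<beta>(t)\<close> show that the difference of two solutions, in the coordinates
  \<open>(s, t)\<close> of the characteristics, has vanishing integral over every box.\<close>
lemma weak_transport_unique:
  fixes u w :: "real \<times> real \<Rightarrow> real"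
  assumes lT: "l > 0" "T > 0" and a: "a > 0"
    and u: "u absolutely_integrable_on {0<..<l} \<times> {0<..<T}" and w: "w absolutely_integrable_on {0<..<l} \<times> {0<..<T}"
    and wu: "weak_transport l T a v q u" and ww: "weak_transport l T a v q' w"
    and q: "AE t in lebesgue. t \<in> {0<..<T} \<longrightarrow> q t = q' t"
  shows "negligible {z\<in>{0<..<l} \<times> {0<..<T}. u z \<noteq> w z}"
proof -
  let ?S = "{0..<l} \<times> {0..<T}" and ?R = "{0<..<l} \<times> {0<..<T}"
  note hk = set_lebesgue_integral_eq_integral
  define d where "d z = u z - w z" for z
  have oR: "open ?R" by (intro open_Times) auto
  have Rl: "?R \<in> sets lebesgue" using oR by (simp add: borel_open)
  have d: "d absolutely_integrable_on ?R" unfolding d_def[abs_def] using set_integral_diff(1)[OF u w] .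
  have key: "(LINT z:?R|lebesgue. d z * (bump k s0 s1 (fst z - a * snd z) * bump k t0 t1 (snd z))) = 0"
    if s: "s0 < s1" "s1 + a * t1 < l" and t: "0 < t0" "t0 < t1" "t1 < T" for k s0 s1 t0 t1
  proof -
    obtain \<alpha>' where \<alpha>': "\<And>x. (bump k s0 s1 has_real_derivative \<alpha>' x) (at x)" "continuous_on UNIV \<alpha>'"
      using bump_differentiable by blast
    obtain \<Phi> where \<Phi>: "\<And>x. (\<Phi> has_real_derivative bump k t0 t1 x) (at x)" "\<And>x. x \<ge> t1 \<Longrightarrow> \<Phi> x = \<Phi> t1"
      using bump_primitive[OF t(2), of k] by metis
    \<comment> \<open>\<open>\<beta>\<close> vanishes from \<open>t1\<close> on, and the bump in
      \<open>s\<close> then confines the support to \<open>x \<le> s1 + a * t1 < l\<close>. At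
      \<open>x = 0\<close> and \<open>t = 0\<close> the test function may be nonzero; the terms
      produced there are the same for both solutions.\<close>
    define \<beta> where "\<beta> t = \<Phi> t - \<Phi> t1" for t
    have d\<beta>: "(\<beta> has_real_derivative bump k t0 t1 x) (at x)" for x
      unfolding \<beta>_def[abs_def] using DERIV_diff[OF \<Phi>(1) DERIV_const] by simp
    have c\<beta>: "continuous_on A \<beta>" for A using d\<beta> by (intro DERIV_continuous_on) (rule has_field_derivative_at_within)
    let ?s = "\<lambda>z::real \<times> real. fst z - a * snd z"
    define \<phi> where "\<phi> z = bump k s0 s1 (?s z) * \<beta> (snd z)" for z
    define D where "D z h = bump k s0 s1 (?s z) * (bump k t0 t1 (snd z) * snd h) + \<alpha>' (?s z) * (fst h - a * snd h) * \<beta> (snd z)" for z h :: "real \<times> real"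
    have "C1c_on ?S \<phi> D"
      unfolding C1c_on_def
    proof (intro conjI ballI allI)
      fix z
      have ds: "(?s has_derivative (\<lambda>h. fst h - a * snd h)) (at z within ?S)"
        by (auto intro!: derivative_eq_intros)
      have "(bump k s0 s1 has_derivative (*) (\<alpha>' (?s z))) (at (?s z))" using \<alpha>'(1) by (simp add: has_field_derivative_def)
      from has_derivative_compose[OF ds this]
      have 1: "((\<lambda>z. bump k s0 s1 (?s z)) has_derivative (\<lambda>h. \<alpha>' (?s z) * (fst h - a * snd h))) (at z within ?S)" .
      have d2: "(\<beta> has_derivative (*) (bump k t0 t1 (snd z))) (at (snd z))" using d\<beta> by (simp add: has_field_derivative_def)
      have "(snd has_derivative snd) (at z within ?S)" by (auto intro!: derivative_eq_intros)
      from has_derivative_compose[OF this d2]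
      have 2: "((\<lambda>z. \<beta> (snd z)) has_derivative (\<lambda>h. bump k t0 t1 (snd z) * snd h)) (at z within ?S)" .
      show "(\<phi> has_derivative D z) (at z within ?S)"
        using has_derivative_mult[OF 1 2] by (simp add: \<phi>_def[abs_def] D_def[abs_def])
    next
      fix h
      have cs: "continuous_on ?S ?s" by (intro continuous_intros)
      have "continuous_on ?S (\<lambda>z. bump k s0 s1 (?s z))" "continuous_on ?S (\<lambda>z. \<alpha>' (?s z))"
        "continuous_on ?S (\<lambda>z. bump k t0 t1 (snd z))" "continuous_on ?S (\<lambda>z. \<beta> (snd z))"
        using continuous_on_compose2[OF continuous_on_bump cs subset_UNIV] continuous_on_compose2[OF \<alpha>'(2) cs subset_UNIV]
          continuous_on_compose2[OF continuous_on_bump continuous_on_snd[OF continuous_on_id] subset_UNIV, of ?S k t0 t1]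
          continuous_on_compose2[OF c\<beta> continuous_on_snd[OF continuous_on_id] subset_UNIV, of ?S] by blast+
      then show "continuous_on ?S (\<lambda>z. D z h)" unfolding D_def by (intro continuous_intros)
    next
      let ?K = "{z. 0 \<le> fst z \<and> 0 \<le> snd z \<and> snd z \<le> t1 \<and> s0 \<le> ?s z \<and> ?s z \<le> s1}"
      have sub: "?K \<subseteq> {0..s1 + a * t1} \<times> {0..t1}"
      proof
        fix z assume z: "z \<in> ?K"
        then have "a * snd z \<le> a * t1" using a by auto
        then show "z \<in> {0..s1 + a * t1} \<times> {0..t1}" using z by (cases z) auto
      qed
      have "closed ?K"
        by (intro closed_Collect_conj closed_Collect_le continuous_intros)
      moreover have "bounded ?K" by (rule bounded_subset[OF _ sub]) (intro bounded_Times, auto)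
      ultimately have "compact ?K" by (simp add: compact_eq_bounded_closed)
      moreover have "?K \<subseteq> ?S" using sub s t by fastforce
      moreover have "\<phi> z = 0" if z: "z \<in> ?S - ?K" for z
      proof -
        have "snd z > t1 \<or> ?s z \<notin> {s0<..<s1}" using z by (cases z) auto
        then show ?thesis
          using bump_eq_0[OF s(1), of "?s z" k] \<Phi>(2)[of "snd z"] by (auto simp: \<phi>_def \<beta>_def)
      qed
      ultimately show "\<exists>K. compact K \<and> K \<subseteq> ?S \<and> (\<forall>z\<in>?S - K. \<phi> z = 0)" by blast
    qed
    from wu[unfolded weak_transport_def, rule_format, OF this] ww[unfolded weak_transport_def, rule_format, OF this]
    have eq: "(LINT z:?R|lebesgue. u z * (D z (0, 1) + a * D z (1, 0))) = (LINT z:?R|lebesgue. w z * (D z (0, 1) + a * D z (1, 0)))"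
    proof -
      have "(LINT t:{0<..<T}|lebesgue. \<phi> (0, t) * q t) = (LINT t:{0<..<T}|lebesgue. \<phi> (0, t) * q' t)"
        by (rule set_lebesgue_integral_cong_AE') (use q in auto)
      then show ?thesis
        using wu[unfolded weak_transport_def, rule_format, OF \<open>C1c_on ?S \<phi> D\<close>] ww[unfolded weak_transport_def, rule_format, OF \<open>C1c_on ?S \<phi> D\<close>]
        by linarith
    qed
    define b where "b z = bump k s0 s1 (?s z) * bump k t0 t1 (snd z)" for z
    \<comment> \<open>The first factor is constant along characteristics, so the transport
      derivative falls on \<open>\<beta>\<close> alone and produces a product of two bumps.\<close>
    have Db: "D z (0, 1) + a * D z (1, 0) = b z" for z by (simp add: D_def b_def algebra_simps)
    have cb: "continuous_on UNIV b" unfolding b_def[abs_def]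
      by (intro continuous_on_mult continuous_on_compose2[OF continuous_on_bump] continuous_intros) auto
    have bb: "\<bar>b z\<bar> \<le> 1" for z
      using bump_nonneg bump_le_1 by (auto simp: b_def abs_mult intro!: mult_le_one)
    have fb: "(\<lambda>z. f z * b z) absolutely_integrable_on ?R" if f: "f absolutely_integrable_on ?R" for f
    proof -
      have "b \<in> borel_measurable (lebesgue_on ?R)"
        by (intro continuous_imp_measurable_on_sets_lebesgue continuous_on_subset[OF cb] Rl) auto
      moreover have "bounded (b ` ?R)" using bb by (auto simp: bounded_iff)
      ultimately have "(\<lambda>z. b z * f z) absolutely_integrable_on ?R"
        using absolutely_integrable_bounded_measurable_product[OF bilinear_times, of b ?R f] f Rl by simp
      then show ?thesis by (simp add: mult.commute)
    qed
    have "(LINT z:?R|lebesgue. d z * b z) = (LINT z:?R|lebesgue. u z * b z) - (LINT z:?R|lebesgue. w z * b z)"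
      using set_integral_diff(2)[OF fb[OF u] fb[OF w]] by (simp add: d_def left_diff_distrib)
    then show ?thesis using eq by (simp add: Db b_def)
  qed
  define dR where "dR z = indicator ?R z * d z" for z
  have "integrable lebesgue dR" using d by (simp add: dR_def[abs_def] set_integrable_def)
  then obtain f where f: "f \<in> borel_measurable lborel" "AE z in lborel. dR z = f z"
    using completion_ex_borel_measurable_real[of dR lborel] by (auto dest: borel_measurable_integrable)
  have fl: "AE z in lebesgue. dR z = f z" using f(2) by (rule AE_completion)
  have "integrable lebesgue f"
    using \<open>integrable lebesgue dR\<close> fl f(1) by (subst integrable_cong_AE[of _ _ dR]) (auto simp: measurable_completion eq_commute)
  then have fi: "integrable lborel f" using f(1) by (simp add: integrable_completion)
  have fM: "f \<in> borel_measurable borel" using f(1) by simp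
  \<comment> \<open>The difference of the solutions in characteristic coordinates, where the product
    of bumps approximates the indicator of a box.\<close>
  define h where "h z = f (fst z + a * snd z, snd z)" for z
  have hM: "h \<in> borel_measurable borel" unfolding h_def[abs_def] using measurable_compose[OF shear_measurable fM] .
  have hi: "integrable lborel h" unfolding h_def[abs_def] using fi integral_shear(2)[OF fM] by blast
  have ha: "h absolutely_integrable_on UNIV"
    using hi hM by (simp add: set_integrable_def integrable_completion)
  let ?Q = "{z. 0 < snd z \<and> snd z < T \<and> 0 < fst z + a * snd z \<and> fst z + a * snd z < l}"
  have oQ: "open ?Q" by (intro open_Collect_conj open_Collect_less continuous_intros)
  have "negligible {z\<in>?Q. h z \<noteq> 0}"
  proof (rule negligible_nonzero_if_box_integrals_zero[OF oQ])
    show "h absolutely_integrable_on ?Q" by (rule set_integrable_subset[OF ha]) (use oQ in \<open>auto simp: borel_open\<close>)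
    fix p q assume pq: "cbox p q \<subseteq> ?Q"
    obtain s0 t0 where p: "p = (s0, t0)" by fastforce
    obtain s1 t1 where q: "q = (s1, t1)" by fastforce
    show "integral (cbox p q) h = 0"
    proof (cases "s0 < s1 \<and> t0 < t1")
      case True
      then have "(s1, t1) \<in> cbox p q" "(s0, t0) \<in> cbox p q" by (auto simp: p q cbox_Pair_eq)
      then have "(s1, t1) \<in> ?Q" "(s0, t0) \<in> ?Q" using pq by blast+
      then have st: "s0 < s1" "s1 + a * t1 < l" "0 < t0" "t0 < t1" "t1 < T" using True by auto
      have "integral ({s0<..<s1} \<times> {t0<..<t1}) h = 0"
      proof (rule integral_zero_if_cutoffs_zero[OF ha, where ch = "\<lambda>k z. bump k s0 s1 (fst z) * bump k t0 t1 (snd z)"])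
        show "continuous_on UNIV (\<lambda>z. bump k s0 s1 (fst z) * bump k t0 t1 (snd z))" for k
          by (intro continuous_on_mult continuous_on_compose2[OF continuous_on_bump] continuous_intros) auto
        show "\<bar>bump k s0 s1 (fst z) * bump k t0 t1 (snd z)\<bar> \<le> 1" for k and z :: "real \<times> real"
          using bump_nonneg bump_le_1 by (auto simp: abs_mult intro!: mult_le_one)
        show "(\<lambda>k. bump k s0 s1 (fst z) * bump k t0 t1 (snd z)) \<longlonglongrightarrow> indicator ({s0<..<s1} \<times> {t0<..<t1}) z" for z
          using tendsto_mult[OF bump_tendsto[OF st(1), of "fst z"] bump_tendsto[OF st(4), of "snd z"]]
          by (simp add: indicator_times)
        fix k :: nat
        let ?b = "\<lambda>z. bump k s0 s1 (fst z - a * snd z) * bump k t0 t1 (snd z)"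
        have cb: "continuous_on UNIV ?b"
          by (intro continuous_on_mult continuous_on_compose2[OF continuous_on_bump] continuous_intros) auto
        then have bM: "?b \<in> borel_measurable borel" by (rule borel_measurable_continuous_onI)
        have "0 = (LINT z:?R|lebesgue. d z * ?b z)" using key[OF st] by simp
        also have "\<dots> = (LINT z|lebesgue. f z * ?b z)"
          unfolding set_lebesgue_integral_def
          by (rule lebesgue_integral_cong_AE') (use fl in \<open>eventually_elim, simp add: dR_def\<close>)
        also have "\<dots> = (LINT z|lborel. f z * ?b z)" using fM bM by (intro integral_completion) simp
        also have "\<dots> = (LINT z|lborel. h z * (bump k s0 s1 (fst z) * bump k t0 t1 (snd z)))"
          using integral_shear(1)[of "\<lambda>z. f z * ?b z" a] fM bM by (simp add: h_def)
        finally have z: "(LINT z|lborel. h z * (bump k s0 s1 (fst z) * bump k t0 t1 (snd z))) = 0" by simp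
        have cc: "continuous_on UNIV (\<lambda>z::real \<times> real. bump k s0 s1 (fst z) * bump k t0 t1 (snd z))"
          by (intro continuous_on_mult continuous_on_compose2[OF continuous_on_bump] continuous_intros) auto
        have cM: "(\<lambda>z::real \<times> real. bump k s0 s1 (fst z) * bump k t0 t1 (snd z)) \<in> borel_measurable borel"
          by (rule borel_measurable_continuous_onI[OF cc])
        have "integrable lborel (\<lambda>z. h z * (bump k s0 s1 (fst z) * bump k t0 t1 (snd z)))"
          by (rule Bochner_Integration.integrable_bound[OF hi])
            (use hM cM bump_nonneg bump_le_1 in \<open>auto simp: abs_mult intro!: mult_left_le mult_le_one\<close>)
        then show "integral UNIV (\<lambda>z. h z * (bump k s0 s1 (fst z) * bump k t0 t1 (snd z))) = 0"
          using z by (simp add: integral_lborel)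
      qed auto
      moreover have "integral (cbox p q) h = integral (box p q) h" by (simp add: integral_open_interval)
      moreover have "box p q = {s0<..<s1} \<times> {t0<..<t1}" by (auto simp: p q box_prod box_real)
      ultimately show ?thesis by simp
    next
      case False
      then have "measure lborel (cbox p q) = 0" unfolding p q by (auto simp: content_Pair content_real_eq_0)
      then show ?thesis by (rule integral_null)
    qed
  qed
  moreover have "{z\<in>?Q. h z \<noteq> 0} \<in> sets borel"
  proof -
    have "{z\<in>space borel. h z \<noteq> 0} \<in> sets borel" using hM by measurable
    then have "?Q \<inter> {z\<in>space borel. h z \<noteq> 0} \<in> sets borel" using oQ by (intro sets.Int) auto
    moreover have "?Q \<inter> {z\<in>space borel. h z \<noteq> 0} = {z\<in>?Q. h z \<noteq> 0}" by auto
    ultimately show ?thesis by simp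
  qed
  ultimately have 0: "emeasure lborel {z\<in>?Q. h z \<noteq> 0} = 0"
    by (simp add: negligible_iff_null_sets null_sets_def main_part_sets emeasure_completion)
  let ?G = "?R \<inter> {z\<in>space borel. f z \<noteq> 0}"
  let ?h = "\<lambda>z::real \<times> real. (fst z + a * snd z, snd z)"
  have G: "?G \<in> sets borel"
  proof -
    have "{z\<in>space borel. f z \<noteq> 0} \<in> sets borel" using fM by measurable
    then show ?thesis using oR by (intro sets.Int) auto
  qed
  \<comment> \<open>The shear preserves measure, so a null set in characteristic coordinates is null
    in the original ones.\<close>
  have "emeasure lborel ?G = emeasure (distr lborel borel ?h) ?G" by (simp only: distr_shear)
  also have "\<dots> = emeasure lborel (?h -` ?G \<inter> space lborel)"
    using shear_measurable[of a] G by (subst emeasure_distr) auto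
  also have "?h -` ?G \<inter> space lborel = {z\<in>?Q. h z \<noteq> 0}" by (auto simp: h_def)
  finally have "?G \<in> null_sets lborel" using 0 G by (simp add: null_sets_def)
  then have "AE z in lborel. z \<in> ?R \<longrightarrow> f z = 0" by (rule AE_I'[where N = ?G]) auto
  then have "AE z in lebesgue. z \<in> ?R \<longrightarrow> f z = 0" by (rule AE_completion)
  with fl have "AE z in lebesgue. \<not> (z \<in> ?R \<and> u z \<noteq> w z)"
    by eventually_elim (auto simp: dR_def d_def)
  then have "negligible {z. \<not> \<not> (z \<in> ?R \<and> u z \<noteq> w z)}" unfolding negligible_iff_AE .
  then show ?thesis by (rule negligible_subset) auto
qed

section \<open>Representatives of parabolic solutions\<close>

text \<open>Helly's selection is applied to the indefinite integrals of
  \<open>\<bar>G n\<bar>\<close> and to their differences with \<open>F n\<close>, both monotone and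
  uniformly bounded. Along two successive subsequences they converge off a countable set, and
  dominated convergence identifies the difference of the limits with \<open>u\<close>.\<close>

lemma monotone_difference_L1_limit:
  fixes F G :: "nat \<Rightarrow> real \<Rightarrow> real"
  assumes l: "l > 0" and F: "\<And>n. primitive_on 0 l (F n) (G n)"
    and G_bound: "\<And>n. abs_integral l (G n) \<le> C" and F0: "\<And>n. \<bar>F n 0\<bar> \<le> C"
    and u: "u absolutely_integrable_on {0..l}"
    and lim: "(\<lambda>n. abs_integral l (\<lambda>x. F n x - u x)) \<longlonglongrightarrow> 0"
  obtains V where "monotone_difference V" "negligible {x\<in>{0<..<l}. u x \<noteq> V x}"
proof -
  note hk = set_lebesgue_integral_eq_integral
  \<comment> \<open>Clamping the argument to the arc extends all functions to the line as constants
    outside, the setting of Helly's theorem.\<close>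
  define cl where "cl x = max 0 (min l x)" for x :: real
  define A where "A n x = abs_integral x (G n)" for n x
  define P where "P n x = A n (cl x)" for n x
  define N where "N n x = A n (cl x) - F n (cl x)" for n x
  have cl: "cl x \<in> {0..l}" "x \<le> y \<Longrightarrow> cl x \<le> cl y" "continuous_on UNIV cl" for x y
    unfolding cl_def using l by (auto intro!: continuous_intros)
  have clx: "cl x = x" if "x \<in> {0..l}" for x using that by (auto simp: cl_def)
  have Gi: "G n absolutely_integrable_on {a..b}" if "0 \<le> a" "b \<le> l" for n a b
    using absolutely_integrable_subinterval[OF primitive_onD(1)[OF F] that] .
  have Ai: "primitive_on 0 l (A n) (\<lambda>x. \<bar>G n x\<bar>)" for n
    unfolding primitive_on_def A_def using set_integrable_abs[OF Gi[of 0 l]] l by simp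
  have step: "\<bar>F n y - F n x\<bar> \<le> A n y - A n x" if "0 \<le> x" "x \<le> y" "y \<le> l" for n x y
    unfolding primitive_on_diff[OF F that] primitive_on_diff[OF Ai that]
    using integral_norm_bound_integral[of "G n" "{x..y}" "\<lambda>x. \<bar>G n x\<bar>"]
      hk(1)[OF Gi[OF that(1,3)]] hk(1)[OF set_integrable_abs[OF Gi[OF that(1,3)]]] by simp
  have Fb: "\<bar>F n x\<bar> \<le> 2 * C" and Ab: "0 \<le> A n x" "A n x \<le> C" if "x \<in> {0..l}" for n x
  proof -
    have 0: "A n 0 = 0" by (simp add: A_def)
    have "A n l \<le> C" using G_bound by (simp add: A_def)
    then show "0 \<le> A n x" "A n x \<le> C" "\<bar>F n x\<bar> \<le> 2 * C"
      using step[of 0 x n] step[of x l n] F0[of n] that 0 by auto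
  qed
  have cont: "continuous_on UNIV (P n)" "continuous_on UNIV (N n)" for n
    unfolding P_def[abs_def] N_def[abs_def]
    by (intro continuous_on_diff continuous_on_compose2[OF primitive_on_continuous[OF Ai] cl(3)]
        continuous_on_compose2[OF primitive_on_continuous[OF F] cl(3)]; use cl(1) in blast)+
  have rc: "continuous (at_right x) (P n)" "continuous (at_right x) (N n)" for n x
    using cont[of n] by (auto simp: continuous_on_eq_continuous_at intro: continuous_at_imp_continuous_at_within)
  have mono: "mono (P n)" "mono (N n)" for n
  proof -
    have "\<bar>F n (cl y) - F n (cl x)\<bar> \<le> A n (cl y) - A n (cl x)" if "x \<le> y" for x y
      using step[of "cl x" "cl y"] cl(1)[of x] cl(1)[of y] cl(2)[OF that] by simp
    then show "mono (P n)" "mono (N n)" unfolding mono_def P_def N_def by (simp_all add: abs_le_iff) force+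
  qed
  have bd: "\<bar>P n x\<bar> \<le> 3 * C" "\<bar>N n x\<bar> \<le> 3 * C" for n x
    using Fb[OF cl(1), of n x] Ab[OF cl(1), of n x] by (auto simp: P_def N_def)
  obtain s P' where s: "strict_mono s" and P': "mono P'" "\<And>x. \<bar>P' x\<bar> \<le> 3 * C"
    and sP: "\<And>x. isCont P' x \<Longrightarrow> (\<lambda>n. P (s n) x) \<longlonglongrightarrow> P' x"
    using Helly_selection[of P "3 * C", OF rc(1) mono(1) bd(1)] by blast
  obtain r N' where r: "strict_mono r" and N': "mono N'" "\<And>x. \<bar>N' x\<bar> \<le> 3 * C"
    and rN: "\<And>x. isCont N' x \<Longrightarrow> (\<lambda>n. N (s (r n)) x) \<longlonglongrightarrow> N' x"
    using Helly_selection[of "\<lambda>n. N (s n)" "3 * C", OF rc(2) mono(2) bd(2)] by blast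
  define V where "V x = P' x - N' x" for x
  have V: "monotone_difference V"
    using P' N' by (intro monotone_differenceI[of P' N' "3 * C"]) (auto simp: V_def)
  have VC: "\<bar>V x\<bar> \<le> 6 * C" for x using P'(2)[of x] N'(2)[of x] by (simp add: V_def)
  let ?I = "indicator {0..l} :: real \<Rightarrow> real"
  have ui: "integrable lebesgue (\<lambda>x. ?I x * u x)" using u by (simp add: set_integrable_def)
  have Fi: "F n absolutely_integrable_on {0..l}" for n
    using absolutely_integrable_continuous_real[OF primitive_on_continuous[OF F]] .
  have "{x. \<not> isCont P' x} \<in> null_sets lborel" "{x. \<not> isCont N' x} \<in> null_sets lborel"
    using mono_ctble_discont[OF P'(1)] mono_ctble_discont[OF N'(1)] by (simp_all add: countable_imp_null_set_lborel)
  then have "{x. \<not> isCont P' x} \<in> null_sets lebesgue" "{x. \<not> isCont N' x} \<in> null_sets lebesgue"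
    by (blast intro: null_sets_completionI)+
  then have "AE x in lebesgue. isCont P' x" "AE x in lebesgue. isCont N' x"
    by (auto elim: AE_I')
  then have ae: "AE x in lebesgue. isCont P' x \<and> isCont N' x" by eventually_elim simp
  have Vm: "V \<in> borel_measurable lebesgue"
    using monotone_difference_measurable[OF V] by (intro measurable_completion) simp
  have "(\<lambda>n. LINT x|lebesgue. ?I x * \<bar>F (s (r n)) x - u x\<bar>) \<longlonglongrightarrow> (LINT x|lebesgue. ?I x * \<bar>V x - u x\<bar>)"
  proof (rule integral_dominated_convergence[where w = "\<lambda>x. ?I x * (2 * C) + \<bar>?I x * u x\<bar>"])
    have e: "?I x * \<bar>f x - u x\<bar> = \<bar>?I x * f x - ?I x * u x\<bar>" for f x by (simp add: indicator_def)
    have m: "(\<lambda>x. ?I x * u x) \<in> borel_measurable lebesgue" using ui by (rule borel_measurable_integrable)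
    show "(\<lambda>x. ?I x * \<bar>V x - u x\<bar>) \<in> borel_measurable lebesgue"
    proof -
      have "?I \<in> borel_measurable lebesgue" by (rule borel_measurable_indicator) simp
      then show ?thesis unfolding e by (intro borel_measurable_abs borel_measurable_diff m borel_measurable_times Vm)
    qed
    have "(\<lambda>x. ?I x * F n x) \<in> borel_measurable lebesgue" for n
      using Fi[of n] by (auto simp: set_integrable_def dest: borel_measurable_integrable)
    then show "(\<lambda>x. ?I x * \<bar>F (s (r n)) x - u x\<bar>) \<in> borel_measurable lebesgue" for n
      unfolding e using m by (intro borel_measurable_abs borel_measurable_diff) auto
    show "integrable lebesgue (\<lambda>x. ?I x * (2 * C) + \<bar>?I x * u x\<bar>)"
      using ui by (intro Bochner_Integration.integrable_add integrable_abs integrable_mult_left) (auto simp: integrable_indicator_iff emeasure_lborel_Icc_eq)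
    show "AE x in lebesgue. norm (?I x * \<bar>F (s (r n)) x - u x\<bar>) \<le> ?I x * (2 * C) + \<bar>?I x * u x\<bar>" for n
    proof (rule AE_I2)
      fix x show "norm (?I x * \<bar>F (s (r n)) x - u x\<bar>) \<le> ?I x * (2 * C) + \<bar>?I x * u x\<bar>"
        using Fb[of x "s (r n)"] by (auto simp: indicator_def)
    qed
    show "AE x in lebesgue. (\<lambda>n. ?I x * \<bar>F (s (r n)) x - u x\<bar>) \<longlonglongrightarrow> ?I x * \<bar>V x - u x\<bar>"
      using ae
    proof eventually_elim
      case (elim x)
      have "(\<lambda>n. P (s (r n)) x - N (s (r n)) x) \<longlonglongrightarrow> V x"
        unfolding V_def using LIMSEQ_subseq_LIMSEQ[OF sP r] rN elim by (intro tendsto_diff) (auto simp: o_def)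
      then have "(\<lambda>n. F (s (r n)) x) \<longlonglongrightarrow> V x" if "x \<in> {0..l}" using that by (simp add: P_def N_def clx)
      then show ?case by (cases "x \<in> {0..l}") (auto intro!: tendsto_intros)
    qed
  qed
  moreover have "(LINT x|lebesgue. ?I x * \<bar>F n x - u x\<bar>) = abs_integral l (\<lambda>x. F n x - u x)" for n
    using hk(2)[OF set_integrable_abs[OF set_integral_diff(1)[OF Fi u]]] by (simp add: set_lebesgue_integral_def)
  then have "(\<lambda>n. LINT x|lebesgue. ?I x * \<bar>F (s (r n)) x - u x\<bar>) \<longlonglongrightarrow> 0"
    using LIMSEQ_subseq_LIMSEQ[OF lim strict_mono_o[OF s r]] by (simp add: o_def)
  ultimately have 0: "(LINT x|lebesgue. ?I x * \<bar>V x - u x\<bar>) = 0" by (rule LIMSEQ_unique)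
  have "V absolutely_integrable_on {0..l}"
    by (rule bounded_borel_absolutely_integrable[OF monotone_difference_measurable[OF V], of _ "6 * C"])
      (use VC in auto)
  then have "integrable lebesgue (\<lambda>x. ?I x * \<bar>V x - u x\<bar>)"
    using set_integrable_abs[OF set_integral_diff(1)[OF _ u]] by (simp add: set_integrable_def)
  then have "AE x in lebesgue. ?I x * \<bar>V x - u x\<bar> = 0"
    using 0 by (subst (asm) integral_nonneg_eq_0_iff_AE) auto
  then have "AE x in lebesgue. \<not> (x \<in> {0<..<l} \<and> u x \<noteq> V x)" by eventually_elim auto
  then have "negligible {x\<in>{0<..<l}. u x \<noteq> V x}" unfolding negligible_iff_AE[symmetric] not_not .
  with V show ?thesis by (rule that)
qed

section \<open>Regular representatives and Sobolev embedding on an interval\<close>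

text \<open>\<open>F\<close> is the continuously differentiable representative of \<open>f\<close>,
  and \<open>G\<close> is its derivative and the absolutely continuous representative of
  \<open>weak_deriv\<close>. The first two clauses certify that the chosen derivatives really are
  weak derivatives, which the choice operator alone does not guarantee.\<close>

definition W21_representative :: "real \<Rightarrow> (real \<Rightarrow> real) \<Rightarrow> (real \<Rightarrow> real) \<Rightarrow> (real \<Rightarrow> real) \<Rightarrow> bool" where
  "W21_representative l f F G \<longleftrightarrow>
     has_weak_deriv {0<..<l} f (weak_deriv {0<..<l} f) \<and>
     has_weak_deriv {0<..<l} (weak_deriv {0<..<l} f) (weak_deriv {0<..<l} (weak_deriv {0<..<l} f)) \<and>
     (AE x in lebesgue. x \<in> {0<..<l} \<longrightarrow> f x = F x) \<and>
     (AE x in lebesgue. x \<in> {0<..<l} \<longrightarrow> weak_deriv {0<..<l} f x = G x) \<and>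
     (\<forall>x\<in>{0..l}. (F has_real_derivative G x) (at x within {0..l})) \<and>
     primitive_on 0 l G (weak_deriv {0<..<l} (weak_deriv {0<..<l} f))"

lemma negligible_neq_iff: "negligible {x\<in>S. f x \<noteq> g x} \<longleftrightarrow> (AE x in lebesgue. x \<in> S \<longrightarrow> f x = g x)"
  unfolding negligible_iff_AE[symmetric] by (rule arg_cong[of _ _ negligible]) auto

lemma L1_norm_cong_AE: "AE x in lebesgue. x \<in> S \<longrightarrow> f x = g x \<Longrightarrow> L1_norm S f = L1_norm S g"
  unfolding L1_norm_def by (rule set_lebesgue_integral_cong_AE') (auto elim: eventually_mono)

lemma L1_norm_interval:
  assumes "f absolutely_integrable_on {0<..<l::real}"
  shows "L1_norm {0<..<l} f = abs_integral l f"
  unfolding L1_norm_def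
  using set_lebesgue_integral_eq_integral(2)[OF set_integrable_abs[OF assms]] by (simp add: integral_open_closed_interval)

lemma has_weak_deriv_cong_AE:
  assumes w: "has_weak_deriv S f g" and f: "AE x in lebesgue. x \<in> S \<longrightarrow> f' x = f x"
  shows "has_weak_deriv S f' g"
proof -
  have "f' absolutely_integrable_on S"
    by (rule absolutely_integrable_spike[where f = f and S = "{x\<in>S. f' x \<noteq> f x}"])
      (use w f[folded negligible_neq_iff] in \<open>auto simp: has_weak_deriv_def\<close>)
  moreover have "(LINT x:S|lebesgue. f' x * D\<phi> x 1) = (LINT x:S|lebesgue. f x * D\<phi> x 1)" for D\<phi> :: "real \<Rightarrow> real \<Rightarrow> real"
    by (rule set_lebesgue_integral_cong_AE') (use f in \<open>auto elim: eventually_mono\<close>)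
  ultimately show ?thesis using w by (auto simp: has_weak_deriv_def)
qed

lemma integrable_mult_compact_support:
  fixes \<phi> :: "real \<Rightarrow> real"
  assumes S: "open S" and f: "f absolutely_integrable_on S" and \<phi>: "continuous_on S \<phi>"
    and K: "compact K" "K \<subseteq> S" "\<And>x. x \<in> S - K \<Longrightarrow> \<phi> x = 0"
  shows "(\<lambda>x. f x * \<phi> x) absolutely_integrable_on S"
proof -
  have "bounded (\<phi> ` K)" by (intro compact_imp_bounded compact_continuous_image continuous_on_subset[OF \<phi>] K)
  then have "bounded (insert 0 (\<phi> ` K))" by simp
  then have "bounded (\<phi> ` S)" by (rule bounded_subset) (use K(3) in auto)
  moreover have "\<phi> \<in> borel_measurable (lebesgue_on S)"
    using S by (intro continuous_imp_measurable_on_sets_lebesgue \<phi>) (auto simp: borel_open)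
  ultimately have "(\<lambda>x. \<phi> x * f x) absolutely_integrable_on S"
    using absolutely_integrable_bounded_measurable_product[OF bilinear_times, of \<phi> S f] f S by (simp add: borel_open)
  then show ?thesis by (simp add: mult.commute)
qed

text \<open>Splitting the integrals requires integrable products, hence bounded factors: the test
  function has compact support, and its derivative vanishes off that support as well.\<close>

lemma has_weak_deriv_diff:
  assumes S: "open S" and w: "has_weak_deriv S f g" "has_weak_deriv S f' g'"
  shows "has_weak_deriv S (\<lambda>x. f x - f' x) (\<lambda>x. g x - g' x)"
proof -
  have a: "f absolutely_integrable_on S" "g absolutely_integrable_on S" "f' absolutely_integrable_on S" "g' absolutely_integrable_on S"
    using w by (auto simp: has_weak_deriv_def)
  have "(LINT x:S|lebesgue. (f x - f' x) * D\<phi> x 1) = - (LINT x:S|lebesgue. (g x - g' x) * \<phi> x)"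
    if t: "C1c_on S \<phi> D\<phi>" for \<phi> :: "real \<Rightarrow> real" and D\<phi>
  proof -
    obtain K where K: "compact K" "K \<subseteq> S" "\<And>x. x \<in> S - K \<Longrightarrow> \<phi> x = 0" using t by (auto simp: C1c_on_def)
    have d: "(\<phi> has_derivative D\<phi> x) (at x within S)" if "x \<in> S" for x using t that by (auto simp: C1c_on_def)
    have c: "continuous_on S \<phi>" using d has_derivative_continuous_on by blast
    have cD: "continuous_on S (\<lambda>x. D\<phi> x 1)" using t by (auto simp: C1c_on_def)
    have D0: "D\<phi> x 1 = 0" if x: "x \<in> S - K" for x
    proof -
      have "open (S - K)" using S K(1) by (simp add: compact_imp_closed open_Diff)
      have "(\<phi> has_derivative D\<phi> x) (at x)" using d[of x] x at_within_open[OF _ S] by auto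
      moreover have "(\<phi> has_derivative (\<lambda>_. 0)) (at x)"
        by (rule has_derivative_transform_within_open[OF has_derivative_const[of 0] \<open>open (S - K)\<close> x]) (simp add: K(3))
      ultimately have "D\<phi> x = (\<lambda>_. 0)" by (rule has_derivative_unique)
      then show ?thesis by simp
    qed
    have "(LINT x:S|lebesgue. (f x - f' x) * D\<phi> x 1) = (LINT x:S|lebesgue. f x * D\<phi> x 1) - (LINT x:S|lebesgue. f' x * D\<phi> x 1)"
      unfolding left_diff_distrib
      by (rule set_integral_diff(2)) (rule integrable_mult_compact_support[OF S _ cD K(1,2) D0], use a in auto)+
    moreover have "(LINT x:S|lebesgue. (g x - g' x) * \<phi> x) = (LINT x:S|lebesgue. g x * \<phi> x) - (LINT x:S|lebesgue. g' x * \<phi> x)"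
      unfolding left_diff_distrib
      by (rule set_integral_diff(2)) (rule integrable_mult_compact_support[OF S _ c K], use a in auto)+
    ultimately show ?thesis using w t by (auto simp: has_weak_deriv_def)
  qed
  then show ?thesis using a by (simp add: has_weak_deriv_def set_integral_diff(1))
qed

lemma has_weak_deriv_weak_deriv: "has_weak_deriv S f g \<Longrightarrow> has_weak_deriv S f (weak_deriv S f)"
  unfolding weak_deriv_def by (rule someI[where P = "has_weak_deriv S f"])

text \<open>By uniqueness the choice is harmless: it returns a known derivative up to a null set,
  also after \<open>f\<close> has been changed on a null set.\<close>

lemma weak_deriv_AE_eq:
  assumes "has_weak_deriv {a<..<b} f g" "AE x in lebesgue. x \<in> {a<..<b} \<longrightarrow> f x = f' x" 
  shows "AE x in lebesgue. x \<in> {a<..<b} \<longrightarrow> weak_deriv {a<..<b} f' x = g x"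
proof -
  have "has_weak_deriv {a<..<b} f' g"
    by (rule has_weak_deriv_cong_AE[OF assms(1)]) (use assms(2) in \<open>auto elim: eventually_mono\<close>)
  from has_weak_deriv_unique[OF has_weak_deriv_weak_deriv[OF this] this]
  show ?thesis unfolding negligible_neq_iff by simp
qed

lemma W21_representative_exists:
  assumes l: "l > 0" and f: "W21_on {0<..<l} f"
  obtains F G where "W21_representative l f F G"
proof -
  let ?S = "{0<..<l}"
  let ?g = "weak_deriv ?S f" and ?h = "weak_deriv ?S (weak_deriv ?S f)"
  obtain g h where gh: "has_weak_deriv ?S f g" "has_weak_deriv ?S g h" using f by (auto simp: W21_on_def)
  have w1: "has_weak_deriv ?S f ?g" by (rule has_weak_deriv_weak_deriv[OF gh(1)])
  have "has_weak_deriv ?S ?g h"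
    by (rule has_weak_deriv_cong_AE[OF gh(2)]) (rule weak_deriv_AE_eq[OF gh(1)], simp)
  then have w2: "has_weak_deriv ?S ?g ?h" by (rule has_weak_deriv_weak_deriv)
  obtain F where F: "primitive_on 0 l F ?g" "negligible {x\<in>?S. f x \<noteq> F x}"
    by (rule has_weak_deriv_imp_primitive_on[OF l w1]) blast
  obtain G where G: "primitive_on 0 l G ?h" "negligible {x\<in>?S. ?g x \<noteq> G x}"
    by (rule has_weak_deriv_imp_primitive_on[OF l w2]) blast
  have cG: "continuous_on {0..l} G" by (rule primitive_on_continuous[OF G(1)])
  have FG: "F x = F 0 + integral {0..x} G" if "x \<in> {0..l}" for x
  proof -
    have "integral {0..x} ?g = integral {0..x} G"
      by (rule integral_spike[of "{x\<in>?S. ?g x \<noteq> G x} \<union> {0, l}"]) (use G(2) that in auto)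
    then show ?thesis using primitive_onD(2)[OF F(1) that] by simp
  qed
  have "(F has_real_derivative G x) (at x within {0..l})" if x: "x \<in> {0..l}" for x
  proof -
    have "((\<lambda>x. integral {0..x} G) has_real_derivative G x) (at x within {0..l})"
      using integral_has_vector_derivative[OF cG x] by (simp add: has_real_derivative_iff_has_vector_derivative)
    from DERIV_add[OF DERIV_const[of "F 0"] this]
    have "((\<lambda>x. F 0 + integral {0..x} G) has_derivative (*) (G x)) (at x within {0..l})" by (simp add: has_field_derivative_def)
    from has_derivative_transform[where g = F, OF x _ this]
    show ?thesis unfolding has_field_derivative_def using FG by blast
  qed
  then have "W21_representative l f F G" using w1 w2 F(2) G unfolding W21_representative_def negligible_neq_iff by blast
  then show ?thesis by (rule that)
qed

lemma W21_representativeD: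
  assumes "W21_representative l f F G"
  shows "has_weak_deriv {0<..<l} f (weak_deriv {0<..<l} f)"
    "has_weak_deriv {0<..<l} (weak_deriv {0<..<l} f) (weak_deriv {0<..<l} (weak_deriv {0<..<l} f))"
    "AE x in lebesgue. x \<in> {0<..<l} \<longrightarrow> f x = F x" "AE x in lebesgue. x \<in> {0<..<l} \<longrightarrow> weak_deriv {0<..<l} f x = G x"
    "\<And>x. x \<in> {0..l} \<Longrightarrow> (F has_real_derivative G x) (at x within {0..l})"
    "primitive_on 0 l G (weak_deriv {0<..<l} (weak_deriv {0<..<l} f))"
    "continuous_on {0..l} F" "continuous_on {0..l} G"
proof -
  note r = assms[unfolded W21_representative_def]
  show d: "\<And>x. x \<in> {0..l} \<Longrightarrow> (F has_real_derivative G x) (at x within {0..l})" using r by blast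
  then show "continuous_on {0..l} F" by (rule DERIV_continuous_on)
  show "primitive_on 0 l G (weak_deriv {0<..<l} (weak_deriv {0<..<l} f))" using r by blast
  then show "continuous_on {0..l} G" by (rule primitive_on_continuous)
qed (use assms[unfolded W21_representative_def] in blast)+

lemma W21_representative_integrable:
  assumes "W21_representative l f F G"
  shows "F absolutely_integrable_on {0<..<l}" "G absolutely_integrable_on {0<..<l}"
    "weak_deriv {0<..<l} (weak_deriv {0<..<l} f) absolutely_integrable_on {0<..<l}"
  unfolding absolutely_integrable_open_closed_interval
  by (intro absolutely_integrable_continuous_real W21_representativeD(7,8)[OF assms]
      primitive_onD(1)[OF W21_representativeD(6)[OF assms]])+

lemma W21_norm_diff:
  assumes r: "W21_representative l f F G" "W21_representative l f' F' G'"
  defines "h \<equiv> weak_deriv {0<..<l} (weak_deriv {0<..<l} f)" and "h' \<equiv> weak_deriv {0<..<l} (weak_deriv {0<..<l} f')"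
  shows "W21_norm {0<..<l} (\<lambda>x. f x - f' x) =
    abs_integral l (\<lambda>x. F x - F' x) + abs_integral l (\<lambda>x. G x - G' x) + abs_integral l (\<lambda>x. h x - h' x)"
proof -
  let ?S = "{0<..<l}"
  let ?g = "weak_deriv ?S f" and ?g' = "weak_deriv ?S f'"
  let ?f = "\<lambda>x. f x - f' x"
  note d = W21_representativeD[OF r(1), folded h_def] and d' = W21_representativeD[OF r(2), folded h'_def]
  note i = W21_representative_integrable[OF r(1), folded h_def] and i' = W21_representative_integrable[OF r(2), folded h'_def]
  have wd: "has_weak_deriv ?S ?f (\<lambda>x. ?g x - ?g' x)" "has_weak_deriv ?S (\<lambda>x. ?g x - ?g' x) (\<lambda>x. h x - h' x)"
    by (rule has_weak_deriv_diff; use d(1,2) d'(1,2) in simp)+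
  have 1: "AE x in lebesgue. x \<in> ?S \<longrightarrow> weak_deriv ?S ?f x = ?g x - ?g' x"
    by (rule weak_deriv_AE_eq[OF wd(1)]) simp
  have 2: "AE x in lebesgue. x \<in> ?S \<longrightarrow> weak_deriv ?S (weak_deriv ?S ?f) x = h x - h' x"
    by (rule weak_deriv_AE_eq[OF wd(2)]) (use 1 in \<open>auto elim: eventually_mono\<close>)
  have "L1_norm ?S ?f = L1_norm ?S (\<lambda>x. F x - F' x)"
    by (rule L1_norm_cong_AE) (use d(3) d'(3) in eventually_elim, simp)
  moreover have "L1_norm ?S (weak_deriv ?S ?f) = L1_norm ?S (\<lambda>x. G x - G' x)"
    by (rule L1_norm_cong_AE) (use d(4) d'(4) 1 in eventually_elim, simp)
  moreover have "L1_norm ?S (weak_deriv ?S (weak_deriv ?S ?f)) = L1_norm ?S (\<lambda>x. h x - h' x)"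
    by (rule L1_norm_cong_AE[OF 2])
  ultimately show ?thesis
    unfolding W21_norm_def
    by (simp only: L1_norm_interval[OF set_integral_diff(1)] i i')
qed

lemma W21_norm_representative:
  assumes r: "W21_representative l f F G"
  defines "h \<equiv> weak_deriv {0<..<l} (weak_deriv {0<..<l} f)"
  shows "L1_norm {0<..<l} f = abs_integral l F"
    "L1_norm {0<..<l} (weak_deriv {0<..<l} f) = abs_integral l G"
    "L1_norm {0<..<l} h = abs_integral l h"
proof -
  let ?S = "{0<..<l}"
  note i = W21_representative_integrable[OF r, folded h_def]
  show "L1_norm {0<..<l} f = abs_integral l F"
    "L1_norm {0<..<l} (weak_deriv {0<..<l} f) = abs_integral l G"
    "L1_norm {0<..<l} h = abs_integral l h"
    using L1_norm_cong_AE[OF W21_representativeD(3)[OF r]] L1_norm_cong_AE[OF W21_representativeD(4)[OF r]] by (simp_all add: L1_norm_interval i)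
qed

text \<open>The value at \<open>x\<close> differs from that at any \<open>y\<close> by at most the
  integral of \<open>\<bar>G\<bar>\<close>; averaging over \<open>y\<close> gives the
  one-dimensional Sobolev embedding.\<close>

lemma primitive_on_sup_bound:
  assumes l: "l > 0" and F: "primitive_on 0 l F G" and x: "x \<in> {0..l}"
  shows "\<bar>F x\<bar> \<le> abs_integral l F / l + abs_integral l G"
proof -
  note hk = set_lebesgue_integral_eq_integral
  let ?J = "abs_integral l G"
  have G: "G absolutely_integrable_on {0..l}" by (rule primitive_onD(1)[OF F])
  have step: "\<bar>F z - F y\<bar> \<le> ?J" if "0 \<le> y" "y \<le> z" "z \<le> l" for y z
  proof -
    have g: "G absolutely_integrable_on {y..z}" by (rule absolutely_integrable_subinterval[OF G]) (use that in auto)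
    have "\<bar>F z - F y\<bar> \<le> integral {y..z} (\<lambda>x. \<bar>G x\<bar>)"
      unfolding primitive_on_diff[OF F that]
      using integral_norm_bound_integral[of G "{y..z}" "\<lambda>x. \<bar>G x\<bar>"] hk(1)[OF g] hk(1)[OF set_integrable_abs[OF g]] by simp
    also have "\<dots> \<le> ?J"
      by (rule integral_subset_le) (use that hk(1)[OF set_integrable_abs[OF g]] hk(1)[OF set_integrable_abs[OF G]] in auto)
    finally show ?thesis .
  qed
  have "\<bar>F x\<bar> \<le> \<bar>F y\<bar> + ?J" if "y \<in> {0..l}" for y
    using step[of x y] step[of y x] x that by (cases "x \<le> y") auto
  moreover have "(\<lambda>y. \<bar>F y\<bar>) integrable_on {0..l}"
    by (intro integrable_continuous_interval continuous_intros primitive_on_continuous[OF F])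
  ultimately have "abs_integral l (\<lambda>y. F x) \<le> integral {0..l} (\<lambda>y. \<bar>F y\<bar> + ?J)"
    by (intro integral_le integrable_const_ivl Henstock_Kurzweil_Integration.integrable_add) auto
  also have "\<dots> = abs_integral l F + l * ?J"
    using \<open>(\<lambda>y. \<bar>F y\<bar>) integrable_on {0..l}\<close> l by (subst Henstock_Kurzweil_Integration.integral_add) (auto intro: integrable_const_ivl)
  finally show ?thesis using l by (simp add: field_simps)
qed

text \<open>A time modulus uniform in \<open>x\<close>, combined with continuity in \<open>x\<close>
  at the single time \<open>s\<close>, gives joint continuity by the triangle inequality.\<close>

lemma continuous_on_curve:
  fixes F :: "real \<Rightarrow> real \<Rightarrow> real"
  assumes F: "\<And>t. t \<ge> 0 \<Longrightarrow> continuous_on {0..l} (F t)"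
    and lim: "\<And>s. s \<ge> 0 \<Longrightarrow> (N s \<longlongrightarrow> 0) (at s within {0..})"
    and bd: "\<And>s t x. s \<ge> 0 \<Longrightarrow> t \<ge> 0 \<Longrightarrow> x \<in> {0..l} \<Longrightarrow> \<bar>F t x - F s x\<bar> \<le> N s t"
  shows "continuous_on ({0..} \<times> {0..l}) (\<lambda>(t, x). F t x)"
  unfolding continuous_on_def
proof
  fix z :: "real \<times> real" assume "z \<in> {0..} \<times> {0..l}"
  then obtain s x where z: "z = (s, x)" and sx: "s \<in> {0..}" "x \<in> {0..l}" by auto
  let ?A = "at (s, x) within {0..} \<times> {0..l}"
  have nn: "N s s \<ge> 0" using bd[of s s x] sx by simp
  have "((\<lambda>(t, x). F t x) \<longlongrightarrow> F s x) ?A"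
  proof (rule tendstoI)
    fix r :: real assume r: "r > 0"
    have "\<forall>\<^sub>F t in at s within {0..}. N s t < r / 2" using lim[of s] sx r by (intro order_tendstoD) auto
    then obtain d where d: "d > 0" "\<And>t. t \<ge> 0 \<Longrightarrow> t \<noteq> s \<Longrightarrow> dist t s < d \<Longrightarrow> N s t < r / 2"
      by (auto simp: eventually_at)
    obtain d' where d': "d' > 0" "\<And>y. y \<in> {0..l} \<Longrightarrow> dist y x < d' \<Longrightarrow> dist (F s y) (F s x) < r / 2"
      using F[of s] sx r unfolding continuous_on_iff by (metis atLeast_iff half_gt_zero)
    have "dist (F t y) (F s x) < r" if "t \<ge> 0" "y \<in> {0..l}" "dist (t, y) (s, x) < min d d'" for t y
    proof -
      have "dist t s < d" "dist y x < d'" using that dist_fst_le[of "(t, y)" "(s, x)"] dist_snd_le[of "(t, y)" "(s, x)"] by auto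
      then have "\<bar>F t y - F s y\<bar> < r / 2" using d(2)[of t] bd[of s t y] that sx r by (cases "t = s") auto
      moreover have "\<bar>F s y - F s x\<bar> < r / 2" using d'(2)[OF that(2) \<open>dist y x < d'\<close>] by (simp add: dist_real_def)
      ultimately have "\<bar>F t y - F s x\<bar> < r" by linarith
      then show ?thesis by (simp add: dist_real_def)
    qed
    then show "\<forall>\<^sub>F z in ?A. dist ((\<lambda>(t, x). F t x) z) (F s x) < r"
      unfolding eventually_at using d(1) d'(1) by (intro exI[of _ "min d d'"]) auto
  qed
  then show "((\<lambda>(t, x). F t x) \<longlongrightarrow> (case z of (t, x) \<Rightarrow> F t x)) (at z within {0..} \<times> {0..l})" by (simp add: z)
qed

lemma W21_representative_primitive: "W21_representative l f F G \<Longrightarrow> primitive_on 0 l F G"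
  by (rule primitive_on_of_derivative) (auto dest: W21_representativeD(5,8))

lemma W21_representative_traces:
  assumes l: "l > 0" and r: "W21_representative l f F G"
  shows "boundary_trace {0<..<l} f 0 = F 0" "boundary_trace {0<..<l} f l = F l"
    "boundary_trace {0<..<l} (weak_deriv {0<..<l} f) 0 = G 0" "boundary_trace {0<..<l} (weak_deriv {0<..<l} f) l = G l"
proof -
  note d = W21_representativeD[OF r]
  have i: "f absolutely_integrable_on {0<..<l}" "weak_deriv {0<..<l} f absolutely_integrable_on {0<..<l}"
    using d(1) by (auto simp: has_weak_deriv_def)
  show "boundary_trace {0<..<l} f 0 = F 0" "boundary_trace {0<..<l} f l = F l"
    using boundary_trace_interval[OF l i(1) d(7)] d(3) by (simp_all only: negligible_neq_iff)
  show "boundary_trace {0<..<l} (weak_deriv {0<..<l} f) 0 = G 0" "boundary_trace {0<..<l} (weak_deriv {0<..<l} f) l = G l"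
    using boundary_trace_interval[OF l i(2) d(8)] d(4) by (simp_all only: negligible_neq_iff)
qed

lemma L1_norm_nonneg: "L1_norm S f \<ge> 0"
  unfolding L1_norm_def set_lebesgue_integral_def by (intro integral_nonneg_AE) auto

lemma integral_abs_nonneg: "integral S (\<lambda>x. \<bar>f x :: real\<bar>) \<ge> 0"
  by (cases "(\<lambda>x. \<bar>f x\<bar>) integrable_on S") (auto intro: Henstock_Kurzweil_Integration.integral_nonneg simp: not_integrable_integral)

lemma W21_norm_nonneg: "W21_norm S f \<ge> 0"
  unfolding W21_norm_def by (intro add_nonneg_nonneg L1_norm_nonneg)

lemma tendsto_0_sum_component:
  fixes f :: "'a \<Rightarrow> 'b \<Rightarrow> real"
  assumes "((\<lambda>t. \<Sum>i\<in>M. f i t) \<longlongrightarrow> 0) F" "finite M" "i \<in> M" "\<And>i t. f i t \<ge> 0"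
  shows "(f i \<longlongrightarrow> 0) F"
  by (rule tendsto_sandwich[OF _ _ tendsto_const assms(1)])
    (use assms(2-4) member_le_sum[of i M "\<lambda>i. f i _"] in auto)

text \<open>The embedding is used twice, for the difference of the representatives and for the
  difference of their derivatives.\<close>

lemma W21_sup_bound:
  assumes l: "l > 0" and r: "W21_representative l f F G" "W21_representative l f' F' G'" and x: "x \<in> {0..l}"
  shows "\<bar>F x - F' x\<bar> \<le> (1 / l + 1) * W21_norm {0<..<l} (\<lambda>x. f x - f' x)"
    "\<bar>G x - G' x\<bar> \<le> (1 / l + 1) * W21_norm {0<..<l} (\<lambda>x. f x - f' x)"
proof -
  let ?h = "weak_deriv {0<..<l} (weak_deriv {0<..<l} f)" and ?h' = "weak_deriv {0<..<l} (weak_deriv {0<..<l} f')"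
  define A where "A = abs_integral l (\<lambda>x. F x - F' x)"
  define C where "C = abs_integral l (\<lambda>x. G x - G' x)"
  define E where "E = abs_integral l (\<lambda>x. ?h x - ?h' x)"
  have n: "A \<ge> 0" "C \<ge> 0" "E \<ge> 0" unfolding A_def C_def E_def by (rule integral_abs_nonneg)+
  have N: "W21_norm {0<..<l} (\<lambda>x. f x - f' x) = A + C + E" using W21_norm_diff[OF r] by (simp add: A_def C_def E_def)
  have 1: "\<bar>F x - F' x\<bar> \<le> A / l + C"
    using primitive_on_sup_bound[OF l primitive_on_minus[OF W21_representative_primitive[OF r(1)] W21_representative_primitive[OF r(2)]] x]
    by (simp add: A_def C_def)
  have 2: "\<bar>G x - G' x\<bar> \<le> C / l + E"
    using primitive_on_sup_bound[OF l primitive_on_minus[OF W21_representativeD(6)[OF r(1)] W21_representativeD(6)[OF r(2)]] x]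
    by (simp add: E_def C_def)
  have "A / l \<ge> 0" "C / l \<ge> 0" "E / l \<ge> 0" using n l by auto
  moreover have "(1 / l + 1) * (A + C + E) = A / l + C / l + E / l + (A + C + E)" by (simp add: distrib_right add_divide_distrib)
  ultimately show "\<bar>F x - F' x\<bar> \<le> (1 / l + 1) * W21_norm {0<..<l} (\<lambda>x. f x - f' x)"
    "\<bar>G x - G' x\<bar> \<le> (1 / l + 1) * W21_norm {0<..<l} (\<lambda>x. f x - f' x)"
    unfolding N using 1 2 n by linarith+
qed

text \<open>The embedding makes the Sobolev-valued curve jointly continuous together with its space
  derivative. \<open>H\<close> is defined by the right-hand side of the equation at all times,
  including \<open>t = 0\<close>, where the equation is not imposed; its continuity there, the last
  conclusion, gives access to the initial size of the time derivative.\<close>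

lemma parabolic_solution_arcs:
  assumes fin: "finite (Inc \<union> Out)" and L: "\<And>i. i \<in> Inc \<union> Out \<Longrightarrow> L i > 0" and lam: "\<And>i. i \<in> Inc \<union> Out \<Longrightarrow> lam i > 0"
    and e: "e > 0" and sol: "parabolic_solution Inc Out L lam K B e u0 u"
  obtains U P H where
    "\<And>i t. i \<in> Inc \<union> Out \<Longrightarrow> t \<ge> 0 \<Longrightarrow> W21_representative (L i) (\<lambda>x. u i (x, t)) (U i t) (P i t)"
    "\<And>i. i \<in> Inc \<union> Out \<Longrightarrow> viscous_arc (L i) (lam i) e (U i) (P i) (H i)"
    "\<And>i t x. H i t x = - lam i * P i t x + e * weak_deriv {0<..<L i} (weak_deriv {0<..<L i} (\<lambda>x. u i (x, t))) x"
    "\<And>i. i \<in> Inc \<union> Out \<Longrightarrow> ((\<lambda>t. abs_integral (L i) (\<lambda>x. H i t x - H i 0 x)) \<longlongrightarrow> 0) (at 0 within {0..})"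
proof -
  let ?M = "Inc \<union> Out"
  have "\<exists>F G. i \<in> ?M \<and> t \<ge> 0 \<longrightarrow> W21_representative (L i) (\<lambda>x. u i (x, t)) F G" for i t
    using sol L W21_representative_exists[of "L i" "\<lambda>x. u i (x, t)"] unfolding parabolic_solution_def arc_interval_def by metis
  then obtain U P where "\<forall>i t. i \<in> ?M \<and> t \<ge> 0 \<longrightarrow> W21_representative (L i) (\<lambda>x. u i (x, t)) (U i t) (P i t)" by metis
  then have r: "W21_representative (L i) (\<lambda>x. u i (x, t)) (U i t) (P i t)" if "i \<in> ?M" "t \<ge> 0" for i t using that by blast
  define h where "h i t = weak_deriv {0<..<L i} (weak_deriv {0<..<L i} (\<lambda>x. u i (x, t)))" for i t
  define H where "H i t x = - lam i * P i t x + e * h i t x" for i t x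
  define N where "N i s t = W21_norm {0<..<L i} (\<lambda>x. u i (x, t) - u i (x, s))" for i s t
  have N0: "N i s t \<ge> 0" for i s t unfolding N_def by (rule W21_norm_nonneg)
  have lim: "(N i s \<longlongrightarrow> 0) (at s within {0..})" if "i \<in> ?M" "s \<ge> 0" for i s
  proof (rule tendsto_0_sum_component[OF _ fin that(1)])
    show "((\<lambda>t. \<Sum>i\<in>?M. N i s t) \<longlongrightarrow> 0) (at s within {0..})"
      using sol that(2) unfolding parabolic_solution_def continuous_curve_def W21_net_norm_def arc_interval_def N_def by blast
  qed (rule N0)
  have lim': "((\<lambda>t. (1 / L i + 1) * N i s t) \<longlongrightarrow> 0) (at s within {0..})" if "i \<in> ?M" "s \<ge> 0" for i s
    using tendsto_mult_right_zero[OF lim[OF that]] .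
  have hi: "h i t absolutely_integrable_on {0..L i}" and Pi: "P i t absolutely_integrable_on {0..L i}"
    and Hi: "H i t absolutely_integrable_on {0..L i}" if "i \<in> ?M" "t \<ge> 0" for i t
  proof -
    show i: "h i t absolutely_integrable_on {0..L i}" "P i t absolutely_integrable_on {0..L i}"
      using W21_representative_integrable[OF r[OF that]] by (auto simp: absolutely_integrable_open_closed_interval h_def)
    show "H i t absolutely_integrable_on {0..L i}" unfolding H_def
      by (intro set_integral_add(1) set_integrable_mult_right i)
  qed
  show ?thesis
  proof (rule that[of U P H])
    fix i assume i: "i \<in> ?M"
    show "viscous_arc (L i) (lam i) e (U i) (P i) (H i)"
    proof
      show "L i > 0" "lam i > 0" "e > 0" using L lam e i by auto
      show "continuous_on ({0..} \<times> {0..L i}) (\<lambda>(t, x). U i t x)" "continuous_on ({0..} \<times> {0..L i}) (\<lambda>(t, x). P i t x)"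
        by (rule continuous_on_curve[where N = "\<lambda>s t. (1 / L i + 1) * N i s t", OF _ lim'[OF i]],
          use W21_representativeD(7,8)[OF r[OF i]] W21_sup_bound[OF L[OF i] r[OF i] r[OF i]] in \<open>simp_all add: N_def\<close>)+
      show "(U i t has_real_derivative P i t x) (at x within {0..L i})" if "t \<ge> 0" "x \<in> {0..L i}" for t x
        using W21_representativeD(5)[OF r[OF i that(1)] that(2)] .
      show "primitive_on 0 (L i) (\<lambda>x. lam i * U i t x - e * P i t x) (\<lambda>x. - H i t x)" if "t > 0" for t
      proof -
        have t: "t \<ge> 0" using that by simp
        have p: "primitive_on 0 (L i) (U i t) (P i t)" by (rule W21_representative_primitive[OF r[OF i t]])
        have q: "primitive_on 0 (L i) (P i t) (h i t)" using W21_representativeD(6)[OF r[OF i t]] by (simp add: h_def)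
        have c: "primitive_on 0 (L i) (\<lambda>x. a * f x) (\<lambda>x. a * g x)" if "primitive_on 0 (L i) f g" for a f g
        proof -
          have "a * f x = a * f 0 + integral {0..x} (\<lambda>x. a * g x)" if x: "x \<in> {0..L i}" for x
            using primitive_onD(2)[OF \<open>primitive_on 0 (L i) f g\<close> x] by (simp add: algebra_simps)
          then show ?thesis unfolding primitive_on_def
            using set_integrable_mult_right[OF primitive_onD(1)[OF that], of a] by blast
        qed
        have "(\<lambda>x. lam i * P i t x - e * h i t x) = (\<lambda>x. - H i t x)" by (simp add: H_def fun_eq_iff)
        then show ?thesis using primitive_on_minus[OF c[OF p, of "lam i"] c[OF q, of e]] by simp
      qed
      show "((\<lambda>s. abs_integral (L i) (\<lambda>x. (U i s x - U i t x) / (s - t) - H i t x)) \<longlongrightarrow> 0) (at t)" if t: "t > 0" for t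
      proof -
        let ?S = "{0<..<L i}"
        obtain ut where D: "has_curve_derivative (L1_net_norm ?M L) u ut"
          and pde: "\<forall>i\<in>?M. \<forall>t>0. AE x in lebesgue. x \<in> arc_interval L i \<longrightarrow>
              ut i (x, t) = - lam i * weak_deriv (arc_interval L i) (\<lambda>y. u i (y, t)) x
                + e * weak_deriv (arc_interval L i) (weak_deriv (arc_interval L i) (\<lambda>y. u i (y, t))) x"
          using sol unfolding parabolic_solution_def by blast
        have w: "AE x in lebesgue. x \<in> ?S \<longrightarrow> ut i (x, t) = H i t x"
          using pde[rule_format, OF i t, unfolded arc_interval_def] W21_representativeD(4)[OF r[OF i, of t]] t
          by (auto simp: H_def h_def elim: eventually_elim2)
        have "((\<lambda>s. \<Sum>i\<in>?M. L1_norm {0<..<L i} (\<lambda>x. (u i (x, s) - u i (x, t)) / (s - t) - ut i (x, t))) \<longlongrightarrow> 0) (at t within {0..})"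
          using D t unfolding has_curve_derivative_def L1_net_norm_def arc_interval_def by auto
        from tendsto_0_sum_component[OF this fin i L1_norm_nonneg]
        have "((\<lambda>s. L1_norm ?S (\<lambda>x. (u i (x, s) - u i (x, t)) / (s - t) - ut i (x, t))) \<longlongrightarrow> 0) (at t)"
          using t at_within_open_subset[of t "{0<..}" "{0..}"] by (simp add: subset_eq)
        moreover have "\<forall>\<^sub>F s in at t. L1_norm ?S (\<lambda>x. (u i (x, s) - u i (x, t)) / (s - t) - ut i (x, t))
          = abs_integral (L i) (\<lambda>x. (U i s x - U i t x) / (s - t) - H i t x)"
        proof (rule eventually_mono[OF eventually_at_in_open'[of "{0<..}" t]])
          fix s :: real assume "s \<in> {0<..}"
          then have s: "s \<ge> 0" "t \<ge> 0" using t by auto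
          have "L1_norm ?S (\<lambda>x. (u i (x, s) - u i (x, t)) / (s - t) - ut i (x, t))
            = L1_norm ?S (\<lambda>x. (U i s x - U i t x) / (s - t) - H i t x)"
            by (rule L1_norm_cong_AE) (use w W21_representativeD(3)[OF r[OF i s(1)]] W21_representativeD(3)[OF r[OF i s(2)]] in eventually_elim, simp)
          also have "\<dots> = abs_integral (L i) (\<lambda>x. (U i s x - U i t x) / (s - t) - H i t x)"
            using W21_representative_integrable(1)[OF r[OF i s(1)]] W21_representative_integrable(1)[OF r[OF i s(2)]] Hi[OF i s(2)]
            by (intro L1_norm_interval set_integral_diff(1) set_integrable_divide) (auto simp: absolutely_integrable_open_closed_interval)
          finally show "L1_norm ?S (\<lambda>x. (u i (x, s) - u i (x, t)) / (s - t) - ut i (x, t))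
            = abs_integral (L i) (\<lambda>x. (U i s x - U i t x) / (s - t) - H i t x)" .
        qed (use t in auto)
        ultimately show ?thesis by (rule Lim_transform_eventually)
      qed
    qed
    show "((\<lambda>t. abs_integral (L i) (\<lambda>x. H i t x - H i 0 x)) \<longlongrightarrow> 0) (at 0 within {0..})"
    proof (rule tendsto_sandwich[OF _ _ tendsto_const])
      have "((\<lambda>t. (lam i + e) * N i 0 t) \<longlongrightarrow> 0) (at 0 within {0..})" using tendsto_mult_right_zero[OF lim[OF i order_refl]] .
      then show "((\<lambda>t. (lam i + e) * N i 0 t) \<longlongrightarrow> 0) (at 0 within {0..})" .
      show "\<forall>\<^sub>F t in at 0 within {0..}. 0 \<le> abs_integral (L i) (\<lambda>x. H i t x - H i 0 x)"
        by (auto intro!: always_eventually integral_abs_nonneg)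
      have "abs_integral (L i) (\<lambda>x. H i t x - H i 0 x) \<le> (lam i + e) * N i 0 t" if t: "t \<ge> 0" for t
      proof -
        note hk = set_lebesgue_integral_eq_integral(1)
        define X where "X = abs_integral (L i) (\<lambda>x. P i t x - P i 0 x)"
        define Y where "Y = abs_integral (L i) (\<lambda>x. h i t x - h i 0 x)"
        define Z where "Z = abs_integral (L i) (\<lambda>x. U i t x - U i 0 x)"
        have xyz: "X \<ge> 0" "Y \<ge> 0" "Z \<ge> 0" unfolding X_def Y_def Z_def by (rule integral_abs_nonneg)+
        have N: "N i 0 t = Z + X + Y"
          using W21_norm_diff[OF r[OF i t] r[OF i order_refl]] by (simp add: N_def X_def Y_def Z_def h_def)
        have ii: "(\<lambda>x. \<bar>P i t x - P i 0 x\<bar>) integrable_on {0..L i}" "(\<lambda>x. \<bar>h i t x - h i 0 x\<bar>) integrable_on {0..L i}"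
          "(\<lambda>x. \<bar>H i t x - H i 0 x\<bar>) integrable_on {0..L i}"
          by (intro hk set_integrable_abs set_integral_diff(1) Pi hi Hi i t order_refl)+
        have "abs_integral (L i) (\<lambda>x. H i t x - H i 0 x) \<le> integral {0..L i} (\<lambda>x. lam i * \<bar>P i t x - P i 0 x\<bar> + e * \<bar>h i t x - h i 0 x\<bar>)"
        proof (rule integral_le[OF ii(3)])
          show "(\<lambda>x. lam i * \<bar>P i t x - P i 0 x\<bar> + e * \<bar>h i t x - h i 0 x\<bar>) integrable_on {0..L i}"
            using ii by (intro Henstock_Kurzweil_Integration.integrable_add integrable_on_mult_right) auto
          fix x
          have "H i t x - H i 0 x = e * (h i t x - h i 0 x) - lam i * (P i t x - P i 0 x)" by (simp add: H_def algebra_simps)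
          then have "\<bar>H i t x - H i 0 x\<bar> \<le> \<bar>e * (h i t x - h i 0 x)\<bar> + \<bar>lam i * (P i t x - P i 0 x)\<bar>" by linarith
          then show "\<bar>H i t x - H i 0 x\<bar> \<le> lam i * \<bar>P i t x - P i 0 x\<bar> + e * \<bar>h i t x - h i 0 x\<bar>"
            using e lam[OF i] by (simp add: abs_mult)
        qed
        also have "\<dots> = lam i * X + e * Y"
          using ii by (subst Henstock_Kurzweil_Integration.integral_add) (auto simp: X_def Y_def integrable_on_mult_right)
        also have "\<dots> \<le> (lam i + e) * N i 0 t"
        proof -
          have "0 \<le> lam i * (Z + Y)" "0 \<le> e * (Z + X)" using xyz e lam[OF i] by simp_all
          then show ?thesis unfolding N by (simp add: algebra_simps)
        qed
        finally show ?thesis .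
      qed
      then show "\<forall>\<^sub>F t in at 0 within {0..}. abs_integral (L i) (\<lambda>x. H i t x - H i 0 x) \<le> (lam i + e) * N i 0 t"
        by (auto simp: eventually_at_filter)
    qed
  qed (use r in \<open>auto simp: H_def h_def\<close>)
qed

section \<open>From time slices to space-time\<close>

text \<open>The set is the union of a Borel set and a subset of a Borel null set; Tonelli decides
  the first from its slices.\<close>

lemma negligible_if_slices_negligible:
  fixes N :: "(real \<times> real) set"
  assumes N: "N \<in> sets lebesgue" and sl: "\<And>t. negligible {x. (x, t) \<in> N}"
  shows "negligible N"
proof -
  have e: "N = main_part lborel N \<union> null_part lborel N" and m: "main_part lborel N \<in> sets lborel"
    using N main_part_null_part_Un[of N lborel] main_part_sets[of N lborel] by auto
  let ?A = "main_part lborel N"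
  have A: "?A \<in> sets (lborel \<Otimes>\<^sub>M lborel)" unfolding lborel_prod by (rule m)
  have z: "emeasure lborel ((\<lambda>x. (x, t)) -` ?A) = 0" for t
  proof -
    have s: "(\<lambda>x. (x, t)) -` ?A \<in> sets lborel" using sets_Pair2[OF A, of t] .
    have "negligible ((\<lambda>x. (x, t)) -` ?A)" by (rule negligible_subset[OF sl[of t]]) (use e in blast)
    then have "emeasure lebesgue ((\<lambda>x. (x, t)) -` ?A) = 0" by (simp add: negligible_iff_null_sets null_sets_def)
    then show ?thesis using s by simp
  qed
  have "emeasure (lborel \<Otimes>\<^sub>M lborel) ?A = (\<integral>\<^sup>+ t. emeasure lborel ((\<lambda>x. (x, t)) -` ?A) \<partial>lborel)"
    by (rule lborel_pair.emeasure_pair_measure_alt2[OF A])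
  also have "\<dots> = 0" by (simp add: z)
  finally have "emeasure lborel ?A = 0" by (simp add: lborel_prod)
  then have "?A \<in> null_sets lebesgue" using m by (intro null_sets_completionI) (auto simp: null_sets_def)
  moreover obtain N' where "N' \<in> null_sets lborel" "null_part lborel N \<subseteq> N'" using null_part[OF N] by auto
  then have "null_part lborel N \<in> null_sets lebesgue"
    by (meson completion.complete2 null_sets_completionI null_sets_completion)
  ultimately have "N \<in> null_sets lebesgue" using e by (metis null_sets.Un)
  then show ?thesis by (simp add: negligible_iff_null_sets)
qed

text \<open>Equality is known for each time up to a null set of points. Joint measurability of
  \<open>u\<close> makes the exceptional set in space-time measurable, and then its slices
  decide.\<close>

lemma negligible_space_time:
  fixes u :: "real \<times> real \<Rightarrow> real"
  assumes u: "u \<in> borel_measurable (lebesgue_on ({0<..<l} \<times> {0<..}))"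
    and U: "continuous_on ({0..} \<times> {0..l}) (\<lambda>(t, x). U t x)"
    and eq: "\<And>t. t > 0 \<Longrightarrow> AE x in lebesgue. x \<in> {0<..<l} \<longrightarrow> u (x, t) = U t x"
  shows "negligible {z\<in>{0<..<l} \<times> {0<..}. u z \<noteq> U (snd z) (fst z)}"
proof (rule negligible_if_slices_negligible)
  let ?R = "{0<..<l} \<times> {0<..} :: (real \<times> real) set"
  have "open ?R" by (intro open_Times) auto
  then have R: "?R \<in> sets lebesgue" by (simp add: borel_open)
  have "continuous_on ?R (\<lambda>z. (\<lambda>(t, x). U t x) (snd z, fst z))"
    by (rule continuous_on_compose2[OF U]) (auto intro!: continuous_intros)
  then have "(\<lambda>z. U (snd z) (fst z)) \<in> borel_measurable (lebesgue_on ?R)"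
    using R by (intro continuous_imp_measurable_on_sets_lebesgue) simp
  with u have "{z \<in> space (lebesgue_on ?R). u z \<noteq> U (snd z) (fst z)} \<in> sets (lebesgue_on ?R)"
    by (rule borel_measurable_neq)
  then show "{z\<in>?R. u z \<noteq> U (snd z) (fst z)} \<in> sets lebesgue"
    using R sets_restrict_space_iff[of ?R lebesgue] by (auto simp: space_restrict_space)
  fix t
  show "negligible {x. (x, t) \<in> {z\<in>?R. u z \<noteq> U (snd z) (fst z)}}"
  proof (cases "t > 0")
    case True
    have "{x. (x, t) \<in> {z\<in>?R. u z \<noteq> U (snd z) (fst z)}} = {x\<in>{0<..<l}. u (x, t) \<noteq> U t x}" using True by auto
    then show ?thesis using eq[OF True] by (simp only: negligible_neq_iff)
  qed simp
qed

text \<open>Tonelli: a slice bound \<open>r\<close> is integrated over a time interval of length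
  \<open>T\<close>. The computation uses a Borel function built from \<open>U\<close> and
  \<open>V\<close>, which agrees with the integrand off a null set.\<close>

lemma space_time_L1_bound:
  fixes u v :: "real \<times> real \<Rightarrow> real"
  defines "Q \<equiv> \<lambda>l T. {0<..<l} \<times> {0<..<T} :: (real \<times> real) set"
  assumes lT: "l > 0" "T > 0" and u: "u \<in> borel_measurable (lebesgue_on ({0<..<l} \<times> {0<..}))"
    and U: "continuous_on ({0..} \<times> {0..l}) (\<lambda>(t, x). U t x)"
    and eq: "\<And>t. t > 0 \<Longrightarrow> AE x in lebesgue. x \<in> {0<..<l} \<longrightarrow> u (x, t) = U t x"
    and V: "monotone_difference V" and v: "negligible {z\<in>Q l T. v z \<noteq> V (fst z - a * snd z)}"
  shows "u absolutely_integrable_on Q l T"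
    and "(\<And>t. t \<in> {0<..<T} \<Longrightarrow> abs_integral l (\<lambda>x. U t x - V (x - a * t)) \<le> r) \<Longrightarrow>
      L1_norm (Q l T) (\<lambda>z. u z - v z) \<le> T * r"
proof -
  let ?R = "Q l T"
  have oR: "open ?R" unfolding Q_def by (intro open_Times) auto
  have RB: "?R \<in> sets borel" using oR by simp
  have bR: "?R \<in> lmeasurable" unfolding Q_def
    by (intro lmeasurable_open oR[unfolded Q_def] bounded_Times) auto
  have neg: "negligible {z\<in>?R. u z \<noteq> U (snd z) (fst z)}"
    by (rule negligible_subset[OF negligible_space_time[OF u U eq]]) (auto simp: Q_def)
  let ?U = "\<lambda>z. U (snd z) (fst z)" and ?V = "\<lambda>z. V (fst z - a * snd z)"
  have cU: "continuous_on ({0..l} \<times> {0..T}) ?U"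
  proof -
    have "continuous_on ({0..l} \<times> {0..T}) (\<lambda>z. (\<lambda>(t, x). U t x) (snd z, fst z))"
      by (rule continuous_on_compose2[OF U]) (auto intro!: continuous_intros)
    then show ?thesis by simp
  qed
  have sub: "?R \<subseteq> {0..l} \<times> {0..T}" by (auto simp: Q_def)
  have "bounded (?U ` ({0..l} \<times> {0..T}))"
    by (intro compact_imp_bounded compact_continuous_image cU compact_Times) auto
  then obtain C where Cb: "\<forall>y\<in>?U ` ({0..l} \<times> {0..T}). norm y \<le> C" unfolding bounded_iff by blast
  then have C: "\<bar>?U z\<bar> \<le> C" if "z \<in> {0..l} \<times> {0..T}" for z using bspec[OF Cb imageI[OF that, of ?U]] by simp
  obtain CV where CV: "\<And>x. \<bar>V x\<bar> \<le> CV" by (rule monotone_difference_bounded[OF V]) blast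
  have C0: "C \<ge> 0" "CV \<ge> 0" using C[of "(0, 0)"] CV[of 0] lT by auto
  have UM: "(\<lambda>z. indicator ?R z * ?U z) \<in> borel_measurable borel"
    using borel_measurable_continuous_on_indicator[OF RB continuous_on_subset[OF cU sub]] by simp
  have VM: "?V \<in> borel_measurable borel"
  proof -
    have "(\<lambda>z::real \<times> real. fst z - a * snd z) \<in> borel_measurable borel"
      by (intro borel_measurable_continuous_onI continuous_intros)
    then show ?thesis using monotone_difference_measurable[OF V] by (rule measurable_compose)
  qed
  have Ua: "?U absolutely_integrable_on ?R"
    by (rule absolutely_integrable_spike[OF bounded_borel_absolutely_integrable[OF UM, of ?R C] negligible_empty])
      (use C sub bR C0 in \<open>auto simp: indicator_def\<close>)
  show "u absolutely_integrable_on ?R"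
    by (rule absolutely_integrable_spike[OF Ua neg]) auto
  define f where "f z = indicator ?R z * \<bar>indicator ?R z * ?U z - ?V z\<bar>" for z
  have fM: "f \<in> borel_measurable borel" unfolding f_def 
    by (rule borel_measurable_times[OF borel_measurable_indicator[OF RB] borel_measurable_abs[OF borel_measurable_diff[OF UM VM]]])
  have fi: "integrable lborel f"
  proof (rule Bochner_Integration.integrable_bound[where f = "\<lambda>z. indicator ?R z * (C + CV)"])
    show "integrable lborel (\<lambda>z. indicator ?R z * (C + CV))"
      using bR RB by (intro integrable_mult_left) (auto simp: fmeasurable_def integrable_indicator_iff)
    have "\<bar>f z\<bar> \<le> \<bar>indicator ?R z * (C + CV)\<bar>" for z
      using C[of z] sub CV[of "fst z - a * snd z"] C0 by (auto simp: f_def indicator_def)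
    then show "AE z in lborel. norm (f z) \<le> norm (indicator ?R z * (C + CV))" by simp
  qed (use fM in simp)
  have uv: "AE z in lebesgue. z \<in> ?R \<longrightarrow> \<bar>u z - v z\<bar> = \<bar>?U z - ?V z\<bar>"
    using neg[unfolded negligible_neq_iff] v[unfolded negligible_neq_iff] by eventually_elim simp
  have "L1_norm ?R (\<lambda>z. u z - v z) = (LINT z:?R|lebesgue. \<bar>?U z - ?V z\<bar>)"
    unfolding L1_norm_def by (rule set_lebesgue_integral_cong_AE'[OF uv])
  also have "\<dots> = (LINT z|lebesgue. f z)"
    unfolding set_lebesgue_integral_def by (rule Bochner_Integration.integral_cong) (auto simp: f_def indicator_def)
  also have "\<dots> = (LINT z|lborel. f z)" using fM by (simp add: integral_completion)
  finally have L: "L1_norm ?R (\<lambda>z. u z - v z) = (LINT t|lborel. LINT x|lborel. f (x, t))"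
    using integral_pair_swap(2)[OF fi] by simp
  assume r: "\<And>t. t \<in> {0<..<T} \<Longrightarrow> abs_integral l (\<lambda>x. U t x - V (x - a * t)) \<le> r"
  have slice: "(LINT x|lborel. f (x, t)) \<le> indicator {0<..<T} t * r" for t
  proof (cases "t \<in> {0<..<T}")
    case True
    let ?g = "\<lambda>x. \<bar>U t x - V (x - a * t)\<bar>"
    have "continuous_on {0..l} (\<lambda>x. (\<lambda>(t, x). U t x) (t, x))"
      using True by (intro continuous_on_compose2[OF U]) (auto intro!: continuous_intros)
    then have "U t absolutely_integrable_on {0..l}" by (intro absolutely_integrable_continuous_real) simp
    moreover have "(\<lambda>x. V (x - a * t)) absolutely_integrable_on {0..l}"
    proof (rule bounded_borel_absolutely_integrable[OF _ CV])
      have "(\<lambda>x. x - a * t) \<in> borel_measurable borel" by simp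
      then show "(\<lambda>x. V (x - a * t)) \<in> borel_measurable borel" using monotone_difference_measurable[OF V] by (rule measurable_compose)
    qed auto
    ultimately have g: "?g absolutely_integrable_on {0<..<l}"
      unfolding absolutely_integrable_open_closed_interval by (intro set_integrable_abs set_integral_diff(1))
    have "(\<lambda>x. (x, t)) \<in> borel_measurable borel" by (intro borel_measurable_continuous_onI continuous_intros)
    then have "(\<lambda>x. f (x, t)) \<in> borel_measurable borel" using fM by (rule measurable_compose)
    then have "(LINT x|lborel. f (x, t)) = (LINT x|lebesgue. f (x, t))" by (simp add: integral_completion)
    also have "\<dots> = (LINT x:{0<..<l}|lebesgue. ?g x)"
      unfolding set_lebesgue_integral_def
      by (rule Bochner_Integration.integral_cong) (use True in \<open>auto simp: f_def indicator_def Q_def\<close>)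
    also have "\<dots> = integral {0..l} ?g"
      using set_lebesgue_integral_eq_integral(2)[OF g] by (simp add: integral_open_closed_interval)
    finally show ?thesis using r[OF True] True by simp
  next
    case False
    then have "f (x, t) = 0" for x by (auto simp: f_def Q_def indicator_def)
    then show ?thesis using False by simp
  qed
  have "(LINT t|lborel. LINT x|lborel. f (x, t)) \<le> (LINT t|lborel. indicator {0<..<T} t * r)"
    by (rule integral_mono_AE[OF integral_pair_swap(4)[OF fi]])
      (use slice lT in \<open>auto intro!: integrable_mult_left simp: integrable_indicator_iff\<close>)
  also have "\<dots> = T * r" using lT by simp
  finally show "L1_norm ?R (\<lambda>z. u z - v z) \<le> T * r" using L by simp
qed

lemma W21_representative_cong:
  assumes r: "W21_representative l f F G" and eq: "AE x in lebesgue. x \<in> {0<..<l} \<longrightarrow> f x = f' x"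
  shows "W21_representative l f' F G"
    "AE x in lebesgue. x \<in> {0<..<l} \<longrightarrow> weak_deriv {0<..<l} (weak_deriv {0<..<l} f') x = weak_deriv {0<..<l} (weak_deriv {0<..<l} f) x"
proof -
  let ?S = "{0<..<l}"
  note d = W21_representativeD[OF r]
  have 1: "AE x in lebesgue. x \<in> ?S \<longrightarrow> weak_deriv ?S f' x = weak_deriv ?S f x" by (rule weak_deriv_AE_eq[OF d(1) eq])
  have w1: "has_weak_deriv ?S f' (weak_deriv ?S f')"
    by (rule has_weak_deriv_weak_deriv[OF has_weak_deriv_cong_AE[OF d(1)]]) (use eq in eventually_elim, simp)
  have w2: "has_weak_deriv ?S (weak_deriv ?S f') (weak_deriv ?S (weak_deriv ?S f'))"
    by (rule has_weak_deriv_weak_deriv[OF has_weak_deriv_cong_AE[OF d(2) 1]])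
  show 2: "AE x in lebesgue. x \<in> ?S \<longrightarrow> weak_deriv ?S (weak_deriv ?S f') x = weak_deriv ?S (weak_deriv ?S f) x"
    by (rule weak_deriv_AE_eq[OF d(2)]) (use 1 in eventually_elim, simp)
  let ?h = "weak_deriv ?S (weak_deriv ?S f)" and ?h' = "weak_deriv ?S (weak_deriv ?S f')"
  have "primitive_on 0 l G ?h'"
    unfolding primitive_on_def
  proof (intro conjI ballI)
    show "?h' absolutely_integrable_on {0..l}"
      using w2 by (simp add: has_weak_deriv_def absolutely_integrable_open_closed_interval[symmetric])
    fix x assume x: "x \<in> {0..l}"
    have "integral {0..x} ?h' = integral {0..x} ?h"
      by (rule integral_spike[of "{x\<in>?S. ?h' x \<noteq> ?h x} \<union> {0, l}"]) (use 2[folded negligible_neq_iff] x in auto)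
    then show "G x = G 0 + integral {0..x} ?h'" using primitive_onD(2)[OF d(6) x] by simp
  qed
  moreover have "AE x in lebesgue. x \<in> ?S \<longrightarrow> f' x = F x" using eq d(3) by eventually_elim simp
  moreover have "AE x in lebesgue. x \<in> ?S \<longrightarrow> weak_deriv ?S f' x = G x" using 1 d(4) by eventually_elim simp
  ultimately show "W21_representative l f' F G" using w1 w2 d(5) unfolding W21_representative_def by blast
qed

section \<open>Estimates of the parabolic problem in terms of the initial data\<close>

text \<open>The interface between the formulation in function spaces and the pointwise estimates.
  Its last clause bounds the time derivative by initial quantities, uniformly in time; these are the
  quantities that admissibility bounds independently of \<open>n\<close>.\<close>

definition viscous_network ::
  "nat set \<Rightarrow> nat set \<Rightarrow> (nat \<Rightarrow> real) \<Rightarrow> (nat \<Rightarrow> real) \<Rightarrow> (nat \<Rightarrow> nat \<Rightarrow> real) \<Rightarrow> (nat \<Rightarrow> real)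
   \<Rightarrow> real \<Rightarrow> (nat \<Rightarrow> real \<Rightarrow> real) \<Rightarrow> (nat \<Rightarrow> real \<times> real \<Rightarrow> real)
   \<Rightarrow> (nat \<Rightarrow> real \<Rightarrow> real \<Rightarrow> real) \<Rightarrow> (nat \<Rightarrow> real \<Rightarrow> real \<Rightarrow> real) \<Rightarrow> (nat \<Rightarrow> real \<Rightarrow> real \<Rightarrow> real) \<Rightarrow> bool" where
  "viscous_network Inc Out L lam K B e u0 u U P H \<longleftrightarrow>
     (let M = Inc \<union> Out; nd = (\<lambda>i. if i \<in> Inc then L i else 0) in
      (\<forall>i\<in>M. viscous_arc (L i) (lam i) e (U i) (P i) (H i)) \<and>
      (\<forall>i\<in>M. \<forall>t\<ge>0. AE x in lebesgue. x \<in> {0<..<L i} \<longrightarrow> u i (x, t) = U i t x) \<and>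
      (\<forall>i\<in>M. W21_representative (L i) (u0 i) (U i 0) (P i 0)) \<and>
      (\<forall>i\<in>M. \<forall>t>0. node_sign Inc i * (- lam i * U i t (nd i) + e * P i t (nd i)) = (\<Sum>j\<in>M. K i j * (U j t (nd j) - U i t (nd i)))) \<and>
      (\<forall>i\<in>Inc. \<forall>t>0. U i t 0 = B i) \<and> (\<forall>i\<in>Out. \<forall>t>0. U i t (L i) = U i 0 (L i)) \<and>
      (\<forall>i\<in>M. \<forall>t>0. abs_integral (L i) (H i t)
        \<le> (\<Sum>i\<in>M. lam i) * L1_net_norm M L (\<lambda>i. weak_deriv (arc_interval L i) (u0 i)) + e * W21_net_norm M L u0))"

lemma parabolic_solution_estimates:
  fixes Inc Out L lam K B e u0 u
  defines "M \<equiv> Inc \<union> Out" and "nd \<equiv> \<lambda>i. if i \<in> Inc then L i else 0"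
  assumes fin: "finite Inc" "finite Out" and disj: "Inc \<inter> Out = {}"
    and L: "\<And>i. i \<in> M \<Longrightarrow> L i > 0" and lam: "\<And>i. i \<in> M \<Longrightarrow> lam i > 0"
    and K: "\<And>i j. i \<in> M \<Longrightarrow> j \<in> M \<Longrightarrow> K i j \<ge> 0 \<and> K i j = K j i"
    and e: "e > 0" and sol: "parabolic_solution Inc Out L lam K B e u0 u"
  obtains U P H where "viscous_network Inc Out L lam K B e u0 u U P H"
proof -
  have finM: "finite M" using fin by (simp add: M_def)
  obtain U P H where
    r: "\<And>i t. i \<in> M \<Longrightarrow> t \<ge> 0 \<Longrightarrow> W21_representative (L i) (\<lambda>x. u i (x, t)) (U i t) (P i t)" and
    arc: "\<And>i. i \<in> M \<Longrightarrow> viscous_arc (L i) (lam i) e (U i) (P i) (H i)" and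
    H: "\<And>i t x. H i t x = - lam i * P i t x + e * weak_deriv {0<..<L i} (weak_deriv {0<..<L i} (\<lambda>x. u i (x, t))) x" and
    H0: "\<And>i. i \<in> M \<Longrightarrow> ((\<lambda>t. abs_integral (L i) (\<lambda>x. H i t x - H i 0 x)) \<longlongrightarrow> 0) (at 0 within {0..})"
    by (rule parabolic_solution_arcs[OF finM[unfolded M_def] _ _ e sol, folded M_def]) (erule L, erule lam, blast)
  have tr: "boundary_trace {0<..<L i} (\<lambda>x. u i (x, t)) 0 = U i t 0" "boundary_trace {0<..<L i} (\<lambda>x. u i (x, t)) (L i) = U i t (L i)"
    "boundary_trace {0<..<L i} (weak_deriv {0<..<L i} (\<lambda>x. u i (x, t))) 0 = P i t 0"
    "boundary_trace {0<..<L i} (weak_deriv {0<..<L i} (\<lambda>x. u i (x, t))) (L i) = P i t (L i)" if "i \<in> M" "t \<ge> 0" for i t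
    using W21_representative_traces[OF L[OF that(1)] r[OF that]] .
  have init: "AE x in lebesgue. x \<in> {0<..<L i} \<longrightarrow> u i (x, 0) = u0 i x" if "i \<in> M" for i
    using sol that unfolding parabolic_solution_def arc_interval_def M_def by blast
  have r0: "W21_representative (L i) (u0 i) (U i 0) (P i 0)" if "i \<in> M" for i
    by (rule W21_representative_cong(1)[OF r[OF that order_refl] init[OF that]])
  have inlet: "U i t 0 = B i" if "i \<in> Inc" "t > 0" for i t
  proof -
    have "boundary_trace (arc_interval L i) (\<lambda>x. u i (x, t)) 0 = B i" using sol that unfolding parabolic_solution_def by blast
    then show ?thesis using tr(1)[of i t] that by (simp add: M_def arc_interval_def)
  qed
  have outlet: "U i t (L i) = U i 0 (L i)" if "i \<in> Out" "t > 0" for i t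
  proof -
    have i: "i \<in> M" using that by (simp add: M_def)
    have "boundary_trace (arc_interval L i) (\<lambda>x. u i (x, t)) (L i) = boundary_trace (arc_interval L i) (u0 i) (L i)"
      using sol that unfolding parabolic_solution_def by blast
    then show ?thesis using tr(2)[OF i, of t] W21_representative_traces(2)[OF L[OF i] r0[OF i]] that by (simp add: arc_interval_def)
  qed
  have node: "node_sign Inc i * (- lam i * U i t (nd i) + e * P i t (nd i)) = (\<Sum>j\<in>M. K i j * (U j t (nd j) - U i t (nd i)))"
    if i: "i \<in> M" and t: "t > 0" for i t
  proof -
    have v: "node_value Inc L j (\<lambda>x. u j (x, t)) = U j t (nd j)"
      "node_value Inc L j (weak_deriv (arc_interval L j) (\<lambda>x. u j (x, t))) = P j t (nd j)" if "j \<in> M" for j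
      using tr[OF that, of t] t by (auto simp: node_value_def nd_def arc_interval_def)
    have "node_condition Inc Out L lam K e (\<lambda>i x. u i (x, t))" using sol t unfolding parabolic_solution_def by blast
    then have "node_sign Inc i * (- lam i * node_value Inc L i (\<lambda>x. u i (x, t)) + e * node_value Inc L i (weak_deriv (arc_interval L i) (\<lambda>x. u i (x, t))))
      = (\<Sum>j\<in>M. K i j * (node_value Inc L j (\<lambda>x. u j (x, t)) - node_value Inc L i (\<lambda>x. u i (x, t))))"
      using i unfolding node_condition_def M_def by blast
    also have "\<dots> = (\<Sum>j\<in>M. K i j * (U j t (nd j) - U i t (nd i)))"
      by (rule sum.cong[OF refl]) (simp only: v(1) v(1)[OF i])
    finally show ?thesis unfolding v(1)[OF i] v(2)[OF i] .
  qed
  let ?h = "\<lambda>i. weak_deriv {0<..<L i} (weak_deriv {0<..<L i} (\<lambda>x. u i (x, 0)))"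
  let ?S = "\<lambda>t. \<Sum>i\<in>M. abs_integral (L i) (H i t)"
  let ?D = "\<lambda>t. \<Sum>i\<in>M. abs_integral (L i) (\<lambda>x. H i t x - H i 0 x)"
  define X where "X i = abs_integral (L i) (P i 0)" for i
  define Y where "Y i = abs_integral (L i) (\<lambda>x. ?h i x)" for i
  note hk = set_lebesgue_integral_eq_integral(1)
  have Pi: "P i t absolutely_integrable_on {0..L i}" and hi: "weak_deriv {0<..<L i} (weak_deriv {0<..<L i} (\<lambda>x. u i (x, t))) absolutely_integrable_on {0..L i}"
    if "i \<in> M" "t \<ge> 0" for i t
    using W21_representative_integrable[OF r[OF that]] by (auto simp: absolutely_integrable_open_closed_interval)
  have Hi: "H i t absolutely_integrable_on {0..L i}" if "i \<in> M" "t \<ge> 0" for i t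
    unfolding H by (intro set_integral_add(1) set_integrable_mult_right Pi hi that)
  \<comment> \<open>At time 0 the formula for \<open>H\<close> and the triangle inequality bound it
    by first and second derivatives of the initial datum.\<close>
  have S0: "?S 0 \<le> (\<Sum>i\<in>M. lam i * X i + e * Y i)"
  proof (rule sum_mono)
    fix i assume i: "i \<in> M"
    have ii: "(\<lambda>x. \<bar>P i 0 x\<bar>) integrable_on {0..L i}" "(\<lambda>x. \<bar>?h i x\<bar>) integrable_on {0..L i}" "(\<lambda>x. \<bar>H i 0 x\<bar>) integrable_on {0..L i}"
      by (intro hk set_integrable_abs Pi hi Hi i order_refl)+
    have "abs_integral (L i) (H i 0) \<le> integral {0..L i} (\<lambda>x. lam i * \<bar>P i 0 x\<bar> + e * \<bar>?h i x\<bar>)"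
    proof (rule integral_le[OF ii(3)])
      show "(\<lambda>x. lam i * \<bar>P i 0 x\<bar> + e * \<bar>?h i x\<bar>) integrable_on {0..L i}"
        using ii by (intro Henstock_Kurzweil_Integration.integrable_add integrable_on_mult_right) auto
      fix x
      have "\<bar>H i 0 x\<bar> \<le> \<bar>lam i * P i 0 x\<bar> + \<bar>e * ?h i x\<bar>" unfolding H by linarith
      then show "\<bar>H i 0 x\<bar> \<le> lam i * \<bar>P i 0 x\<bar> + e * \<bar>?h i x\<bar>" using e lam[OF i] by (simp add: abs_mult)
    qed
    also have "\<dots> = lam i * X i + e * Y i"
      using ii by (subst Henstock_Kurzweil_Integration.integral_add) (auto simp: X_def Y_def integrable_on_mult_right)
    finally show "abs_integral (L i) (H i 0) \<le> lam i * X i + e * Y i" .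
  qed
  \<comment> \<open>Monotonicity compares positive times only; the earlier time is sent to 0, where
    \<open>H\<close> is continuous in \<open>L^1\<close>.\<close>
  have St: "?S t \<le> ?S 0" if t: "t > 0" for t
  proof (rule tendsto_lowerbound[where F = "at 0 within {0..}"])
    have "(?D \<longlongrightarrow> 0) (at 0 within {0..})" using H0 by (intro tendsto_null_sum) auto
    then show "((\<lambda>s. ?S 0 + ?D s) \<longlongrightarrow> ?S 0) (at 0 within {0..})" using tendsto_add[OF tendsto_const, of ?D 0 _ "?S 0"] by simp
    have "?S t \<le> ?S 0 + ?D s" if s: "0 < s" "s \<le> t" for s
    proof -
      have "?S t \<le> ?S s"
        by (rule network_time_derivative_decreasing[where P = P and lam = lam and e = e and K = K and nd = nd and U = U and B = B and b = "\<lambda>i. U i 0 (L i)",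
          OF fin disj, folded M_def]) (use arc K node inlet outlet s in \<open>simp_all add: nd_def\<close>)
      also have "\<dots> \<le> (\<Sum>i\<in>M. abs_integral (L i) (H i 0) + abs_integral (L i) (\<lambda>x. H i s x - H i 0 x))"
      proof (rule sum_mono)
        fix i assume i: "i \<in> M"
        have ii: "(\<lambda>x. \<bar>H i 0 x\<bar>) integrable_on {0..L i}" "(\<lambda>x. \<bar>H i s x - H i 0 x\<bar>) integrable_on {0..L i}" "(\<lambda>x. \<bar>H i s x\<bar>) integrable_on {0..L i}"
          using s i by (auto intro!: hk set_integrable_abs set_integral_diff(1) Hi)
        have "abs_integral (L i) (H i s) \<le> integral {0..L i} (\<lambda>x. \<bar>H i 0 x\<bar> + \<bar>H i s x - H i 0 x\<bar>)"
          by (rule integral_le) (use ii in \<open>auto intro: Henstock_Kurzweil_Integration.integrable_add\<close>)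
        then show "abs_integral (L i) (H i s) \<le> abs_integral (L i) (H i 0) + abs_integral (L i) (\<lambda>x. H i s x - H i 0 x)"
          by (subst (asm) Henstock_Kurzweil_Integration.integral_add[OF ii(1,2)])
      qed
      finally show ?thesis by (simp add: sum.distrib)
    qed
    then show "\<forall>\<^sub>F s in at 0 within {0..}. ?S t \<le> ?S 0 + ?D s"
      unfolding eventually_at using t by (intro exI[of _ t]) (auto simp: dist_real_def)
    show "at 0 within {0..} \<noteq> (bot :: real filter)" by (simp add: at_within_Ici_at_right)
  qed
  have X: "X i = L1_norm {0<..<L i} (weak_deriv {0<..<L i} (u0 i))" if "i \<in> M" for i
    using W21_norm_representative(2)[OF r0[OF that]] by (simp add: X_def)
  have Y: "Y i \<le> W21_norm {0<..<L i} (u0 i)" if "i \<in> M" for i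
  proof -
    have "Y i = L1_norm {0<..<L i} (?h i)" using W21_norm_representative(3)[OF r[OF that order_refl]] by (simp add: Y_def)
    also have "\<dots> = L1_norm {0<..<L i} (weak_deriv {0<..<L i} (weak_deriv {0<..<L i} (u0 i)))"
      by (rule L1_norm_cong_AE) (use W21_representative_cong(2)[OF r[OF that order_refl] init[OF that]] in eventually_elim, simp)
    finally show ?thesis using L1_norm_nonneg[of "{0<..<L i}" "u0 i"] L1_norm_nonneg[of "{0<..<L i}" "weak_deriv {0<..<L i} (u0 i)"] unfolding W21_norm_def by linarith
  qed
  have X0: "X i \<ge> 0" for i unfolding X_def by (rule integral_abs_nonneg)
  have bound: "abs_integral (L i) (H i t)
      \<le> (\<Sum>i\<in>M. lam i) * L1_net_norm M L (\<lambda>i. weak_deriv (arc_interval L i) (u0 i)) + e * W21_net_norm M L u0" if i: "i \<in> M" and t: "t > 0" for i t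
  proof -
    have "abs_integral (L i) (H i t) \<le> ?S t"
      by (rule member_le_sum[OF i integral_abs_nonneg finM])
    also have "\<dots> \<le> (\<Sum>i\<in>M. lam i * X i + e * Y i)" using St[OF t] S0 by simp
    also have "\<dots> \<le> (\<Sum>i\<in>M. (\<Sum>i\<in>M. lam i) * X i + e * W21_norm {0<..<L i} (u0 i))"
    proof (rule sum_mono)
      fix i assume i: "i \<in> M"
      have "lam i \<le> (\<Sum>i\<in>M. lam i)" by (rule member_le_sum[OF i]) (use finM lam in \<open>auto intro: less_imp_le\<close>)
      then show "lam i * X i + e * Y i \<le> (\<Sum>i\<in>M. lam i) * X i + e * W21_norm {0<..<L i} (u0 i)"
        using Y[OF i] X0[of i] e by (intro add_mono mult_right_mono mult_left_mono) auto
    qed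
    also have "\<dots> = (\<Sum>i\<in>M. lam i) * (\<Sum>i\<in>M. X i) + e * (\<Sum>i\<in>M. W21_norm {0<..<L i} (u0 i))"
      by (simp add: sum.distrib sum_distrib_left)
    also have "(\<Sum>i\<in>M. X i) = L1_net_norm M L (\<lambda>i. weak_deriv (arc_interval L i) (u0 i))"
      unfolding L1_net_norm_def arc_interval_def by (rule sum.cong[OF refl X])
    also have "(\<Sum>i\<in>M. W21_norm {0<..<L i} (u0 i)) = W21_net_norm M L u0"
      unfolding W21_net_norm_def arc_interval_def ..
    finally show ?thesis .
  qed
  show ?thesis
    by (rule that[of U P H], unfold viscous_network_def Let_def M_def[symmetric] nd_def[symmetric])
      (use arc W21_representativeD(3)[OF r] r0 node inlet outlet bound in blast)
qed

section \<open>Transported profiles on the network\<close>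

text \<open>The exceptional times are the image of the countably many discontinuities of
  \<open>V\<close> under an affine map.\<close>

lemma AE_isCont_profile:
  assumes V: "monotone_difference V" and a: "a > 0"
  shows "AE t in lebesgue. isCont V (x0 - a * t)"
proof (rule AE_I')
  let ?N = "(\<lambda>s. (x0 - s) / a) ` {s. \<not> isCont V s}"
  have "countable ?N" using monotone_difference_continuity[OF V] by simp
  then show "?N \<in> null_sets lebesgue" by (intro null_sets_completionI countable_imp_null_set_lborel)
  show "{t \<in> space lebesgue. \<not> isCont V (x0 - a * t)} \<subseteq> ?N"
  proof
    fix t assume "t \<in> {t \<in> space lebesgue. \<not> isCont V (x0 - a * t)}"
    then show "t \<in> ?N" using a by (intro image_eqI[of _ _ "x0 - a * t"]) auto
  qed
qed

lemma AE_boundary_trace_of_profile: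
  assumes lT: "l > 0" "T > 0" and x0: "x0 = 0 \<or> x0 = l" and V: "monotone_difference V" and a: "a > 0"
    and u: "u absolutely_integrable_on {0<..<l} \<times> {0<..<T}"
    and eq: "negligible {z\<in>{0<..<l} \<times> {0<..<T}. u z \<noteq> V (fst z - a * snd z)}"
  shows "AE t in lebesgue. t \<in> {0<..<T} \<longrightarrow> boundary_trace ({0<..<l} \<times> {0<..<T}) u (x0, t) = V (x0 - a * t)"
  using AE_isCont_profile[OF V a, of x0]
proof eventually_elim
  case (elim t)
  then show ?case using boundary_trace_of_profile[OF lT x0 _ _ elim u eq] by simp
qed

text \<open>Values of \<open>V i\<close> at negative arguments encode the inflow: the candidate solution is \<open>V i (x - lam i * t)\<close>.\<close>
locale network_profile =
  fixes Inc Out :: "nat set" and L lam g B :: "nat \<Rightarrow> real" and T :: real and u0 V :: "nat \<Rightarrow> real \<Rightarrow> real"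
  assumes fin: "finite Inc" and L: "\<And>i. i \<in> Inc \<union> Out \<Longrightarrow> L i > 0" and lam: "\<And>i. i \<in> Inc \<union> Out \<Longrightarrow> lam i > 0"
    and T: "T > 0" and V: "\<And>i. i \<in> Inc \<union> Out \<Longrightarrow> monotone_difference (V i)"
    and V_initial: "\<And>i. i \<in> Inc \<union> Out \<Longrightarrow> AE x in lebesgue. x \<in> {0<..<L i} \<longrightarrow> u0 i x = V i x"
    and V_in: "\<And>i s. i \<in> Inc \<Longrightarrow> s \<le> 0 \<Longrightarrow> V i s = B i"
    and V_out: "\<And>i t. i \<in> Out \<Longrightarrow> t > 0 \<Longrightarrow> lam i * V i (- (lam i * t)) = g i * (\<Sum>j\<in>Inc. lam j * V j (L j - lam j * t))"
begin

text \<open>The inflow of an outgoing arc is written with traces of the incoming ones; at almost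
  every time these are values of the profile, so \<open>V_out\<close> supplies the required
  flux.\<close>

lemma solution_if_profile:
  "transport_solution Inc Out L lam (\<lambda>i j. g i) B u0 T (\<lambda>i z. V i (fst z - lam i * snd z))"
proof -
  let ?w = "\<lambda>i z. V i (fst z - lam i * snd z)"
  have bv: "BV_on (arc_interval L i \<times> {0<..<T}) (?w i)" if "i \<in> Inc \<union> Out" for i
    unfolding arc_interval_def by (rule BV_on_transported_profile[OF V[OF that] L[OF that] T])
  moreover have "weak_transport (L i) T (lam i) (u0 i) (\<lambda>t. lam i * B i) (?w i)" if i: "i \<in> Inc" for i
  proof (rule weak_transport_of_profile)
    show "AE t in lebesgue. t \<in> {0<..<T} \<longrightarrow> lam i * B i = lam i * V i (- (lam i * t))"
      using V_in[OF i] lam[of i] i by (auto intro!: AE_I2)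
  qed (use V L T lam V_initial i in auto)
  moreover have "weak_transport (L i) T (lam i) (u0 i)
      (\<lambda>t. \<Sum>j\<in>Inc. g i * lam j * boundary_trace (arc_interval L j \<times> {0<..<T}) (?w j) (L j, t)) (?w i)" if i: "i \<in> Out" for i
  proof (rule weak_transport_of_profile)
    have "AE t in lebesgue. \<forall>j\<in>Inc. t \<in> {0<..<T} \<longrightarrow>
        boundary_trace (arc_interval L j \<times> {0<..<T}) (?w j) (L j, t) = V j (L j - lam j * t)"
    proof (rule AE_finite_allI[OF fin])
      fix j assume j: "j \<in> Inc"
      show "AE t in lebesgue. t \<in> {0<..<T} \<longrightarrow>
          boundary_trace (arc_interval L j \<times> {0<..<T}) (?w j) (L j, t) = V j (L j - lam j * t)"
        unfolding arc_interval_def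
        by (rule AE_boundary_trace_of_profile) (use j L T V lam bv[of j] in \<open>auto simp: BV_on_def arc_interval_def\<close>)
    qed
    then show "AE t in lebesgue. t \<in> {0<..<T} \<longrightarrow>
        (\<Sum>j\<in>Inc. g i * lam j * boundary_trace (arc_interval L j \<times> {0<..<T}) (?w j) (L j, t)) = lam i * V i (- (lam i * t))"
      by eventually_elim (simp add: V_out[OF i] sum_distrib_left mult.assoc)
  qed (use V L T lam V_initial i in auto)
  ultimately show ?thesis by (simp add: transport_solution_def)
qed

lemma AE_trace_at_node:
  assumes i: "i \<in> Inc \<union> Out" and x0: "x0 = 0 \<or> x0 = L i" and v: "BV_on (arc_interval L i \<times> {0<..<T}) (v i)"
    and eq: "negligible {z\<in>arc_interval L i \<times> {0<..<T}. v i z \<noteq> V i (fst z - lam i * snd z)}"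
  shows "AE t in lebesgue. t \<in> {0<..<T} \<longrightarrow> boundary_trace (arc_interval L i \<times> {0<..<T}) (v i) (x0, t) = V i (x0 - lam i * t)"
  using AE_boundary_trace_of_profile[OF L[OF i] T x0 V[OF i] lam[OF i]] v eq
  unfolding BV_on_def arc_interval_def by blast

text \<open>On incoming arcs the data alone determine the solution. Their traces at the node then
  agree with those of the profile for almost every time, so both solutions have the same inflow on
  each outgoing arc and uniqueness applies once more.\<close>

lemma solution_imp_profile:
  assumes v: "transport_solution Inc Out L lam (\<lambda>i j. g i) B u0 T v" and i: "i \<in> Inc \<union> Out"
  shows "negligible {z\<in>arc_interval L i \<times> {0<..<T}. v i z \<noteq> V i (fst z - lam i * snd z)}"
proof -
  let ?w = "\<lambda>i z. V i (fst z - lam i * snd z)"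
  have w: "transport_solution Inc Out L lam (\<lambda>i j. g i) B u0 T ?w" by (rule solution_if_profile)
  have ai: "v i absolutely_integrable_on {0<..<L i} \<times> {0<..<T}" "?w i absolutely_integrable_on {0<..<L i} \<times> {0<..<T}"
    if "i \<in> Inc \<union> Out" for i
    using v w that by (auto simp: transport_solution_def BV_on_def arc_interval_def)
  have inc: "negligible {z\<in>arc_interval L i \<times> {0<..<T}. v i z \<noteq> ?w i z}" if i: "i \<in> Inc" for i
  proof -
    have M: "i \<in> Inc \<union> Out" using i by simp
    show ?thesis unfolding arc_interval_def
      by (rule weak_transport_unique[OF L[OF M] T lam[OF M] ai[OF M]])
        (use v w i in \<open>auto simp: transport_solution_def\<close>)
  qed
  show ?thesis
  proof (cases "i \<in> Inc")
    case False
    then have i: "i \<in> Out" and M: "i \<in> Inc \<union> Out" using i by auto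
    let ?q = "\<lambda>v t. \<Sum>j\<in>Inc. g i * lam j * boundary_trace (arc_interval L j \<times> {0<..<T}) (v j) (L j, t)"
    have tr: "AE t in lebesgue. t \<in> {0<..<T} \<longrightarrow> boundary_trace (arc_interval L j \<times> {0<..<T}) (f j) (L j, t) = V j (L j - lam j * t)"
      if j: "j \<in> Inc" and f: "f = v \<or> f = ?w" for j f
      using f
    proof
      assume f: "f = v"
      have "BV_on (arc_interval L j \<times> {0<..<T}) (v j)" using v j by (auto simp: transport_solution_def)
      then show ?thesis unfolding f by (intro AE_trace_at_node) (use j inc in auto)
    next
      assume f: "f = ?w"
      have "BV_on (arc_interval L j \<times> {0<..<T}) (?w j)" using w j by (auto simp: transport_solution_def)
      then show ?thesis unfolding f by (intro AE_trace_at_node) (use j in auto)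
    qed
    have "AE t in lebesgue. \<forall>j\<in>Inc. t \<in> {0<..<T} \<longrightarrow>
        boundary_trace (arc_interval L j \<times> {0<..<T}) (v j) (L j, t) = boundary_trace (arc_interval L j \<times> {0<..<T}) (?w j) (L j, t)"
    proof (rule AE_finite_allI[OF fin])
      fix j assume j: "j \<in> Inc"
      show "AE t in lebesgue. t \<in> {0<..<T} \<longrightarrow>
        boundary_trace (arc_interval L j \<times> {0<..<T}) (v j) (L j, t) = boundary_trace (arc_interval L j \<times> {0<..<T}) (?w j) (L j, t)"
        using tr[OF j disjI1[OF refl]] tr[OF j disjI2[OF refl]] by eventually_elim simp
    qed
    then have "AE t in lebesgue. t \<in> {0<..<T} \<longrightarrow> ?q v t = ?q ?w t" by eventually_elim simp
    moreover have "weak_transport (L i) T (lam i) (u0 i) (?q v) (v i)" "weak_transport (L i) T (lam i) (u0 i) (?q ?w) (?w i)"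
      using v w i unfolding transport_solution_def by blast+
    ultimately show ?thesis unfolding arc_interval_def[of L i]
      using weak_transport_unique[OF L[OF M] T lam[OF M] ai[OF M]] by blast
  qed (rule inc)
qed

text \<open>All traces are read off from the profile, for which \<open>V_out\<close> is the relation
  between values.\<close>

lemma solution_node_relation:
  assumes v: "transport_solution Inc Out L lam (\<lambda>i j. g i) B u0 T v" and i: "i \<in> Out"
  shows "AE t in lebesgue. t \<in> {0<..<T} \<longrightarrow>
    lam i * boundary_trace (arc_interval L i \<times> {0<..<T}) (v i) (0, t) =
    g i * (\<Sum>j\<in>Inc. lam j * boundary_trace (arc_interval L j \<times> {0<..<T}) (v j) (L j, t))"
proof -
  have bv: "BV_on (arc_interval L j \<times> {0<..<T}) (v j)" if "j \<in> Inc \<union> Out" for j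
    using v that by (auto simp: transport_solution_def)
  have "AE t in lebesgue. \<forall>j\<in>Inc. t \<in> {0<..<T} \<longrightarrow>
      boundary_trace (arc_interval L j \<times> {0<..<T}) (v j) (L j, t) = V j (L j - lam j * t)"
    by (rule AE_finite_allI[OF fin]) (rule AE_trace_at_node, use bv solution_imp_profile[OF v] in auto)
  moreover have "AE t in lebesgue. t \<in> {0<..<T} \<longrightarrow> boundary_trace (arc_interval L i \<times> {0<..<T}) (v i) (0, t) = V i (0 - lam i * t)"
    by (rule AE_trace_at_node) (use i bv solution_imp_profile[OF v] in auto)
  ultimately show ?thesis by eventually_elim (simp add: V_out[OF i])
qed

end

lemma monotone_difference_integrable:
  assumes "monotone_difference V" shows "V absolutely_integrable_on {a..b}"
proof -
  obtain C where C: "\<And>x. \<bar>V x\<bar> \<le> C" by (rule monotone_difference_bounded[OF assms]) blast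
  show ?thesis by (rule bounded_borel_absolutely_integrable[OF monotone_difference_measurable[OF assms] C]) auto
qed

section \<open>Construction of the profile from the data\<close>

text \<open>The substitution by \<open>x0 - a * s\<close> is split into a reflection and an affine
  map with positive slope.\<close>

lemma has_integral_profile:
  assumes V: "monotone_difference V" and a: "a > 0" and t: "t \<ge> 0"
  shows "((\<lambda>s. a * V (x0 - a * s)) has_integral integral {x0 - a * t..x0} V) {0..t}"
proof -
  have "(V has_integral integral {x0 - a * t..x0} V) {x0 - a * t..x0}"
    by (intro integrable_integral set_lebesgue_integral_eq_integral(1) monotone_difference_integrable V)
  then have "((\<lambda>s. V (- s)) has_integral integral {x0 - a * t..x0} V) {- x0..- (x0 - a * t)}"
    by (simp only: has_integral_reflect_real)
  from has_integral_affinity'[of _ _ "- x0" "- (x0 - a * t)" a "- x0", OF this[folded cbox_interval] a]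
  have "((\<lambda>s. V (x0 - a * s)) has_integral integral {x0 - a * t..x0} V / a) {0..t}" using a by (simp add: field_simps)
  from has_integral_mult_right[OF this, of a] show ?thesis using a by simp
qed

text \<open>On an outgoing arc \<open>s = - (lam i * t)\<close> encodes the time \<open>t\<close> at
  the node, and \<open>L j + lam j * s / lam i\<close> is then \<open>L j - lam j * t\<close>, the
  label of the characteristic of arc \<open>j\<close> that arrives at that time. If it is not
  positive, the characteristic started at the inlet and carries \<open>B j\<close>.\<close>

definition boundary_profile ::
  "nat set \<Rightarrow> (nat \<Rightarrow> real) \<Rightarrow> (nat \<Rightarrow> real) \<Rightarrow> (nat \<Rightarrow> real) \<Rightarrow> (nat \<Rightarrow> real) \<Rightarrow> (nat \<Rightarrow> real \<Rightarrow> real) \<Rightarrow> nat \<Rightarrow> real \<Rightarrow> real" where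
  "boundary_profile Inc L lam g B V0 i s =
     (if s > 0 then V0 i s
      else if i \<in> Inc then B i
      else g i / lam i * (\<Sum>j\<in>Inc. lam j * (if L j + lam j * s / lam i > 0 then V0 j (L j + lam j * s / lam i) else B j)))"

text \<open>Incoming profiles are glued from the initial datum and a constant; outgoing ones are
  then built from them by affine substitution, linear combination and gluing, operations that
  preserve bounded differences of monotone functions.\<close>

lemma network_profile_boundary_profile:
  assumes fin: "finite Inc" and disj: "Inc \<inter> Out = {}"
    and L: "\<And>i. i \<in> Inc \<union> Out \<Longrightarrow> L i > 0" and lam: "\<And>i. i \<in> Inc \<union> Out \<Longrightarrow> lam i > 0"
    and T: "T > 0" and V0: "\<And>i. i \<in> Inc \<union> Out \<Longrightarrow> monotone_difference (V0 i)"
    and eq: "\<And>i. i \<in> Inc \<union> Out \<Longrightarrow> AE x in lebesgue. x \<in> {0<..<L i} \<longrightarrow> u0 i x = V0 i x"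
  shows "network_profile Inc Out L lam g B T u0 (boundary_profile Inc L lam g B V0)"
proof
  let ?V = "boundary_profile Inc L lam g B V0"
  have VI: "?V i = (\<lambda>s. if s > 0 then V0 i s else B i)" if "i \<in> Inc" for i
    using that by (simp add: boundary_profile_def fun_eq_iff)
  have VO: "?V i = (\<lambda>s. if s > 0 then V0 i s else g i / lam i * (\<Sum>j\<in>Inc. lam j * ?V j (lam j / lam i * s + L j)))" if "i \<in> Out" for i
  proof -
    have "i \<notin> Inc" using that disj by blast
    moreover have "(\<Sum>j\<in>Inc. lam j * ?V j (lam j / lam i * s + L j)) =
        (\<Sum>j\<in>Inc. lam j * (if L j + lam j * s / lam i > 0 then V0 j (L j + lam j * s / lam i) else B j))" for s
      by (rule sum.cong[OF refl]) (simp add: VI add.commute)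
    ultimately show ?thesis by (simp add: fun_eq_iff) (simp add: boundary_profile_def)
  qed
  have md: "monotone_difference (?V i)" if "i \<in> Inc" for i
    unfolding VI[OF that] using that by (intro monotone_difference_if V0 monotone_difference_const) simp
  show "monotone_difference (?V i)" if i: "i \<in> Inc \<union> Out" for i
  proof (cases "i \<in> Inc")
    case False
    then have o: "i \<in> Out" using i by simp
    show ?thesis
      unfolding VO[OF o]
      by (intro monotone_difference_if V0 monotone_difference_mult monotone_difference_sum i monotone_difference_affine md)
  qed (rule md)
  show "AE x in lebesgue. x \<in> {0<..<L i} \<longrightarrow> u0 i x = ?V i x" if "i \<in> Inc \<union> Out" for i
    using eq[OF that] by eventually_elim (simp add: boundary_profile_def)
  show "?V i s = B i" if "i \<in> Inc" "s \<le> 0" for i s using that by (simp add: boundary_profile_def)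
  show "lam i * ?V i (- (lam i * t)) = g i * (\<Sum>j\<in>Inc. lam j * ?V j (L j - lam j * t))" if i: "i \<in> Out" and t: "t > 0" for i t
  proof -
    have l: "lam i > 0" using lam i by simp
    have "\<not> - (lam i * t) > 0" using mult_pos_pos[OF l t] by simp
    then have "lam i * ?V i (- (lam i * t)) = g i * (\<Sum>j\<in>Inc. lam j * ?V j (lam j / lam i * (- (lam i * t)) + L j))"
      using l by (simp only: VO[OF i] if_False) simp
    moreover have "lam j / lam i * (- (lam i * t)) + L j = L j - lam j * t" for j using l by simp
    ultimately show ?thesis by simp
  qed
qed (use fin L lam T in auto)

text \<open>The relation \<open>V_out\<close> integrated in time, each arc with its own change of
  variables. The single time 0, which \<open>V_out\<close> does not cover, is a null set.\<close>

lemma (in network_profile) integral_profile_node: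
  assumes i: "i \<in> Out" and t: "t \<ge> 0"
  shows "integral {- (lam i * t)..0} (V i) = g i * (\<Sum>j\<in>Inc. integral {L j - lam j * t..L j} (V j))"
proof -
  have "((\<lambda>s. lam i * V i (0 - lam i * s)) has_integral integral {0 - lam i * t..0} (V i)) {0..t}"
    by (rule has_integral_profile) (use V lam i t in auto)
  moreover have "((\<lambda>s. g i * (\<Sum>j\<in>Inc. lam j * V j (L j - lam j * s))) has_integral g i * (\<Sum>j\<in>Inc. integral {L j - lam j * t..L j} (V j))) {0..t}"
    by (intro has_integral_mult_right has_integral_sum fin has_integral_profile) (use V lam t in auto)
  then have "((\<lambda>s. lam i * V i (0 - lam i * s)) has_integral g i * (\<Sum>j\<in>Inc. integral {L j - lam j * t..L j} (V j))) {0..t}"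
    by (rule has_integral_spike[of "{0}", rotated 2]) (use V_out[OF i] in auto)
  ultimately have "integral {0 - lam i * t..0} (V i) = g i * (\<Sum>j\<in>Inc. integral {L j - lam j * t..L j} (V j))"
    by (rule has_integral_unique)
  then show ?thesis by simp
qed

section \<open>Assembly of the convergence proof\<close>

text \<open>The conclusion quantifies over every \<open>v\<close> that agrees with the profile
  almost everywhere, so it can be applied to an arbitrary solution of the transport problem once
  uniqueness has identified it.\<close>

lemma vanishing_viscosity_limit:
  fixes Inc Out :: "nat set" and L lam g c B eps :: "nat \<Rightarrow> real" and th T :: real
  assumes fin: "finite Inc" "finite Out" and disj: "Inc \<inter> Out = {}" and ne: "Inc \<noteq> {}" "Out \<noteq> {}"
    and L: "\<And>i. i \<in> Inc \<union> Out \<Longrightarrow> L i > 0" and lam: "\<And>i. i \<in> Inc \<union> Out \<Longrightarrow> lam i > 0"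
    and g: "(\<Sum>i\<in>Out. g i) = 1"
    and c: "\<And>i. i \<in> Out \<Longrightarrow> c i > 0" and c_rel: "\<And>i. i \<in> Out \<Longrightarrow> c i = th * g i * (1 + c i * card Inc / lam i)"
    and K: "\<And>i j. i \<in> Inc \<union> Out \<Longrightarrow> j \<in> Inc \<union> Out \<Longrightarrow>
      K i j = (if i \<in> Out \<and> j \<in> Inc then c i else if i \<in> Inc \<and> j \<in> Out then c j else 0)"
    and T: "T > 0" and eps: "\<And>n. eps n > 0" "eps \<longlonglongrightarrow> 0"
    and u0: "\<And>i. i \<in> Inc \<union> Out \<Longrightarrow> BV_on (arc_interval L i) (u0 i)"
    and adm: "admissible_approximation Inc Out L lam K B eps u0 u0n"
    and sol: "\<And>n. parabolic_solution Inc Out L lam K B (eps n) (u0n n) (u n)"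
  obtains V where "network_profile Inc Out L lam g B T u0 V"
    "\<And>v. (\<And>i. i \<in> Inc \<union> Out \<Longrightarrow> v i absolutely_integrable_on arc_interval L i \<times> {0<..<T} \<and>
        negligible {z\<in>arc_interval L i \<times> {0<..<T}. v i z \<noteq> V i (fst z - lam i * snd z)}) \<Longrightarrow> L1_converges (Inc \<union> Out) L T u v"
proof -
  let ?M = "Inc \<union> Out" and ?nd = "\<lambda>i. if i \<in> Inc then L i else 0"
  note hk = set_lebesgue_integral_eq_integral(1)
  have finM: "finite ?M" using fin by simp
  have Knn: "K i j \<ge> 0 \<and> K i j = K j i" if "i \<in> ?M" "j \<in> ?M" for i j
    using that disj c by (auto simp: K less_imp_le)
  \<comment> \<open>The bound on the time derivative of the \<open>n\<close>-th solution.
    Admissibility bounds both summands independently of \<open>n\<close>.\<close>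
  define A where "A n = (\<Sum>i\<in>?M. lam i) * L1_net_norm ?M L (\<lambda>i. weak_deriv (arc_interval L i) (u0n n i)) + eps n * W21_net_norm ?M L (u0n n)" for n
  have "\<exists>U P H. viscous_network Inc Out L lam K B (eps n) (u0n n) (u n) U P H" for n
    by (rule parabolic_solution_estimates[OF fin disj L lam Knn eps(1) sol[of n]]) (assumption+, blast)
  then obtain U P H where "\<And>n. viscous_network Inc Out L lam K B (eps n) (u0n n) (u n) (U n) (P n) (H n)" by metis
  then have arc: "\<And>n i. i \<in> ?M \<Longrightarrow> viscous_arc (L i) (lam i) (eps n) (U n i) (P n i) (H n i)"
    and uU: "\<And>n i t. i \<in> ?M \<Longrightarrow> t \<ge> 0 \<Longrightarrow> AE x in lebesgue. x \<in> {0<..<L i} \<longrightarrow> u n i (x, t) = U n i t x"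
    and rep: "\<And>n i. i \<in> ?M \<Longrightarrow> W21_representative (L i) (u0n n i) (U n i 0) (P n i 0)"
    and node: "\<And>n i t. i \<in> ?M \<Longrightarrow> t > 0 \<Longrightarrow> node_sign Inc i * (- lam i * U n i t (?nd i) + eps n * P n i t (?nd i)) = (\<Sum>j\<in>?M. K i j * (U n j t (?nd j) - U n i t (?nd i)))"
    and inlet: "\<And>n i t. i \<in> Inc \<Longrightarrow> t > 0 \<Longrightarrow> U n i t 0 = B i"
    and outlet: "\<And>n i t. i \<in> Out \<Longrightarrow> t > 0 \<Longrightarrow> U n i t (L i) = U n i 0 (L i)"
    and HA: "\<And>n i t. i \<in> ?M \<Longrightarrow> t > 0 \<Longrightarrow> abs_integral (L i) (H n i t) \<le> A n"
    unfolding viscous_network_def Let_def A_def by blast+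
  have u0i: "u0 i absolutely_integrable_on {0..L i}" if "i \<in> ?M" for i
    using u0[OF that] by (simp add: BV_on_def arc_interval_def absolutely_integrable_open_closed_interval)
  have Ui: "U n i 0 absolutely_integrable_on {0..L i}" if "i \<in> ?M" for n i
    using W21_representative_integrable(1)[OF rep[OF that]] by (simp add: absolutely_integrable_open_closed_interval)
  define d where "d n i = abs_integral (L i) (\<lambda>x. U n i 0 x - u0 i x)" for n i
  have d0: "d n i \<ge> 0" for n i unfolding d_def by (rule integral_abs_nonneg)
  have lim: "(\<lambda>n. \<Sum>i\<in>?M. d n i) \<longlonglongrightarrow> 0"
  proof -
    have "L1_norm {0<..<L i} (\<lambda>x. u0n n i x - u0 i x) = d n i" if i: "i \<in> ?M" for n i
    proof -
      have "L1_norm {0<..<L i} (\<lambda>x. u0n n i x - u0 i x) = L1_norm {0<..<L i} (\<lambda>x. U n i 0 x - u0 i x)"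
        by (rule L1_norm_cong_AE) (use W21_representativeD(3)[OF rep[OF i]] in eventually_elim, simp)
      also have "\<dots> = d n i"
        unfolding d_def using Ui[OF i] u0i[OF i]
        by (intro L1_norm_interval set_integral_diff(1)) (simp_all add: absolutely_integrable_open_closed_interval)
      finally show ?thesis .
    qed
    then have "(\<lambda>n. L1_net_norm ?M L (\<lambda>i x. u0n n i x - u0 i x)) = (\<lambda>n. \<Sum>i\<in>?M. d n i)"
      by (simp add: L1_net_norm_def arc_interval_def)
    then show ?thesis using adm by (simp add: admissible_approximation_def)
  qed
  have limd: "(\<lambda>n. d n i) \<longlonglongrightarrow> 0" if "i \<in> ?M" for i
    by (rule tendsto_0_sum_component[of "\<lambda>i n. d n i", OF lim finM that d0])
  obtain D where D: "\<And>n. \<bar>\<Sum>i\<in>?M. d n i\<bar> \<le> D"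
    using convergent_imp_Bseq[OF convergentI[OF lim]] unfolding Bseq_def by auto
  have dD: "d n i \<le> D" if "i \<in> ?M" for n i
    using member_le_sum[of i ?M "d n", OF that d0 finM] D[of n] by linarith
  obtain Ca where Ca: "\<And>n. L1_net_norm ?M L (\<lambda>i. weak_deriv (arc_interval L i) (u0n n i)) \<le> Ca"
    using adm unfolding admissible_approximation_def by blast
  obtain Cw where Cw: "\<And>n. eps n * W21_net_norm ?M L (u0n n) \<le> Cw"
    using adm unfolding admissible_approximation_def by blast
  have wP: "abs_integral (L i) (P n i 0) \<le> Ca" if i: "i \<in> ?M" for n i
  proof -
    have "abs_integral (L i) (P n i 0) = L1_norm {0<..<L i} (weak_deriv {0<..<L i} (u0n n i))"
      using W21_norm_representative(2)[OF rep[OF i]] by simp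
    also have "\<dots> \<le> L1_net_norm ?M L (\<lambda>i. weak_deriv (arc_interval L i) (u0n n i))"
      unfolding L1_net_norm_def arc_interval_def by (rule member_le_sum[OF i L1_norm_nonneg finM])
    finally show ?thesis using Ca[of n] by simp
  qed
  have Ca0: "Ca \<ge> 0"
  proof -
    obtain i where "i \<in> ?M" using ne by blast
    then show ?thesis using wP[of i 0] integral_abs_nonneg[of "{0..L i}" "P 0 i 0"] by linarith
  qed
  have Cw0: "Cw \<ge> 0"
  proof -
    have "0 \<le> eps 0 * W21_net_norm ?M L (u0n 0)"
      using eps(1)[of 0] unfolding W21_net_norm_def by (intro mult_nonneg_nonneg sum_nonneg W21_norm_nonneg) auto
    then show ?thesis using Cw[of 0] by linarith
  qed
  define C1 where "C1 = (\<Sum>i\<in>?M. lam i) * Ca + Cw"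
  have lam0: "(\<Sum>i\<in>?M. lam i) \<ge> 0" using lam by (intro sum_nonneg) (auto intro: less_imp_le)
  have AC: "A n \<le> C1" for n
    unfolding A_def C1_def by (intro add_mono mult_left_mono Ca Cw lam0)
  have C10: "C1 \<ge> 0" unfolding C1_def using lam0 Ca0 Cw0 by simp
  define Cu where "Cu = D + (\<Sum>i\<in>?M. abs_integral (L i) (\<lambda>x. u0 i x))"
  have UCu: "abs_integral (L i) (U n i 0) \<le> Cu" if i: "i \<in> ?M" for n i
  proof -
    have ii: "(\<lambda>x. \<bar>U n i 0 x\<bar>) integrable_on {0..L i}" "(\<lambda>x. \<bar>U n i 0 x - u0 i x\<bar>) integrable_on {0..L i}" "(\<lambda>x. \<bar>u0 i x\<bar>) integrable_on {0..L i}"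
      by (intro hk set_integrable_abs set_integral_diff(1) Ui u0i i)+
    have "abs_integral (L i) (U n i 0) \<le> integral {0..L i} (\<lambda>x. \<bar>U n i 0 x - u0 i x\<bar> + \<bar>u0 i x\<bar>)"
      by (rule integral_le) (use ii in \<open>auto intro: Henstock_Kurzweil_Integration.integrable_add\<close>)
    also have "\<dots> = d n i + abs_integral (L i) (\<lambda>x. u0 i x)"
      unfolding d_def by (rule Henstock_Kurzweil_Integration.integral_add[OF ii(2,3)])
    also have "\<dots> \<le> Cu"
      unfolding Cu_def by (intro add_mono dD i member_le_sum[OF i integral_abs_nonneg finM])
    finally show ?thesis .
  qed
  \<comment> \<open>A uniform bound for the approximating data by Sobolev embedding; it also bounds
    the outlet values on outgoing arcs. The sum of the \<open>1 / L i\<close> stands in for a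
    maximum.\<close>
  define Cs where "Cs = Cu * (\<Sum>i\<in>?M. 1 / L i) + Ca"
  have Usup: "\<bar>U n i 0 x\<bar> \<le> Cs" if i: "i \<in> ?M" and x: "x \<in> {0..L i}" for n i x
  proof -
    have p: "primitive_on 0 (L i) (U n i 0) (P n i 0)" by (rule W21_representative_primitive[OF rep[OF i]])
    have "1 / L i \<le> (\<Sum>i\<in>?M. 1 / L i)" by (rule member_le_sum[OF i _ finM]) (use L in \<open>auto intro: less_imp_le\<close>)
    moreover have "0 \<le> Cu" using UCu[OF i, of n] integral_abs_nonneg[of "{0..L i}" "U n i 0"] by linarith
    ultimately have "Cu * (1 / L i) \<le> Cu * (\<Sum>i\<in>?M. 1 / L i)" by (rule mult_left_mono)
    moreover have "abs_integral (L i) (U n i 0) / L i \<le> Cu / L i"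
      using UCu[OF i, of n] L[OF i] by (intro divide_right_mono) auto
    ultimately show ?thesis using primitive_on_sup_bound[OF L[OF i] p x] wP[OF i, of n] unfolding Cs_def by simp
  qed
  \<comment> \<open>Bounded gradients in \<open>L^1\<close> and bounded values at 0 allow Helly's
    selection, so the limit of the approximations has a representative defined everywhere.\<close>
  have "\<exists>V0. i \<in> ?M \<longrightarrow> monotone_difference V0 \<and> (AE x in lebesgue. x \<in> {0<..<L i} \<longrightarrow> u0 i x = V0 x)" for i
  proof (cases "i \<in> ?M")
    case True
    note i = True
    have Cs0: "Cs \<ge> 0" using Usup[OF i, of 0 0] L[OF i] by auto
    obtain V0 where "monotone_difference V0" "negligible {x\<in>{0<..<L i}. u0 i x \<noteq> V0 x}"
    proof (rule monotone_difference_L1_limit[of "L i" "\<lambda>n. U n i 0" "\<lambda>n. P n i 0" "Ca + Cs" "u0 i"])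
      show "abs_integral (L i) (P n i 0) \<le> Ca + Cs" for n using wP[OF i, of n] Cs0 by simp
      show "\<bar>U n i 0 0\<bar> \<le> Ca + Cs" for n using Usup[OF i, of 0 n] Ca0 L[OF i] by simp
      show "(\<lambda>n. abs_integral (L i) (\<lambda>x. U n i 0 x - u0 i x)) \<longlonglongrightarrow> 0" using limd[OF i] by (simp add: d_def)
    qed (use L i u0i W21_representative_primitive[OF rep] in auto)
    then show ?thesis unfolding negligible_neq_iff by blast
  qed simp
  then obtain V0 where V0: "\<And>i. i \<in> ?M \<Longrightarrow> monotone_difference (V0 i)"
    "\<And>i. i \<in> ?M \<Longrightarrow> AE x in lebesgue. x \<in> {0<..<L i} \<longrightarrow> u0 i x = V0 i x" by metis
  define V where "V = boundary_profile Inc L lam g B V0"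
  interpret V: network_profile Inc Out L lam g B T u0 V
    unfolding V_def by (rule network_profile_boundary_profile[OF fin(1) disj L lam T V0])
  have "\<exists>R C. i \<in> ?M \<longrightarrow> (\<forall>x y. x \<le> y \<longrightarrow> \<bar>V i x - V i y\<bar> \<le> R y - R x) \<and> (\<forall>x. \<bar>R x\<bar> \<le> C \<and> \<bar>V i x\<bar> \<le> C)" for i
  proof (cases "i \<in> ?M")
    case True
    obtain R C where R: "\<And>x y. x \<le> y \<Longrightarrow> \<bar>V i x - V i y\<bar> \<le> R y - R x" "\<And>x. \<bar>R x\<bar> \<le> C"
      by (rule monotone_difference_variation[OF V.V[OF True]]) blast
    obtain C' where C': "\<And>x. \<bar>V i x\<bar> \<le> C'" by (rule monotone_difference_bounded[OF V.V[OF True]]) blast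
    have "\<bar>R x\<bar> \<le> max C C' \<and> \<bar>V i x\<bar> \<le> max C C'" for x using R(2)[of x] C'[of x] by linarith
    then show ?thesis using R(1) by blast
  qed simp
  then obtain R C where R: "\<And>i x y. i \<in> ?M \<Longrightarrow> x \<le> y \<Longrightarrow> \<bar>V i x - V i y\<bar> \<le> R i y - R i x"
    "\<And>i x. i \<in> ?M \<Longrightarrow> \<bar>R i x\<bar> \<le> C i \<and> \<bar>V i x\<bar> \<le> C i" by metis
  define CV where "CV = (\<Sum>i\<in>?M. \<bar>C i\<bar>)"
  have CV: "C i \<le> CV" if "i \<in> ?M" for i
    using member_le_sum[OF that _ finM, of "\<lambda>i. \<bar>C i\<bar>"] unfolding CV_def by fastforce
  \<comment> \<open>The lower limit is the smallest value that \<open>x - lam i * t\<close> takes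
    for times up to \<open>T\<close>.\<close>
  define W where "W i x = integral {- (lam i * T)..x} (V i)" for i x
  have Vi: "V i absolutely_integrable_on {a..b}" if "i \<in> ?M" for i a b
    by (rule monotone_difference_integrable[OF V.V[OF that]])
  have W: "primitive_on (- (lam i * T)) (L i) (W i) (V i)" if "i \<in> ?M" for i
    unfolding primitive_on_def W_def using Vi[OF that] by simp
  have W_diff: "W i y - W i x = integral {x..y} (V i)" if "i \<in> ?M" "- (lam i * T) \<le> x" "x \<le> y" "y \<le> L i" for i x y
    by (rule primitive_on_diff[OF W that(2-4)]) (rule that(1))
  have lT: "lam i * t \<le> lam i * T" "0 \<le> lam i * t" if "i \<in> ?M" "0 \<le> t" "t \<le> T" for i t
    using that lam[OF that(1)] by (auto intro: mult_left_mono)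
  \<comment> \<open>On the open arc the profile agrees with the initial datum almost everywhere, so
    the distance to the datum is the distance to the profile.\<close>
  have dV: "d n i = abs_integral (L i) (\<lambda>x. U n i 0 x - V i x)" if i: "i \<in> ?M" for n i
  proof -
    have "negligible ({x\<in>{0<..<L i}. u0 i x \<noteq> V i x} \<union> {0, L i})"
      using V.V_initial[OF i] unfolding negligible_neq_iff[symmetric] by simp
    then show ?thesis unfolding d_def by (rule integral_spike) auto
  qed
  have init: "\<forall>\<^sub>F n in sequentially. \<forall>i\<in>?M. \<forall>x\<in>{0..L i}. \<bar>integral {0..x} (U n i 0) - (W i x - W i 0)\<bar> \<le> r" if r: "r > 0" for r
  proof -
    have "\<forall>\<^sub>F n in sequentially. (\<Sum>i\<in>?M. d n i) < r" using lim r by (intro order_tendstoD) auto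
    then show ?thesis
    proof (eventually_elim, intro ballI)
      fix n i x assume s: "(\<Sum>i\<in>?M. d n i) < r" and i: "i \<in> ?M" and x: "x \<in> {0..L i}"
      have U: "U n i 0 absolutely_integrable_on {0..x}" by (rule absolutely_integrable_subinterval[OF Ui[OF i]]) (use x in auto)
      have df: "(\<lambda>x. \<bar>U n i 0 x - V i x\<bar>) integrable_on {0..L i}" "(\<lambda>x. \<bar>U n i 0 x - V i x\<bar>) integrable_on {0..x}"
        by (intro hk set_integrable_abs set_integral_diff(1) Ui Vi U i)+
      have "W i x - W i 0 = integral {0..x} (V i)" using lT(2)[OF i, of T] T x by (intro W_diff i) auto
      then have "integral {0..x} (U n i 0) - (W i x - W i 0) = integral {0..x} (\<lambda>y. U n i 0 y - V i y)"
        using integral_diff[OF hk[OF U] hk[OF Vi[OF i]]] by simp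
      also have "\<bar>integral {0..x} (\<lambda>y. U n i 0 y - V i y)\<bar> \<le> abs_integral x (\<lambda>y. U n i 0 y - V i y)"
        using integral_norm_bound_integral[of "\<lambda>y. U n i 0 y - V i y" "{0..x}", OF hk[OF set_integral_diff(1)[OF U Vi[OF i]]] df(2)] by simp
      also have "\<dots> \<le> d n i"
        unfolding dV[OF i] by (rule integral_subset_le) (use x df in auto)
      also have "\<dots> \<le> r" using member_le_sum[of i ?M "d n", OF i d0 finM] s by linarith
      finally show "\<bar>integral {0..x} (U n i 0) - (W i x - W i 0)\<bar> \<le> r" .
    qed
  qed
  have U_bound: "abs_integral (L i) (U n i t) \<le> Cu + C1 * T" if i: "i \<in> ?M" and t: "0 < t" "t \<le> T" for n i t
  proof -
    have H: "abs_integral (L i) (H n i s) \<le> C1" if "s > 0" for s using HA[OF i that, of n] AC[of n] by simp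
    have "abs_integral (L i) (U n i t) \<le> abs_integral (L i) (U n i 0) + C1 * t"
      using viscous_arc.L1_growth[OF arc[OF i] H, of t] t by simp
    also have "\<dots> \<le> Cu + C1 * T" using UCu[OF i, of n] t C10 by (intro add_mono mult_left_mono) auto
    finally show ?thesis .
  qed
  have sumM: "(\<Sum>j\<in>?M. f j) = (\<Sum>j\<in>Inc. f j) + (\<Sum>j\<in>Out. f j)" for f :: "nat \<Rightarrow> real"
    using sum.union_disjoint[OF fin disj] .
  \<comment> \<open>Couplings between two incoming arcs vanish, so only outgoing ones remain in the
    sum; the sign of the node condition flips the differences.\<close>
  have node_in: "lam i * U n i t (L i) - eps n * P n i t (L i) = (\<Sum>j\<in>Out. c j * (U n i t (L i) - U n j t 0))"
    if i: "i \<in> Inc" and t: "t > 0" for n i t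
  proof -
    have no: "i \<notin> Out" "\<And>j. j \<in> Out \<Longrightarrow> j \<notin> Inc" "\<And>j. j \<in> Inc \<Longrightarrow> j \<notin> Out" using i disj by auto
    have "(\<Sum>j\<in>?M. K i j * (U n j t (?nd j) - U n i t (?nd i))) = (\<Sum>j\<in>Out. c j * (U n j t 0 - U n i t (L i)))"
      unfolding sumM using i no by (simp add: K)
    also have "\<dots> = - (\<Sum>j\<in>Out. c j * (U n i t (L i) - U n j t 0))" by (simp add: sum_negf[symmetric] algebra_simps)
    finally show ?thesis using node[of i t n] i t by (simp add: node_sign_def)
  qed
  have node_out: "lam i * U n i t 0 - eps n * P n i t 0 = (\<Sum>j\<in>Inc. c i * (U n j t (L j) - U n i t 0))"
    if i: "i \<in> Out" and t: "t > 0" for n i t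
  proof -
    have no: "i \<notin> Inc" "\<And>j. j \<in> Inc \<Longrightarrow> j \<notin> Out" "\<And>j. j \<in> Out \<Longrightarrow> j \<notin> Inc" using i disj by auto
    have "(\<Sum>j\<in>?M. K i j * (U n j t (?nd j) - U n i t (?nd i))) = (\<Sum>j\<in>Inc. c i * (U n j t (L j) - U n i t 0))"
      unfolding sumM using i no by (simp add: K)
    then show ?thesis using node[of i t n] i t no by (simp add: node_sign_def)
  qed
  interpret S: viscosity_limit Inc Out L lam g c th eps U P H B "\<lambda>n i. U n i 0 (L i)" T C1 "Cu + C1 * T" "Cs + (\<Sum>i\<in>Inc. \<bar>B i\<bar>)" CV V W R
  proof (rule viscosity_limit.intro)
    show "abs_integral (L i) (H n i t) \<le> C1" if "i \<in> ?M" "t > 0" for n i t using HA[OF that, of n] AC[of n] by simp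
    show "\<bar>U n i 0 (L i)\<bar> \<le> Cs + (\<Sum>i\<in>Inc. \<bar>B i\<bar>)" if "i \<in> Out" for n i
    proof -
      have "\<bar>U n i 0 (L i)\<bar> \<le> Cs" using that L[of i] by (intro Usup) auto
      moreover have "0 \<le> (\<Sum>i\<in>Inc. \<bar>B i\<bar>)" by (rule sum_nonneg) simp
      ultimately show ?thesis by linarith
    qed
    show "\<bar>B i\<bar> \<le> Cs + (\<Sum>i\<in>Inc. \<bar>B i\<bar>)" if i: "i \<in> Inc" for i
    proof -
      have "0 \<le> Cs" using Usup[of i 0 0] i L[of i] abs_ge_zero[of "U 0 i 0 0"] by fastforce
      moreover have "\<bar>B i\<bar> \<le> (\<Sum>i\<in>Inc. \<bar>B i\<bar>)" by (rule member_le_sum[OF i _ fin(1)]) simp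
      ultimately show ?thesis by simp
    qed
    show "\<bar>V i x\<bar> \<le> CV" "\<bar>R i x\<bar> \<le> CV" if "i \<in> ?M" for i x using R(2)[OF that, of x] CV[OF that] by linarith+
    show "W i 0 - W i (- (lam i * t)) = g i * (\<Sum>j\<in>Inc. W j (L j) - W j (L j - lam j * t))" if i: "i \<in> Out" and t: "0 \<le> t" "t \<le> T" for i t
    proof -
      have "W i 0 - W i (- (lam i * t)) = integral {- (lam i * t)..0} (V i)"
        using lT[of i t] L[of i] i t by (intro W_diff) auto
      also have "\<dots> = g i * (\<Sum>j\<in>Inc. integral {L j - lam j * t..L j} (V j))" by (rule V.integral_profile_node[OF i t(1)])
      also have "(\<Sum>j\<in>Inc. integral {L j - lam j * t..L j} (V j)) = (\<Sum>j\<in>Inc. W j (L j) - W j (L j - lam j * t))"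
      proof (rule sum.cong[OF refl])
        fix j assume j: "j \<in> Inc"
        show "integral {L j - lam j * t..L j} (V j) = W j (L j) - W j (L j - lam j * t)"
          by (rule W_diff[symmetric]) (use j lT[of j t] L[of j] t in auto)
      qed
      finally show ?thesis .
    qed
  qed (fact fin disj ne T c c_rel g arc eps(2) node_in node_out inlet outlet U_bound W R(1) V.V_in init)+
  show ?thesis
  proof (rule that[OF V.network_profile_axioms])
    fix v :: "nat \<Rightarrow> real \<times> real \<Rightarrow> real"
    assume v: "\<And>i. i \<in> ?M \<Longrightarrow> v i absolutely_integrable_on arc_interval L i \<times> {0<..<T} \<and>
        negligible {z\<in>arc_interval L i \<times> {0<..<T}. v i z \<noteq> V i (fst z - lam i * snd z)}"
    have um: "u n i \<in> borel_measurable (lebesgue_on ({0<..<L i} \<times> {0<..}))" if "i \<in> ?M" for n i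
      using sol[of n] that unfolding parabolic_solution_def arc_interval_def by blast
    have st: "u n i absolutely_integrable_on {0<..<L i} \<times> {0<..<T}"
      "(\<And>t. t \<in> {0<..<T} \<Longrightarrow> abs_integral (L i) (\<lambda>x. U n i t x - V i (x - lam i * t)) \<le> r) \<Longrightarrow>
        L1_norm ({0<..<L i} \<times> {0<..<T}) (\<lambda>z. u n i z - v i z) \<le> T * r" if i: "i \<in> ?M" for n i r
    proof -
      have "negligible {z\<in>{0<..<L i} \<times> {0<..<T}. v i z \<noteq> V i (fst z - lam i * snd z)}"
        using v[OF i] by (simp add: arc_interval_def)
      note sp = space_time_L1_bound[OF L[OF i] T um[OF i, of n] viscous_arc.contU[OF arc[OF i]] uU[OF i less_imp_le] V.V[OF i] this]
      show "u n i absolutely_integrable_on {0<..<L i} \<times> {0<..<T}" by (rule sp(1))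
      assume r: "\<And>t. t \<in> {0<..<T} \<Longrightarrow> abs_integral (L i) (\<lambda>x. U n i t x - V i (x - lam i * t)) \<le> r"
      show "L1_norm ({0<..<L i} \<times> {0<..<T}) (\<lambda>z. u n i z - v i z) \<le> T * r"
        by (rule sp(2)) (assumption | rule r)+
    qed
    have "(\<lambda>n. \<Sum>i\<in>?M. L1_norm ({0<..<L i} \<times> {0<..<T}) (\<lambda>z. u n i z - v i z)) \<longlonglongrightarrow> 0"
    proof (intro tendsto_null_sum)
      fix i assume i: "i \<in> ?M"
      show "(\<lambda>n. L1_norm ({0<..<L i} \<times> {0<..<T}) (\<lambda>z. u n i z - v i z)) \<longlonglongrightarrow> 0"
      proof (rule tendstoI)
        fix r :: real assume r: "r > 0"
        have "\<forall>\<^sub>F n in sequentially. \<forall>i\<in>?M. \<forall>t\<in>{0<..T}. abs_integral (L i) (\<lambda>x. U n i t x - V i (x - lam i * t)) \<le> r / (2 * T)"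
          using r T by (intro S.L1_limit) simp
        then show "\<forall>\<^sub>F n in sequentially. dist (L1_norm ({0<..<L i} \<times> {0<..<T}) (\<lambda>z. u n i z - v i z)) 0 < r"
        proof eventually_elim
          case (elim n)
          have "L1_norm ({0<..<L i} \<times> {0<..<T}) (\<lambda>z. u n i z - v i z) \<le> T * (r / (2 * T))"
            by (rule st(2)[OF i]) (use elim i in auto)
          then show ?case using r T L1_norm_nonneg[of "{0<..<L i} \<times> {0<..<T}" "\<lambda>z. u n i z - v i z"] by simp
        qed
      qed
    qed
    then show "L1_converges ?M L T u v" using st(1) v by (simp add: L1_converges_def arc_interval_def)
  qed
qed

theorem mainTheorem3:
  fixes m :: nat and Inc Out :: "nat set" and L lam g :: "nat \<Rightarrow> real"
  assumes arcs: "Inc \<union> Out = {1..m}" "Inc \<inter> Out = {}" "Inc \<noteq> {}" "Out \<noteq> {}"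
    and lengths: "\<forall>i\<in>{1..m}. L i > 0"
    and velocities: "\<forall>i\<in>{1..m}. lam i > 0"
    and coefficients: "\<forall>i\<in>Out. g i > 0" "(\<Sum>i\<in>Out. g i) = 1"
  shows "\<exists>K :: nat \<Rightarrow> nat \<Rightarrow> real.
    (\<forall>i\<in>{1..m}. \<forall>j\<in>{1..m}. K i j \<ge> 0 \<and> K i j = K j i) \<and>
    (\<forall>i\<in>Inc. \<exists>j\<in>Out. K i j > 0) \<and>
    (\<forall>(u0 :: nat \<Rightarrow> real \<Rightarrow> real) (B :: nat \<Rightarrow> real) (eps :: nat \<Rightarrow> real)
       (u0n :: nat \<Rightarrow> nat \<Rightarrow> real \<Rightarrow> real) (u :: nat \<Rightarrow> nat \<Rightarrow> real \<times> real \<Rightarrow> real) (T :: real).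
       (\<forall>i\<in>{1..m}. BV_on (arc_interval L i) (u0 i)) \<and>
       (\<forall>n. eps n > 0) \<and> decseq eps \<and> eps \<longlonglongrightarrow> 0 \<and>
       admissible_approximation Inc Out L lam K B eps u0 u0n \<and>
       (\<forall>n. parabolic_solution Inc Out L lam K B (eps n) (u0n n) (u n)) \<and>
       T > 0 \<longrightarrow>
       (\<exists>v. transport_solution Inc Out L lam (\<lambda>i j. g i) B u0 T v) \<and>
       (\<forall>v. transport_solution Inc Out L lam (\<lambda>i j. g i) B u0 T v \<longrightarrow>
          L1_converges {1..m} L T u v \<and>
          (\<forall>i\<in>Out. AE t in lebesgue. t \<in> {0<..<T} \<longrightarrow>
             lam i * boundary_trace (arc_interval L i \<times> {0<..<T}) (v i) (0, t) =
             g i * (\<Sum>j\<in>Inc. lam j * boundary_trace (arc_interval L j \<times> {0<..<T}) (v j) (L j, t)))))"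
proof -
  let ?M = "Inc \<union> Out" and ?k = "real (card Inc)"
  have fM: "finite ?M" by (simp add: arcs(1))
  then have fin: "finite Inc" "finite Out" by auto
  have L: "\<And>i. i \<in> ?M \<Longrightarrow> L i > 0" and lam: "\<And>i. i \<in> ?M \<Longrightarrow> lam i > 0"
    using lengths velocities arcs(1) by auto
  have k: "?k > 0" using fin arcs(3) by (simp add: card_gt_0_iff)
  \<comment> \<open>The sum dominates each of its positive terms, which lets one \<open>th\<close>
    serve all outgoing arcs.\<close>
  define S where "S = (\<Sum>i\<in>Out. g i * ?k / lam i)"
  have p: "g i * ?k / lam i > 0" if "i \<in> Out" for i using that coefficients(1) k lam by simp
  have S: "S > 0" unfolding S_def using p by (intro sum_pos fin arcs(4)) auto
  \<comment> \<open>This choice gives \<open>th * g i * ?k / lam i \<le> 1 / 2\<close>, so the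
    denominators in \<open>c\<close> stay at least one half; any smaller positive value would serve
    as well.\<close>
  define th where "th = 1 / (2 * S)"
  \<comment> \<open>The solution of \<open>c i = th * g i * (1 + c i * ?k / lam i)\<close>, which is
    linear in \<open>c i\<close>.\<close>
  define c where "c i = th * g i / (1 - th * g i * ?k / lam i)" for i
  have half: "th * g i * ?k / lam i \<le> 1 / 2" if i: "i \<in> Out" for i
  proof -
    have "g i * ?k / lam i \<le> S" unfolding S_def by (rule member_le_sum[OF i _ fin(2)]) (use p in \<open>auto intro: less_imp_le\<close>)
    then have "th * (g i * ?k / lam i) \<le> th * S" using S by (intro mult_left_mono) (auto simp: th_def)
    then show ?thesis using S by (simp add: th_def)
  qed
  have c: "c i > 0" if i: "i \<in> Out" for i
    unfolding c_def using half[OF i] S coefficients(1) i by (intro divide_pos_pos mult_pos_pos) (auto simp: th_def)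
  have c_rel: "c i = th * g i * (1 + c i * ?k / lam i)" if i: "i \<in> Out" for i
  proof -
    have "1 - th * g i * ?k / lam i \<noteq> 0" using half[OF i] by linarith
    then have "c i * (1 - th * g i * ?k / lam i) = th * g i"
      unfolding c_def by (simp only: times_divide_eq_left nonzero_mult_div_cancel_right not_False_eq_True)
    then show ?thesis by (simp add: algebra_simps)
  qed
  \<comment> \<open>One constant per outgoing arc, shared by all incoming arcs, so that an outgoing
    flux depends on the incoming node values only through their sum.\<close>
  define K where "K i j = (if i \<in> Out \<and> j \<in> Inc then c i else if i \<in> Inc \<and> j \<in> Out then c j else 0)" for i j
  show ?thesis
  proof (intro exI[of _ K] conjI allI impI)
    show "\<forall>i\<in>{1..m}. \<forall>j\<in>{1..m}. K i j \<ge> 0 \<and> K i j = K j i"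
      using c arcs(2) by (auto simp: K_def less_imp_le)
    show "\<forall>i\<in>Inc. \<exists>j\<in>Out. K i j > 0" using c arcs(2,4) by (fastforce simp: K_def)
    fix u0 :: "nat \<Rightarrow> real \<Rightarrow> real" and B eps :: "nat \<Rightarrow> real" and u0n u and T :: real
    assume "(\<forall>i\<in>{1..m}. BV_on (arc_interval L i) (u0 i)) \<and>
       (\<forall>n. eps n > 0) \<and> decseq eps \<and> eps \<longlonglongrightarrow> 0 \<and>
       admissible_approximation Inc Out L lam K B eps u0 u0n \<and>
       (\<forall>n. parabolic_solution Inc Out L lam K B (eps n) (u0n n) (u n)) \<and>
       T > 0"
    then have h: "\<And>n. eps n > 0" "eps \<longlonglongrightarrow> 0" "admissible_approximation Inc Out L lam K B eps u0 u0n"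
      "\<And>n. parabolic_solution Inc Out L lam K B (eps n) (u0n n) (u n)" "T > 0" "\<And>i. i \<in> ?M \<Longrightarrow> BV_on (arc_interval L i) (u0 i)"
      using arcs(1) by auto
    obtain V where V: "network_profile Inc Out L lam g B T u0 V"
      and conv: "\<And>v. (\<And>i. i \<in> ?M \<Longrightarrow> v i absolutely_integrable_on arc_interval L i \<times> {0<..<T} \<and>
        negligible {z\<in>arc_interval L i \<times> {0<..<T}. v i z \<noteq> V i (fst z - lam i * snd z)}) \<Longrightarrow> L1_converges ?M L T u v"
      by (rule vanishing_viscosity_limit[OF fin arcs(2-4) L lam coefficients(2) c c_rel K_def h(5,1,2,6,3,4)]) (assumption+, blast)
    interpret V: network_profile Inc Out L lam g B T u0 V by (rule V)
    show "\<exists>v. transport_solution Inc Out L lam (\<lambda>i j. g i) B u0 T v" using V.solution_if_profile by blast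
    fix v assume v: "transport_solution Inc Out L lam (\<lambda>i j. g i) B u0 T v"
    show "L1_converges {1..m} L T u v"
      unfolding arcs(1)[symmetric]
      by (rule conv) (use v V.solution_imp_profile[OF v] in \<open>auto simp: transport_solution_def BV_on_def\<close>)
    show "\<forall>i\<in>Out. AE t in lebesgue. t \<in> {0<..<T} \<longrightarrow>
         lam i * boundary_trace (arc_interval L i \<times> {0<..<T}) (v i) (0, t) =
         g i * (\<Sum>j\<in>Inc. lam j * boundary_trace (arc_interval L j \<times> {0<..<T}) (v j) (L j, t))"
      using V.solution_node_relation[OF v] by blast
  qed
qed

end
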